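(* Let $n\geq 5$ be a natural number and let $B_n=k^{\mathbb{A}_n}\#kC_2$ be the bismash product Hopf algebra defined in the context. Let $\tilde{\mathcal{C}}$ be a fusion category over $k$ that is Grothendieck equivalent to $\operatorname{Rep}B_n$. Then $\tilde{\mathcal{C}}$ is not solvable.
   Context: $k$ is an algebraically closed field of characteristic zero. A fusion category over $k$ is a semisimple rigid $k$-linear monoidal category with finitely many isomorphism classes of simple objects, finite-dimensional Hom spaces and simple unit object $\mathbf{1}$. $\operatorname{Irr}(\mathcal{C})$ is the set of isomorphism classes of simple objects, and the fusion rules are $N_{X,Y}^Z=\dim\operatorname{Hom}(Z,X\otimes Y)$ for $X,Y,Z\in\operatorname{Irr}(\mathcal{C})$. $\operatorname{Rep}H$ is the category of finite-dimensional representations of a semisimple Hopf algebra $H$. Grothendieck equivalence: $\mathcal{C}$ and $\tilde{\mathcal{C}}$ are Grothendieck equivalent if there is a bijection $f:\operatorname{Irr}(\mathcal{C})\to\operatorname{Irr}(\tilde{\mathcal{C}})$ with $f(\mathbf{1})=\mathbf{1}$ and $N_{f(X),f(Y)}^{f(Z)}=N_{X,Y}^Z$ for all $X,Y,Z\in\operatorname{Irr}(\mathcal{C})$. Solvability: for a finite group $G$, $\mathcal{C}$ is a $G$-extension of $\mathcal{D}$ if there is a decomposition $\mathcal{C}=\bigoplus_{g\in G}\mathcal{C}_g$ with all $\mathcal{C}_g\ne 0$, $\mathcal{C}_g\otimes\mathcal{C}_h\subseteq\mathcal{C}_{gh}$, $\mathcal{C}_g^*\subseteq \mathcal{C}_{g^{-1}}$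 and $\mathcal{C}_e\cong\mathcal{D}$. If $G$ acts on $\mathcal{D}$ by tensor autoequivalences $\rho$, the $G$-equivariantization $\mathcal{D}^G$ is the fusion category of pairs $(X,(\mu^g)_{g\in G})$ with isomorphisms $\mu^g:\rho^g(X)\to X$ compatible with the action. $\mathcal{C}$ is solvable if there are fusion categories $\mathrm{Vect}=\mathcal{C}_0,\dots,\mathcal{C}_n=\mathcal{C}$, $n\ge0$, and cyclic groups of prime order $G_1,\dots,G_n$ such that each $\mathcal{C}_i$ is a $G_i$-equivariantization or a $G_i$-extension of $\mathcal{C}_{i-1}$. $B_n$: let $C_2=\langle(12)\rangle\subseteq\mathbb{S}_n$ act on the alternating group $\mathbb{A}_n$ by conjugation, $s\lhd x=x^{-1}sx$ ($s\in\mathbb{A}_n$, $x\in C_2$), and let $\mathbb{A}_n$ act trivially on $C_2$. $B_n=k^{\mathbb{A}_n}\#kC_2$ is the Hopf algebra with basis $e_s\#x$ ($s\in\mathbb{A}_n$, $x\in C_2$), multiplication $(e_s\#x)(e_t\#y)=\delta_{t,s\lhd x}\,e_s\#xy$ and comultiplication $\Delta(e_s\#x)=\sum_{gh=s}e_g\#x\otimes e_h\#x$. *)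

theory Defs
  imports
    "HOL-Library.Function_Algebras"
    "HOL-Library.Nat_Bijection"
    "HOL-Computational_Algebra.Polynomial"
    "HOL-Algebra.Elementary_Groups"
    "HOL-Algebra.Sym_Groups"
begin

section \<open>Linear categories and monoidal categories\<close>

text \<open>
  All arrows live in one ambient vector space, of which the Hom sets are subspaces. They need not
  be disjoint (\<open>0\<close> lies in all of them), so notions concerning an arrow mention its source and
  target. Every small linear (monoidal) category has this form up to isomorphism: take the ambient
  space to be the direct sum of all Hom spaces and extend composition and tensor product
  bilinearly, by 0 on pairs that do not match.

  Composition is written in the order of application of functions. \<open>\<boxtimes>\<close> is the tensor product of
  objects and \<open>\<star>\<close> the tensor product of arrows.
\<close>

record ('o, 'a, 'k) tensor_category =
  Ob :: "'o set"
  Hom :: "'o \<Rightarrow> 'o \<Rightarrow> 'a set"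
  scl :: "'k \<Rightarrow> 'a \<Rightarrow> 'a"
  cmp :: "'a \<Rightarrow> 'a \<Rightarrow> 'a"  (infixl "\<odot>\<index>" 65)
  idn :: "'o \<Rightarrow> 'a"
  tob :: "'o \<Rightarrow> 'o \<Rightarrow> 'o"  (infixl "\<boxtimes>\<index>" 70)
  tar :: "'a \<Rightarrow> 'a \<Rightarrow> 'a"  (infixl "\<star>\<index>" 70)
  unit_ob :: "'o"
  assoc :: "'o \<Rightarrow> 'o \<Rightarrow> 'o \<Rightarrow> 'a"
  lunit :: "'o \<Rightarrow> 'a"
  runit :: "'o \<Rightarrow> 'a"

definition iso_arr :: "('o, 'a, 'k) tensor_category \<Rightarrow> 'o \<Rightarrow> 'o \<Rightarrow> 'a \<Rightarrow> bool" where
  "iso_arr C X Y f \<longleftrightarrow> f \<in> Hom C X Y \<and>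
     (\<exists>g \<in> Hom C Y X. g \<odot>\<^bsub>C\<^esub> f = idn C X \<and> f \<odot>\<^bsub>C\<^esub> g = idn C Y)"

definition inv_arr :: "('o, 'a, 'k) tensor_category \<Rightarrow> 'o \<Rightarrow> 'o \<Rightarrow> 'a \<Rightarrow> 'a" where
  "inv_arr C X Y f = (THE g. g \<in> Hom C Y X \<and> g \<odot>\<^bsub>C\<^esub> f = idn C X \<and> f \<odot>\<^bsub>C\<^esub> g = idn C Y)"

definition isomorphic :: "('o, 'a, 'k) tensor_category \<Rightarrow> 'o \<Rightarrow> 'o \<Rightarrow> bool" where
  "isomorphic C X Y \<longleftrightarrow> (\<exists>f. iso_arr C X Y f)"

locale linear_category =
  vector_space "scl C" for C :: "('o, 'a::ab_group_add, 'k::field) tensor_category" (structure) +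
  assumes subspace_Hom: "\<lbrakk>X \<in> Ob C; Y \<in> Ob C\<rbrakk> \<Longrightarrow> subspace (Hom C X Y)"
    and idn_in: "X \<in> Ob C \<Longrightarrow> idn C X \<in> Hom C X X"
    and cmp_in: "\<lbrakk>X \<in> Ob C; Y \<in> Ob C; Z \<in> Ob C; f \<in> Hom C X Y; g \<in> Hom C Y Z\<rbrakk>
      \<Longrightarrow> g \<odot> f \<in> Hom C X Z"
    and idn_left: "\<lbrakk>X \<in> Ob C; Y \<in> Ob C; f \<in> Hom C X Y\<rbrakk> \<Longrightarrow> idn C Y \<odot> f = f"
    and idn_right: "\<lbrakk>X \<in> Ob C; Y \<in> Ob C; f \<in> Hom C X Y\<rbrakk> \<Longrightarrow> f \<odot> idn C X = f"
    and cmp_assoc: "\<lbrakk>W \<in> Ob C; X \<in> Ob C; Y \<in> Ob C; Z \<in> Ob C;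
        f \<in> Hom C W X; g \<in> Hom C X Y; h \<in> Hom C Y Z\<rbrakk> \<Longrightarrow> h \<odot> (g \<odot> f) = h \<odot> g \<odot> f"
    and cmp_add_left: "\<lbrakk>X \<in> Ob C; Y \<in> Ob C; Z \<in> Ob C;
        f \<in> Hom C X Y; g \<in> Hom C Y Z; g' \<in> Hom C Y Z\<rbrakk> \<Longrightarrow> (g + g') \<odot> f = (g \<odot> f) + (g' \<odot> f)"
    and cmp_add_right: "\<lbrakk>X \<in> Ob C; Y \<in> Ob C; Z \<in> Ob C;
        f \<in> Hom C X Y; f' \<in> Hom C X Y; g \<in> Hom C Y Z\<rbrakk> \<Longrightarrow> g \<odot> (f + f') = (g \<odot> f) + (g \<odot> f')"
    and cmp_scl_left: "\<lbrakk>X \<in> Ob C; Y \<in> Ob C; Z \<in> Ob C; f \<in> Hom C X Y; g \<in> Hom C Y Z\<rbrakk>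
      \<Longrightarrow> scl C c g \<odot> f = scl C c (g \<odot> f)"
    and cmp_scl_right: "\<lbrakk>X \<in> Ob C; Y \<in> Ob C; Z \<in> Ob C; f \<in> Hom C X Y; g \<in> Hom C Y Z\<rbrakk>
      \<Longrightarrow> g \<odot> scl C c f = scl C c (g \<odot> f)"

text \<open>Associator \<open>(X \<boxtimes> Y) \<boxtimes> Z \<rightarrow> X \<boxtimes> (Y \<boxtimes> Z)\<close>, unitors \<open>1 \<boxtimes> X \<rightarrow> X\<close> and \<open>X \<boxtimes> 1 \<rightarrow> X\<close>.\<close>

locale linear_monoidal_category = linear_category +
  assumes unit_in: "unit_ob C \<in> Ob C"
    and tob_in: "\<lbrakk>X \<in> Ob C; Y \<in> Ob C\<rbrakk> \<Longrightarrow> X \<boxtimes> Y \<in> Ob C"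
    and tar_in: "\<lbrakk>X \<in> Ob C; X' \<in> Ob C; Y \<in> Ob C; Y' \<in> Ob C; f \<in> Hom C X X'; g \<in> Hom C Y Y'\<rbrakk>
      \<Longrightarrow> f \<star> g \<in> Hom C (X \<boxtimes> Y) (X' \<boxtimes> Y')"
    and tar_idn: "\<lbrakk>X \<in> Ob C; Y \<in> Ob C\<rbrakk> \<Longrightarrow> idn C X \<star> idn C Y = idn C (X \<boxtimes> Y)"
    and tar_cmp: "\<lbrakk>X \<in> Ob C; X' \<in> Ob C; X'' \<in> Ob C; Y \<in> Ob C; Y' \<in> Ob C; Y'' \<in> Ob C;
        f \<in> Hom C X X'; f' \<in> Hom C X' X''; g \<in> Hom C Y Y'; g' \<in> Hom C Y' Y''\<rbrakk>
      \<Longrightarrow> (f' \<odot> f) \<star> (g' \<odot> g) = (f' \<star> g') \<odot> (f \<star> g)"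
    and tar_add_left: "\<lbrakk>X \<in> Ob C; X' \<in> Ob C; Y \<in> Ob C; Y' \<in> Ob C;
        f \<in> Hom C X X'; f' \<in> Hom C X X'; g \<in> Hom C Y Y'\<rbrakk> \<Longrightarrow> (f + f') \<star> g = (f \<star> g) + (f' \<star> g)"
    and tar_add_right: "\<lbrakk>X \<in> Ob C; X' \<in> Ob C; Y \<in> Ob C; Y' \<in> Ob C;
        f \<in> Hom C X X'; g \<in> Hom C Y Y'; g' \<in> Hom C Y Y'\<rbrakk> \<Longrightarrow> f \<star> (g + g') = (f \<star> g) + (f \<star> g')"
    and tar_scl_left: "\<lbrakk>X \<in> Ob C; X' \<in> Ob C; Y \<in> Ob C; Y' \<in> Ob C; f \<in> Hom C X X'; g \<in> Hom C Y Y'\<rbrakk>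
      \<Longrightarrow> scl C c f \<star> g = scl C c (f \<star> g)"
    and tar_scl_right: "\<lbrakk>X \<in> Ob C; X' \<in> Ob C; Y \<in> Ob C; Y' \<in> Ob C; f \<in> Hom C X X'; g \<in> Hom C Y Y'\<rbrakk>
      \<Longrightarrow> f \<star> scl C c g = scl C c (f \<star> g)"
    and assoc_iso: "\<lbrakk>X \<in> Ob C; Y \<in> Ob C; Z \<in> Ob C\<rbrakk>
      \<Longrightarrow> iso_arr C (X \<boxtimes> Y \<boxtimes> Z) (X \<boxtimes> (Y \<boxtimes> Z)) (assoc C X Y Z)"
    and assoc_natural: "\<lbrakk>X \<in> Ob C; X' \<in> Ob C; Y \<in> Ob C; Y' \<in> Ob C; Z \<in> Ob C; Z' \<in> Ob C;
        f \<in> Hom C X X'; g \<in> Hom C Y Y'; h \<in> Hom C Z Z'\<rbrakk>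
      \<Longrightarrow> assoc C X' Y' Z' \<odot> (f \<star> g \<star> h) = (f \<star> (g \<star> h)) \<odot> assoc C X Y Z"
    and lunit_iso: "X \<in> Ob C \<Longrightarrow> iso_arr C (unit_ob C \<boxtimes> X) X (lunit C X)"
    and lunit_natural: "\<lbrakk>X \<in> Ob C; Y \<in> Ob C; f \<in> Hom C X Y\<rbrakk>
      \<Longrightarrow> lunit C Y \<odot> (idn C (unit_ob C) \<star> f) = f \<odot> lunit C X"
    and runit_iso: "X \<in> Ob C \<Longrightarrow> iso_arr C (X \<boxtimes> unit_ob C) X (runit C X)"
    and runit_natural: "\<lbrakk>X \<in> Ob C; Y \<in> Ob C; f \<in> Hom C X Y\<rbrakk>
      \<Longrightarrow> runit C Y \<odot> (f \<star> idn C (unit_ob C)) = f \<odot> runit C X"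
    and pentagon: "\<lbrakk>W \<in> Ob C; X \<in> Ob C; Y \<in> Ob C; Z \<in> Ob C\<rbrakk>
      \<Longrightarrow> (idn C W \<star> assoc C X Y Z) \<odot> assoc C W (X \<boxtimes> Y) Z \<odot> (assoc C W X Y \<star> idn C Z)
          = assoc C W X (Y \<boxtimes> Z) \<odot> assoc C (W \<boxtimes> X) Y Z"
    and triangle: "\<lbrakk>X \<in> Ob C; Y \<in> Ob C\<rbrakk>
      \<Longrightarrow> (idn C X \<star> lunit C Y) \<odot> assoc C X (unit_ob C) Y = runit C X \<star> idn C Y"


section \<open>Semisimple abelian categories\<close>

definition zero_ob :: "('o, 'a::zero, 'k) tensor_category \<Rightarrow> 'o \<Rightarrow> bool" where
  "zero_ob C X \<longleftrightarrow> X \<in> Ob C \<and> idn C X = 0"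

definition mono_arr :: "('o, 'a, 'k) tensor_category \<Rightarrow> 'o \<Rightarrow> 'o \<Rightarrow> 'a \<Rightarrow> bool" where
  "mono_arr C X Y f \<longleftrightarrow> f \<in> Hom C X Y \<and>
     (\<forall>W \<in> Ob C. \<forall>g \<in> Hom C W X. \<forall>h \<in> Hom C W X. f \<odot>\<^bsub>C\<^esub> g = f \<odot>\<^bsub>C\<^esub> h \<longrightarrow> g = h)"

definition epi_arr :: "('o, 'a, 'k) tensor_category \<Rightarrow> 'o \<Rightarrow> 'o \<Rightarrow> 'a \<Rightarrow> bool" where
  "epi_arr C X Y f \<longleftrightarrow> f \<in> Hom C X Y \<and>
     (\<forall>Z \<in> Ob C. \<forall>g \<in> Hom C Y Z. \<forall>h \<in> Hom C Y Z. g \<odot>\<^bsub>C\<^esub> f = h \<odot>\<^bsub>C\<^esub> f \<longrightarrow> g = h)"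

text \<open>\<open>i : K \<rightarrow> X\<close> is a kernel, resp. \<open>p : Y \<rightarrow> Q\<close> a cokernel, of \<open>f : X \<rightarrow> Y\<close>.\<close>

definition kernel_arr ::
  "('o, 'a::zero, 'k) tensor_category \<Rightarrow> 'o \<Rightarrow> 'o \<Rightarrow> 'a \<Rightarrow> 'o \<Rightarrow> 'a \<Rightarrow> bool" where
  "kernel_arr C X Y f K i \<longleftrightarrow> K \<in> Ob C \<and> i \<in> Hom C K X \<and> f \<odot>\<^bsub>C\<^esub> i = 0 \<and>
     (\<forall>W \<in> Ob C. \<forall>g \<in> Hom C W X. f \<odot>\<^bsub>C\<^esub> g = 0 \<longrightarrow> (\<exists>!h. h \<in> Hom C W K \<and> i \<odot>\<^bsub>C\<^esub> h = g))"

definition cokernel_arr ::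
  "('o, 'a::zero, 'k) tensor_category \<Rightarrow> 'o \<Rightarrow> 'o \<Rightarrow> 'a \<Rightarrow> 'o \<Rightarrow> 'a \<Rightarrow> bool" where
  "cokernel_arr C X Y f Q p \<longleftrightarrow> Q \<in> Ob C \<and> p \<in> Hom C Y Q \<and> p \<odot>\<^bsub>C\<^esub> f = 0 \<and>
     (\<forall>Z \<in> Ob C. \<forall>g \<in> Hom C Y Z. g \<odot>\<^bsub>C\<^esub> f = 0 \<longrightarrow> (\<exists>!h. h \<in> Hom C Q Z \<and> h \<odot>\<^bsub>C\<^esub> p = g))"

definition direct_sum ::
  "('o, 'a::ab_group_add, 'k) tensor_category \<Rightarrow> 'i set \<Rightarrow> ('i \<Rightarrow> 'o) \<Rightarrow> 'o \<Rightarrow> bool" where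
  "direct_sum C I Y X \<longleftrightarrow> finite I \<and> X \<in> Ob C \<and> (\<forall>i\<in>I. Y i \<in> Ob C) \<and>
     (\<exists>inj prj. (\<forall>i\<in>I. inj i \<in> Hom C (Y i) X \<and> prj i \<in> Hom C X (Y i)) \<and>
        (\<forall>i\<in>I. \<forall>j\<in>I. prj j \<odot>\<^bsub>C\<^esub> inj i = (if i = j then idn C (Y i) else 0)) \<and>
        (\<Sum>i\<in>I. inj i \<odot>\<^bsub>C\<^esub> prj i) = idn C X)"

text \<open>The empty family provides the zero object.\<close>

definition abelian_category :: "('o, 'a::ab_group_add, 'k::field) tensor_category \<Rightarrow> bool" where
  "abelian_category C \<longleftrightarrow> linear_category C \<and>
     (\<forall>(n::nat) Y. (\<forall>i<n. Y i \<in> Ob C) \<longrightarrow> (\<exists>X. direct_sum C {..<n} Y X)) \<and>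
     (\<forall>X \<in> Ob C. \<forall>Y \<in> Ob C. \<forall>f \<in> Hom C X Y.
        (\<exists>K i. kernel_arr C X Y f K i) \<and> (\<exists>Q p. cokernel_arr C X Y f Q p)) \<and>
     (\<forall>X \<in> Ob C. \<forall>Y \<in> Ob C. \<forall>f. mono_arr C X Y f \<longrightarrow>
        (\<exists>Z \<in> Ob C. \<exists>g \<in> Hom C Y Z. kernel_arr C Y Z g X f)) \<and>
     (\<forall>X \<in> Ob C. \<forall>Y \<in> Ob C. \<forall>f. epi_arr C X Y f \<longrightarrow>
        (\<exists>W \<in> Ob C. \<exists>g \<in> Hom C W X. cokernel_arr C W X g Y f))"

text \<open>The only subobjects of a simple object are 0 and the object itself.\<close>

definition simple_ob :: "('o, 'a::ab_group_add, 'k) tensor_category \<Rightarrow> 'o \<Rightarrow> bool" where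
  "simple_ob C X \<longleftrightarrow> X \<in> Ob C \<and> \<not> zero_ob C X \<and>
     (\<forall>Y \<in> Ob C. \<forall>f. mono_arr C Y X f \<longrightarrow> zero_ob C Y \<or> iso_arr C Y X f)"

definition semisimple_category :: "('o, 'a::ab_group_add, 'k::field) tensor_category \<Rightarrow> bool" where
  "semisimple_category C \<longleftrightarrow> abelian_category C \<and>
     (\<forall>X \<in> Ob C. \<exists>(n::nat) Y. (\<forall>i<n. simple_ob C (Y i)) \<and> direct_sum C {..<n} Y X)"

definition iso_class :: "('o, 'a, 'k) tensor_category \<Rightarrow> 'o \<Rightarrow> 'o set" where
  "iso_class C X = {Y \<in> Ob C. isomorphic C X Y}"

definition Irr :: "('o, 'a::ab_group_add, 'k) tensor_category \<Rightarrow> 'o set set" where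
  "Irr C = iso_class C ` {X. simple_ob C X}"


section \<open>Fusion categories\<close>

text \<open>\<open>Y\<close> is a left dual of \<open>X\<close> (equivalently, \<open>X\<close> is a right dual of \<open>Y\<close>), with evaluation
  \<open>Y \<boxtimes> X \<rightarrow> 1\<close> and coevaluation \<open>1 \<rightarrow> X \<boxtimes> Y\<close>.\<close>

definition left_dual :: "('o, 'a, 'k) tensor_category \<Rightarrow> 'o \<Rightarrow> 'o \<Rightarrow> bool" where
  "left_dual C X Y \<longleftrightarrow> X \<in> Ob C \<and> Y \<in> Ob C \<and>
     (\<exists>ev \<in> Hom C (Y \<boxtimes>\<^bsub>C\<^esub> X) (unit_ob C). \<exists>coev \<in> Hom C (unit_ob C) (X \<boxtimes>\<^bsub>C\<^esub> Y).
        runit C X \<odot>\<^bsub>C\<^esub> (idn C X \<star>\<^bsub>C\<^esub> ev) \<odot>\<^bsub>C\<^esub> assoc C X Y X \<odot>\<^bsub>C\<^esub> (coev \<star>\<^bsub>C\<^esub> idn C X) = lunit C X \<and>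
        lunit C Y \<odot>\<^bsub>C\<^esub> (ev \<star>\<^bsub>C\<^esub> idn C Y) \<odot>\<^bsub>C\<^esub>
          inv_arr C (Y \<boxtimes>\<^bsub>C\<^esub> X \<boxtimes>\<^bsub>C\<^esub> Y) (Y \<boxtimes>\<^bsub>C\<^esub> (X \<boxtimes>\<^bsub>C\<^esub> Y)) (assoc C Y X Y) \<odot>\<^bsub>C\<^esub>
          (idn C Y \<star>\<^bsub>C\<^esub> coev) = runit C Y)"

definition rigid :: "('o, 'a, 'k) tensor_category \<Rightarrow> bool" where
  "rigid C \<longleftrightarrow> (\<forall>X \<in> Ob C. (\<exists>Y. left_dual C X Y) \<and> (\<exists>Z. left_dual C Z X))"

definition fusion_category :: "('o, 'a::ab_group_add, 'k::field) tensor_category \<Rightarrow> bool" where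
  "fusion_category C \<longleftrightarrow>
     linear_monoidal_category C \<and> semisimple_category C \<and> rigid C \<and> finite (Irr C) \<and>
     (\<forall>X \<in> Ob C. \<forall>Y \<in> Ob C. \<exists>B. finite B \<and> Hom C X Y = module.span (scl C) B) \<and>
     simple_ob C (unit_ob C)"

definition rep_ob :: "'o set \<Rightarrow> 'o" where
  "rep_ob x = (SOME X. X \<in> x)"

text \<open>\<open>fusion_rule C x y z\<close> is \<open>dim Hom(Z, X \<boxtimes> Y)\<close> for the isomorphism classes \<open>x\<close>, \<open>y\<close>, \<open>z\<close> of
  \<open>X\<close>, \<open>Y\<close>, \<open>Z\<close>.\<close>

definition fusion_rule ::
  "('o, 'a::ab_group_add, 'k::field) tensor_category \<Rightarrow> 'o set \<Rightarrow> 'o set \<Rightarrow> 'o set \<Rightarrow> nat" where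
  "fusion_rule C x y z =
     vector_space.dim (scl C) (Hom C (rep_ob z) (rep_ob x \<boxtimes>\<^bsub>C\<^esub> rep_ob y))"

definition grothendieck_equivalent ::
  "('o, 'a::ab_group_add, 'k::field) tensor_category \<Rightarrow>
   ('p, 'b::ab_group_add, 'k) tensor_category \<Rightarrow> bool" where
  "grothendieck_equivalent C D \<longleftrightarrow>
     (\<exists>f. bij_betw f (Irr C) (Irr D) \<and>
        f (iso_class C (unit_ob C)) = iso_class D (unit_ob D) \<and>
        (\<forall>x \<in> Irr C. \<forall>y \<in> Irr C. \<forall>z \<in> Irr C.
           fusion_rule D (f x) (f y) (f z) = fusion_rule C x y z))"


section \<open>Tensor functors and tensor equivalences\<close>

text \<open>
  Since Hom sets may overlap, the action of a functor on arrows depends on source and target.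
  The structure isomorphisms are \<open>ften F X Y : F X \<boxtimes> F Y \<rightarrow> F (X \<boxtimes> Y)\<close> and \<open>funi F : 1 \<rightarrow> F 1\<close>.
\<close>

record ('o, 'a, 'p, 'b) tensor_functor =
  fob :: "'o \<Rightarrow> 'p"
  far :: "'o \<Rightarrow> 'o \<Rightarrow> 'a \<Rightarrow> 'b"
  ften :: "'o \<Rightarrow> 'o \<Rightarrow> 'b"
  funi :: "'b"

locale is_tensor_functor =
  fixes C :: "('o, 'a::ab_group_add, 'k::field) tensor_category"
    and D :: "('p, 'b::ab_group_add, 'k) tensor_category" (structure)
    and F :: "('o, 'a, 'p, 'b) tensor_functor"
  assumes fob_in: "X \<in> Ob C \<Longrightarrow> fob F X \<in> Ob D"
    and far_in: "\<lbrakk>X \<in> Ob C; Y \<in> Ob C; f \<in> Hom C X Y\<rbrakk> \<Longrightarrow> far F X Y f \<in> Hom D (fob F X) (fob F Y)"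
    and far_idn: "X \<in> Ob C \<Longrightarrow> far F X X (idn C X) = idn D (fob F X)"
    and far_cmp: "\<lbrakk>X \<in> Ob C; Y \<in> Ob C; Z \<in> Ob C; f \<in> Hom C X Y; g \<in> Hom C Y Z\<rbrakk>
      \<Longrightarrow> far F X Z (g \<odot>\<^bsub>C\<^esub> f) = far F Y Z g \<odot> far F X Y f"
    and far_add: "\<lbrakk>X \<in> Ob C; Y \<in> Ob C; f \<in> Hom C X Y; g \<in> Hom C X Y\<rbrakk>
      \<Longrightarrow> far F X Y (f + g) = far F X Y f + far F X Y g"
    and far_scl: "\<lbrakk>X \<in> Ob C; Y \<in> Ob C; f \<in> Hom C X Y\<rbrakk>
      \<Longrightarrow> far F X Y (scl C c f) = scl D c (far F X Y f)"
    and ften_iso: "\<lbrakk>X \<in> Ob C; Y \<in> Ob C\<rbrakk>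
      \<Longrightarrow> iso_arr D (fob F X \<boxtimes> fob F Y) (fob F (X \<boxtimes>\<^bsub>C\<^esub> Y)) (ften F X Y)"
    and ften_natural: "\<lbrakk>X \<in> Ob C; X' \<in> Ob C; Y \<in> Ob C; Y' \<in> Ob C; f \<in> Hom C X X'; g \<in> Hom C Y Y'\<rbrakk>
      \<Longrightarrow> ften F X' Y' \<odot> (far F X X' f \<star> far F Y Y' g)
          = far F (X \<boxtimes>\<^bsub>C\<^esub> Y) (X' \<boxtimes>\<^bsub>C\<^esub> Y') (f \<star>\<^bsub>C\<^esub> g) \<odot> ften F X Y"
    and funi_iso: "iso_arr D (unit_ob D) (fob F (unit_ob C)) (funi F)"
    and hexagon: "\<lbrakk>X \<in> Ob C; Y \<in> Ob C; Z \<in> Ob C\<rbrakk>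
      \<Longrightarrow> far F (X \<boxtimes>\<^bsub>C\<^esub> Y \<boxtimes>\<^bsub>C\<^esub> Z) (X \<boxtimes>\<^bsub>C\<^esub> (Y \<boxtimes>\<^bsub>C\<^esub> Z)) (assoc C X Y Z) \<odot> ften F (X \<boxtimes>\<^bsub>C\<^esub> Y) Z
            \<odot> (ften F X Y \<star> idn D (fob F Z))
          = ften F X (Y \<boxtimes>\<^bsub>C\<^esub> Z) \<odot> (idn D (fob F X) \<star> ften F Y Z)
            \<odot> assoc D (fob F X) (fob F Y) (fob F Z)"
    and lunit_compat: "X \<in> Ob C
      \<Longrightarrow> far F (unit_ob C \<boxtimes>\<^bsub>C\<^esub> X) X (lunit C X) \<odot> ften F (unit_ob C) X \<odot> (funi F \<star> idn D (fob F X))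
          = lunit D (fob F X)"
    and runit_compat: "X \<in> Ob C
      \<Longrightarrow> far F (X \<boxtimes>\<^bsub>C\<^esub> unit_ob C) X (runit C X) \<odot> ften F X (unit_ob C) \<odot> (idn D (fob F X) \<star> funi F)
          = runit D (fob F X)"

definition is_tensor_equivalence ::
  "('o, 'a::ab_group_add, 'k::field) tensor_category \<Rightarrow> ('p, 'b::ab_group_add, 'k) tensor_category \<Rightarrow>
   ('o, 'a, 'p, 'b) tensor_functor \<Rightarrow> bool" where
  "is_tensor_equivalence C D F \<longleftrightarrow> is_tensor_functor C D F \<and>
     (\<forall>X \<in> Ob C. \<forall>Y \<in> Ob C. bij_betw (far F X Y) (Hom C X Y) (Hom D (fob F X) (fob F Y))) \<and>
     (\<forall>Z \<in> Ob D. \<exists>X \<in> Ob C. isomorphic D (fob F X) Z)"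

definition tensor_equivalent ::
  "('o, 'a::ab_group_add, 'k::field) tensor_category \<Rightarrow> ('p, 'b::ab_group_add, 'k) tensor_category \<Rightarrow>
   bool" where
  "tensor_equivalent C D \<longleftrightarrow> (\<exists>F. is_tensor_equivalence C D F)"

definition id_functor :: "('o, 'a, 'k) tensor_category \<Rightarrow> ('o, 'a, 'o, 'a) tensor_functor" where
  "id_functor C = \<lparr> fob = (\<lambda>X. X), far = (\<lambda>X Y f. f), ften = (\<lambda>X Y. idn C (X \<boxtimes>\<^bsub>C\<^esub> Y)),
     funi = idn C (unit_ob C) \<rparr>"

text \<open>The composite \<open>G F\<close> of tensor endofunctors of \<open>C\<close>.\<close>

definition comp_functor ::
  "('o, 'a, 'k) tensor_category \<Rightarrow> ('o, 'a, 'o, 'a) tensor_functor \<Rightarrow>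
   ('o, 'a, 'o, 'a) tensor_functor \<Rightarrow> ('o, 'a, 'o, 'a) tensor_functor" where
  "comp_functor C G F = \<lparr>
     fob = (\<lambda>X. fob G (fob F X)),
     far = (\<lambda>X Y f. far G (fob F X) (fob F Y) (far F X Y f)),
     ften = (\<lambda>X Y. far G (fob F X \<boxtimes>\<^bsub>C\<^esub> fob F Y) (fob F (X \<boxtimes>\<^bsub>C\<^esub> Y)) (ften F X Y)
                    \<odot>\<^bsub>C\<^esub> ften G (fob F X) (fob F Y)),
     funi = far G (unit_ob C) (fob F (unit_ob C)) (funi F) \<odot>\<^bsub>C\<^esub> funi G \<rparr>"

definition tensor_natural_iso ::
  "('o, 'a, 'k) tensor_category \<Rightarrow> ('p, 'b, 'k) tensor_category \<Rightarrow>
   ('o, 'a, 'p, 'b) tensor_functor \<Rightarrow> ('o, 'a, 'p, 'b) tensor_functor \<Rightarrow> ('o \<Rightarrow> 'b) \<Rightarrow> bool" where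
  "tensor_natural_iso C D F G \<eta> \<longleftrightarrow>
     (\<forall>X \<in> Ob C. iso_arr D (fob F X) (fob G X) (\<eta> X)) \<and>
     (\<forall>X \<in> Ob C. \<forall>Y \<in> Ob C. \<forall>f \<in> Hom C X Y. \<eta> Y \<odot>\<^bsub>D\<^esub> far F X Y f = far G X Y f \<odot>\<^bsub>D\<^esub> \<eta> X) \<and>
     (\<forall>X \<in> Ob C. \<forall>Y \<in> Ob C.
        \<eta> (X \<boxtimes>\<^bsub>C\<^esub> Y) \<odot>\<^bsub>D\<^esub> ften F X Y = ften G X Y \<odot>\<^bsub>D\<^esub> (\<eta> X \<star>\<^bsub>D\<^esub> \<eta> Y)) \<and>
     \<eta> (unit_ob C) \<odot>\<^bsub>D\<^esub> funi F = funi G"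


section \<open>Group extensions\<close>

text \<open>
  The components are full subcategories, given by sets of objects closed under isomorphism.
  Together with the existence of decompositions and the vanishing of Hom between different
  components this says that the category is their direct sum; in particular the components are
  closed under direct sums and direct summands.
\<close>

definition direct_sum_decomposition ::
  "'g set \<Rightarrow> ('o, 'a::ab_group_add, 'k) tensor_category \<Rightarrow> ('g \<Rightarrow> 'o set) \<Rightarrow> bool" where
  "direct_sum_decomposition I C \<A> \<longleftrightarrow>
     (\<forall>g\<in>I. \<A> g \<subseteq> Ob C \<and> (\<forall>X \<in> \<A> g. \<forall>Y \<in> Ob C. isomorphic C X Y \<longrightarrow> Y \<in> \<A> g)) \<and>
     (\<forall>g\<in>I. \<forall>h\<in>I. g \<noteq> h \<longrightarrow> (\<forall>X \<in> \<A> g. \<forall>Y \<in> \<A> h. Hom C X Y = {0})) \<and>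
     (\<forall>X \<in> Ob C. \<exists>Y. (\<forall>g\<in>I. Y g \<in> \<A> g) \<and> direct_sum C I Y X)"

definition is_extension ::
  "('g, 'm) monoid_scheme \<Rightarrow> ('o, 'a::ab_group_add, 'k::field) tensor_category \<Rightarrow>
   ('p, 'b::ab_group_add, 'k) tensor_category \<Rightarrow> bool" where
  "is_extension G C D \<longleftrightarrow>
     (\<exists>\<A>. direct_sum_decomposition (carrier G) C \<A> \<and>
        (\<forall>g \<in> carrier G. \<exists>X \<in> \<A> g. \<not> zero_ob C X) \<and>
        (\<forall>g \<in> carrier G. \<forall>h \<in> carrier G. \<forall>X \<in> \<A> g. \<forall>Y \<in> \<A> h. X \<boxtimes>\<^bsub>C\<^esub> Y \<in> \<A> (g \<otimes>\<^bsub>G\<^esub> h)) \<and>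
        (\<forall>g \<in> carrier G. \<forall>X \<in> \<A> g. \<forall>Y. left_dual C X Y \<longrightarrow> Y \<in> \<A> (inv\<^bsub>G\<^esub> g)) \<and>
        tensor_equivalent (C\<lparr>Ob := \<A> \<one>\<^bsub>G\<^esub>\<rparr>) D)"


section \<open>Group actions and equivariantizations\<close>

text \<open>
  An action of \<open>G\<close> on \<open>D\<close> by tensor autoequivalences is a monoidal functor from \<open>G\<close> (as a discrete
  monoidal category) to the category of tensor autoequivalences of \<open>D\<close> and monoidal natural
  isomorphisms, with structure isomorphisms \<open>\<gamma> g h : \<rho> g \<rho> h \<rightarrow> \<rho> (g h)\<close> and \<open>\<upsilon> : id \<rightarrow> \<rho> 1\<close>.
\<close>

locale tensor_action =
  fixes G :: "('g, 'm) monoid_scheme"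
    and D :: "('o, 'a::ab_group_add, 'k::field) tensor_category"
    and \<rho> :: "'g \<Rightarrow> ('o, 'a, 'o, 'a) tensor_functor"
    and \<gamma> :: "'g \<Rightarrow> 'g \<Rightarrow> 'o \<Rightarrow> 'a"
    and \<upsilon> :: "'o \<Rightarrow> 'a"
  assumes autoequivalence: "g \<in> carrier G \<Longrightarrow> is_tensor_equivalence D D (\<rho> g)"
    and mult_iso: "\<lbrakk>g \<in> carrier G; h \<in> carrier G\<rbrakk>
      \<Longrightarrow> tensor_natural_iso D D (comp_functor D (\<rho> g) (\<rho> h)) (\<rho> (g \<otimes>\<^bsub>G\<^esub> h)) (\<gamma> g h)"
    and one_iso: "tensor_natural_iso D D (id_functor D) (\<rho> \<one>\<^bsub>G\<^esub>) \<upsilon>"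
    and mult_coherent: "\<lbrakk>g \<in> carrier G; h \<in> carrier G; l \<in> carrier G; X \<in> Ob D\<rbrakk>
      \<Longrightarrow> \<gamma> (g \<otimes>\<^bsub>G\<^esub> h) l X \<odot>\<^bsub>D\<^esub> \<gamma> g h (fob (\<rho> l) X)
          = \<gamma> g (h \<otimes>\<^bsub>G\<^esub> l) X
            \<odot>\<^bsub>D\<^esub> far (\<rho> g) (fob (\<rho> h) (fob (\<rho> l) X)) (fob (\<rho> (h \<otimes>\<^bsub>G\<^esub> l)) X) (\<gamma> h l X)"
    and one_coherent_left: "\<lbrakk>g \<in> carrier G; X \<in> Ob D\<rbrakk>
      \<Longrightarrow> \<gamma> \<one>\<^bsub>G\<^esub> g X \<odot>\<^bsub>D\<^esub> \<upsilon> (fob (\<rho> g) X) = idn D (fob (\<rho> g) X)"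
    and one_coherent_right: "\<lbrakk>g \<in> carrier G; X \<in> Ob D\<rbrakk>
      \<Longrightarrow> \<gamma> g \<one>\<^bsub>G\<^esub> X \<odot>\<^bsub>D\<^esub> far (\<rho> g) X (fob (\<rho> \<one>\<^bsub>G\<^esub>) X) (\<upsilon> X) = idn D (fob (\<rho> g) X)"

definition equivariant_obs ::
  "('g, 'm) monoid_scheme \<Rightarrow> ('o, 'a, 'k) tensor_category \<Rightarrow>
   ('g \<Rightarrow> ('o, 'a, 'o, 'a) tensor_functor) \<Rightarrow> ('g \<Rightarrow> 'g \<Rightarrow> 'o \<Rightarrow> 'a) \<Rightarrow> ('o \<Rightarrow> 'a) \<Rightarrow>
   ('o \<times> ('g \<Rightarrow> 'a)) set" where
  "equivariant_obs G D \<rho> \<gamma> \<upsilon> = {(X, \<mu>). X \<in> Ob D \<and> \<mu> \<in> extensional (carrier G) \<and>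
     (\<forall>g \<in> carrier G. iso_arr D (fob (\<rho> g) X) X (\<mu> g)) \<and>
     (\<forall>g \<in> carrier G. \<forall>h \<in> carrier G.
        \<mu> g \<odot>\<^bsub>D\<^esub> far (\<rho> g) (fob (\<rho> h) X) X (\<mu> h) = \<mu> (g \<otimes>\<^bsub>G\<^esub> h) \<odot>\<^bsub>D\<^esub> \<gamma> g h X) \<and>
     \<mu> \<one>\<^bsub>G\<^esub> \<odot>\<^bsub>D\<^esub> \<upsilon> X = idn D X}"

definition equivariantization ::
  "('g, 'm) monoid_scheme \<Rightarrow> ('o, 'a, 'k) tensor_category \<Rightarrow>
   ('g \<Rightarrow> ('o, 'a, 'o, 'a) tensor_functor) \<Rightarrow> ('g \<Rightarrow> 'g \<Rightarrow> 'o \<Rightarrow> 'a) \<Rightarrow> ('o \<Rightarrow> 'a) \<Rightarrow>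
   ('o \<times> ('g \<Rightarrow> 'a), 'a, 'k) tensor_category" where
  "equivariantization G D \<rho> \<gamma> \<upsilon> = \<lparr>
     Ob = equivariant_obs G D \<rho> \<gamma> \<upsilon>,
     Hom = (\<lambda>(X, \<mu>) (Y, \<nu>). {f \<in> Hom D X Y. \<forall>g \<in> carrier G. f \<odot>\<^bsub>D\<^esub> \<mu> g = \<nu> g \<odot>\<^bsub>D\<^esub> far (\<rho> g) X Y f}),
     scl = scl D,
     cmp = cmp D,
     idn = (\<lambda>(X, \<mu>). idn D X),
     tob = (\<lambda>(X, \<mu>) (Y, \<nu>). (X \<boxtimes>\<^bsub>D\<^esub> Y, \<lambda>g \<in> carrier G. (\<mu> g \<star>\<^bsub>D\<^esub> \<nu> g) \<odot>\<^bsub>D\<^esub>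
        inv_arr D (fob (\<rho> g) X \<boxtimes>\<^bsub>D\<^esub> fob (\<rho> g) Y) (fob (\<rho> g) (X \<boxtimes>\<^bsub>D\<^esub> Y)) (ften (\<rho> g) X Y))),
     tar = tar D,
     unit_ob = (unit_ob D, \<lambda>g \<in> carrier G. inv_arr D (unit_ob D) (fob (\<rho> g) (unit_ob D)) (funi (\<rho> g))),
     assoc = (\<lambda>(X, \<mu>) (Y, \<nu>) (Z, \<xi>). assoc D X Y Z),
     lunit = (\<lambda>(X, \<mu>). lunit D X),
     runit = (\<lambda>(X, \<mu>). runit D X) \<rparr>"

definition is_equivariantization ::
  "('g, 'm) monoid_scheme \<Rightarrow> ('o, 'a::ab_group_add, 'k::field) tensor_category \<Rightarrow>
   ('p, 'b::ab_group_add, 'k) tensor_category \<Rightarrow> bool" where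
  "is_equivariantization G C D \<longleftrightarrow>
     (\<exists>\<rho> \<gamma> \<upsilon>. tensor_action G D \<rho> \<gamma> \<upsilon> \<and> tensor_equivalent C (equivariantization G D \<rho> \<gamma> \<upsilon>))"


section \<open>Vector spaces and representations of Hopf algebras\<close>

text \<open>
  \<open>Vect\<close>: an object is a finite set of natural numbers, standing for the vector space with that
  basis. An arrow is a matrix, rows indexed by the basis of the target. The tensor product of the
  spaces on \<open>A\<close> and \<open>B\<close> has the basis \<open>A \<times> B\<close>, coded by \<open>prod_encode\<close>.
\<close>

definition mat_scl :: "'k::field \<Rightarrow> (nat \<Rightarrow> nat \<Rightarrow> 'k) \<Rightarrow> nat \<Rightarrow> nat \<Rightarrow> 'k" where
  "mat_scl c S = (\<lambda>i j. c * S i j)"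

definition mat_cmp ::
  "(nat \<Rightarrow> nat \<Rightarrow> 'k::field) \<Rightarrow> (nat \<Rightarrow> nat \<Rightarrow> 'k) \<Rightarrow> nat \<Rightarrow> nat \<Rightarrow> 'k" where
  "mat_cmp S T = (\<lambda>i j. \<Sum>p | T p j \<noteq> 0. S i p * T p j)"

definition mat_idn :: "nat set \<Rightarrow> nat \<Rightarrow> nat \<Rightarrow> 'k::field" where
  "mat_idn A = (\<lambda>i j. of_bool (i \<in> A \<and> i = j))"

definition mat_tob :: "nat set \<Rightarrow> nat set \<Rightarrow> nat set" where
  "mat_tob A B = prod_encode ` (A \<times> B)"

definition mat_tar ::
  "(nat \<Rightarrow> nat \<Rightarrow> 'k::field) \<Rightarrow> (nat \<Rightarrow> nat \<Rightarrow> 'k) \<Rightarrow> nat \<Rightarrow> nat \<Rightarrow> 'k" where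
  "mat_tar S T = (\<lambda>i j. S (fst (prod_decode i)) (fst (prod_decode j)) *
                        T (snd (prod_decode i)) (snd (prod_decode j)))"

definition mat_assoc :: "nat set \<Rightarrow> nat set \<Rightarrow> nat set \<Rightarrow> nat \<Rightarrow> nat \<Rightarrow> 'k::field" where
  "mat_assoc A B C = (\<lambda>i j. of_bool (\<exists>a\<in>A. \<exists>b\<in>B. \<exists>c\<in>C.
     i = prod_encode (a, prod_encode (b, c)) \<and> j = prod_encode (prod_encode (a, b), c)))"

definition mat_lunit :: "nat set \<Rightarrow> nat \<Rightarrow> nat \<Rightarrow> 'k::field" where
  "mat_lunit A = (\<lambda>i j. of_bool (i \<in> A \<and> j = prod_encode (0, i)))"

definition mat_runit :: "nat set \<Rightarrow> nat \<Rightarrow> nat \<Rightarrow> 'k::field" where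
  "mat_runit A = (\<lambda>i j. of_bool (i \<in> A \<and> j = prod_encode (i, 0)))"

definition Vect :: "(nat set, nat \<Rightarrow> nat \<Rightarrow> 'k::field, 'k) tensor_category" where
  "Vect = \<lparr>
     Ob = {A. finite A},
     Hom = (\<lambda>A B. {S. \<forall>i j. S i j \<noteq> 0 \<longrightarrow> i \<in> B \<and> j \<in> A}),
     scl = mat_scl,
     cmp = mat_cmp,
     idn = mat_idn,
     tob = mat_tob,
     tar = mat_tar,
     unit_ob = {0},
     assoc = mat_assoc,
     lunit = mat_lunit,
     runit = mat_runit \<rparr>"

text \<open>
  A Hopf algebra with finite basis \<open>hbas\<close>, given by the coefficients of its structure maps:
  \<open>hmul b c d\<close> of \<open>d\<close> in \<open>b c\<close>, \<open>hone b\<close> of \<open>b\<close> in 1, \<open>hcom b c d\<close> of \<open>c \<otimes> d\<close> in \<open>\<Delta> b\<close>, \<open>hcou b = \<epsilon> b\<close>,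
  and \<open>hant b c\<close> of \<open>c\<close> in \<open>S b\<close>.
\<close>

record ('b, 'k) hopf_algebra_data =
  hbas :: "'b set"
  hmul :: "'b \<Rightarrow> 'b \<Rightarrow> 'b \<Rightarrow> 'k"
  hone :: "'b \<Rightarrow> 'k"
  hcom :: "'b \<Rightarrow> 'b \<Rightarrow> 'b \<Rightarrow> 'k"
  hcou :: "'b \<Rightarrow> 'k"
  hant :: "'b \<Rightarrow> 'b \<Rightarrow> 'k"

locale hopf_algebra =
  fixes H :: "('b, 'k::field) hopf_algebra_data"
  assumes finite_hbas: "finite (hbas H)"
    and mul_assoc: "\<lbrakk>a \<in> hbas H; b \<in> hbas H; c \<in> hbas H; d \<in> hbas H\<rbrakk>
      \<Longrightarrow> (\<Sum>x\<in>hbas H. hmul H a b x * hmul H x c d) = (\<Sum>x\<in>hbas H. hmul H b c x * hmul H a x d)"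
    and one_left: "\<lbrakk>a \<in> hbas H; b \<in> hbas H\<rbrakk>
      \<Longrightarrow> (\<Sum>x\<in>hbas H. hone H x * hmul H x a b) = of_bool (a = b)"
    and one_right: "\<lbrakk>a \<in> hbas H; b \<in> hbas H\<rbrakk>
      \<Longrightarrow> (\<Sum>x\<in>hbas H. hone H x * hmul H a x b) = of_bool (a = b)"
    and com_coassoc: "\<lbrakk>a \<in> hbas H; b \<in> hbas H; c \<in> hbas H; d \<in> hbas H\<rbrakk>
      \<Longrightarrow> (\<Sum>x\<in>hbas H. hcom H a x d * hcom H x b c) = (\<Sum>x\<in>hbas H. hcom H a b x * hcom H x c d)"
    and cou_left: "\<lbrakk>a \<in> hbas H; b \<in> hbas H\<rbrakk>
      \<Longrightarrow> (\<Sum>x\<in>hbas H. hcou H x * hcom H a x b) = of_bool (a = b)"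
    and cou_right: "\<lbrakk>a \<in> hbas H; b \<in> hbas H\<rbrakk>
      \<Longrightarrow> (\<Sum>x\<in>hbas H. hcou H x * hcom H a b x) = of_bool (a = b)"
    and com_mul: "\<lbrakk>a \<in> hbas H; b \<in> hbas H; c \<in> hbas H; d \<in> hbas H\<rbrakk>
      \<Longrightarrow> (\<Sum>x\<in>hbas H. hmul H a b x * hcom H x c d)
          = (\<Sum>p\<in>hbas H. \<Sum>q\<in>hbas H. \<Sum>r\<in>hbas H. \<Sum>s\<in>hbas H.
               hcom H a p q * hcom H b r s * hmul H p r c * hmul H q s d)"
    and com_one: "\<lbrakk>b \<in> hbas H; c \<in> hbas H\<rbrakk>
      \<Longrightarrow> (\<Sum>x\<in>hbas H. hone H x * hcom H x b c) = hone H b * hone H c"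
    and cou_mul: "\<lbrakk>a \<in> hbas H; b \<in> hbas H\<rbrakk>
      \<Longrightarrow> (\<Sum>x\<in>hbas H. hmul H a b x * hcou H x) = hcou H a * hcou H b"
    and cou_one: "(\<Sum>x\<in>hbas H. hone H x * hcou H x) = 1"
    and ant_left: "\<lbrakk>a \<in> hbas H; b \<in> hbas H\<rbrakk>
      \<Longrightarrow> (\<Sum>p\<in>hbas H. \<Sum>q\<in>hbas H. \<Sum>r\<in>hbas H. hcom H a p q * hant H p r * hmul H r q b)
          = hcou H a * hone H b"
    and ant_right: "\<lbrakk>a \<in> hbas H; b \<in> hbas H\<rbrakk>
      \<Longrightarrow> (\<Sum>p\<in>hbas H. \<Sum>q\<in>hbas H. \<Sum>r\<in>hbas H. hcom H a p q * hant H q r * hmul H p r b)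
          = hcou H a * hone H b"

text \<open>A representation is an object of \<open>Vect\<close> with a matrix for each basis element.\<close>

definition reps ::
  "('b, 'k::field) hopf_algebra_data \<Rightarrow> (nat set \<times> ('b \<Rightarrow> nat \<Rightarrow> nat \<Rightarrow> 'k)) set" where
  "reps H = {(A, \<rho>). finite A \<and> (\<forall>b \<in> hbas H. \<rho> b \<in> Hom Vect A A) \<and> (\<forall>b. b \<notin> hbas H \<longrightarrow> \<rho> b = 0) \<and>
     (\<forall>b \<in> hbas H. \<forall>c \<in> hbas H. mat_cmp (\<rho> b) (\<rho> c) = (\<Sum>d \<in> hbas H. mat_scl (hmul H b c d) (\<rho> d))) \<and>
     (\<Sum>b \<in> hbas H. mat_scl (hone H b) (\<rho> b)) = mat_idn A}"

definition Rep ::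
  "('b, 'k::field) hopf_algebra_data \<Rightarrow>
   (nat set \<times> ('b \<Rightarrow> nat \<Rightarrow> nat \<Rightarrow> 'k), nat \<Rightarrow> nat \<Rightarrow> 'k, 'k) tensor_category" where
  "Rep H = \<lparr>
     Ob = reps H,
     Hom = (\<lambda>(A, \<rho>) (B, \<sigma>). {S \<in> Hom Vect A B. \<forall>b \<in> hbas H. mat_cmp S (\<rho> b) = mat_cmp (\<sigma> b) S}),
     scl = mat_scl,
     cmp = mat_cmp,
     idn = (\<lambda>(A, \<rho>). mat_idn A),
     tob = (\<lambda>(A, \<rho>) (B, \<sigma>). (mat_tob A B, \<lambda>b. if b \<in> hbas H
        then \<Sum>c \<in> hbas H. \<Sum>d \<in> hbas H. mat_scl (hcom H b c d) (mat_tar (\<rho> c) (\<sigma> d)) else 0)),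
     tar = mat_tar,
     unit_ob = ({0}, \<lambda>b. if b \<in> hbas H then mat_scl (hcou H b) (mat_idn {0}) else 0),
     assoc = (\<lambda>(A, \<rho>) (B, \<sigma>) (C, \<tau>). mat_assoc A B C),
     lunit = (\<lambda>(A, \<rho>). mat_lunit A),
     runit = (\<lambda>(A, \<rho>). mat_runit A) \<rparr>"


section \<open>Solvable fusion categories\<close>

text \<open>
  The intermediate categories range over all fusion categories with objects in \<open>'p\<close> and arrows in
  \<open>'b\<close>. As finitely many categories fit into common types, a category is not solvable iff
  \<open>\<not> solvable_fusion TYPE('p) TYPE('b) C\<close> holds for all types \<open>'p\<close> and \<open>'b\<close>. Every finite group is
  isomorphic to one with elements in \<open>int\<close>.
\<close>

definition solvable_fusion ::
  "'p itself \<Rightarrow> 'b::ab_group_add itself \<Rightarrow> ('o, 'a::ab_group_add, 'k::field) tensor_category \<Rightarrow> bool" where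
  "solvable_fusion _ _ C \<longleftrightarrow>
     (\<exists>n (\<C> :: nat \<Rightarrow> ('p, 'b, 'k) tensor_category) (\<G> :: nat \<Rightarrow> int monoid).
        (\<forall>i\<le>n. fusion_category (\<C> i)) \<and>
        tensor_equivalent (\<C> 0) Vect \<and>
        tensor_equivalent (\<C> n) C \<and>
        (\<forall>i\<in>{1..n}. group (\<G> i) \<and> cyclic_group (\<G> i) \<and> prime (order (\<G> i)) \<and>
           (is_equivariantization (\<G> i) (\<C> i) (\<C> (i - 1)) \<or> is_extension (\<G> i) (\<C> i) (\<C> (i - 1)))))"


section \<open>The bismash product\<close>

definition C2 :: "nat \<Rightarrow> (nat \<Rightarrow> nat) set" where
  "C2 n = generate (sym_group n) {transpose 1 2}"

definition conj_act :: "nat \<Rightarrow> (nat \<Rightarrow> nat) \<Rightarrow> (nat \<Rightarrow> nat) \<Rightarrow> nat \<Rightarrow> nat" where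
  "conj_act n s x = inv\<^bsub>sym_group n\<^esub> x \<otimes>\<^bsub>sym_group n\<^esub> s \<otimes>\<^bsub>sym_group n\<^esub> x"

text \<open>The pair \<open>(s, x)\<close> stands for the basis element \<open>e\<^sub>s # x\<close>.\<close>

definition bismash :: "nat \<Rightarrow> ((nat \<Rightarrow> nat) \<times> (nat \<Rightarrow> nat), 'k::field) hopf_algebra_data" where
  "bismash n = \<lparr>
     hbas = carrier (alt_group n) \<times> C2 n,
     hmul = (\<lambda>(s, x) (t, y) (u, z). of_bool (t = conj_act n s x \<and> u = s \<and> z = x \<otimes>\<^bsub>sym_group n\<^esub> y)),
     hone = (\<lambda>(s, x). of_bool (x = \<one>\<^bsub>sym_group n\<^esub>)),
     hcom = (\<lambda>(s, x) (g, y) (h, z). of_bool (g \<otimes>\<^bsub>alt_group n\<^esub> h = s \<and> y = x \<and> z = x)),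
     hcou = (\<lambda>(s, x). of_bool (s = \<one>\<^bsub>alt_group n\<^esub>)),
     hant = (\<lambda>(s, x) (t, y). of_bool (t = inv\<^bsub>alt_group n\<^esub> (conj_act n s x) \<and> y = inv\<^bsub>sym_group n\<^esub> x)) \<rparr>"


subsection \<open>The structure constants define a Hopf algebra\<close>

lemma sum_single:
  assumes "finite S" "a \<in> S" "\<And>x. x \<in> S \<Longrightarrow> x \<noteq> a \<Longrightarrow> f x = 0"
  shows "sum f S = f a"
proof -
  have "sum f S = sum f {a}"
    by (rule sum.mono_neutral_right) (use assms in auto)
  then show ?thesis by simp
qed

context
  fixes n :: nat assumes n2: "n \<ge> 2"
begin

lemma C2_subgroup: "subgroup (C2 n) (sym_group n)"
  unfolding C2_def
  by (rule group.generate_is_subgroup[OF sym_group_is_group])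
     (use n2 in \<open>auto simp: sym_group_carrier intro!: permutes_swap_id\<close>)

lemma C2_permutes: "x \<in> C2 n \<Longrightarrow> x permutes {1..n}"
  using subgroup.subset[OF C2_subgroup] by (auto simp: sym_group_carrier)

lemma C2_id: "id \<in> C2 n"
  using subgroup.one_closed[OF C2_subgroup] by (simp add: sym_group_one)

lemma C2_comp: "x \<in> C2 n \<Longrightarrow> y \<in> C2 n \<Longrightarrow> x \<circ> y \<in> C2 n"
  using subgroup.m_closed[OF C2_subgroup] by (simp add: sym_group_mult)

lemma C2_inv: "x \<in> C2 n \<Longrightarrow> inv' x \<in> C2 n"
  using subgroup.m_inv_closed[OF C2_subgroup, of x]
  by (simp add: sym_group_inv_equality[unfolded sym_group_carrier, OF C2_permutes])

lemma conj_eq: "x \<in> C2 n \<Longrightarrow> conj_act n s x = inv' x \<circ> s \<circ> x"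
  by (simp add: conj_act_def sym_group_mult sym_group_inv_equality[unfolded sym_group_carrier, OF C2_permutes])

lemma conj_in: "x \<in> C2 n \<Longrightarrow> s \<in> carrier (alt_group n) \<Longrightarrow> conj_act n s x \<in> carrier (alt_group n)"
  apply (frule C2_permutes)
  apply (auto simp: conj_eq alt_group_carrier permutes_compose permutes_inv)
  by (smt (verit) evenperm_comp evenperm_inv finite_atLeastAtMost permutation_compose permutation_inverse permutation_permutes)

lemma alt_comp: "g \<in> carrier (alt_group n) \<Longrightarrow> h \<in> carrier (alt_group n) \<Longrightarrow> g \<circ> h \<in> carrier (alt_group n)"
  using group.is_monoid[OF alt_group_is_group] monoid.m_closed by (metis alt_group_mult)

lemma alt_id: "id \<in> carrier (alt_group n)"
  by (simp add: alt_group_carrier permutes_id)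

lemma fin: "finite (carrier (alt_group n) \<times> C2 n)"
proof -
  have "finite {p. p permutes {1..n}}" by (simp add: finite_permutations)
  then show ?thesis
    using C2_permutes by (auto simp: alt_group_carrier elim!: rev_finite_subset intro!: finite_cartesian_product)
qed

lemma inv_o: "x permutes {1..n} \<Longrightarrow> x \<circ> inv' x = id" "x permutes {1..n} \<Longrightarrow> inv' x \<circ> x = id"
  by (auto simp: permutes_inv_o)

lemma alt_inv: "g \<in> carrier (alt_group n) \<Longrightarrow> g \<circ> inv' g = id \<and> inv' g \<circ> g = id"
  by (simp add: alt_group_carrier inv_o)

lemma alt_inv_inv: "g \<in> carrier (alt_group n) \<Longrightarrow> inv' (inv' g) = g"
  by (auto simp only: alt_group_carrier intro: permutes_inv_inv)

lemma conj_comp: "x \<in> C2 n \<Longrightarrow> y \<in> C2 n \<Longrightarrow> conj_act n s (x \<circ> y) = conj_act n (conj_act n s x) y"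
  using C2_permutes[of x] C2_permutes[of y]
  by (simp add: conj_eq C2_comp o_inv_distrib permutes_bij comp_assoc)

lemma conj_mult: "x \<in> C2 n \<Longrightarrow> conj_act n (g \<circ> h) x = conj_act n g x \<circ> conj_act n h x"
  using inv_o[OF C2_permutes, of x] by (simp add: conj_eq fun_eq_iff)

lemma conj_id: "conj_act n s id = s" "x \<in> C2 n \<Longrightarrow> conj_act n id x = id"
  using inv_o[OF C2_permutes, of x] C2_id by (simp_all add: conj_eq)

lemma conj_inv: "x \<in> C2 n \<Longrightarrow> s \<in> carrier (alt_group n) \<Longrightarrow> conj_act n (inv' s) x = inv' (conj_act n s x)"
  using alt_inv[of s] conj_mult[of x "inv' s" s] conj_id(2)[of x] conj_in[of x s] alt_inv[of "conj_act n s x"]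
  by (metis comp_assoc comp_id id_comp)

lemma hopf_algebra_bismash: "hopf_algebra (bismash n :: (_, 'k::field) hopf_algebra_data)"
proof -
  let ?A = "carrier (alt_group n)" and ?K = "C2 n"
  let ?B = "?A \<times> ?K"
  let ?H = "bismash n :: (_, 'k) hopf_algebra_data"
  define c where "c = conj_act n"
  note c_in = conj_in[folded c_def] and c_comp = conj_comp[folded c_def]
    and c_mult = conj_mult[folded c_def] and c_id = conj_id[folded c_def] and c_inv = conj_inv[folded c_def]
  have B: "hbas ?H = ?B" by (simp add: bismash_def)
  have mul: "hmul ?H (s,x) (t,y) (u,z) = of_bool (t = c s x \<and> u = s \<and> z = x \<circ> y)" for s x t y u z
    by (simp add: bismash_def c_def sym_group_mult)
  have one: "hone ?H (s,x) = of_bool (x = id)" for s x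
    by (simp add: bismash_def sym_group_one)
  have com: "hcom ?H (s,x) (g,y) (h,z) = of_bool (g \<circ> h = s \<and> y = x \<and> z = x)" for s x g y h z
    by (simp add: bismash_def alt_group_mult)
  have cou: "hcou ?H (s,x) = of_bool (s = id)" for s x
    by (simp add: bismash_def alt_group_one)
  have ant: "hant ?H (s,x) (t,y) = of_bool (t = inv' (c s x) \<and> y = inv' x)" if "s \<in> ?A" "x \<in> ?K" for s x t y
    using that by (simp add: bismash_def alt_group_inv_equality conj_in c_def
        sym_group_inv_equality[unfolded sym_group_carrier, OF C2_permutes])
  have sgl: "sum f ?B = f (s, x)" 
    if "s \<in> ?A" "x \<in> ?K" "\<And>t y. t \<in> ?A \<Longrightarrow> y \<in> ?K \<Longrightarrow> (t, y) \<noteq> (s, x) \<Longrightarrow> f (t, y) = 0" 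
    for s x and f :: "_ \<Rightarrow> 'k"
    using that by (intro sum_single[OF fin]) auto
  have K: "x \<circ> inv' x = id" "inv' x \<circ> x = id" if "x \<in> ?K" for x using inv_o C2_permutes that by auto
  have ainv: "inv' g \<in> ?A" if "g \<in> ?A" for g using that by (rule alt_group_inv_closed)
  show ?thesis
  proof (unfold hopf_algebra_def B, intro conjI allI impI)
    show "finite ?B" by (rule fin)
  next
    fix a b e d assume "a \<in> ?B" "b \<in> ?B" "e \<in> ?B" "d \<in> ?B"
    then obtain s x t y g z h w where [simp]: "a = (s,x)" "b = (t,y)" "e = (g,z)" "d = (h,w)"
      and i: "s \<in> ?A" "x \<in> ?K" "t \<in> ?A" "y \<in> ?K" "g \<in> ?A" "z \<in> ?K" "h \<in> ?A" "w \<in> ?K" by auto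
    have "(\<Sum>x\<in>?B. hmul ?H a b x * hmul ?H x e d) 
       = of_bool (t = c s x \<and> g = c s (x \<circ> y) \<and> h = s \<and> w = x \<circ> y \<circ> z)"
      by (subst sgl[of s "x \<circ> y"]) (use i in \<open>auto simp: mul C2_comp\<close>)
    also have "\<dots> = (\<Sum>x\<in>?B. hmul ?H b e x * hmul ?H a x d)"
      by (subst sgl[of t "y \<circ> z"]) (use i in \<open>auto simp: mul C2_comp c_comp comp_assoc\<close>)
    finally show "(\<Sum>x\<in>?B. hmul ?H a b x * hmul ?H x e d) = (\<Sum>x\<in>?B. hmul ?H b e x * hmul ?H a x d)" .
    show "(\<Sum>x\<in>?B. hcom ?H a x d * hcom ?H x b e) = (\<Sum>x\<in>?B. hcom ?H a b x * hcom ?H x e d)"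
    proof -
      have "(\<Sum>x\<in>?B. hcom ?H a x d * hcom ?H x b e) = of_bool (t \<circ> g \<circ> h = s \<and> x = w \<and> y = x \<and> z = x)"
        by (subst sgl[of "t \<circ> g" x]) (use i in \<open>auto simp: com alt_comp\<close>)
      also have "\<dots> = (\<Sum>x\<in>?B. hcom ?H a b x * hcom ?H x e d)"
        by (subst sgl[of "g \<circ> h" x]) (use i in \<open>auto simp: com alt_comp comp_assoc\<close>)
      finally show ?thesis .
    qed
    show "(\<Sum>x\<in>?B. hmul ?H a b x * hcom ?H x e d)
          = (\<Sum>p\<in>?B. \<Sum>q\<in>?B. \<Sum>r\<in>?B. \<Sum>s\<in>?B.
               hcom ?H a p q * hcom ?H b r s * hmul ?H p r e * hmul ?H q s d)"
    proof -
      have "(\<Sum>x\<in>?B. hmul ?H a b x * hcom ?H x e d) 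
        = of_bool (t = c s x \<and> g \<circ> h = s \<and> z = x \<circ> y \<and> w = x \<circ> y)"
        by (subst sgl[of s "x \<circ> y"]) (use i in \<open>auto simp: mul com C2_comp\<close>)
      also have "\<dots> = (\<Sum>p\<in>?B. \<Sum>q\<in>?B. \<Sum>r\<in>?B. \<Sum>s\<in>?B.
               hcom ?H a p q * hcom ?H b r s * hmul ?H p r e * hmul ?H q s d)"
        apply (rule sym)
        apply (rule trans[OF sgl[of g x]]) prefer 3
        subgoal for g' x' using i by (auto simp: mul com intro!: sum.neutral)
          apply (use i in simp_all)[2]
        apply (rule trans[OF sgl[of h x]]) prefer 3
        subgoal for g' x' using i by (auto simp: mul com intro!: sum.neutral)
          apply (use i in simp_all)[2]
        apply (rule trans[OF sgl[of "c g x" y]]) prefer 3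
        subgoal for g' x' using i by (auto simp: mul com intro!: sum.neutral)
          apply (use i c_in in simp_all)[2]
        apply (rule trans[OF sgl[of "c h x" y]]) prefer 3
        subgoal for g' x' using i by (auto simp: mul com intro!: sum.neutral)
          apply (use i c_in in simp_all)[2]
        using i by (auto simp: mul com c_mult)
      finally show ?thesis .
    qed
  next
    fix a b assume "a \<in> ?B" "b \<in> ?B" 
    then obtain s x t y where [simp]: "a = (s,x)" "b = (t,y)"
      and i: "s \<in> ?A" "x \<in> ?K" "t \<in> ?A" "y \<in> ?K" by auto
    show "(\<Sum>x\<in>?B. hone ?H x * hmul ?H x a b) = of_bool (a = b)"
      by (subst sgl[of s id]) (use i in \<open>auto simp: mul one C2_id c_id\<close>)
    show "(\<Sum>x\<in>?B. hone ?H x * hmul ?H a x b) = of_bool (a = b)"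
      by (subst sgl[of "c s x" id]) (use i in \<open>auto simp: mul one C2_id c_in\<close>)
    show "(\<Sum>x\<in>?B. hcou ?H x * hcom ?H a x b) = of_bool (a = b)"
      by (subst sgl[of id x]) (use i in \<open>auto simp: com cou alt_id\<close>)
    show "(\<Sum>x\<in>?B. hcou ?H x * hcom ?H a b x) = of_bool (a = b)"
      by (subst sgl[of id x]) (use i in \<open>auto simp: com cou alt_id\<close>)
    show "(\<Sum>x\<in>?B. hone ?H x * hcom ?H x a b) = hone ?H a * hone ?H b"
      by (subst sgl[of "s \<circ> t" id]) (use i in \<open>auto simp: com one alt_comp C2_id\<close>)
    show "(\<Sum>x\<in>?B. hmul ?H a b x * hcou ?H x) = hcou ?H a * hcou ?H b"
      by (subst sgl[of s "x \<circ> y"]) (use i in \<open>auto simp: mul cou C2_comp c_id\<close>)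
    show "(\<Sum>p\<in>?B. \<Sum>q\<in>?B. \<Sum>r\<in>?B. hcom ?H a p q * hant ?H p r * hmul ?H r q b) = hcou ?H a * hone ?H b"
    proof -
      define g where "g = c (inv' t) (inv' x)"
      have g: "g \<in> ?A" "c g x = inv' t" using i by (auto simp: g_def c_in ainv C2_inv K c_comp[symmetric] c_id)
      have tt: "inv' (inv' t) = t" using i by (simp add: alt_inv_inv)
      have *: "g' = g" if "g' \<in> ?A" "t = inv' (c g' x)" for g'
      proof -
        have "inv' t = c g' x" using c_in[of x g'] that i by (simp add: alt_inv_inv)
        then show ?thesis using i by (simp add: g_def c_comp[symmetric] C2_inv K c_id)
      qed
      have gi: "c t (inv' x) = inv' g" using g i 
        by (metis C2_inv K(1) c_comp c_id(1) c_inv tt ainv)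
      show ?thesis
        apply (rule trans[OF sgl[of g x]]) prefer 3
        subgoal for g' x' using i * by (auto simp: mul com ant intro!: sum.neutral)
          apply (use i g in simp_all)[2]
        apply (rule trans[OF sgl[of "inv' g" x]]) prefer 3 
        subgoal for g' x' using i g gi by (auto simp: mul com ant intro!: sum.neutral)
          apply (use i g ainv in simp_all)[2]
        apply (rule trans[OF sgl[of t "inv' x"]]) prefer 3 
        subgoal for g' x' using i g gi by (auto simp: mul com ant intro!: sum.neutral)
          apply (use i g ainv C2_inv in simp_all)[2]
        using alt_inv[OF g(1)] gi tt g i K[of x] by (auto simp: mul com ant cou one)
    qed
    show "(\<Sum>p\<in>?B. \<Sum>q\<in>?B. \<Sum>r\<in>?B. hcom ?H a p q * hant ?H q r * hmul ?H p r b) = hcou ?H a * hone ?H b"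
    proof -
      have tt: "inv' (inv' t) = t" using i by (simp add: alt_inv_inv)
      have *: "inv' (c h x) = c t x \<Longrightarrow> h = inv' t" if "h \<in> ?A" for h
      proof -
        assume "inv' (c h x) = c t x"
        then have "c (inv' h) x = c t x" using that i by (simp add: c_inv)
        then have "c (c (inv' h) x) (inv' x) = c (c t x) (inv' x)" by simp
        then have "inv' h = t" using i by (simp add: c_comp[symmetric] C2_inv K c_id)
        then show ?thesis using that by (auto simp: alt_inv_inv)
      qed
      have ci: "inv' (c (inv' t) x) = c t x" using i by (simp add: c_inv[symmetric] ainv tt)
      show ?thesis
        apply (rule trans[OF sgl[of t x]]) prefer 3
        subgoal for g' x' using i by (auto simp: mul com ant intro!: sum.neutral)
          apply (use i in simp_all)[2]
        apply (rule trans[OF sgl[of "inv' t" x]]) prefer 3 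
        subgoal for g' x' using i * by (auto simp: mul com ant intro!: sum.neutral)
          apply (use i ainv in simp_all)[2]
        apply (rule trans[OF sgl[of "c t x" "inv' x"]]) prefer 3 
        subgoal for g' x' using i ainv[OF i(3)] by (auto simp: mul com ant intro!: sum.neutral)
          apply (use i ainv C2_inv c_in in simp_all)[2]
        using alt_inv[OF i(3)] ci i ainv[OF i(3)] K[of x] by (auto simp: mul com ant cou one)
    qed
  next
    show "(\<Sum>x\<in>?B. hone ?H x * hcou ?H x) = 1"
      by (subst sgl[of id id]) (auto simp: one cou alt_id C2_id)
  qed
qed

end

end

theory Submission
  imports Defs "HOL-Algebra.Solvable_Groups" "HOL-Algebra.Multiplicative_Group" "HOL-Library.Multiset"
begin

text \<open>
  The group \<open>U(C)\<close> of isomorphism classes of invertible objects is solvable for every solvable fusion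
  category \<open>C\<close>: a \<open>G\<close>-extension \<open>C\<close> of \<open>D\<close> has a homomorphism \<open>U(C) \<rightarrow> G\<close> whose kernel embeds into \<open>U(D)\<close>,
  and if \<open>C\<close> is an equivariantization of \<open>D\<close>, then the kernel of \<open>U(C) \<rightarrow> U(D)\<close> is abelian.

  Let \<open>flip\<close> be conjugation with \<open>(1 2)\<close> on the alternating group \<open>A\<close>. A category \<open>C\<close> with the fusion rules
  of \<open>Rep B\<^sub>n\<close> has the simple objects \<open>V s = V (flip s)\<close> for \<open>s \<in> A\<close> and \<open>W h\<close> for \<open>h \<in> A\<close> with
  \<open>flip h = h\<close>, and \<open>V s \<boxtimes> V u\<close> is \<open>V (s u)\<close> if \<open>s\<close> or \<open>u\<close> is fixed by \<open>flip\<close>, while otherwise it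
  consists of \<open>V (s u)\<close>, \<open>V (s (flip u))\<close> and the corresponding \<open>W\<close>.
  If \<open>C\<close> is graded by an abelian group, then the degree of \<open>V s\<close> is a homomorphism on the perfect group \<open>A\<close>,
  and the grading is trivial. If \<open>C\<close> is an equivariantization of \<open>D\<close> by \<open>G\<close>, then the twist of the unit
  by a nontrivial character of \<open>G\<close> commutes with all objects and has a simple square, so that it is \<open>W 1\<close>.
  As its square is the unit, \<open>G\<close> consists of 1 and an involution \<open>g\<close>. In \<open>D\<close> the object \<open>V s\<close> becomes simple
  or a sum of two simple objects exchanged by \<open>g\<close>. By comparison of lengths these are
  invertible, and we get a map \<open>q : A \<rightarrow> U(D)\<close> that is a homomorphism up to the action of \<open>g\<close>. There is
  no such map to a solvable group except the trivial one.
\<close>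

text \<open>The invertible objects of C itself give no contradiction. They are the
  \<open>V h\<close> and \<open>W h\<close> with \<open>flip h = h\<close> and form a group
  isomorphic to S_(n-2) x C_2, which is solvable for n = 5 and n = 6. Therefore the last step of the
  chain is undone and the contradiction is sought one category earlier, where the objects
  \<open>V s\<close> with \<open>flip s \<noteq> s\<close> fall apart into invertible ones. Only
  fusion rules are given, so all information has to come from multiplicities and lengths. In
  particular nothing singles out one of the two summands of \<open>V s\<close>: the value
  \<open>q s\<close> is an arbitrary choice between them. This is why \<open>q\<close> is
  multiplicative only up to the involution, and why a separate argument on derived subgroups takes
  the place of the remark that a nontrivial image of a perfect group is not solvable. Characteristic
  zero enters twice: a group of prime order needs a nontrivial character, and arrows are split into
  eigencomponents of an involution, which requires 1/2.\<close>

no_notation module.smult (infixl "\<odot>\<index>" 70)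
hide_const (open) module.smult UnivPoly.monom UnivPoly.coeff

section \<open>Linear categories\<close>

text \<open>Simplicity is tested by scalar endomorphisms. This condition speaks of Hom spaces only,
  so it passes through equivalences and can be checked on matrices; in a fusion category over an
  algebraically closed field it agrees with \<open>simple_ob\<close>.\<close>

definition brick :: "('o, 'a::ab_group_add, 'k::field) tensor_category \<Rightarrow> 'o \<Rightarrow> bool" where
  "brick C X \<longleftrightarrow> X \<in> Ob C \<and> idn C X \<noteq> 0 \<and> Hom C X X = range (\<lambda>c. scl C c (idn C X))"

lemma iso_arrI:
  "\<lbrakk>f \<in> Hom C X Y; g \<in> Hom C Y X; g \<odot>\<^bsub>C\<^esub> f = idn C X; f \<odot>\<^bsub>C\<^esub> g = idn C Y\<rbrakk> \<Longrightarrow> iso_arr C X Y f"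
  by (auto simp: iso_arr_def)

lemma iso_arr_Hom: "iso_arr C X Y f \<Longrightarrow> f \<in> Hom C X Y"
  by (simp add: iso_arr_def)

lemma iso_arrE:
  assumes "iso_arr C X Y f"
  obtains g where "f \<in> Hom C X Y" "g \<in> Hom C Y X" "g \<odot>\<^bsub>C\<^esub> f = idn C X" "f \<odot>\<^bsub>C\<^esub> g = idn C Y"
  using assms by (auto simp: iso_arr_def)

lemma isomorphicI: "iso_arr C X Y f \<Longrightarrow> isomorphic C X Y"
  by (auto simp: isomorphic_def)

text \<open>\<open>direct_sum\<close> with its inclusions and projections named, for the arguments
  that compute with them.\<close>

definition biproduct ::
  "('o, 'a::ab_group_add, 'k) tensor_category \<Rightarrow> 'i set \<Rightarrow> ('i \<Rightarrow> 'o) \<Rightarrow> 'o \<Rightarrow> ('i \<Rightarrow> 'a) \<Rightarrow> ('i \<Rightarrow> 'a) \<Rightarrow> bool" where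
  "biproduct C I Y X inc prj \<longleftrightarrow> finite I \<and> X \<in> Ob C \<and> (\<forall>i\<in>I. Y i \<in> Ob C) \<and>
     (\<forall>i\<in>I. inc i \<in> Hom C (Y i) X) \<and> (\<forall>i\<in>I. prj i \<in> Hom C X (Y i)) \<and>
     (\<forall>i\<in>I. \<forall>j\<in>I. prj j \<odot>\<^bsub>C\<^esub> inc i = (if i = j then idn C (Y i) else 0)) \<and>
     (\<Sum>i\<in>I. inc i \<odot>\<^bsub>C\<^esub> prj i) = idn C X"

lemma direct_sum_biproduct: "direct_sum C I Y X \<longleftrightarrow> (\<exists>inc prj. biproduct C I Y X inc prj)"
  unfolding direct_sum_def biproduct_def by blast

lemma biproductD:
  assumes "biproduct C I Y X inc prj"
  shows "finite I" "X \<in> Ob C" "\<And>i. i \<in> I \<Longrightarrow> Y i \<in> Ob C"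
    "\<And>i. i \<in> I \<Longrightarrow> inc i \<in> Hom C (Y i) X" "\<And>i. i \<in> I \<Longrightarrow> prj i \<in> Hom C X (Y i)"
    "\<And>i j. i \<in> I \<Longrightarrow> j \<in> I \<Longrightarrow> prj j \<odot>\<^bsub>C\<^esub> inc i = (if i = j then idn C (Y i) else 0)"
    "(\<Sum>i\<in>I. inc i \<odot>\<^bsub>C\<^esub> prj i) = idn C X"
  using assms unfolding biproduct_def by auto

context linear_category
begin

lemma zero_in: "X \<in> Ob C \<Longrightarrow> Y \<in> Ob C \<Longrightarrow> 0 \<in> Hom C X Y"
  using subspace_Hom subspace_0 by blast

lemma add_in: "X \<in> Ob C \<Longrightarrow> Y \<in> Ob C \<Longrightarrow> f \<in> Hom C X Y \<Longrightarrow> g \<in> Hom C X Y \<Longrightarrow> f + g \<in> Hom C X Y"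
  using subspace_Hom subspace_add by blast

lemma scl_in: "X \<in> Ob C \<Longrightarrow> Y \<in> Ob C \<Longrightarrow> f \<in> Hom C X Y \<Longrightarrow> scl C c f \<in> Hom C X Y"
  using subspace_Hom subspace_scale by blast

lemma diff_in: "X \<in> Ob C \<Longrightarrow> Y \<in> Ob C \<Longrightarrow> f \<in> Hom C X Y \<Longrightarrow> g \<in> Hom C X Y \<Longrightarrow> f - g \<in> Hom C X Y"
  using subspace_Hom subspace_diff by blast

lemma sum_in: "X \<in> Ob C \<Longrightarrow> Y \<in> Ob C \<Longrightarrow> (\<And>i. i \<in> I \<Longrightarrow> f i \<in> Hom C X Y) \<Longrightarrow> sum f I \<in> Hom C X Y"
  using subspace_Hom subspace_sum by blast

lemma cmp_zero_right: "\<lbrakk>X \<in> Ob C; Y \<in> Ob C; Z \<in> Ob C; g \<in> Hom C Y Z\<rbrakk> \<Longrightarrow> g \<odot> 0 = 0"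
  using cmp_add_right[of X Y Z 0 0 g] zero_in[of X Y] by simp

lemma cmp_zero_left: "\<lbrakk>X \<in> Ob C; Y \<in> Ob C; Z \<in> Ob C; f \<in> Hom C X Y\<rbrakk> \<Longrightarrow> 0 \<odot> f = 0"
  using cmp_add_left[of X Y Z f 0 0] zero_in[of Y Z] by simp

lemma cmp_diff_right:
  "\<lbrakk>X \<in> Ob C; Y \<in> Ob C; Z \<in> Ob C; f \<in> Hom C X Y; f' \<in> Hom C X Y; g \<in> Hom C Y Z\<rbrakk>
    \<Longrightarrow> g \<odot> (f - f') = (g \<odot> f) - (g \<odot> f')"
  using cmp_add_right[of X Y Z "f - f'" f' g] by (simp add: diff_in algebra_simps)

lemma cmp_diff_left:
  "\<lbrakk>X \<in> Ob C; Y \<in> Ob C; Z \<in> Ob C; f \<in> Hom C X Y; g \<in> Hom C Y Z; g' \<in> Hom C Y Z\<rbrakk>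
    \<Longrightarrow> (g - g') \<odot> f = (g \<odot> f) - (g' \<odot> f)"
  using cmp_add_left[of X Y Z f "g - g'" g'] by (simp add: diff_in algebra_simps)

lemma cmp_sum_right:
  assumes "X \<in> Ob C" "Y \<in> Ob C" "Z \<in> Ob C" "\<And>i. i \<in> I \<Longrightarrow> f i \<in> Hom C X Y" "g \<in> Hom C Y Z"
  shows "g \<odot> (\<Sum>i\<in>I. f i) = (\<Sum>i\<in>I. g \<odot> f i)"
  using assms(4)
proof (induction I rule: infinite_finite_induct)
  case (insert i I)
  then show ?case using assms(1,2,3,5)
    by (simp add: cmp_add_right[of X Y Z] sum_in)
qed (use assms(1,2,3,5) cmp_zero_right in auto)

lemma cmp_sum_left:
  assumes "X \<in> Ob C" "Y \<in> Ob C" "Z \<in> Ob C" "\<And>i. i \<in> I \<Longrightarrow> g i \<in> Hom C Y Z" "f \<in> Hom C X Y"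
  shows "(\<Sum>i\<in>I. g i) \<odot> f = (\<Sum>i\<in>I. g i \<odot> f)"
  using assms(4)
proof (induction I rule: infinite_finite_induct)
  case (insert i I)
  then show ?case using assms(1,2,3,5)
    by (simp add: cmp_add_left[of X Y Z] sum_in)
qed (use assms(1,2,3,5) cmp_zero_left in auto)

lemma iso_arr_idn: "X \<in> Ob C \<Longrightarrow> iso_arr C X X (idn C X)"
  by (rule iso_arrI[of _ _ _ _ "idn C X"]) (auto simp: idn_in idn_left[of X X])

lemma iso_arr_cmp:
  assumes "X \<in> Ob C" "Y \<in> Ob C" "Z \<in> Ob C" "iso_arr C X Y f" "iso_arr C Y Z g"
  shows "iso_arr C X Z (g \<odot> f)"
proof -
  obtain f' where f: "f \<in> Hom C X Y" "f' \<in> Hom C Y X" "f' \<odot> f = idn C X" "f \<odot> f' = idn C Y"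
    using assms(4) by (rule iso_arrE)
  obtain g' where g: "g \<in> Hom C Y Z" "g' \<in> Hom C Z Y" "g' \<odot> g = idn C Y" "g \<odot> g' = idn C Z"
    using assms(5) by (rule iso_arrE)
  have 1: "(f' \<odot> g') \<odot> (g \<odot> f) = f' \<odot> (g' \<odot> (g \<odot> f))"
    using cmp_assoc[of X Z Y X "g \<odot> f" g' f'] cmp_in[of X Y Z f g] assms f g by simp
  have 2: "g' \<odot> (g \<odot> f) = f"
    using cmp_assoc[of X Y Z Y f g g'] assms f g by (simp add: idn_left[of X Y])
  have 3: "(g \<odot> f) \<odot> (f' \<odot> g') = g \<odot> (f \<odot> (f' \<odot> g'))"
    using cmp_assoc[of Z X Y Z "f' \<odot> g'" f g] cmp_in[of Z Y X g' f'] assms f g by simp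
  have 4: "f \<odot> (f' \<odot> g') = g'"
    using cmp_assoc[of Z Y X Y g' f' f] assms f g by (simp add: idn_left[of Z Y])
  show ?thesis
    by (rule iso_arrI[of _ _ _ _ "f' \<odot> g'"])
      (use 1 2 3 4 f g cmp_in[of X Y Z] cmp_in[of Z Y X] assms in auto)
qed

lemma isomorphic_refl: "X \<in> Ob C \<Longrightarrow> isomorphic C X X"
  using iso_arr_idn isomorphicI by metis

lemma isomorphic_sym: "isomorphic C X Y \<Longrightarrow> isomorphic C Y X"
  by (auto simp: isomorphic_def iso_arr_def)

lemma isomorphic_trans:
  "\<lbrakk>X \<in> Ob C; Y \<in> Ob C; Z \<in> Ob C; isomorphic C X Y; isomorphic C Y Z\<rbrakk> \<Longrightarrow> isomorphic C X Z"
  unfolding isomorphic_def using iso_arr_cmp by blast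

lemma iso_class_eq:
  assumes "X \<in> Ob C" "Y \<in> Ob C"
  shows "iso_class C X = iso_class C Y \<longleftrightarrow> isomorphic C X Y"
proof
  assume "iso_class C X = iso_class C Y"
  then show "isomorphic C X Y"
    using isomorphic_refl[OF assms(2)] assms(2) by (auto simp: iso_class_def set_eq_iff)
next
  assume "isomorphic C X Y"
  then show "iso_class C X = iso_class C Y"
    using isomorphic_trans[OF assms(2,1)] isomorphic_trans[OF assms] isomorphic_sym[of X Y]
    unfolding iso_class_def by blast
qed

lemma iso_class_self: "X \<in> Ob C \<Longrightarrow> X \<in> iso_class C X"
  by (simp add: iso_class_def isomorphic_refl)

lemma rep_ob_iso_class:
  assumes "X \<in> Ob C"
  shows "rep_ob (iso_class C X) \<in> Ob C" "isomorphic C X (rep_ob (iso_class C X))"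
    "isomorphic C (rep_ob (iso_class C X)) X" "iso_class C (rep_ob (iso_class C X)) = iso_class C X"
proof -
  have "rep_ob (iso_class C X) \<in> iso_class C X"
    unfolding rep_ob_def by (rule someI) (rule iso_class_self[OF assms])
  then show 1: "rep_ob (iso_class C X) \<in> Ob C" "isomorphic C X (rep_ob (iso_class C X))"
    by (auto simp: iso_class_def)
  then show "isomorphic C (rep_ob (iso_class C X)) X" by (blast intro: isomorphic_sym)
  then show "iso_class C (rep_ob (iso_class C X)) = iso_class C X"
    by (simp add: iso_class_eq assms 1)
qed

lemma inv_arr_eq:
  assumes "X \<in> Ob C" "Y \<in> Ob C" "f \<in> Hom C X Y" "g \<in> Hom C Y X" "g \<odot> f = idn C X" "f \<odot> g = idn C Y"
  shows "inv_arr C X Y f = g"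
  unfolding inv_arr_def
proof (rule the_equality)
  fix h assume h: "h \<in> Hom C Y X \<and> h \<odot> f = idn C X \<and> f \<odot> h = idn C Y"
  have "h \<odot> (f \<odot> g) = h \<odot> f \<odot> g" using cmp_assoc[of Y X Y X g f h] assms h by simp
  then show "h = g" using assms h by (simp add: idn_left[of Y X] idn_right[of Y X])
qed (use assms in simp)

lemma inv_arr:
  assumes "X \<in> Ob C" "Y \<in> Ob C" "iso_arr C X Y f"
  shows "inv_arr C X Y f \<in> Hom C Y X" "inv_arr C X Y f \<odot> f = idn C X" "f \<odot> inv_arr C X Y f = idn C Y"
    "iso_arr C Y X (inv_arr C X Y f)"
proof -
  obtain g where g: "f \<in> Hom C X Y" "g \<in> Hom C Y X" "g \<odot> f = idn C X" "f \<odot> g = idn C Y"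
    using assms(3) by (rule iso_arrE)
  then have "inv_arr C X Y f = g" using inv_arr_eq assms by blast
  then show "inv_arr C X Y f \<in> Hom C Y X" "inv_arr C X Y f \<odot> f = idn C X" "f \<odot> inv_arr C X Y f = idn C Y"
    "iso_arr C Y X (inv_arr C X Y f)"
    using g by (auto intro: iso_arrI)
qed

lemma iso_cancel_left:
  assumes "X \<in> Ob C" "Y \<in> Ob C" "Z \<in> Ob C" "iso_arr C Y Z f" "g \<in> Hom C X Y" "h \<in> Hom C X Y" "f \<odot> g = f \<odot> h"
  shows "g = h"
proof -
  note i = inv_arr[OF assms(2,3,4)]
  have "inv_arr C Y Z f \<odot> (f \<odot> g) = g" "inv_arr C Y Z f \<odot> (f \<odot> h) = h"
    using cmp_assoc[of X Y Z Y _ f "inv_arr C Y Z f"] iso_arr_Hom[OF assms(4)] assms(1,2,3,5,6) i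
    by (simp_all add: idn_left[of X Y])
  then show ?thesis using assms(7) by metis
qed

lemma iso_cancel_right:
  assumes "X \<in> Ob C" "Y \<in> Ob C" "Z \<in> Ob C" "iso_arr C X Y f" "g \<in> Hom C Y Z" "h \<in> Hom C Y Z" "g \<odot> f = h \<odot> f"
  shows "g = h"
proof -
  note i = inv_arr[OF assms(1,2,4)]
  have "(g \<odot> f) \<odot> inv_arr C X Y f = g" "(h \<odot> f) \<odot> inv_arr C X Y f = h"
    using cmp_assoc[of Y X Y Z "inv_arr C X Y f" f] iso_arr_Hom[OF assms(4)] assms(1,2,3,5,6) i
    by (metis idn_right)+
  then show ?thesis using assms(7) by metis
qed

lemma zero_ob_iso: "\<lbrakk>zero_ob C X; Y \<in> Ob C; isomorphic C X Y\<rbrakk> \<Longrightarrow> zero_ob C Y"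
proof -
  assume a: "zero_ob C X" "Y \<in> Ob C" "isomorphic C X Y"
  then obtain f g where f: "f \<in> Hom C X Y" "g \<in> Hom C Y X" "g \<odot> f = idn C X" "f \<odot> g = idn C Y"
    unfolding isomorphic_def by (blast elim: iso_arrE)
  have X: "X \<in> Ob C" "idn C X = 0" using a by (auto simp: zero_ob_def)
  have "f = 0" using idn_right[of X Y f] cmp_zero_right[of X X Y f] X a f by simp
  then have "idn C Y = 0" using f(4) cmp_zero_left[of Y X Y g] X a f by simp
  then show "zero_ob C Y" using a by (simp add: zero_ob_def)
qed

lemma Hom_zero_ob:
  assumes "zero_ob C X" "Y \<in> Ob C"
  shows "Hom C X Y = {0}" "Hom C Y X = {0}"
proof -
  have X: "X \<in> Ob C" "idn C X = 0" using assms by (auto simp: zero_ob_def)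
  have "f = 0" if "f \<in> Hom C X Y" for f
    using idn_right[of X Y f] cmp_zero_right[of X X Y f] X that assms by simp
  moreover have "f = 0" if "f \<in> Hom C Y X" for f
    using idn_left[of Y X f] cmp_zero_left[of Y X X f] X that assms by simp
  ultimately show "Hom C X Y = {0}" "Hom C Y X = {0}" using zero_in X assms by auto
qed

subsection \<open>Direct sums\<close>

lemma direct_sumI:
  assumes "finite I" "X \<in> Ob C" "\<And>i. i \<in> I \<Longrightarrow> Y i \<in> Ob C"
    "\<And>i. i \<in> I \<Longrightarrow> inc i \<in> Hom C (Y i) X" "\<And>i. i \<in> I \<Longrightarrow> prj i \<in> Hom C X (Y i)"
    "\<And>i j. i \<in> I \<Longrightarrow> j \<in> I \<Longrightarrow> prj j \<odot> inc i = (if i = j then idn C (Y i) else 0)"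
    "(\<Sum>i\<in>I. inc i \<odot> prj i) = idn C X"
  shows "direct_sum C I Y X"
  using assms unfolding direct_sum_def by blast

lemma direct_sum_reindex:
  assumes "bij_betw h J I" "direct_sum C I Y X"
  shows "direct_sum C J (\<lambda>j. Y (h j)) X"
proof -
  obtain inc prj where "biproduct C I Y X inc prj"
    using assms(2) unfolding direct_sum_biproduct by blast
  note d = biproductD[OF this]
  have h: "\<And>j. j \<in> J \<Longrightarrow> h j \<in> I" "\<And>i j. i \<in> J \<Longrightarrow> j \<in> J \<Longrightarrow> h i = h j \<longleftrightarrow> i = j"
    using assms(1) by (auto simp: bij_betw_def inj_on_eq_iff)
  show ?thesis
  proof (rule direct_sumI[of _ _ _ "\<lambda>j. inc (h j)" "\<lambda>j. prj (h j)"])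
    show "finite J" using assms(1) d(1) bij_betw_finite by blast
    show "(\<Sum>i\<in>J. inc (h i) \<odot> prj (h i)) = idn C X"
      using sum.reindex_bij_betw[OF assms(1), of "\<lambda>i. inc i \<odot> prj i"] d by simp
  qed (use d h in auto)
qed

lemma direct_sum_cong:
  assumes "direct_sum C I Y X" "\<And>i. i \<in> I \<Longrightarrow> Y i = Y' i"
  shows "direct_sum C I Y' X"
proof -
  obtain inc prj where "biproduct C I Y X inc prj"
    using assms(1) unfolding direct_sum_biproduct by blast
  note d = biproductD[OF this]
  show ?thesis by (rule direct_sumI[of _ _ _ inc prj]) (use d assms(2) in auto)
qed

text \<open>Sums of sums are flattened by composing the inclusions and projections of both levels.
  With a one-element outer family this also moves a decomposition along an isomorphism.\<close>

lemma direct_sum_Sigma: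
  assumes "direct_sum C I Y X" "\<And>i. i \<in> I \<Longrightarrow> direct_sum C (J i) (Z i) (Y i)"
  shows "direct_sum C (Sigma I J) (\<lambda>(i, j). Z i j) X"
proof -
  obtain inc prj where "biproduct C I Y X inc prj"
    using assms(1) unfolding direct_sum_biproduct by blast
  note d = biproductD[OF this]
  have "\<forall>i\<in>I. \<exists>p. biproduct C (J i) (Z i) (Y i) (fst p) (snd p)"
    using assms(2) unfolding direct_sum_biproduct by simp
  then obtain p where "\<forall>i\<in>I. biproduct C (J i) (Z i) (Y i) (fst (p i)) (snd (p i))" by metis
  then obtain inc' prj' where "\<And>i. i \<in> I \<Longrightarrow> biproduct C (J i) (Z i) (Y i) (inc' i) (prj' i)"
    using that[of "\<lambda>i. fst (p i)" "\<lambda>i. snd (p i)"] by blast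
  note e = biproductD[OF this]
  show ?thesis
  proof (rule direct_sumI[of _ _ _ "\<lambda>(i,j). inc i \<odot> inc' i j" "\<lambda>(i,j). prj' i j \<odot> prj i"])
    show "finite (Sigma I J)" using d e by auto
    show "X \<in> Ob C" by fact
    show "(case p of (i, j) \<Rightarrow> Z i j) \<in> Ob C" if "p \<in> Sigma I J" for p using that e by auto
    show "(case p of (i, j) \<Rightarrow> inc i \<odot> inc' i j) \<in> Hom C (case p of (i, j) \<Rightarrow> Z i j) X" if "p \<in> Sigma I J" for p 
      using that d e by (auto intro!: cmp_in[of _ "Y (fst p)" X])
    show "(case p of (i, j) \<Rightarrow> prj' i j \<odot> prj i) \<in> Hom C X (case p of (i, j) \<Rightarrow> Z i j)" if "p \<in> Sigma I J" for p 
      using that d e by (auto intro!: cmp_in[of X "Y (fst p)"])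
    show "(case q of (i, j) \<Rightarrow> prj' i j \<odot> prj i) \<odot> (case p of (i, j) \<Rightarrow> inc i \<odot> inc' i j) 
       = (if p = q then idn C (case p of (i, j) \<Rightarrow> Z i j) else 0)" if pq: "p \<in> Sigma I J" "q \<in> Sigma I J" for p q
    proof -
      obtain i j k l where [simp]: "p = (i,j)" "q = (k,l)" by fastforce
      have i: "i \<in> I" "j \<in> J i" "k \<in> I" "l \<in> J k" using pq by auto
      have "prj' k l \<odot> prj k \<odot> (inc i \<odot> inc' i j) = prj' k l \<odot> (prj k \<odot> (inc i \<odot> inc' i j))"
        using cmp_assoc[of "Z i j" X "Y k" "Z k l" "inc i \<odot> inc' i j" "prj k" "prj' k l"]
          cmp_in[of "Z i j" "Y i" X "inc' i j" "inc i"] d e i by simp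
      also have "prj k \<odot> (inc i \<odot> inc' i j) = prj k \<odot> inc i \<odot> inc' i j"
        using cmp_assoc[of "Z i j" "Y i" X "Y k" "inc' i j" "inc i" "prj k"] d e i by simp
      also have "\<dots> = (if i = k then inc' i j else 0)"
        using d e i cmp_zero_left[of "Z i j" "Y i" "Y k" "inc' i j"] idn_left[of "Z i j" "Y i"] by auto
      also have "prj' k l \<odot> \<dots> = (if p = q then idn C (Z i j) else 0)"
        using d e i cmp_zero_right[of "Z i j" "Y k" "Z k l"] by auto
      finally show ?thesis by simp
    qed
    have "(\<Sum>p\<in>Sigma I J. (case p of (i, j) \<Rightarrow> inc i \<odot> inc' i j) \<odot> (case p of (i, j) \<Rightarrow> prj' i j \<odot> prj i))
       = (\<Sum>i\<in>I. \<Sum>j\<in>J i. inc i \<odot> inc' i j \<odot> (prj' i j \<odot> prj i))"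
      using d e by (subst sum.Sigma) (auto intro!: sum.cong)
    also have "\<dots> = (\<Sum>i\<in>I. inc i \<odot> prj i)"
    proof (rule sum.cong[OF refl])
      fix i assume i: "i \<in> I"
      have P: "inc' i j \<odot> prj' i j \<in> Hom C (Y i) (Y i)" if "j \<in> J i" for j
        by (rule cmp_in[of _ "Z i j"]) (use d e i that in auto)
      have "inc i \<odot> inc' i j \<odot> (prj' i j \<odot> prj i) = inc i \<odot> ((inc' i j \<odot> prj' i j) \<odot> prj i)" if j: "j \<in> J i" for j
      proof -
        have "inc i \<odot> inc' i j \<odot> (prj' i j \<odot> prj i) = inc i \<odot> (inc' i j \<odot> (prj' i j \<odot> prj i))"
          using cmp_assoc[of X "Z i j" "Y i" X "prj' i j \<odot> prj i" "inc' i j" "inc i"]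
            cmp_in[of X "Y i" "Z i j"] d e i j by simp
        also have "inc' i j \<odot> (prj' i j \<odot> prj i) = (inc' i j \<odot> prj' i j) \<odot> prj i"
          using cmp_assoc[of X "Y i" "Z i j" "Y i" "prj i" "prj' i j" "inc' i j"] d e i j by simp
        finally show ?thesis .
      qed
      then have "(\<Sum>j\<in>J i. inc i \<odot> inc' i j \<odot> (prj' i j \<odot> prj i)) = (\<Sum>j\<in>J i. inc i \<odot> ((inc' i j \<odot> prj' i j) \<odot> prj i))"
        by simp
      also have "\<dots> = inc i \<odot> (\<Sum>j\<in>J i. (inc' i j \<odot> prj' i j) \<odot> prj i)"
        by (rule cmp_sum_right[symmetric, of X "Y i" X]) (use d i P in \<open>auto intro!: cmp_in[of X "Y i" "Y i"]\<close>)
      also have "(\<Sum>j\<in>J i. (inc' i j \<odot> prj' i j) \<odot> prj i) = (\<Sum>j\<in>J i. inc' i j \<odot> prj' i j) \<odot> prj i"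
        by (rule cmp_sum_left[symmetric, of X "Y i" "Y i"]) (use d i P in auto)
      also have "\<dots> = prj i" using d e i idn_left[of X "Y i"] by simp
      finally show "(\<Sum>j\<in>J i. inc i \<odot> inc' i j \<odot> (prj' i j \<odot> prj i)) = inc i \<odot> prj i" .
    qed
    finally show "(\<Sum>p\<in>Sigma I J. (case p of (i, j) \<Rightarrow> inc i \<odot> inc' i j) \<odot> (case p of (i, j) \<Rightarrow> prj' i j \<odot> prj i)) = idn C X"
      using d by simp
  qed
qed

lemma direct_sum_one:
  assumes "X \<in> Ob C" "Y \<in> Ob C" "isomorphic C Y X"
  shows "direct_sum C {i} (\<lambda>_. Y) X"
proof -
  obtain f g where f: "f \<in> Hom C Y X" "g \<in> Hom C X Y" "g \<odot> f = idn C Y" "f \<odot> g = idn C X"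
    using assms(3) unfolding isomorphic_def by (blast elim: iso_arrE)
  show ?thesis by (rule direct_sumI[of _ _ _ "\<lambda>_. f" "\<lambda>_. g"]) (use f assms in auto)
qed

lemma direct_sum_iso_sum:
  assumes "direct_sum C I Y X" "X' \<in> Ob C" "isomorphic C X X'"
  shows "direct_sum C I Y X'"
proof -
  have X: "X \<in> Ob C" using assms(1) by (simp add: direct_sum_def)
  have "direct_sum C (Sigma {()} (\<lambda>_. I)) (\<lambda>(i, j). Y j) X'"
    by (rule direct_sum_Sigma[OF direct_sum_one[of X' X]]) (use assms X in auto)
  from direct_sum_reindex[of "\<lambda>j. ((), j)" I, OF _ this] show ?thesis
    by (auto simp: bij_betw_def inj_on_def)
qed

lemma direct_sum_unique:
  assumes "direct_sum C I Y X" "direct_sum C I Y X'"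
  shows "isomorphic C X X'"
proof -
  obtain inc prj where "biproduct C I Y X inc prj"
    using assms(1) unfolding direct_sum_biproduct by blast
  note d = biproductD[OF this]
  obtain inc' prj' where "biproduct C I Y X' inc' prj'"
    using assms(2) unfolding direct_sum_biproduct by blast
  note e = biproductD[OF this]
  \<comment> \<open>Product of two block diagonal arrows, kept general because both composites of
    the two mediating arrows are instances.\<close>
  have key: "(\<Sum>i\<in>I. b i \<odot> p i) \<odot> (\<Sum>i\<in>I. a i \<odot> q i) = (\<Sum>i\<in>I. b i \<odot> q i)"
    if o: "U \<in> Ob C" "V \<in> Ob C" "W \<in> Ob C" "\<And>i. i \<in> I \<Longrightarrow> a i \<in> Hom C (Y i) V" "\<And>i. i \<in> I \<Longrightarrow> q i \<in> Hom C U (Y i)"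
      "\<And>i. i \<in> I \<Longrightarrow> p i \<in> Hom C V (Y i)" "\<And>i. i \<in> I \<Longrightarrow> b i \<in> Hom C (Y i) W"
      "\<And>i j. i \<in> I \<Longrightarrow> j \<in> I \<Longrightarrow> p j \<odot> a i = (if i = j then idn C (Y i) else 0)" for U V W a b p q
  proof -
    have "(\<Sum>i\<in>I. b i \<odot> p i) \<odot> (\<Sum>i\<in>I. a i \<odot> q i) = (\<Sum>i\<in>I. (b i \<odot> p i) \<odot> (\<Sum>i\<in>I. a i \<odot> q i))"
      by (rule cmp_sum_left[of U V W]) (use o d in \<open>(blast intro: sum_in cmp_in)+\<close>)
    also have "\<dots> = (\<Sum>i\<in>I. b i \<odot> q i)"
    proof (rule sum.cong[OF refl])
      fix i assume i: "i \<in> I"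
      have "(b i \<odot> p i) \<odot> (\<Sum>i\<in>I. a i \<odot> q i) = (\<Sum>j\<in>I. (b i \<odot> p i) \<odot> (a j \<odot> q j))"
        by (rule cmp_sum_right[of U V W]) (use o d i in \<open>(blast intro: sum_in cmp_in)+\<close>)
      also have "\<dots> = (\<Sum>j\<in>I. if j = i then b i \<odot> q i else 0)"
      proof (rule sum.cong[OF refl])
        fix j assume j: "j \<in> I"
        have "(b i \<odot> p i) \<odot> (a j \<odot> q j) = b i \<odot> (p i \<odot> (a j \<odot> q j))"
          using cmp_assoc[of U V "Y i" W "a j \<odot> q j" "p i" "b i"] cmp_in[of U "Y j" V] o d i j by simp
        also have "p i \<odot> (a j \<odot> q j) = p i \<odot> a j \<odot> q j"
          using cmp_assoc[of U "Y j" V "Y i" "q j" "a j" "p i"] o d i j by simp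
        also have "\<dots> = (if j = i then q i else 0)"
          using o d i j idn_left[of U "Y i" "q i"] cmp_zero_left[of U "Y j" "Y i" "q j"] by simp
        also have "b i \<odot> \<dots> = (if j = i then b i \<odot> q i else 0)"
          using o d i j cmp_zero_right[of U "Y i" W "b i"] by simp
        finally show "(b i \<odot> p i) \<odot> (a j \<odot> q j) = (if j = i then b i \<odot> q i else 0)" .
      qed
      also have "\<dots> = b i \<odot> q i" using i d by simp
      finally show "(b i \<odot> p i) \<odot> (\<Sum>i\<in>I. a i \<odot> q i) = b i \<odot> q i" .
    qed
    finally show ?thesis .
  qed
  have "iso_arr C X X' (\<Sum>i\<in>I. inc' i \<odot> prj i)"
    by (rule iso_arrI[of _ _ _ _ "\<Sum>i\<in>I. inc i \<odot> prj' i"])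
      (use d e in \<open>(blast intro: sum_in cmp_in | simp add: key[of X X' X] key[of X' X X'])+\<close>)
  then show ?thesis by (rule isomorphicI)
qed

text \<open>Each summand isomorphic to the brick Z contributes a line of arrows, spanned by an
  isomorphism followed by the inclusion, and the projections show that these lines are independent.
  The hypothesis on the summands stands in for Schur's lemma, which becomes available later.\<close>

lemma dim_Hom_direct_sum:
  assumes Z: "brick C Z" and ds: "direct_sum C I Y X"
    and Y: "\<And>i. i \<in> I \<Longrightarrow> isomorphic C Z (Y i) \<or> Hom C Z (Y i) = {0}"
  shows "dim (Hom C Z X) = card {i \<in> I. isomorphic C Z (Y i)}"
proof -
  have ZO: "Z \<in> Ob C" and Z0: "idn C Z \<noteq> 0" and ZZ: "Hom C Z Z = range (\<lambda>c. scl C c (idn C Z))"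
    using Z by (auto simp: brick_def)
  obtain inc prj where "biproduct C I Y X inc prj"
    using ds unfolding direct_sum_biproduct by blast
  note d = biproductD[OF this]
  define K where "K = {i \<in> I. isomorphic C Z (Y i)}"
  have K: "finite K" "K \<subseteq> I" using d by (auto simp: K_def)
  have "\<forall>i\<in>K. \<exists>p. fst p \<in> Hom C Z (Y i) \<and> snd p \<in> Hom C (Y i) Z \<and> snd p \<odot> fst p = idn C Z \<and> fst p \<odot> snd p = idn C (Y i)"
    unfolding K_def isomorphic_def iso_arr_def by fastforce
  then obtain p where "\<forall>i\<in>K. fst (p i) \<in> Hom C Z (Y i) \<and> snd (p i) \<in> Hom C (Y i) Z \<and>
      snd (p i) \<odot> fst (p i) = idn C Z \<and> fst (p i) \<odot> snd (p i) = idn C (Y i)" by metis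
  then obtain u v where uv: "\<And>i. i \<in> K \<Longrightarrow> u i \<in> Hom C Z (Y i)" "\<And>i. i \<in> K \<Longrightarrow> v i \<in> Hom C (Y i) Z"
    "\<And>i. i \<in> K \<Longrightarrow> v i \<odot> u i = idn C Z" "\<And>i. i \<in> K \<Longrightarrow> u i \<odot> v i = idn C (Y i)"
    using that[of "fst \<circ> p" "snd \<circ> p"] by simp
  \<comment> \<open>Followed by \<open>v i\<close>, an arrow into a copy of Z becomes an
    endomorphism of Z, hence a scalar.\<close>
  have HomY: "\<exists>c. f = scl C c (u i)" if i: "i \<in> K" and f: "f \<in> Hom C Z (Y i)" for i f
  proof -
    have iI: "i \<in> I" using i K by auto
    have "v i \<odot> f \<in> Hom C Z Z" by (rule cmp_in[of _ "Y i"]) (use ZO d iI uv[OF i] f in auto)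
    then obtain c where c: "v i \<odot> f = scl C c (idn C Z)" using ZZ by auto
    have "f = u i \<odot> (v i \<odot> f)"
      using cmp_assoc[of Z "Y i" Z "Y i" f "v i" "u i"] idn_left[of Z "Y i" f] ZO d iI uv[OF i] f by simp
    also have "\<dots> = scl C c (u i)"
      using c cmp_scl_right[of Z Z "Y i" "idn C Z" "u i" c] idn_right[of Z "Y i" "u i"] ZO d iI uv[OF i] idn_in by simp
    finally show ?thesis by blast
  qed
  have u0: "u i \<noteq> 0" if i: "i \<in> K" for i
  proof
    assume "u i = 0"
    then show False using uv(3)[OF i] cmp_zero_right[of Z "Y i" Z "v i"] Z0 ZO d K i uv(2)[OF i] by auto
  qed
  define b where "b i = inc i \<odot> u i" for i
  have bH: "b i \<in> Hom C Z X" if "i \<in> K" for i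
    unfolding b_def by (rule cmp_in[of _ "Y i"]) (use that K ZO d uv in auto)
  have prjb: "prj j \<odot> b i = (if i = j then u i else 0)" if "i \<in> K" "j \<in> I" for i j
  proof -
    have "i \<in> I" using that K by auto
    then have "prj j \<odot> b i = prj j \<odot> inc i \<odot> u i"
      unfolding b_def by (intro cmp_assoc[of Z "Y i" X "Y j"]) (use that ZO d uv in auto)
    also have "\<dots> = (if i = j then u i else 0)"
      using \<open>i \<in> I\<close> that d uv ZO idn_left[of Z "Y i" "u i"] cmp_zero_left[of Z "Y i" "Y j" "u i"] by auto
    finally show ?thesis .
  qed
  have inj_b: "inj_on b K"
  proof (rule inj_onI)
    fix i j assume ij: "i \<in> K" "j \<in> K" "b i = b j"
    have "i \<in> I" using ij K by auto
    then have "prj i \<odot> b j = u i" using prjb[of i i] ij by metis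
    moreover have "prj i \<odot> b j = (if j = i then u j else 0)" by (rule prjb) fact+
    ultimately show "i = j" using u0[OF ij(1)] by metis
  qed
  have prjsum: "prj j \<odot> (\<Sum>i\<in>K. scl C (c i) (b i)) = scl C (c j) (u j)" if j: "j \<in> K" for c j
  proof -
    have jI: "j \<in> I" using j K by auto
    have "prj j \<odot> (\<Sum>i\<in>K. scl C (c i) (b i)) = (\<Sum>i\<in>K. prj j \<odot> scl C (c i) (b i))"
      by (rule cmp_sum_right[of Z X "Y j"]) (use ZO d jI bH scl_in in auto)
    also have "\<dots> = (\<Sum>i\<in>K. if i = j then scl C (c j) (u j) else 0)"
      using cmp_scl_right[of Z X "Y j" _ "prj j"] bH ZO d jI by (intro sum.cong) (auto simp: prjb)
    also have "\<dots> = scl C (c j) (u j)" using K j by simp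
    finally show ?thesis .
  qed
  have "independent (b ` K)"
  proof (rule independent_if_scalars_zero)
    show "finite (b ` K)" using K by simp
    fix c x assume s: "(\<Sum>x\<in>b ` K. scl C (c x) x) = 0" and x: "x \<in> b ` K"
    then obtain j where j: "j \<in> K" "x = b j" by blast
    have "(\<Sum>i\<in>K. scl C (c (b i)) (b i)) = 0" using s sum.reindex[OF inj_b, of "\<lambda>x. scl C (c x) x"] by simp
    then have "prj j \<odot> 0 = scl C (c x) (u j)" using prjsum[OF j(1), of "\<lambda>i. c (b i)"] j by simp
    moreover have "prj j \<odot> 0 = 0" using cmp_zero_right[of Z X "Y j"] ZO d j K by auto
    ultimately show "c x = 0" using u0[OF j(1)] by simp
  qed
  moreover have "span (b ` K) = span (Hom C Z X)"
  proof
    show "span (b ` K) \<subseteq> span (Hom C Z X)" using bH by (intro span_mono) auto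
    have "f \<in> span (b ` K)" if f: "f \<in> Hom C Z X" for f
    proof -
      have pf: "prj i \<odot> f \<in> Hom C Z (Y i)" if "i \<in> I" for i by (rule cmp_in[of _ X]) (use ZO d that f in auto)
      have "f = idn C X \<odot> f" using idn_left[of Z X f] f ZO d by simp
      also have "\<dots> = (\<Sum>i\<in>I. inc i \<odot> prj i) \<odot> f" using d by simp
      also have "\<dots> = (\<Sum>i\<in>I. inc i \<odot> prj i \<odot> f)"
        by (rule cmp_sum_left[of Z X X]) (use ZO d f in \<open>(blast intro: cmp_in)+\<close>)
      also have "\<dots> \<in> span (b ` K)"
      proof (rule span_sum)
        fix i assume i: "i \<in> I"
        have e: "inc i \<odot> prj i \<odot> f = inc i \<odot> (prj i \<odot> f)"
          using cmp_assoc[of Z X "Y i" X f "prj i" "inc i"] ZO d i f by simp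
        show "inc i \<odot> prj i \<odot> f \<in> span (b ` K)"
        proof (cases "i \<in> K")
          case True
          then obtain c where "prj i \<odot> f = scl C c (u i)" using HomY pf i by blast
          then have "inc i \<odot> prj i \<odot> f = scl C c (b i)" unfolding e b_def
            using cmp_scl_right[of Z "Y i" X "u i" "inc i" c] ZO d i uv True by simp
          then show ?thesis using True by (simp add: span_scale span_base)
        next
          case False
          then have "prj i \<odot> f = 0" using Y[OF i] pf[OF i] i by (auto simp: K_def)
          then show ?thesis unfolding e using cmp_zero_right[of Z "Y i" X "inc i"] ZO d i span_zero by simp
        qed
      qed
      finally show ?thesis .
    qed
    then show "span (Hom C Z X) \<subseteq> span (b ` K)" by (intro span_minimal) auto
  qed
  ultimately have "dim (Hom C Z X) = card (b ` K)" by (metis dim_eq_card)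
  then show ?thesis using card_image[OF inj_b] by (simp add: K_def)
qed

lemma brick_iso:
  assumes X: "brick C X" and Y: "Y \<in> Ob C" "isomorphic C X Y"
  shows "brick C Y"
proof -
  have XO: "X \<in> Ob C" and X0: "idn C X \<noteq> 0" and XX: "Hom C X X = range (\<lambda>c. scl C c (idn C X))"
    using X by (auto simp: brick_def)
  obtain f g where f: "f \<in> Hom C X Y" "g \<in> Hom C Y X" "g \<odot> f = idn C X" "f \<odot> g = idn C Y"
    using Y(2) unfolding isomorphic_def by (blast elim: iso_arrE)
  have "h \<in> range (\<lambda>c. scl C c (idn C Y))" if h: "h \<in> Hom C Y Y" for h
  proof -
    have hf: "h \<odot> f \<in> Hom C X Y" by (rule cmp_in[of _ Y]) (use XO Y f h in auto)
    then have "g \<odot> (h \<odot> f) \<in> Hom C X X" by (intro cmp_in[of _ Y]) (use XO Y f h in auto)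
    then obtain c where c: "g \<odot> (h \<odot> f) = scl C c (idn C X)" using XX by auto
    have "f \<odot> (g \<odot> (h \<odot> f)) = h \<odot> f"
      using cmp_assoc[of X Y X Y "h \<odot> f" g f] idn_left[of X Y] XO Y f h hf by simp
    then have "h \<odot> f = scl C c f"
      using c cmp_scl_right[of X X Y "idn C X" f c] idn_right[of X Y f] XO Y f idn_in by simp
    then have "h \<odot> f \<odot> g = scl C c (idn C Y)" using cmp_scl_left[of Y X Y g f c] XO Y f by simp
    then have "h = scl C c (idn C Y)"
      using cmp_assoc[of Y X Y Y g f h] idn_right[of Y Y h] XO Y f h by simp
    then show ?thesis by blast
  qed
  then have "Hom C Y Y = range (\<lambda>c. scl C c (idn C Y))" using idn_in[OF Y(1)] scl_in Y(1) by blast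
  moreover have "idn C Y \<noteq> 0"
    using zero_ob_iso[of Y X] isomorphic_sym[OF Y(2)] XO X0 Y by (auto simp: zero_ob_def)
  ultimately show ?thesis using Y by (simp add: brick_def)
qed

lemma brick_not_zero: "brick C X \<Longrightarrow> \<not> zero_ob C X" by (simp add: brick_def zero_ob_def)

lemma mono_arr_iso_cmp:
  assumes "X \<in> Ob C" "Y \<in> Ob C" "Z \<in> Ob C" "mono_arr C X Y f" "iso_arr C Y Z g"
  shows "mono_arr C X Z (g \<odot> f)"
proof -
  have f: "f \<in> Hom C X Y" using assms(4) by (simp add: mono_arr_def)
  have g: "g \<in> Hom C Y Z" using assms(5) by (simp add: iso_arr_def)
  have "h = k" if W: "W \<in> Ob C" "h \<in> Hom C W X" "k \<in> Hom C W X" and e: "g \<odot> f \<odot> h = g \<odot> f \<odot> k" for W h k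
  proof -
    have "g \<odot> (f \<odot> h) = g \<odot> (f \<odot> k)" 
      using cmp_assoc[of W X Y Z _ f g] assms W f g e by simp
    then have "f \<odot> h = f \<odot> k"
      using iso_cancel_left[of W Y Z g "f \<odot> h" "f \<odot> k"] assms W f cmp_in[of W X Y] by simp
    then show ?thesis using assms(4) W by (auto simp: mono_arr_def)
  qed
  then show ?thesis using cmp_in[of X Y Z f g] assms f g by (auto simp: mono_arr_def)
qed

lemma simple_ob_iso:
  assumes X: "simple_ob C X" and Y: "Y \<in> Ob C" "isomorphic C X Y"
  shows "simple_ob C Y"
proof -
  have XO: "X \<in> Ob C" using X by (simp add: simple_ob_def)
  obtain a where a: "iso_arr C Y X a" using isomorphic_sym[OF Y(2)] by (auto simp: isomorphic_def)
  note i = inv_arr[OF Y(1) XO a]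
  have "zero_ob C Z \<or> iso_arr C Z Y f" if Z: "Z \<in> Ob C" and f: "mono_arr C Z Y f" for Z f
  proof -
    have fH: "f \<in> Hom C Z Y" using f by (simp add: mono_arr_def)
    have "mono_arr C Z X (a \<odot> f)" by (rule mono_arr_iso_cmp[of Z Y X]) (use Z Y XO f a in auto)
    then consider "zero_ob C Z" | "iso_arr C Z X (a \<odot> f)" using X Z by (auto simp: simple_ob_def)
    then show ?thesis
    proof cases
      case 2
      have "iso_arr C Z Y (inv_arr C Y X a \<odot> (a \<odot> f))" by (rule iso_arr_cmp[of _ X]) (use Z XO Y 2 i in auto)
      moreover have "inv_arr C Y X a \<odot> (a \<odot> f) = f"
        using cmp_assoc[of Z Y X Y f a "inv_arr C Y X a"] idn_left[of Z Y f] i iso_arr_Hom[OF a] Z Y XO fH by simp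
      ultimately show ?thesis by simp
    qed simp
  qed
  moreover have "\<not> zero_ob C Y" using zero_ob_iso[of Y X] isomorphic_sym[OF Y(2)] X XO by (auto simp: simple_ob_def)
  ultimately show ?thesis using Y by (simp add: simple_ob_def)
qed

end

section \<open>Decomposition into bricks\<close>

text \<open>A multiset of classes records multiplicities, so uniqueness of decompositions is an
  equation and the length of an object is a size.\<close>

definition decomp :: "('o, 'a::ab_group_add, 'k::field) tensor_category \<Rightarrow> 'o \<Rightarrow> 'o set multiset \<Rightarrow> bool" where
  "decomp C X M \<longleftrightarrow> (\<exists>(n::nat) Y. direct_sum C {..<n} Y X \<and> (\<forall>i<n. brick C (Y i)) \<and>
     M = image_mset (\<lambda>i. iso_class C (Y i)) (mset_set {..<n}))"

lemma count_image_mset_set: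
  "finite A \<Longrightarrow> count (image_mset f (mset_set A)) x = card {a \<in> A. f a = x}"
proof (induction A rule: finite_induct)
  case (insert a A)
  have "{b \<in> insert a A. f b = x} = (if f a = x then insert a {b \<in> A. f b = x} else {b \<in> A. f b = x})" by auto
  then show ?case using insert by auto
qed simp

lemma image_mset_Sigma:
  assumes "finite I" "\<And>i. i \<in> I \<Longrightarrow> finite (J i)"
  shows "image_mset (\<lambda>(i, j). f i j) (mset_set (Sigma I J)) = (\<Sum>i\<in>I. image_mset (f i) (mset_set (J i)))"
proof (rule multiset_eqI)
  fix x
  have "{p \<in> Sigma I J. (case p of (i, j) \<Rightarrow> f i j) = x} = Sigma I (\<lambda>i. {j \<in> J i. f i j = x})" by auto
  then have "count (image_mset (\<lambda>(i, j). f i j) (mset_set (Sigma I J))) x = card (Sigma I (\<lambda>i. {j \<in> J i. f i j = x}))"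
    using assms by (subst count_image_mset_set) auto
  also have "\<dots> = (\<Sum>i\<in>I. card {j \<in> J i. f i j = x})" using assms by (intro card_SigmaI) auto
  also have "\<dots> = count (\<Sum>i\<in>I. image_mset (f i) (mset_set (J i))) x"
    using assms by (simp add: count_sum count_image_mset_set)
  finally show "count (image_mset (\<lambda>(i, j). f i j) (mset_set (Sigma I J))) x 
    = count (\<Sum>i\<in>I. image_mset (f i) (mset_set (J i))) x" .
qed

context linear_category
begin

lemma decompI:
  assumes "direct_sum C I Y X" "\<And>i. i \<in> I \<Longrightarrow> brick C (Y i)"
  shows "decomp C X (image_mset (\<lambda>i. iso_class C (Y i)) (mset_set I))"
proof -
  have "finite I" using assms(1) by (simp add: direct_sum_def)
  then obtain h where "bij_betw h {0..<card I} I" using ex_bij_betw_nat_finite by blast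
  then have h: "bij_betw h {..<card I} I" by (simp add: atLeast0LessThan)
  then have "mset_set I = image_mset h (mset_set {..<card I})"
    by (simp add: image_mset_mset_set bij_betw_def)
  then show ?thesis unfolding decomp_def
    using direct_sum_reindex[OF h assms(1)] assms(2) h
    by (intro exI[of _ "card I"] exI[of _ "\<lambda>j. Y (h j)"]) (auto simp: image_mset.compositionality comp_def bij_betw_def)
qed

lemma decomp_mem: "decomp C X M \<Longrightarrow> x \<in># M \<Longrightarrow> \<exists>Z. brick C Z \<and> x = iso_class C Z"
  unfolding decomp_def by fastforce

lemma brick_Ob: "brick C X \<Longrightarrow> X \<in> Ob C" by (simp add: brick_def)

lemma decomp_brick: "brick C X \<Longrightarrow> decomp C X {#iso_class C X#}"
  using decompI[OF direct_sum_one[of X X "()"]] isomorphic_refl brick_Ob by fastforce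

lemma decomp_iso: "decomp C X M \<Longrightarrow> X' \<in> Ob C \<Longrightarrow> isomorphic C X X' \<Longrightarrow> decomp C X' M"
  unfolding decomp_def using direct_sum_iso_sum by metis

lemma decomp_sum:
  assumes "direct_sum C I Y X" "\<And>i. i \<in> I \<Longrightarrow> decomp C (Y i) (M i)"
  shows "decomp C X (\<Sum>i\<in>I. M i)"
proof -
  have "\<forall>i\<in>I. \<exists>p. direct_sum C {..<fst p::nat} (snd p) (Y i) \<and> (\<forall>j<fst p. brick C (snd p j)) \<and>
    M i = image_mset (\<lambda>j. iso_class C (snd p j)) (mset_set {..<fst p})"
    using assms(2) unfolding decomp_def by (metis fst_conv snd_conv)
  then obtain p where p: "\<And>i. i \<in> I \<Longrightarrow> direct_sum C {..<fst (p i)::nat} (snd (p i)) (Y i)"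
    "\<And>i j. i \<in> I \<Longrightarrow> j<fst (p i) \<Longrightarrow> brick C (snd (p i) j)"
    "\<And>i. i \<in> I \<Longrightarrow> M i = image_mset (\<lambda>j. iso_class C (snd (p i) j)) (mset_set {..<fst (p i)})"
    by metis
  have f: "finite I" using assms(1) by (simp add: direct_sum_def)
  have "decomp C X (image_mset (\<lambda>q. iso_class C (case q of (i, j) \<Rightarrow> snd (p i) j)) (mset_set (Sigma I (\<lambda>i. {..<fst (p i)}))))"
    by (rule decompI[OF direct_sum_Sigma[OF assms(1)]]) (use p in auto)
  also have "(\<lambda>q. iso_class C (case q of (i, j) \<Rightarrow> snd (p i) j)) = (\<lambda>(i, j). iso_class C (snd (p i) j))" by auto
  also have "image_mset \<dots> (mset_set (Sigma I (\<lambda>i. {..<fst (p i)}))) = (\<Sum>i\<in>I. M i)"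
    using f p by (subst image_mset_Sigma) auto
  finally show ?thesis .
qed

lemma decomp_empty: "decomp C X {#} \<Longrightarrow> zero_ob C X"
  by (auto simp: decomp_def mset_set_empty_iff direct_sum_def zero_ob_def)

lemma decomp_single:
  assumes "decomp C X {#iso_class C Z#}" "Z \<in> Ob C"
  shows "isomorphic C X Z" "brick C X" "brick C Z"
proof -
  obtain n Y where d: "direct_sum C {..<n} Y X" "\<And>i. i < n \<Longrightarrow> brick C (Y i)"
    and e: "{#iso_class C Z#} = image_mset (\<lambda>i. iso_class C (Y i)) (mset_set {..<n::nat})"
    using assms(1) unfolding decomp_def by blast
  have "size (image_mset (\<lambda>i. iso_class C (Y i)) (mset_set {..<n})) = 1" using e by (metis size_single)
  then have n: "n = 1" by simp
  have "{#iso_class C Z#} = {#iso_class C (Y 0)#}" unfolding e n by (simp add: lessThan_Suc)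
  then have c: "iso_class C Z = iso_class C (Y 0)" by (rule single_eq_single[THEN iffD1])
  have b: "brick C (Y 0)" using d n by simp
  have "isomorphic C Z (Y 0)" using c iso_class_eq[OF assms(2) brick_Ob[OF b]] by simp
  then have Z: "isomorphic C Z (Y 0)" "isomorphic C (Y 0) Z" by (simp_all add: isomorphic_sym)
  have X: "X \<in> Ob C" using d by (simp add: direct_sum_def)
  have "direct_sum C {0::nat} Y (Y 0)"
    by (rule direct_sum_cong[OF direct_sum_one[of "Y 0" "Y 0"]]) (use isomorphic_refl brick_Ob[OF b] in auto)
  then have "direct_sum C {..<n} Y (Y 0)" unfolding n by (simp add: lessThan_Suc)
  then have "isomorphic C X (Y 0)" using direct_sum_unique[OF d(1)] by simp
  then have Y: "isomorphic C X (Y 0)" "isomorphic C (Y 0) X" by (simp_all add: isomorphic_sym)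
  then show "isomorphic C X Z" using isomorphic_trans[OF X brick_Ob[OF b] assms(2)] Z by simp
  show "brick C X" using brick_iso[OF b X] Y by simp
  show "brick C Z" using brick_iso[OF b assms(2)] Z by simp
qed

end

section \<open>Schur's lemma and uniqueness of decompositions\<close>

context linear_category
begin

text \<open>Composition with the resolution of the identity writes f as the sum of its components,
  which cannot all vanish.\<close>

lemma biproduct_projection_nonzero:
  assumes "biproduct C I Y X inc prj" "Z \<in> Ob C" "f \<in> Hom C Z X" "f \<noteq> 0"
  shows "\<exists>i\<in>I. prj i \<odot> f \<in> Hom C Z (Y i) \<and> prj i \<odot> f \<noteq> 0"
proof (rule ccontr)
  note d = biproductD[OF assms(1)]
  assume *: "\<not> ?thesis"
  have "f = (\<Sum>i\<in>I. inc i \<odot> prj i) \<odot> f" using idn_left[of Z X f] assms d by simp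
  also have "\<dots> = (\<Sum>i\<in>I. inc i \<odot> prj i \<odot> f)"
    by (rule cmp_sum_left[of Z X X]) (use d assms in \<open>(blast intro: cmp_in)+\<close>)
  also have "\<dots> = 0"
  proof (rule sum.neutral, rule ballI)
    fix i assume i: "i \<in> I"
    have "prj i \<odot> f = 0" using * cmp_in[of Z X "Y i" f "prj i"] d i assms by auto
    then show "inc i \<odot> prj i \<odot> f = 0"
      using cmp_assoc[of Z X "Y i" X f "prj i" "inc i"] cmp_zero_right[of Z "Y i" X "inc i"] d i assms by simp
  qed
  finally show False using assms by simp
qed

end

text \<open>Schur's lemma is an axiom here because it is obtained in two unrelated ways: from
  kernels in fusion categories, and from an explicit list of irreducibles for representations of the
  bismash product.\<close>

locale schur_category = linear_category +
  assumes schur: "\<lbrakk>brick C X; brick C Y; f \<in> Hom C X Y; f \<noteq> 0\<rbrakk> \<Longrightarrow> iso_arr C X Y f"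
begin

lemma schur_dichotomy:
  assumes "brick C X" "brick C Y"
  shows "isomorphic C X Y \<or> Hom C X Y = {0}"
proof (cases "\<exists>f\<in>Hom C X Y. f \<noteq> 0")
  case True
  then show ?thesis using schur[OF assms] isomorphicI by metis
next
  case False
  then show ?thesis using zero_in[OF brick_Ob[OF assms(1)] brick_Ob[OF assms(2)]] by auto
qed

lemma decomp_count:
  assumes "decomp C X M" "brick C Z"
  shows "dim (Hom C Z X) = count M (iso_class C Z)"
proof -
  obtain n Y where d: "direct_sum C {..<n} Y X" "\<And>i. i < n \<Longrightarrow> brick C (Y i)"
    and e: "M = image_mset (\<lambda>i. iso_class C (Y i)) (mset_set {..<n::nat})"
    using assms(1) unfolding decomp_def by blast
  have "{i \<in> {..<n}. isomorphic C Z (Y i)} = {i \<in> {..<n}. iso_class C (Y i) = iso_class C Z}"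
    using iso_class_eq[OF brick_Ob brick_Ob, of Z] d(2) assms(2) by auto
  then show ?thesis unfolding e
    using dim_Hom_direct_sum[OF assms(2) d(1)] schur_dichotomy[OF assms(2)] d(2) by (simp add: count_image_mset_set)
qed

text \<open>Krull-Schmidt: the multiplicity of a class is the dimension of a Hom space, which does
  not depend on the decomposition.\<close>

lemma decomp_unique: "decomp C X M \<Longrightarrow> decomp C X N \<Longrightarrow> M = N"
proof (rule multiset_eqI)
  fix x assume a: "decomp C X M" "decomp C X N"
  show "count M x = count N x"
  proof (cases "\<exists>Z. brick C Z \<and> x = iso_class C Z")
    case True
    then show ?thesis using decomp_count a by metis
  next
    case False
    then have "x \<notin># M" "x \<notin># N" using decomp_mem a by blast+
    then show ?thesis by (simp add: not_in_iff)
  qed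
qed

lemma Hom_nonzero_iff:
  assumes "decomp C X M" "brick C Z"
  shows "Hom C Z X \<noteq> {0} \<longleftrightarrow> iso_class C Z \<in># M"
proof -
  obtain n Y where ds: "direct_sum C {..<n} Y X" and b: "\<And>i. i < n \<Longrightarrow> brick C (Y i)"
    and e: "M = image_mset (\<lambda>i. iso_class C (Y i)) (mset_set {..<n::nat})"
    using assms(1) unfolding decomp_def by blast
  obtain inc prj where "biproduct C {..<n} Y X inc prj"
    using ds unfolding direct_sum_biproduct by blast
  note d = biproductD[OF this]
  have ZO: "Z \<in> Ob C" using assms(2) by (rule brick_Ob)
  show ?thesis
  proof
    assume "Hom C Z X \<noteq> {0}"
    then obtain f where f: "f \<in> Hom C Z X" "f \<noteq> 0" using zero_in[OF ZO d(2)] by blast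
    obtain i where i: "i < n" "prj i \<odot> f \<noteq> 0" "prj i \<odot> f \<in> Hom C Z (Y i)"
      using biproduct_projection_nonzero[OF \<open>biproduct C {..<n} Y X inc prj\<close> ZO f] by auto
    have "isomorphic C Z (Y i)" by (rule isomorphicI[OF schur[OF assms(2) b[OF i(1)] i(3,2)]])
    then show "iso_class C Z \<in># M" unfolding e using i iso_class_eq[OF ZO brick_Ob[OF b[OF i(1)]]] by auto
  next
    assume "iso_class C Z \<in># M"
    then have "count M (iso_class C Z) \<noteq> 0" by simp
    then have "dim (Hom C Z X) \<noteq> 0" using decomp_count[OF assms] by simp
    moreover have "dim {0} = 0" using dim_eq_card[of "{}" "{0}"] by (auto simp: independent_empty)
    ultimately show "Hom C Z X \<noteq> {0}" by auto
  qed
qed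

end

locale semisimple_schur_category = schur_category +
  assumes decomposable: "X \<in> Ob C \<Longrightarrow> \<exists>M. decomp C X M"
begin

text \<open>Some component of f is a nonzero arrow between bricks, hence invertible by Schur's
  lemma. The projection followed by the inverse of this component is a retraction.\<close>

lemma split_mono:
  assumes "brick C Z" "X \<in> Ob C" "f \<in> Hom C Z X" "f \<noteq> 0"
  shows "\<exists>r \<in> Hom C X Z. r \<odot> f = idn C Z"
proof -
  obtain M where "decomp C X M" using decomposable assms(2) by blast
  then obtain n Y where ds: "direct_sum C {..<n::nat} Y X" and b: "\<And>i. i < n \<Longrightarrow> brick C (Y i)"
    unfolding decomp_def by blast
  obtain inc prj where "biproduct C {..<n} Y X inc prj"
    using ds unfolding direct_sum_biproduct by blast
  note d = biproductD[OF this]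
  have ZO: "Z \<in> Ob C" using assms(1) by (rule brick_Ob)
  obtain i where i: "i < n" "prj i \<odot> f \<noteq> 0" "prj i \<odot> f \<in> Hom C Z (Y i)"
    using biproduct_projection_nonzero[OF \<open>biproduct C {..<n} Y X inc prj\<close> ZO assms(3,4)] by auto
  have YO: "Y i \<in> Ob C" using b i brick_Ob by blast
  have iso: "iso_arr C Z (Y i) (prj i \<odot> f)" by (rule schur[OF assms(1) b[OF i(1)] i(3,2)])
  note k = inv_arr[OF ZO YO iso]
  let ?r = "inv_arr C Z (Y i) (prj i \<odot> f) \<odot> prj i"
  have "?r \<in> Hom C X Z" by (rule cmp_in[of _ "Y i"]) (use ZO YO d i k in auto)
  moreover have "?r \<odot> f = idn C Z"
    using cmp_assoc[of Z X "Y i" Z f "prj i" "inv_arr C Z (Y i) (prj i \<odot> f)"] k ZO YO d i assms by simp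
  ultimately show ?thesis by blast
qed

end

section \<open>Monoidal categories\<close>

context linear_monoidal_category
begin

lemma tar_zero_left: "\<lbrakk>X \<in> Ob C; X' \<in> Ob C; Y \<in> Ob C; Y' \<in> Ob C; g \<in> Hom C Y Y'\<rbrakk> \<Longrightarrow> 0 \<star> g = 0"
  using tar_add_left[of X X' Y Y' 0 0 g] zero_in[of X X'] by simp

lemma tar_zero_right: "\<lbrakk>X \<in> Ob C; X' \<in> Ob C; Y \<in> Ob C; Y' \<in> Ob C; f \<in> Hom C X X'\<rbrakk> \<Longrightarrow> f \<star> 0 = 0"
  using tar_add_right[of X X' Y Y' f 0 0] zero_in[of Y Y'] by simp

lemma tar_sum_left:
  assumes "X \<in> Ob C" "X' \<in> Ob C" "Y \<in> Ob C" "Y' \<in> Ob C" "\<And>i. i \<in> I \<Longrightarrow> f i \<in> Hom C X X'" "g \<in> Hom C Y Y'"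
  shows "(\<Sum>i\<in>I. f i) \<star> g = (\<Sum>i\<in>I. f i \<star> g)"
  using assms(5)
proof (induction I rule: infinite_finite_induct)
  case (insert i I)
  then show ?case using assms(1-4,6)
    by (simp add: tar_add_left[of X X' Y Y'] sum_in)
qed (use assms(1-4,6) tar_zero_left in auto)

lemma tar_sum_right:
  assumes "X \<in> Ob C" "X' \<in> Ob C" "Y \<in> Ob C" "Y' \<in> Ob C" "\<And>i. i \<in> I \<Longrightarrow> g i \<in> Hom C Y Y'" "f \<in> Hom C X X'"
  shows "f \<star> (\<Sum>i\<in>I. g i) = (\<Sum>i\<in>I. f \<star> g i)"
  using assms(5)
proof (induction I rule: infinite_finite_induct)
  case (insert i I)
  then show ?case using assms(1-4,6)
    by (simp add: tar_add_right[of X X' Y Y'] sum_in)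
qed (use assms(1-4,6) tar_zero_right in auto)

lemma iso_arr_tar:
  assumes "X \<in> Ob C" "X' \<in> Ob C" "Y \<in> Ob C" "Y' \<in> Ob C" "iso_arr C X X' f" "iso_arr C Y Y' g"
  shows "iso_arr C (X \<boxtimes> Y) (X' \<boxtimes> Y') (f \<star> g)"
    "inv_arr C (X \<boxtimes> Y) (X' \<boxtimes> Y') (f \<star> g) = inv_arr C X X' f \<star> inv_arr C Y Y' g"
proof -
  note i = inv_arr[OF assms(1,2,5)] inv_arr[OF assms(3,4,6)] iso_arr_Hom[OF assms(5)] iso_arr_Hom[OF assms(6)]
  let ?g = "inv_arr C X X' f \<star> inv_arr C Y Y' g"
  have *: "f \<star> g \<in> Hom C (X \<boxtimes> Y) (X' \<boxtimes> Y')" "?g \<in> Hom C (X' \<boxtimes> Y') (X \<boxtimes> Y)"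
    using tar_in assms i by auto
  have **: "?g \<odot> (f \<star> g) = idn C (X \<boxtimes> Y)" "(f \<star> g) \<odot> ?g = idn C (X' \<boxtimes> Y')"
    using tar_cmp[of X X' X Y Y' Y f "inv_arr C X X' f" g "inv_arr C Y Y' g"]
      tar_cmp[of X' X X' Y' Y Y' "inv_arr C X X' f" f "inv_arr C Y Y' g" g] tar_idn assms i by auto
  show "iso_arr C (X \<boxtimes> Y) (X' \<boxtimes> Y') (f \<star> g)" by (rule iso_arrI) (use * ** in auto)
  show "inv_arr C (X \<boxtimes> Y) (X' \<boxtimes> Y') (f \<star> g) = ?g"
    by (rule inv_arr_eq) (use * ** tob_in assms in auto)
qed

lemma isomorphic_tob:
  "\<lbrakk>X \<in> Ob C; X' \<in> Ob C; Y \<in> Ob C; Y' \<in> Ob C; isomorphic C X X'; isomorphic C Y Y'\<rbrakk>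
    \<Longrightarrow> isomorphic C (X \<boxtimes> Y) (X' \<boxtimes> Y')"
  unfolding isomorphic_def using iso_arr_tar(1) by blast

lemma zero_ob_tob: "zero_ob C X \<Longrightarrow> Y \<in> Ob C \<Longrightarrow> zero_ob C (X \<boxtimes> Y)" "zero_ob C X \<Longrightarrow> Y \<in> Ob C \<Longrightarrow> zero_ob C (Y \<boxtimes> X)"
  using tar_zero_left[of X X Y Y "idn C Y"] tar_zero_right[of Y Y X X "idn C Y"] tar_idn[of X Y] tar_idn[of Y X] tob_in idn_in
  by (auto simp: zero_ob_def)

lemma direct_sum_tob_left:
  assumes "direct_sum C I Y X" "Z \<in> Ob C"
  shows "direct_sum C I (\<lambda>i. Y i \<boxtimes> Z) (X \<boxtimes> Z)"
proof -
  obtain inc prj where "biproduct C I Y X inc prj"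
    using assms unfolding direct_sum_biproduct by blast
  note d = biproductD[OF this]
  note Z = assms(2) idn_in[OF assms(2)] idn_left[OF assms(2) assms(2) idn_in[OF assms(2)]]
  show ?thesis
  proof (rule direct_sumI[of _ _ _ "\<lambda>i. inc i \<star> idn C Z" "\<lambda>i. prj i \<star> idn C Z"])
    show "(prj j \<star> idn C Z) \<odot> (inc i \<star> idn C Z) = (if i = j then idn C (Y i \<boxtimes> Z) else 0)" if "i \<in> I" "j \<in> I" for i j
      using tar_cmp[of "Y i" X "Y j" Z Z Z "inc i" "prj j" "idn C Z" "idn C Z"] d Z that tar_idn
        tar_zero_left[of "Y i" "Y j" Z Z "idn C Z"] by auto
    have "(\<Sum>i\<in>I. (inc i \<star> idn C Z) \<odot> (prj i \<star> idn C Z)) = (\<Sum>i\<in>I. (inc i \<odot> prj i) \<star> idn C Z)"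
    proof (rule sum.cong[OF refl])
      fix i assume "i \<in> I"
      then show "(inc i \<star> idn C Z) \<odot> (prj i \<star> idn C Z) = (inc i \<odot> prj i) \<star> idn C Z"
        using tar_cmp[of X "Y i" X Z Z Z "prj i" "inc i" "idn C Z" "idn C Z"] d Z by simp
    qed
    also have "\<dots> = (\<Sum>i\<in>I. inc i \<odot> prj i) \<star> idn C Z"
      by (rule tar_sum_left[symmetric, of X X Z Z]) (use d Z in \<open>(blast intro: cmp_in)+\<close>)
    also have "\<dots> = idn C (X \<boxtimes> Z)" using d Z tar_idn by simp
    finally show "(\<Sum>i\<in>I. (inc i \<star> idn C Z) \<odot> (prj i \<star> idn C Z)) = idn C (X \<boxtimes> Z)" .
  qed (use d Z tob_in tar_in in auto)
qed

lemma direct_sum_tob_right: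
  assumes "direct_sum C I Y X" "Z \<in> Ob C"
  shows "direct_sum C I (\<lambda>i. Z \<boxtimes> Y i) (Z \<boxtimes> X)"
proof -
  obtain inc prj where "biproduct C I Y X inc prj"
    using assms unfolding direct_sum_biproduct by blast
  note d = biproductD[OF this]
  note Z = assms(2) idn_in[OF assms(2)] idn_left[OF assms(2) assms(2) idn_in[OF assms(2)]]
  show ?thesis
  proof (rule direct_sumI[of _ _ _ "\<lambda>i. idn C Z \<star> inc i" "\<lambda>i. idn C Z \<star> prj i"])
    show "(idn C Z \<star> prj j) \<odot> (idn C Z \<star> inc i) = (if i = j then idn C (Z \<boxtimes> Y i) else 0)" if "i \<in> I" "j \<in> I" for i j
      using tar_cmp[of Z Z Z "Y i" X "Y j" "idn C Z" "idn C Z" "inc i" "prj j"] d Z that tar_idn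
        tar_zero_right[of Z Z "Y i" "Y j" "idn C Z"] by auto
    have "(\<Sum>i\<in>I. (idn C Z \<star> inc i) \<odot> (idn C Z \<star> prj i)) = (\<Sum>i\<in>I. idn C Z \<star> (inc i \<odot> prj i))"
    proof (rule sum.cong[OF refl])
      fix i assume "i \<in> I"
      then show "(idn C Z \<star> inc i) \<odot> (idn C Z \<star> prj i) = idn C Z \<star> (inc i \<odot> prj i)"
        using tar_cmp[of Z Z Z X "Y i" X "idn C Z" "idn C Z" "prj i" "inc i"] d Z by simp
    qed
    also have "\<dots> = idn C Z \<star> (\<Sum>i\<in>I. inc i \<odot> prj i)"
      by (rule tar_sum_right[symmetric, of Z Z X X]) (use d Z in \<open>(blast intro: cmp_in)+\<close>)
    also have "\<dots> = idn C (Z \<boxtimes> X)" using d Z tar_idn by simp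
    finally show "(\<Sum>i\<in>I. (idn C Z \<star> inc i) \<odot> (idn C Z \<star> prj i)) = idn C (Z \<boxtimes> X)" .
  qed (use d Z tob_in tar_in in auto)
qed

lemma direct_sum_tob:
  assumes "direct_sum C I Y X" "direct_sum C J Z W"
  shows "direct_sum C (I \<times> J) (\<lambda>(i, j). Y i \<boxtimes> Z j) (X \<boxtimes> W)"
proof (rule direct_sum_Sigma[OF direct_sum_tob_left[OF assms(1)]])
  show "W \<in> Ob C" using assms(2) by (simp add: direct_sum_def)
  fix i assume "i \<in> I"
  then have "Y i \<in> Ob C" using assms(1) by (simp add: direct_sum_def)
  then show "direct_sum C J (\<lambda>j. Y i \<boxtimes> Z j) (Y i \<boxtimes> W)" by (rule direct_sum_tob_right[OF assms(2)])
qed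

end

text \<open>On classes the associator and the unitors become equalities, so the invertible objects
  are the units of an honest monoid.\<close>

definition iso_monoid :: "('o, 'a::ab_group_add, 'k::field) tensor_category \<Rightarrow> 'o set monoid" where
  "iso_monoid C = \<lparr>carrier = iso_class C ` Ob C,
     mult = (\<lambda>x y. iso_class C (rep_ob x \<boxtimes>\<^bsub>C\<^esub> rep_ob y)), one = iso_class C (unit_ob C)\<rparr>"

context linear_monoidal_category
begin

lemma iso_monoid_mult:
  assumes "X \<in> Ob C" "Y \<in> Ob C"
  shows "iso_class C X \<otimes>\<^bsub>iso_monoid C\<^esub> iso_class C Y = iso_class C (X \<boxtimes> Y)"
  using isomorphic_tob[of "rep_ob (iso_class C X)" X "rep_ob (iso_class C Y)" Y] assms
  by (simp add: iso_monoid_def iso_class_eq tob_in rep_ob_iso_class)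

lemma iso_monoid_carrier: "X \<in> Ob C \<Longrightarrow> iso_class C X \<in> carrier (iso_monoid C)"
  by (simp add: iso_monoid_def)

lemma iso_monoid_carrierE: "x \<in> carrier (iso_monoid C) \<Longrightarrow> (\<And>X. X \<in> Ob C \<Longrightarrow> x = iso_class C X \<Longrightarrow> P) \<Longrightarrow> P"
  by (auto simp: iso_monoid_def)

lemma iso_monoid_one: "\<one>\<^bsub>iso_monoid C\<^esub> = iso_class C (unit_ob C)"
  by (simp add: iso_monoid_def)

lemma monoid_iso_monoid: "monoid (iso_monoid C)"
proof (rule monoidI)
  fix x y assume "x \<in> carrier (iso_monoid C)" "y \<in> carrier (iso_monoid C)"
  then show "x \<otimes>\<^bsub>iso_monoid C\<^esub> y \<in> carrier (iso_monoid C)"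
    by (elim iso_monoid_carrierE) (simp add: iso_monoid_mult tob_in iso_monoid_carrier)
next
  show "\<one>\<^bsub>iso_monoid C\<^esub> \<in> carrier (iso_monoid C)" by (simp add: iso_monoid_one iso_monoid_carrier unit_in)
next
  fix x y z assume "x \<in> carrier (iso_monoid C)" "y \<in> carrier (iso_monoid C)" "z \<in> carrier (iso_monoid C)"
  then show "x \<otimes>\<^bsub>iso_monoid C\<^esub> y \<otimes>\<^bsub>iso_monoid C\<^esub> z = x \<otimes>\<^bsub>iso_monoid C\<^esub> (y \<otimes>\<^bsub>iso_monoid C\<^esub> z)"
    using isomorphicI[OF assoc_iso]
    by (elim iso_monoid_carrierE) (simp add: iso_monoid_mult tob_in iso_class_eq)
next
  fix x assume "x \<in> carrier (iso_monoid C)"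
  then show "\<one>\<^bsub>iso_monoid C\<^esub> \<otimes>\<^bsub>iso_monoid C\<^esub> x = x" "x \<otimes>\<^bsub>iso_monoid C\<^esub> \<one>\<^bsub>iso_monoid C\<^esub> = x"
    using isomorphicI[OF lunit_iso] isomorphicI[OF runit_iso]
    by (elim iso_monoid_carrierE; simp add: iso_monoid_one iso_monoid_mult unit_in tob_in iso_class_eq)+
qed

end

text \<open>What fusion categories supply to the later arguments. Rigidity enters as the absence of
  zero divisors, which bounds the length of a tensor product from below.\<close>

locale semisimple_monoidal_category = linear_monoidal_category + semisimple_schur_category +
  assumes brick_unit: "brick C (unit_ob C)"
    and tob_not_zero: "\<lbrakk>X \<in> Ob C; Y \<in> Ob C; \<not> zero_ob C X; \<not> zero_ob C Y\<rbrakk> \<Longrightarrow> \<not> zero_ob C (X \<boxtimes> Y)"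
begin

lemma sum_ge_card_eq_1:
  fixes f :: "'i \<Rightarrow> nat"
  assumes "finite I" "\<And>i. i \<in> I \<Longrightarrow> f i \<ge> 1" "sum f I \<le> card I" "i \<in> I"
  shows "f i = 1"
proof (rule ccontr)
  assume "f i \<noteq> 1"
  then have "(\<Sum>i\<in>I. 1) < sum f I" using assms by (intro sum_strict_mono_ex1) (auto intro!: bexI[of _ i] simp: le_neq_implies_less)
  then show False using assms by simp
qed

text \<open>The comparison of lengths. The product of X and Y is the direct sum of the products of
  their summands, and all of these are nonzero. A total length of at most
  \<open>size M * size N\<close> leaves room for one simple object in each, so every product of
  summands is simple and \<open>R\<close> consists of these products.\<close>

lemma decomp_tob:
  assumes "decomp C X M" "decomp C Y N" "decomp C (X \<boxtimes> Y) R" "size R \<le> size M * size N"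
  shows "\<And>x y. x \<in># M \<Longrightarrow> y \<in># N \<Longrightarrow> x \<otimes>\<^bsub>iso_monoid C\<^esub> y \<in># R"
    and "\<And>r. r \<in># R \<Longrightarrow> \<exists>x y. x \<in># M \<and> y \<in># N \<and> r = x \<otimes>\<^bsub>iso_monoid C\<^esub> y"
proof -
  obtain m V where d: "direct_sum C {..<m} V X" "\<And>i. i < m \<Longrightarrow> brick C (V i)"
    and M: "M = image_mset (\<lambda>i. iso_class C (V i)) (mset_set {..<m::nat})"
    using assms(1) unfolding decomp_def by blast
  obtain n W where e: "direct_sum C {..<n} W Y" "\<And>i. i < n \<Longrightarrow> brick C (W i)"
    and N: "N = image_mset (\<lambda>i. iso_class C (W i)) (mset_set {..<n::nat})"
    using assms(2) unfolding decomp_def by blast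
  let ?I = "{..<m} \<times> {..<n}"
  let ?P = "\<lambda>(i, j). V i \<boxtimes> W j"
  have "\<forall>p\<in>?I. \<exists>K. decomp C (?P p) K"
    using decomposable tob_in brick_Ob[OF d(2)] brick_Ob[OF e(2)] by auto
  then obtain K where K: "\<And>p. p \<in> ?I \<Longrightarrow> decomp C (?P p) (K p)" by metis
  have R: "R = (\<Sum>p\<in>?I. K p)"
    by (rule decomp_unique[OF assms(3) decomp_sum[OF direct_sum_tob[OF d(1) e(1)] K]])
  have K1: "size (K p) = 1" if "p \<in> ?I" for p
  proof (rule sum_ge_card_eq_1[OF _ _ _ that])
    show "(\<Sum>p\<in>?I. size (K p)) \<le> card ?I" using assms(4) by (simp add: R M N size_multiset_sum card_cartesian_product)
    fix p assume p: "p \<in> ?I"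
    then have "\<not> zero_ob C (?P p)" using tob_not_zero brick_not_zero[OF d(2)] brick_not_zero[OF e(2)]
        brick_Ob[OF d(2)] brick_Ob[OF e(2)] by auto
    then have "K p \<noteq> {#}" using K[OF p] decomp_empty by metis
    then show "1 \<le> size (K p)" by (simp add: Suc_leI nonempty_has_size)
  qed simp
  have KP: "K (i, j) = {#iso_class C (V i) \<otimes>\<^bsub>iso_monoid C\<^esub> iso_class C (W j)#}" if ij: "i < m" "j < n" for i j
  proof -
    obtain k where k: "K (i, j) = {#k#}" using K1[of "(i, j)"] ij size_1_singleton_mset by auto
    have dk: "decomp C (V i \<boxtimes> W j) {#k#}" using K[of "(i, j)"] k ij by simp
    then obtain Z where Z: "brick C Z" "k = iso_class C Z" using decomp_mem[OF dk, of k] by auto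
    have VW: "V i \<in> Ob C" "W j \<in> Ob C" "V i \<boxtimes> W j \<in> Ob C" using brick_Ob[OF d(2)] brick_Ob[OF e(2)] ij tob_in by auto
    have "isomorphic C (V i \<boxtimes> W j) Z" using decomp_single[of "V i \<boxtimes> W j" Z] dk Z brick_Ob by simp
    then have "k = iso_class C (V i \<boxtimes> W j)" using iso_class_eq[OF VW(3) brick_Ob[OF Z(1)]] Z by simp
    then show ?thesis using k iso_monoid_mult[OF VW(1,2)] by simp
  qed
  have mem: "r \<in># R \<longleftrightarrow> (\<exists>i<m. \<exists>j<n. r = iso_class C (V i) \<otimes>\<^bsub>iso_monoid C\<^esub> iso_class C (W j))" for r
  proof -
    have "r \<in># R \<longleftrightarrow> (\<exists>p\<in>?I. r \<in># K p)" unfolding R by (simp add: set_mset_sum)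
    then show ?thesis using KP by (auto 0 3)
  qed
  show "\<And>x y. x \<in># M \<Longrightarrow> y \<in># N \<Longrightarrow> x \<otimes>\<^bsub>iso_monoid C\<^esub> y \<in># R" unfolding mem by (auto simp: M N)
  show "\<And>r. r \<in># R \<Longrightarrow> \<exists>x y. x \<in># M \<and> y \<in># N \<and> r = x \<otimes>\<^bsub>iso_monoid C\<^esub> y" unfolding mem by (auto simp: M N)
qed

text \<open>The products of the summands of X with Y are all nonzero and together make up the unit,
  which has length one.\<close>

lemma brick_invertible:
  assumes X: "X \<in> Ob C" "Y \<in> Ob C" and iso: "isomorphic C (X \<boxtimes> Y) (unit_ob C)"
  shows "brick C X"
proof -
  obtain M N where M: "decomp C X M" and N: "decomp C Y N" using decomposable X by blast
  obtain m V where d: "direct_sum C {..<m} V X" "\<And>i. i < m \<Longrightarrow> brick C (V i)"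
    and Me: "M = image_mset (\<lambda>i. iso_class C (V i)) (mset_set {..<m::nat})"
    using M unfolding decomp_def by blast
  let ?P = "\<lambda>i. V i \<boxtimes> Y"
  have VO: "V i \<in> Ob C" if "i < m" for i using d(2)[OF that] brick_Ob by simp
  have "\<forall>p\<in>{..<m}. \<exists>K. decomp C (?P p) K" using decomposable tob_in VO X by auto
  then obtain K where K: "\<And>p. p \<in> {..<m} \<Longrightarrow> decomp C (?P p) (K p)" by metis
  have XY: "decomp C (X \<boxtimes> Y) {#iso_class C (unit_ob C)#}"
    using decomp_iso[OF decomp_brick[OF brick_unit]] X tob_in iso isomorphic_sym by simp
  have R: "{#iso_class C (unit_ob C)#} = (\<Sum>p<m. K p)"
    by (rule decomp_unique[OF XY decomp_sum[OF direct_sum_tob_left[OF d(1) X(2)] K]])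
  have "\<not> zero_ob C (X \<boxtimes> Y)" using decomp_single(2)[OF XY unit_in] brick_not_zero by blast
  then have Y0: "\<not> zero_ob C Y" using zero_ob_tob X by blast
  have K1: "size (K p) \<ge> 1" if "p \<in> {..<m}" for p
  proof -
    have "\<not> zero_ob C (V p \<boxtimes> Y)" using tob_not_zero brick_not_zero[OF d(2)] VO that Y0 X by auto
    then have "K p \<noteq> {#}" using K[OF that] decomp_empty by metis
    then show "1 \<le> size (K p)" by (simp add: Suc_leI nonempty_has_size)
  qed
  have "m \<le> (\<Sum>p<m. size (K p))" using sum_mono[of "{..<m}" "\<lambda>_. 1" "\<lambda>p. size (K p)"] K1 by simp
  also have "\<dots> = 1" using R by (metis size_multiset_sum size_single)
  finally have "m \<le> 1" .
  moreover have "m \<noteq> 0" using R by (cases "m = 0") auto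
  ultimately have "m = 1" by simp
  then have "M = {#iso_class C (V 0)#}" unfolding Me by (simp add: lessThan_Suc)
  then show ?thesis using decomp_single(2)[of X "V 0"] M VO \<open>m = 1\<close> by simp
qed

lemma Units_brick:
  assumes "x \<in> Units (iso_monoid C)" "X \<in> Ob C" "x = iso_class C X"
  shows "brick C X"
proof -
  obtain y where y: "y \<in> carrier (iso_monoid C)" "x \<otimes>\<^bsub>iso_monoid C\<^esub> y = \<one>\<^bsub>iso_monoid C\<^esub>"
    using assms(1) by (auto simp: Units_def)
  then obtain Y where "Y \<in> Ob C" "y = iso_class C Y" by (elim iso_monoid_carrierE) blast
  then show ?thesis using brick_invertible[of X Y] y(2) assms
    by (simp add: iso_monoid_mult iso_monoid_one iso_class_eq tob_in unit_in)
qed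

end

section \<open>Fusion categories over an algebraically closed field\<close>

text \<open>The kernel of f is a subobject of X, hence zero or all of X. In the second case f would
  vanish; in the first f is mono, and simplicity of Y makes it an isomorphism.\<close>

lemma abelian_schur:
  assumes ab: "abelian_category C" and X: "simple_ob C X" and Y: "simple_ob C Y"
    and f: "f \<in> Hom C X Y" "f \<noteq> 0"
  shows "iso_arr C X Y f"
proof -
  interpret linear_category C using ab by (simp add: abelian_category_def)
  have XO: "X \<in> Ob C" and YO: "Y \<in> Ob C" using X Y by (auto simp: simple_ob_def)
  obtain K i where k: "kernel_arr C X Y f K i" using ab XO YO f unfolding abelian_category_def by meson
  then have K: "K \<in> Ob C" "i \<in> Hom C K X" "f \<odot>\<^bsub>C\<^esub> i = 0" by (auto simp: kernel_arr_def)
  have "mono_arr C K X i"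
    unfolding mono_arr_def
  proof (intro conjI ballI impI)
    fix W g h assume W: "W \<in> Ob C" "g \<in> Hom C W K" "h \<in> Hom C W K" "i \<odot>\<^bsub>C\<^esub> g = i \<odot>\<^bsub>C\<^esub> h"
    have "f \<odot>\<^bsub>C\<^esub> (i \<odot>\<^bsub>C\<^esub> g) = 0"
      using cmp_assoc[of W K X Y g i f] cmp_zero_left[of W K Y g] W K XO YO f by simp
    moreover have "i \<odot>\<^bsub>C\<^esub> g \<in> Hom C W X" by (rule cmp_in[of _ K]) (use W K XO in auto)
    ultimately have "\<exists>!l. l \<in> Hom C W K \<and> i \<odot>\<^bsub>C\<^esub> l = i \<odot>\<^bsub>C\<^esub> g"
      using k W(1) by (auto simp: kernel_arr_def)
    then show "g = h" using W by metis
  qed (rule K)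
  then consider "zero_ob C K" | "iso_arr C K X i" using X K by (auto simp: simple_ob_def)
  then show ?thesis
  proof cases
    case 1
    have "mono_arr C X Y f"
      unfolding mono_arr_def
    proof (intro conjI ballI impI)
      fix W g h assume W: "W \<in> Ob C" "g \<in> Hom C W X" "h \<in> Hom C W X" "f \<odot>\<^bsub>C\<^esub> g = f \<odot>\<^bsub>C\<^esub> h"
      have "f \<odot>\<^bsub>C\<^esub> (g - h) = 0" using cmp_diff_right[of W X Y g h f] W XO YO f by simp
      moreover have "g - h \<in> Hom C W X" using diff_in W XO by blast
      ultimately obtain l where l: "l \<in> Hom C W K" "i \<odot>\<^bsub>C\<^esub> l = g - h"
        using k W(1) unfolding kernel_arr_def by blast
      have "l = 0" using Hom_zero_ob(2)[OF 1 W(1)] l by simp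
      then have "g - h = 0" using l cmp_zero_right[of W K X i] W K XO by simp
      then show "g = h" by simp
    qed (rule f)
    then show ?thesis using Y XO X by (auto simp: simple_ob_def)
  next
    case 2
    note j = inv_arr[OF K(1) XO 2]
    have "f = f \<odot>\<^bsub>C\<^esub> (i \<odot>\<^bsub>C\<^esub> inv_arr C K X i)" using j idn_right[of X Y f] XO YO f by simp
    also have "\<dots> = 0"
      using cmp_assoc[of X K X Y "inv_arr C K X i" i f] cmp_zero_left[of X K Y] j K XO YO f by simp
    finally show ?thesis using f by simp
  qed
qed

text \<open>The value p(f) in the endomorphism algebra of X, computed by Horner's scheme.\<close>

definition hom_poly :: "('o, 'a::ab_group_add, 'k::field) tensor_category \<Rightarrow> 'o \<Rightarrow> 'a \<Rightarrow> 'k poly \<Rightarrow> 'a"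
  where "hom_poly C X f p = foldr (\<lambda>a g. scl C a (idn C X) + (f \<odot>\<^bsub>C\<^esub> g)) (coeffs p) 0"

context linear_category
begin

context
  fixes X f assumes X: "X \<in> Ob C" and f: "f \<in> Hom C X X"
begin

lemma hom_poly_0: "hom_poly C X f 0 = 0" by (simp add: hom_poly_def)

lemma hom_poly_pCons: "hom_poly C X f (pCons a p) = scl C a (idn C X) + (f \<odot> hom_poly C X f p)"
  using cmp_zero_right[OF X X X f] by (simp add: hom_poly_def cCons_def)

lemma hom_poly_in: "hom_poly C X f p \<in> Hom C X X"
  by (induction p) (auto simp: hom_poly_0 hom_poly_pCons X f zero_in intro!: add_in scl_in idn_in cmp_in[of X X X])

lemma hom_poly_add: "hom_poly C X f (p + q) = hom_poly C X f p + hom_poly C X f q"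
proof (induction p arbitrary: q)
  case (pCons a p)
  obtain b q' where q: "q = pCons b q'" by (cases q)
  show ?case
    unfolding q add_pCons hom_poly_pCons pCons.IH
    using cmp_add_right[OF X X X hom_poly_in hom_poly_in f] by (simp add: algebra_simps scale_left_distrib)
qed (simp add: hom_poly_0)

lemma hom_poly_smult: "hom_poly C X f (smult c p) = scl C c (hom_poly C X f p)"
proof (induction p)
  case (pCons a p)
  show ?case
    unfolding smult_pCons hom_poly_pCons pCons.IH
    using cmp_scl_right[OF X X X hom_poly_in f] by (simp add: scale_right_distrib)
qed (simp add: hom_poly_0)

lemma hom_poly_sum: "hom_poly C X f (sum p I) = (\<Sum>i\<in>I. hom_poly C X f (p i))"
  by (induction I rule: infinite_finite_induct) (auto simp: hom_poly_0 hom_poly_add)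

lemma hom_poly_linear_factor:
  "hom_poly C X f ([:- a, 1:] * q) = (f - scl C a (idn C X)) \<odot> hom_poly C X f q"
proof -
  have "hom_poly C X f ([:- a, 1:] * q) = hom_poly C X f (smult (- a) q + pCons 0 q)" by simp
  also have "\<dots> = (f \<odot> hom_poly C X f q) - scl C a (hom_poly C X f q)"
    unfolding hom_poly_add hom_poly_smult hom_poly_pCons by simp
  also have "\<dots> = (f - scl C a (idn C X)) \<odot> hom_poly C X f q"
    using cmp_diff_left[OF X X X hom_poly_in f scl_in[OF X X idn_in[OF X]]]
      cmp_scl_left[OF X X X hom_poly_in idn_in[OF X]] idn_left[OF X X hom_poly_in] by simp
  finally show ?thesis .
qed

text \<open>The endomorphisms are spanned by finitely many arrows, so the powers of f with exponents
  up to \<open>card B\<close> are too many to be independent.\<close>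

lemma annihilating_poly:
  assumes B: "finite B" "Hom C X X = span B"
  shows "\<exists>p. p \<noteq> 0 \<and> hom_poly C X f p = 0"
proof -
  define v where "v i = hom_poly C X f (monom 1 i)" for i
  have vm: "hom_poly C X f (monom c i) = scl C c (v i)" for c i
    unfolding v_def hom_poly_smult[symmetric] by (simp add: smult_monom)
  show ?thesis
  \<comment> \<open>Dependence is a property of the set of powers. Two equal powers shrink this set
    and escape the count, so they get their own polynomial.\<close>
  proof (cases "inj_on v {..card B}")
    case False
    then obtain i j where ij: "v i = v j" "i \<noteq> j" by (auto simp: inj_on_def)
    have "hom_poly C X f (monom 1 i + monom (-1) j) = 0"
      unfolding hom_poly_add vm using ij by simp
    then obtain p where p: "hom_poly C X f p = 0" "p = monom 1 i + monom (-1) j" by blast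
    then have "coeff p i = 1" using ij by simp
    then have "p \<noteq> 0" by auto
    then show ?thesis using p by blast
  next
    case True
    have "dependent (v ` {..card B})"
    proof (rule ccontr)
      assume "\<not> ?thesis"
      then have "card (v ` {..card B}) \<le> card B"
        using independent_span_bound[OF B(1), of "v ` {..card B}"] hom_poly_in B(2) by (auto simp: v_def)
      then show False using card_image[OF True] by simp
    qed
    then obtain u i where u: "(\<Sum>x\<in>v ` {..card B}. scl C (u x) x) = 0" "i \<le> card B" "u (v i) \<noteq> 0"
      using dependent_finite[of "v ` {..card B}"] by auto
    define p where "p = (\<Sum>i\<le>card B. monom (u (v i)) i)"
    have "hom_poly C X f p = 0"
      unfolding p_def hom_poly_sum vm using u(1) sum.reindex[OF True, of "\<lambda>x. scl C (u x) x"] by simp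
    moreover have "coeff p i = u (v i)" using u(2) by (simp add: p_def coeff_sum)
    then have "p \<noteq> 0" using u(3) by auto
    ultimately show ?thesis by blast
  qed
qed

end

end

text \<open>An annihilating polynomial is stripped of its linear factors, using roots from algebraic
  closedness. When the cofactor q first has q(f) nonzero, q(f) is invertible by Schur's lemma, and f
  is the root times the identity.\<close>

lemma fusion_simple_brick:
  fixes C :: "('o, 'a::ab_group_add, 'k::alg_closed_field) tensor_category"
  assumes fus: "fusion_category C" and X: "simple_ob C X"
  shows "brick C X"
proof -
  interpret linear_category C
    using fus by (simp add: fusion_category_def linear_monoidal_category_def)
  have ab: "abelian_category C" using fus by (simp add: fusion_category_def semisimple_category_def)
  have XO: "X \<in> Ob C" and X0: "idn C X \<noteq> 0" using X by (auto simp: simple_ob_def zero_ob_def)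
  obtain B where B: "finite B" "Hom C X X = span B"
    using fus XO unfolding fusion_category_def by blast
  have "f \<in> range (\<lambda>c. scl C c (idn C X))" if f: "f \<in> Hom C X X" for f
  proof -
    obtain p where "p \<noteq> 0" "hom_poly C X f p = 0" using annihilating_poly[OF XO f B] by blast
    then show ?thesis
    proof (induction "degree p" arbitrary: p rule: less_induct)
      case less
      show ?case
      proof (cases "degree p = 0")
        case True
        then obtain a where a: "p = [:a:]" by (metis degree_eq_zeroE)
        then have "scl C a (idn C X) = 0"
          using less.prems(2) cmp_zero_right[OF XO XO XO f] by (simp add: hom_poly_pCons[OF XO f] hom_poly_0[OF XO f])
        then show ?thesis using less.prems(1) X0 a by simp
      next
        case False
        then obtain a where "poly p a = 0" using alg_closed_imp_poly_has_root[of p] by auto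
        then obtain q where q: "p = [:- a, 1:] * q" by (metis poly_eq_0_iff_dvd dvdE)
        have q0: "q \<noteq> 0" using q less.prems by auto
        have dq: "degree q < degree p" unfolding q using q0 by (subst degree_mult_eq) auto
        show ?thesis
        proof (cases "hom_poly C X f q = 0")
          case True
          then show ?thesis using less.hyps[OF dq q0] by simp
        next
          case nz: False
          note qi = hom_poly_in[OF XO f, of q]
          have iso: "iso_arr C X X (hom_poly C X f q)" by (rule abelian_schur[OF ab X X qi nz])
          have "(f - scl C a (idn C X)) \<odot>\<^bsub>C\<^esub> hom_poly C X f q = 0 \<odot>\<^bsub>C\<^esub> hom_poly C X f q"
            using less.prems(2) q hom_poly_linear_factor[OF XO f, of a q] cmp_zero_left[OF XO XO XO qi] by simp
          then have "f - scl C a (idn C X) = 0"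
            using iso_cancel_right[OF XO XO XO iso diff_in[OF XO XO f scl_in[OF XO XO idn_in[OF XO]]] zero_in[OF XO XO]]
            by simp
          then show ?thesis by (auto simp: algebra_simps)
        qed
      qed
    qed
  qed
  then have "Hom C X X = range (\<lambda>c. scl C c (idn C X))" using scl_in[OF XO XO idn_in[OF XO]] by blast
  then show ?thesis using XO X0 by (simp add: brick_def)
qed

text \<open>On a brick, projection followed by inclusion is a scalar c, and c fixes the nonzero
  projection, so c = 1.\<close>

lemma (in linear_category) brick_summand:
  assumes X: "brick C X" and ds: "direct_sum C I Y X"
  shows "\<exists>i\<in>I. isomorphic C (Y i) X"
proof -
  have XO: "X \<in> Ob C" and X0: "idn C X \<noteq> 0" using X by (auto simp: brick_def)
  obtain inc prj where bp: "biproduct C I Y X inc prj"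
    using ds unfolding direct_sum_biproduct by blast
  note d = biproductD[OF bp]
  obtain i where i: "i \<in> I" "prj i \<odot> idn C X \<noteq> 0"
    using biproduct_projection_nonzero[OF bp XO idn_in[OF XO] X0] by auto
  have YO: "Y i \<in> Ob C" using d i by simp
  have "inc i \<odot> prj i \<in> Hom C X X" by (rule cmp_in[of _ "Y i"]) (use d i in auto)
  then obtain c where c: "inc i \<odot> prj i = scl C c (idn C X)" using X by (auto simp: brick_def)
  have p: "prj i \<in> Hom C X (Y i)" "inc i \<in> Hom C (Y i) X" "prj i \<odot> inc i = idn C (Y i)" using d i by auto
  have "scl C c (prj i) = prj i \<odot> (inc i \<odot> prj i)"
    using c cmp_scl_right[of X X "Y i" "idn C X" "prj i" c] idn_right[of X "Y i" "prj i"] idn_in p XO YO by simp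
  also have "\<dots> = prj i"
    using cmp_assoc[of X "Y i" X "Y i" "prj i" "inc i" "prj i"] p XO YO idn_left[of X "Y i" "prj i"] by simp
  finally have "scl C (c - 1) (prj i) = 0" by (simp add: scale_left_diff_distrib)
  moreover have "prj i \<noteq> 0" using i cmp_zero_left[of X X "Y i" "idn C X"] XO YO idn_in by auto
  ultimately have "c = 1" by simp
  then have "iso_arr C (Y i) X (inc i)" using c p by (intro iso_arrI[of _ _ _ _ "prj i"]) auto
  then show ?thesis using isomorphicI i(1) by metis
qed

lemma fusion_brick_simple:
  fixes C :: "('o, 'a::ab_group_add, 'k::alg_closed_field) tensor_category"
  assumes fus: "fusion_category C" and X: "brick C X"
  shows "simple_ob C X"
proof -
  interpret linear_category C
    using fus by (simp add: fusion_category_def linear_monoidal_category_def)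
  have XO: "X \<in> Ob C" using X by (auto simp: brick_def)
  obtain n Y where ds: "direct_sum C {..<n::nat} Y X" and Y: "\<forall>i<n. simple_ob C (Y i)"
    using fus XO unfolding fusion_category_def semisimple_category_def by blast
  obtain i where "i < n" "isomorphic C (Y i) X" using brick_summand[OF X ds] by auto
  then show ?thesis using simple_ob_iso[of "Y i" X] Y XO by simp
qed

text \<open>Duality excludes zero divisors: if A is a left dual of Z, the unit is a retract of
  \<open>Z \<boxtimes> A\<close>, so B is a retract of
  \<open>Z \<boxtimes> (A \<boxtimes> B)\<close> and vanishes together with
  \<open>A \<boxtimes> B\<close>.\<close>

lemma fusion_semisimple_monoidal:
  fixes C :: "('o, 'a::ab_group_add, 'k::alg_closed_field) tensor_category"
  assumes fus: "fusion_category C"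
  shows "semisimple_monoidal_category C"
proof -
  interpret linear_monoidal_category C using fus by (simp add: fusion_category_def)
  have ab: "abelian_category C" using fus by (simp add: fusion_category_def semisimple_category_def)
  interpret semisimple_schur_category C
  proof
    fix X Y f assume "brick C X" "brick C Y" "f \<in> Hom C X Y" "f \<noteq> 0"
    then show "iso_arr C X Y f" by (intro abelian_schur[OF ab] fusion_brick_simple[OF fus])
  next
    fix X assume "X \<in> Ob C"
    then obtain n Y where ds: "direct_sum C {..<n::nat} Y X" and Y: "\<forall>i<n. simple_ob C (Y i)"
      using fus unfolding fusion_category_def semisimple_category_def by blast
    then have "decomp C X (image_mset (\<lambda>i. iso_class C (Y i)) (mset_set {..<n}))"
      by (intro decompI) (auto intro: fusion_simple_brick[OF fus])
    then show "\<exists>M. decomp C X M" by blast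
  qed
  show ?thesis
  proof
    show u: "brick C (unit_ob C)" using fus by (intro fusion_simple_brick) (auto simp: fusion_category_def)
    fix A B assume A: "A \<in> Ob C" and B: "B \<in> Ob C" and A0: "\<not> zero_ob C A" and B0: "\<not> zero_ob C B"
    show "\<not> zero_ob C (A \<boxtimes>\<^bsub>C\<^esub> B)"
    proof
      assume z: "zero_ob C (A \<boxtimes>\<^bsub>C\<^esub> B)"
      obtain Z where "left_dual C Z A" using fus A unfolding fusion_category_def rigid_def by blast
      then obtain ev coev where Z: "Z \<in> Ob C" and ev: "ev \<in> Hom C (A \<boxtimes>\<^bsub>C\<^esub> Z) (unit_ob C)"
        and co: "coev \<in> Hom C (unit_ob C) (Z \<boxtimes>\<^bsub>C\<^esub> A)"
        and zz: "lunit C A \<odot>\<^bsub>C\<^esub> (ev \<star>\<^bsub>C\<^esub> idn C A) \<odot>\<^bsub>C\<^esub>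
          inv_arr C (A \<boxtimes>\<^bsub>C\<^esub> Z \<boxtimes>\<^bsub>C\<^esub> A) (A \<boxtimes>\<^bsub>C\<^esub> (Z \<boxtimes>\<^bsub>C\<^esub> A)) (assoc C A Z A) \<odot>\<^bsub>C\<^esub>
          (idn C A \<star>\<^bsub>C\<^esub> coev) = runit C A"
        unfolding left_dual_def by blast
      have O: "Z \<boxtimes>\<^bsub>C\<^esub> A \<in> Ob C" "A \<boxtimes>\<^bsub>C\<^esub> Z \<boxtimes>\<^bsub>C\<^esub> A \<in> Ob C" "A \<boxtimes>\<^bsub>C\<^esub> (Z \<boxtimes>\<^bsub>C\<^esub> A) \<in> Ob C" "A \<boxtimes>\<^bsub>C\<^esub> B \<in> Ob C"
        "unit_ob C \<boxtimes>\<^bsub>C\<^esub> A \<in> Ob C" "A \<boxtimes>\<^bsub>C\<^esub> unit_ob C \<in> Ob C" "A \<boxtimes>\<^bsub>C\<^esub> Z \<in> Ob C" using A B Z tob_in unit_in by auto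
      \<comment> \<open>If the coevaluation were 0, the second zigzag identity would make the right
        unitor of A, an isomorphism, equal to 0.\<close>
      have "coev \<noteq> 0"
      proof
        assume c0: "coev = 0"
        let ?h = "lunit C A \<odot>\<^bsub>C\<^esub> (ev \<star>\<^bsub>C\<^esub> idn C A) \<odot>\<^bsub>C\<^esub>
          inv_arr C (A \<boxtimes>\<^bsub>C\<^esub> Z \<boxtimes>\<^bsub>C\<^esub> A) (A \<boxtimes>\<^bsub>C\<^esub> (Z \<boxtimes>\<^bsub>C\<^esub> A)) (assoc C A Z A)"
        have "lunit C A \<odot>\<^bsub>C\<^esub> (ev \<star>\<^bsub>C\<^esub> idn C A) \<in> Hom C (A \<boxtimes>\<^bsub>C\<^esub> Z \<boxtimes>\<^bsub>C\<^esub> A) A"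
          by (rule cmp_in[of _ "unit_ob C \<boxtimes>\<^bsub>C\<^esub> A"])
            (use O A Z unit_in ev idn_in iso_arr_Hom[OF lunit_iso] in \<open>auto intro: tar_in\<close>)
        then have "?h \<in> Hom C (A \<boxtimes>\<^bsub>C\<^esub> (Z \<boxtimes>\<^bsub>C\<^esub> A)) A"
          by (rule cmp_in[of _ "A \<boxtimes>\<^bsub>C\<^esub> Z \<boxtimes>\<^bsub>C\<^esub> A", rotated -1])
            (use O A Z inv_arr(1)[OF O(2,3) assoc_iso] in auto)
        then have "runit C A = 0"
          using zz c0 tar_zero_right[of A A "unit_ob C" "Z \<boxtimes>\<^bsub>C\<^esub> A" "idn C A"] O A unit_in idn_in
            cmp_zero_right[of "A \<boxtimes>\<^bsub>C\<^esub> unit_ob C" "A \<boxtimes>\<^bsub>C\<^esub> (Z \<boxtimes>\<^bsub>C\<^esub> A)" A ?h] by simp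
        moreover note r = inv_arr[OF O(6) A runit_iso[OF A]]
        ultimately have "idn C A = 0" using cmp_zero_left[of A "A \<boxtimes>\<^bsub>C\<^esub> unit_ob C" A] O A by metis
        then show False using A0 A by (simp add: zero_ob_def)
      qed
      \<comment> \<open>Semisimplicity enters here: a nonzero arrow from the unit, a brick, has a
        retraction.\<close>
      then obtain r where r: "r \<in> Hom C (Z \<boxtimes>\<^bsub>C\<^esub> A) (unit_ob C)" "r \<odot>\<^bsub>C\<^esub> coev = idn C (unit_ob C)"
        using split_mono[OF u O(1) co] by blast
      have "zero_ob C (Z \<boxtimes>\<^bsub>C\<^esub> (A \<boxtimes>\<^bsub>C\<^esub> B))" using zero_ob_tob(2)[OF z Z] .
      then have z3: "zero_ob C (Z \<boxtimes>\<^bsub>C\<^esub> A \<boxtimes>\<^bsub>C\<^esub> B)"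
        using zero_ob_iso isomorphic_sym[OF isomorphicI[OF assoc_iso[OF Z A B]]] tob_in O B by metis
      have O2: "unit_ob C \<boxtimes>\<^bsub>C\<^esub> B \<in> Ob C" "Z \<boxtimes>\<^bsub>C\<^esub> A \<boxtimes>\<^bsub>C\<^esub> B \<in> Ob C" using tob_in unit_in O B by auto
      have ri: "r \<star>\<^bsub>C\<^esub> idn C B \<in> Hom C (Z \<boxtimes>\<^bsub>C\<^esub> A \<boxtimes>\<^bsub>C\<^esub> B) (unit_ob C \<boxtimes>\<^bsub>C\<^esub> B)"
        and ci: "coev \<star>\<^bsub>C\<^esub> idn C B \<in> Hom C (unit_ob C \<boxtimes>\<^bsub>C\<^esub> B) (Z \<boxtimes>\<^bsub>C\<^esub> A \<boxtimes>\<^bsub>C\<^esub> B)"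
        using r co O B unit_in idn_in by (auto intro: tar_in)
      have r0: "r \<star>\<^bsub>C\<^esub> idn C B = 0" using Hom_zero_ob(1)[OF z3 O2(1)] ri by simp
      have "idn C (unit_ob C \<boxtimes>\<^bsub>C\<^esub> B) = (r \<odot>\<^bsub>C\<^esub> coev) \<star>\<^bsub>C\<^esub> (idn C B \<odot>\<^bsub>C\<^esub> idn C B)"
        using r tar_idn[of "unit_ob C" B] unit_in B idn_left[of B B "idn C B"] idn_in by simp
      also have "\<dots> = (r \<star>\<^bsub>C\<^esub> idn C B) \<odot>\<^bsub>C\<^esub> (coev \<star>\<^bsub>C\<^esub> idn C B)"
        using tar_cmp[of "unit_ob C" "Z \<boxtimes>\<^bsub>C\<^esub> A" "unit_ob C" B B B coev r "idn C B" "idn C B"] unit_in B O co r idn_in by simp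
      also have "\<dots> = 0" using r0 cmp_zero_left[OF O2(1) O2(2) O2(1) ci] by simp
      finally have "zero_ob C (unit_ob C \<boxtimes>\<^bsub>C\<^esub> B)" using O2 by (simp add: zero_ob_def)
      then show False using zero_ob_iso[OF _ B isomorphicI[OF lunit_iso[OF B]]] B0 by simp
    qed
  qed
qed

lemma fusion_simple_iff_brick:
  fixes C :: "('o, 'a::ab_group_add, 'k::alg_closed_field) tensor_category"
  assumes "fusion_category C"
  shows "simple_ob C X \<longleftrightarrow> brick C X"
  by (rule iffI) (rule fusion_simple_brick[OF assms] fusion_brick_simple[OF assms], assumption)+

section \<open>Solvable groups\<close>

lemma (in group) derived_commuting:
  assumes "N \<subseteq> carrier G" "\<one> \<in> N" "\<And>x y. x \<in> N \<Longrightarrow> y \<in> N \<Longrightarrow> x \<otimes> y = y \<otimes> x"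
  shows "derived G N = {\<one>}"
proof -
  have "x \<otimes> y \<otimes> inv x \<otimes> inv y = \<one>" if "x \<in> N" "y \<in> N" for x y
  proof -
    have "x \<in> carrier G" "y \<in> carrier G" using that assms(1) by auto
    then show ?thesis using assms(3)[OF that] by (metis inv_closed inv_solve_right' m_assoc m_closed r_inv)
  qed
  then have "derived_set G N = {\<one>}" using assms(2) by (auto intro!: exI[of _ \<one>] bexI[of _ \<one>])
  then show ?thesis by (simp add: derived_def generate_one)
qed

text \<open>When the derived series of H has become trivial, that of G lies in the kernel, and one
  more commutator step kills an abelian group.\<close>

lemma (in group_hom) solvable_abelian_kernel:
  assumes "solvable H" "\<And>x y. x \<in> kernel G H h \<Longrightarrow> y \<in> kernel G H h \<Longrightarrow> x \<otimes> y = y \<otimes> x"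
  shows "solvable G"
proof -
  obtain n where n: "(derived H ^^ n) (carrier H) = {\<one>\<^bsub>H\<^esub>}"
    using assms(1) H.solvable_iff_trivial_derived_seq by blast
  let ?N = "(derived G ^^ n) (carrier G)"
  have sub: "subgroup ?N G" using G.exp_of_derived_is_subgroup[OF G.subgroup_self] .
  have "h ` ?N = (derived H ^^ n) (h ` carrier G)" using exp_of_derived_img[of "carrier G" n] by simp
  also have "\<dots> \<subseteq> (derived H ^^ n) (carrier H)" by (rule H.mono_exp_of_derived) auto
  finally have "?N \<subseteq> kernel G H h" using n subgroup.subset[OF sub] by (auto simp: kernel_def)
  then have "derived G ?N = {\<one>}"
    using subgroup.subset[OF sub] subgroup.one_closed[OF sub] assms(2) by (intro G.derived_commuting) blast+
  then have "(derived G ^^ Suc n) (carrier G) = {\<one>}" by simp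
  then show ?thesis using G.solvable_iff_trivial_derived_seq by blast
qed

text \<open>One derived step leads into K, where the series dies out.\<close>

lemma (in group) solvable_derived_le:
  assumes K: "subgroup K G" and der: "derived G (carrier G) \<subseteq> K" and sol: "solvable (G\<lparr>carrier := K\<rparr>)"
  shows "solvable G"
proof -
  interpret K: group "G\<lparr>carrier := K\<rparr>" by (rule subgroup.subgroup_is_group[OF K group_axioms])
  interpret i: group_hom "G\<lparr>carrier := K\<rparr>" G "\<lambda>x. x"
    by unfold_locales (use subgroup.subset[OF K] in \<open>auto simp: hom_def\<close>)
  have "solvable_seq G ((\<lambda>x. x) ` K)"
    by (rule i.solvable_imp_solvable_img) (use sol in \<open>simp add: solvable_def\<close>)
  then obtain n where n: "(derived G ^^ n) K = {\<one>}" using solvable_imp_trivial_derived_seq by auto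
  have "(derived G ^^ n) (derived G (carrier G)) \<subseteq> {\<one>}"
    using mono_exp_of_derived[OF der, of n] n by simp
  moreover have "subgroup ((derived G ^^ n) (derived G (carrier G))) G"
    using exp_of_derived_is_subgroup derived_is_subgroup by blast
  ultimately have "(derived G ^^ n) (derived G (carrier G)) = {\<one>}"
    using subgroup.one_closed by blast
  then have "(derived G ^^ Suc n) (carrier G) = {\<one>}" by (simp add: funpow_swap1)
  then show ?thesis using solvable_iff_trivial_derived_seq by blast
qed

section \<open>Tensor functors\<close>

context linear_category
begin

context
  fixes D :: "('p, 'e::ab_group_add, 'k) tensor_category" and F
  assumes F: "is_tensor_functor C D F"
begin

interpretation F: is_tensor_functor C D F by (rule F)

lemma far_zero: "\<lbrakk>X \<in> Ob C; Y \<in> Ob C\<rbrakk> \<Longrightarrow> far F X Y 0 = 0"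
  using F.far_add[of X Y 0 0] zero_in[of X Y] by simp

lemma far_sum:
  assumes "X \<in> Ob C" "Y \<in> Ob C" "\<And>i. i \<in> I \<Longrightarrow> f i \<in> Hom C X Y"
  shows "far F X Y (\<Sum>i\<in>I. f i) = (\<Sum>i\<in>I. far F X Y (f i))"
  using assms(3)
proof (induction I rule: infinite_finite_induct)
  case (insert i I)
  then show ?case using assms(1,2) by (simp add: F.far_add sum_in)
qed (use assms(1,2) far_zero in auto)

lemma functor_iso_arr:
  assumes "X \<in> Ob C" "Y \<in> Ob C" "iso_arr C X Y f"
  shows "iso_arr D (fob F X) (fob F Y) (far F X Y f)"
proof -
  obtain g where g: "f \<in> Hom C X Y" "g \<in> Hom C Y X" "g \<odot> f = idn C X" "f \<odot> g = idn C Y"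
    using assms(3) by (rule iso_arrE)
  show ?thesis
    by (rule iso_arrI[of _ _ _ _ "far F Y X g"])
      (use g assms F.far_in F.far_idn F.far_cmp[of X Y X f g] F.far_cmp[of Y X Y g f] in auto)
qed

lemma functor_isomorphic:
  "\<lbrakk>X \<in> Ob C; Y \<in> Ob C; isomorphic C X Y\<rbrakk> \<Longrightarrow> isomorphic D (fob F X) (fob F Y)"
  using functor_iso_arr unfolding isomorphic_def by blast

lemma functor_direct_sum:
  assumes "direct_sum C I Y X"
  shows "direct_sum D I (\<lambda>i. fob F (Y i)) (fob F X)"
proof -
  obtain inc prj where "biproduct C I Y X inc prj"
    using assms unfolding direct_sum_biproduct by blast
  note d = biproductD[OF this]
  have "biproduct D I (\<lambda>i. fob F (Y i)) (fob F X) (\<lambda>i. far F (Y i) X (inc i)) (\<lambda>i. far F X (Y i) (prj i))"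
    unfolding biproduct_def
  proof (intro conjI ballI)
    fix i j assume i: "i \<in> I" "j \<in> I"
    have "far F X (Y j) (prj j) \<odot>\<^bsub>D\<^esub> far F (Y i) X (inc i) = far F (Y i) (Y j) (prj j \<odot> inc i)"
      using F.far_cmp[of "Y i" X "Y j" "inc i" "prj j"] d i by simp
    also have "\<dots> = (if i = j then idn D (fob F (Y i)) else 0)"
      using d i F.far_idn far_zero by auto
    finally show "far F X (Y j) (prj j) \<odot>\<^bsub>D\<^esub> far F (Y i) X (inc i) = (if i = j then idn D (fob F (Y i)) else 0)" .
  next
    have "(\<Sum>i\<in>I. far F (Y i) X (inc i) \<odot>\<^bsub>D\<^esub> far F X (Y i) (prj i)) = (\<Sum>i\<in>I. far F X X (inc i \<odot> prj i))"
    proof (rule sum.cong[OF refl])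
      fix i assume "i \<in> I"
      then show "far F (Y i) X (inc i) \<odot>\<^bsub>D\<^esub> far F X (Y i) (prj i) = far F X X (inc i \<odot> prj i)"
        using F.far_cmp[of X "Y i" X "prj i" "inc i"] d by simp
    qed
    also have "\<dots> = far F X X (\<Sum>i\<in>I. inc i \<odot> prj i)"
      by (rule far_sum[symmetric]) (use d in \<open>(blast intro: cmp_in)+\<close>)
    also have "\<dots> = idn D (fob F X)" using d F.far_idn by simp
    finally show "(\<Sum>i\<in>I. far F (Y i) X (inc i) \<odot>\<^bsub>D\<^esub> far F X (Y i) (prj i)) = idn D (fob F X)" .
  qed (use d F.far_in F.fob_in in auto)
  then show ?thesis unfolding direct_sum_biproduct by blast
qed

end

section \<open>Functors that are equivalences\<close>

context
  fixes D :: "('p, 'e::ab_group_add, 'k) tensor_category" and F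
  assumes F: "is_tensor_equivalence C D F"
begin

interpretation F: is_tensor_functor C D F using F by (simp add: is_tensor_equivalence_def)

lemma equivalence_functor: "is_tensor_functor C D F" by unfold_locales

lemma equivalence_Hom:
  assumes "X \<in> Ob C" "Y \<in> Ob C"
  shows "Hom D (fob F X) (fob F Y) = far F X Y ` Hom C X Y" "inj_on (far F X Y) (Hom C X Y)"
  using F assms by (auto simp: is_tensor_equivalence_def bij_betw_def)

lemma equivalence_reflects_iso:
  assumes "X \<in> Ob C" "Y \<in> Ob C" "isomorphic D (fob F X) (fob F Y)"
  shows "isomorphic C X Y"
proof -
  obtain f g where "f \<in> Hom D (fob F X) (fob F Y)" "g \<in> Hom D (fob F Y) (fob F X)" and
    fg: "g \<odot>\<^bsub>D\<^esub> f = idn D (fob F X)" "f \<odot>\<^bsub>D\<^esub> g = idn D (fob F Y)"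
    using assms(3) by (auto simp: isomorphic_def iso_arr_def)
  then obtain a b where a: "a \<in> Hom C X Y" "f = far F X Y a" and b: "b \<in> Hom C Y X" "g = far F Y X b"
    using equivalence_Hom(1) assms by auto
  have "far F X X (b \<odot> a) = far F X X (idn C X)" "far F Y Y (a \<odot> b) = far F Y Y (idn C Y)"
    using F.far_cmp[of X Y X a b] F.far_cmp[of Y X Y b a] F.far_idn a b fg assms by auto
  moreover have "b \<odot> a \<in> Hom C X X" "a \<odot> b \<in> Hom C Y Y"
    using cmp_in[of X Y X a b] cmp_in[of Y X Y b a] a b assms by auto
  ultimately have "b \<odot> a = idn C X" "a \<odot> b = idn C Y"
    using equivalence_Hom(2)[of X X] equivalence_Hom(2)[of Y Y] idn_in assms by (auto simp: inj_on_def)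
  then show ?thesis using a b by (auto simp: isomorphic_def iso_arr_def)
qed

text \<open>The target is constrained by the functor alone, so that an equivariantization can serve
  as target.\<close>

lemma equivalence_brick_iff:
  assumes X: "X \<in> Ob C"
  shows "brick D (fob F X) \<longleftrightarrow> brick C X"
proof -
  have Hom_D: "Hom D (fob F X) (fob F X) = far F X X ` Hom C X X" and inj: "inj_on (far F X X) (Hom C X X)"
    using equivalence_Hom X by auto
  have scl: "far F X X (scl C c (idn C X)) = scl D c (idn D (fob F X))" for c
    using F.far_scl[of X X "idn C X" c] F.far_idn X idn_in by simp
  have nz: "idn D (fob F X) = 0 \<longleftrightarrow> idn C X = 0"
    using F.far_idn[OF X] far_zero[OF equivalence_functor X X] inj idn_in[OF X] zero_in[OF X X]
    by (metis inj_on_eq_iff)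
  have "range (\<lambda>c. scl D c (idn D (fob F X))) = far F X X ` range (\<lambda>c. scl C c (idn C X))"
    unfolding image_image scl ..
  then have "Hom D (fob F X) (fob F X) = range (\<lambda>c. scl D c (idn D (fob F X))) \<longleftrightarrow> Hom C X X = range (\<lambda>c. scl C c (idn C X))"
    unfolding Hom_D using inj scl_in[OF X X idn_in[OF X]] by (simp add: inj_on_image_eq_iff image_subset_iff)
  then show ?thesis using nz X F.fob_in by (simp add: brick_def)
qed

end

end

section \<open>The group of invertible objects\<close>

abbreviation unit_group :: "('o, 'a::ab_group_add, 'k::field) tensor_category \<Rightarrow> 'o set monoid" where
  "unit_group C \<equiv> units_of (iso_monoid C)"

text \<open>A map of objects that respects tensor products up to isomorphism is what classes of
  objects can see of a tensor functor. Three instances follow: the equivalence on the trivial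
  component of a grading, whose objects form \<open>S\<close>, the forgetful functor of an
  equivariantization, and the action of a single group element.\<close>

locale tensor_map = C: linear_monoidal_category C + D: linear_monoidal_category D
  for C :: "('o, 'a::ab_group_add, 'k::field) tensor_category"
    and D :: "('p, 'b::ab_group_add, 'k) tensor_category" +
  fixes S :: "'o set" and \<Phi> :: "'o \<Rightarrow> 'p"
  assumes dom: "S \<subseteq> Ob C"
    and dom_iso: "\<lbrakk>X \<in> S; Y \<in> Ob C; isomorphic C X Y\<rbrakk> \<Longrightarrow> Y \<in> S"
    and dom_tob: "\<lbrakk>X \<in> S; Y \<in> S\<rbrakk> \<Longrightarrow> X \<boxtimes>\<^bsub>C\<^esub> Y \<in> S"
    and dom_unit: "unit_ob C \<in> S"
    and map_Ob: "X \<in> S \<Longrightarrow> \<Phi> X \<in> Ob D"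
    and map_iso: "\<lbrakk>X \<in> S; Y \<in> S; isomorphic C X Y\<rbrakk> \<Longrightarrow> isomorphic D (\<Phi> X) (\<Phi> Y)"
    and map_tob: "\<lbrakk>X \<in> S; Y \<in> S\<rbrakk> \<Longrightarrow> isomorphic D (\<Phi> X \<boxtimes>\<^bsub>D\<^esub> \<Phi> Y) (\<Phi> (X \<boxtimes>\<^bsub>C\<^esub> Y))"
    and map_unit: "isomorphic D (unit_ob D) (\<Phi> (unit_ob C))"
begin

definition class_map :: "'o set \<Rightarrow> 'p set" where
  "class_map x = iso_class D (\<Phi> (rep_ob x))"

lemma class_map_iso_class:
  assumes "X \<in> S"
  shows "class_map (iso_class C X) = iso_class D (\<Phi> X)"
proof -
  have X: "X \<in> Ob C" using assms dom by auto
  note r = C.rep_ob_iso_class[OF X]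
  have "rep_ob (iso_class C X) \<in> S" using dom_iso[OF assms r(1,2)] .
  then show ?thesis unfolding class_map_def
    using map_iso[OF _ assms r(3)] by (simp add: D.iso_class_eq map_Ob assms)
qed

lemma class_map_mult:
  assumes "X \<in> S" "Y \<in> S"
  shows "class_map (iso_class C X \<otimes>\<^bsub>iso_monoid C\<^esub> iso_class C Y) 
    = class_map (iso_class C X) \<otimes>\<^bsub>iso_monoid D\<^esub> class_map (iso_class C Y)"
proof -
  have "X \<in> Ob C" "Y \<in> Ob C" using assms dom by auto
  then show ?thesis using assms map_tob[OF assms] D.isomorphic_sym
    by (simp add: C.iso_monoid_mult class_map_iso_class dom_tob D.iso_monoid_mult map_Ob D.iso_class_eq D.tob_in)
qed

lemma class_map_one: "class_map (iso_class C (unit_ob C)) = \<one>\<^bsub>iso_monoid D\<^esub>"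
  using dom_unit map_unit D.isomorphic_sym
  by (simp add: class_map_iso_class D.iso_monoid_one D.iso_class_eq map_Ob D.unit_in)

lemma class_map_hom:
  assumes K: "subgroup K (unit_group C)" and KS: "K \<subseteq> iso_class C ` S"
  shows "group_hom ((unit_group C)\<lparr>carrier := K\<rparr>) (unit_group D) class_map"
proof -
  interpret MC: monoid "iso_monoid C" by (rule C.monoid_iso_monoid)
  interpret MD: monoid "iso_monoid D" by (rule D.monoid_iso_monoid)
  interpret UC: group "unit_group C" by (rule MC.units_group)
  interpret UD: group "unit_group D" by (rule MD.units_group)
  have mult: "class_map (x \<otimes>\<^bsub>iso_monoid C\<^esub> y) = class_map x \<otimes>\<^bsub>iso_monoid D\<^esub> class_map y" if xy: "x \<in> K" "y \<in> K" for x y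
  proof -
    obtain X Y where "X \<in> S" "x = iso_class C X" "Y \<in> S" "y = iso_class C Y" using xy KS by blast
    then show ?thesis using class_map_mult by simp
  qed
  have car: "class_map x \<in> carrier (iso_monoid D)" if "x \<in> K" for x
    using that KS class_map_iso_class map_Ob D.iso_monoid_carrier by auto
  \<comment> \<open>\<open>K\<close> is closed under inverses, so the inverse class is in the domain
    as well and its image inverts that of x.\<close>
  have "class_map x \<in> Units (iso_monoid D)" if x: "x \<in> K" for x
  proof -
    have i: "inv\<^bsub>unit_group C\<^esub> x \<in> K" using subgroup.m_inv_closed[OF K x] .
    have xc: "x \<in> carrier (unit_group C)" using subgroup.subset[OF K] x by auto
    have "inv\<^bsub>unit_group C\<^esub> x \<otimes>\<^bsub>unit_group C\<^esub> x = \<one>\<^bsub>unit_group C\<^esub>" "x \<otimes>\<^bsub>unit_group C\<^esub> inv\<^bsub>unit_group C\<^esub> x = \<one>\<^bsub>unit_group C\<^esub>"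
      using xc by (simp_all add: UC.l_inv UC.r_inv)
    then have "class_map (inv\<^bsub>unit_group C\<^esub> x) \<otimes>\<^bsub>iso_monoid D\<^esub> class_map x = \<one>\<^bsub>iso_monoid D\<^esub>"
      "class_map x \<otimes>\<^bsub>iso_monoid D\<^esub> class_map (inv\<^bsub>unit_group C\<^esub> x) = \<one>\<^bsub>iso_monoid D\<^esub>"
      using mult[OF i x] mult[OF x i] class_map_one by (simp_all add: units_of_mult units_of_one C.iso_monoid_one)
    then show ?thesis using car[OF x] car[OF i] by (auto simp: Units_def)
  qed
  then show ?thesis
    using subgroup.subgroup_is_group[OF K UC.group_axioms] UD.group_axioms mult
    by (auto simp: group_hom_def group_hom_axioms_def hom_def units_of_carrier units_of_mult)
qed

end

lemma (in linear_monoidal_category) unit_group_is_group: "group (unit_group C)"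
  using monoid.units_group[OF monoid_iso_monoid] .

lemma (in linear_monoidal_category) unit_group_classE:
  assumes "x \<in> carrier (unit_group C)"
  obtains X where "X \<in> Ob C" "x = iso_class C X"
  using assms by (auto simp: units_of_carrier Units_def elim!: iso_monoid_carrierE)

section \<open>Equivalent fusion categories have the same fusion rules\<close>

lemma Irr_bricks:
  fixes C :: "('o, 'a::ab_group_add, 'k::alg_closed_field) tensor_category"
  assumes "fusion_category C"
  shows "Irr C = iso_class C ` {X. brick C X}"
  by (simp add: Irr_def fusion_simple_iff_brick[OF assms])

lemma fusion_rep_brick:
  fixes C :: "('o, 'a::ab_group_add, 'k::alg_closed_field) tensor_category"
  assumes "fusion_category C" "x \<in> Irr C"
  shows "brick C (rep_ob x)" "iso_class C (rep_ob x) = x"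
proof -
  interpret semisimple_monoidal_category C by (rule fusion_semisimple_monoidal[OF assms(1)])
  obtain X where X: "brick C X" "x = iso_class C X" using assms by (auto simp: Irr_bricks)
  note r = rep_ob_iso_class[OF brick_Ob[OF X(1)]]
  show "brick C (rep_ob x)" using brick_iso[OF X(1) r(1,2)] X by simp
  show "iso_class C (rep_ob x) = x" using r X by simp
qed

text \<open>Fusion rules are multiplicities, and an equivalence carries a decomposition of a tensor
  product into bricks to such a decomposition of the image.\<close>

lemma tensor_equivalent_imp_grothendieck_equivalent:
  fixes C :: "('o, 'a::ab_group_add, 'k::alg_closed_field) tensor_category"
    and D :: "('p, 'b::ab_group_add, 'k) tensor_category"
  assumes fC: "fusion_category C" and fD: "fusion_category D" and eq: "tensor_equivalent C D"
  shows "grothendieck_equivalent C D"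
proof -
  interpret C: semisimple_monoidal_category C by (rule fusion_semisimple_monoidal[OF fC])
  interpret D: semisimple_monoidal_category D by (rule fusion_semisimple_monoidal[OF fD])
  obtain F where F: "is_tensor_equivalence C D F" using eq by (auto simp: tensor_equivalent_def)
  then interpret F: is_tensor_functor C D F by (simp add: is_tensor_equivalence_def)
  note F' = C.equivalence_functor[OF F]
  define f where "f x = iso_class D (fob F (rep_ob x))" for x
  have f_class: "f (iso_class C X) = iso_class D (fob F X)" if "X \<in> Ob C" for X
    unfolding f_def using C.rep_ob_iso_class[OF that] C.functor_isomorphic[OF F' _ that]
    by (simp add: D.iso_class_eq F.fob_in that)
  have inj: "inj_on f (Irr C)"
  proof (rule inj_onI)
    fix x y assume "x \<in> Irr C" "y \<in> Irr C" and e: "f x = f y"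
    then obtain X Y where X: "brick C X" "x = iso_class C X" and Y: "brick C Y" "y = iso_class C Y"
      by (auto simp: Irr_bricks[OF fC])
    have O: "X \<in> Ob C" "Y \<in> Ob C" using C.brick_Ob X Y by auto
    then have "isomorphic D (fob F X) (fob F Y)" using e X Y f_class by (simp add: D.iso_class_eq F.fob_in)
    then show "x = y" using C.equivalence_reflects_iso[OF F O] X Y O by (simp add: C.iso_class_eq)
  qed
  have img: "f ` Irr C = Irr D"
  proof
    show "f ` Irr C \<subseteq> Irr D"
      using C.equivalence_brick_iff[OF F] C.brick_Ob by (auto simp: Irr_bricks[OF fC] Irr_bricks[OF fD] f_class)
    show "Irr D \<subseteq> f ` Irr C"
    proof
      fix y assume "y \<in> Irr D"
      then obtain Y where Y: "brick D Y" "y = iso_class D Y" by (auto simp: Irr_bricks[OF fD])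
      then obtain X where X: "X \<in> Ob C" "isomorphic D (fob F X) Y"
        using F D.brick_Ob[OF Y(1)] unfolding is_tensor_equivalence_def by blast
      have "brick D (fob F X)" using D.brick_iso[OF Y(1) F.fob_in[OF X(1)] D.isomorphic_sym[OF X(2)]] .
      then have "brick C X" using C.equivalence_brick_iff[OF F X(1)] by simp
      moreover have "f (iso_class C X) = y" using X Y f_class by (simp add: D.iso_class_eq F.fob_in D.brick_Ob)
      ultimately show "y \<in> f ` Irr C" by (auto simp: Irr_bricks[OF fC])
    qed
  qed
  have unit: "f (iso_class C (unit_ob C)) = iso_class D (unit_ob D)"
    using f_class[OF C.unit_in] isomorphicI[OF F.funi_iso] D.isomorphic_sym
    by (simp add: D.iso_class_eq F.fob_in C.unit_in D.unit_in)
  have rule: "fusion_rule D (f x) (f y) (f z) = fusion_rule C x y z"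
    if x: "x \<in> Irr C" and y: "y \<in> Irr C" and z: "z \<in> Irr C" for x y z
  proof -
    note rb = fusion_rep_brick[OF fC]
    have fIrr: "f x \<in> Irr D" "f y \<in> Irr D" "f z \<in> Irr D" using img x y z by auto
    note rb' = fusion_rep_brick[OF fD]
    let ?XY = "rep_ob x \<boxtimes>\<^bsub>C\<^esub> rep_ob y"
    have O: "rep_ob x \<in> Ob C" "rep_ob y \<in> Ob C" "?XY \<in> Ob C" using rb x y C.brick_Ob C.tob_in by auto
    obtain R where R: "decomp C ?XY R" using C.decomposable O by blast
    obtain n Y where d: "direct_sum C {..<n} Y ?XY" "\<forall>i<n. brick C (Y i)"
      and Re: "R = image_mset (\<lambda>i. iso_class C (Y i)) (mset_set {..<n::nat})"
      using R unfolding decomp_def by blast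
    have RI: "set_mset R \<subseteq> Irr C" unfolding Re Irr_bricks[OF fC] using d(2) by auto
    have "decomp D (fob F ?XY) (image_mset (\<lambda>i. iso_class D (fob F (Y i))) (mset_set {..<n}))"
      by (rule D.decompI[OF C.functor_direct_sum[OF F' d(1)]])
        (use d C.equivalence_brick_iff[OF F] C.brick_Ob in auto)
    also have "image_mset (\<lambda>i. iso_class D (fob F (Y i))) (mset_set {..<n}) = image_mset f R"
      unfolding Re image_mset.compositionality using d(2) f_class C.brick_Ob by (auto intro!: image_mset_cong)
    finally have dD: "decomp D (fob F ?XY) (image_mset f R)" .
    have rO: "rep_ob (f x) \<in> Ob D" "rep_ob (f y) \<in> Ob D" using rb'(1) fIrr D.brick_Ob by auto
    have "isomorphic D (fob F (rep_ob x)) (rep_ob (f x))" "isomorphic D (fob F (rep_ob y)) (rep_ob (f y))"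
      using rb'(2) fIrr rO O by (simp_all add: D.iso_class_eq[symmetric] F.fob_in f_def)
    then have "isomorphic D (fob F (rep_ob x) \<boxtimes>\<^bsub>D\<^esub> fob F (rep_ob y)) (rep_ob (f x) \<boxtimes>\<^bsub>D\<^esub> rep_ob (f y))"
      by (intro D.isomorphic_tob rO F.fob_in O(1,2))
    then have "isomorphic D (fob F ?XY) (rep_ob (f x) \<boxtimes>\<^bsub>D\<^esub> rep_ob (f y))"
      by (rule D.isomorphic_trans[OF F.fob_in[OF O(3)] D.tob_in[OF F.fob_in[OF O(1)] F.fob_in[OF O(2)]] D.tob_in[OF rO]
            D.isomorphic_sym[OF isomorphicI[OF F.ften_iso[OF O(1,2)]]]])
    then have "decomp D (rep_ob (f x) \<boxtimes>\<^bsub>D\<^esub> rep_ob (f y)) (image_mset f R)"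
      by (rule D.decomp_iso[OF dD D.tob_in[OF rO]])
    from D.decomp_count[OF this rb'(1)[OF fIrr(3)]]
    have "fusion_rule D (f x) (f y) (f z) = count (image_mset f R) (f z)"
      unfolding fusion_rule_def using rb'(2)[OF fIrr(3)] by simp
    also have "\<dots> = count R z"
    proof -
      \<comment> \<open>Injectivity on classes of simple objects keeps \<open>image_mset\<close>
        from adding up the multiplicities of different classes.\<close>
      have "f -` {f z} \<inter> set_mset R \<subseteq> {z}" using inj RI z by (auto simp: inj_on_def)
      then have "count (image_mset f R) (f z) = (\<Sum>u\<in>f -` {f z} \<inter> set_mset R. count R u)" by (simp add: count_image_mset)
      also have "\<dots> = (\<Sum>u\<in>{z}. count R u)"
        by (rule sum.mono_neutral_left) (use \<open>f -` {f z} \<inter> set_mset R \<subseteq> {z}\<close> in \<open>auto simp: not_in_iff\<close>)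
      finally show ?thesis by simp
    qed
    also have "\<dots> = fusion_rule C x y z"
      unfolding fusion_rule_def using C.decomp_count[OF R rb(1)[OF z]] rb(2)[OF z] by simp
    finally show ?thesis .
  qed
  show ?thesis unfolding grothendieck_equivalent_def bij_betw_def using inj img unit rule by blast
qed

text \<open>Both equivalences point towards D, so the second one is inverted on
  \<open>Irr C\<close>; simplicity of the unit puts its class where the inverse is under control. In
  this way the last category of a solvable chain can take the place of the given one.\<close>

lemma grothendieck_equivalent_cancel:
  assumes "grothendieck_equivalent A D" "grothendieck_equivalent C D" and C: "simple_ob C (unit_ob C)"
  shows "grothendieck_equivalent A C"
proof -
  obtain f where f: "bij_betw f (Irr A) (Irr D)" "f (iso_class A (unit_ob A)) = iso_class D (unit_ob D)"
    "\<And>x y z. x \<in> Irr A \<Longrightarrow> y \<in> Irr A \<Longrightarrow> z \<in> Irr A \<Longrightarrow> fusion_rule D (f x) (f y) (f z) = fusion_rule A x y z"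
    using assms(1) unfolding grothendieck_equivalent_def by blast
  obtain g where g: "bij_betw g (Irr C) (Irr D)" "g (iso_class C (unit_ob C)) = iso_class D (unit_ob D)"
    "\<And>x y z. x \<in> Irr C \<Longrightarrow> y \<in> Irr C \<Longrightarrow> z \<in> Irr C \<Longrightarrow> fusion_rule D (g x) (g y) (g z) = fusion_rule C x y z"
    using assms(2) unfolding grothendieck_equivalent_def by blast
  define h where "h = inv_into (Irr C) g \<circ> f"
  have ginv: "bij_betw (inv_into (Irr C) g) (Irr D) (Irr C)" using g(1) by (rule bij_betw_inv_into)
  have h: "bij_betw h (Irr A) (Irr C)" unfolding h_def using f(1) ginv by (rule bij_betw_trans)
  have gh: "g (h x) = f x" "h x \<in> Irr C" if "x \<in> Irr A" for x
  proof -
    have "f x \<in> Irr D" using f(1) that by (auto simp: bij_betw_def)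
    then show "g (h x) = f x" using bij_betw_inv_into_right[OF g(1)] by (simp add: h_def)
    show "h x \<in> Irr C" using h that by (auto simp: bij_betw_def)
  qed
  have "iso_class C (unit_ob C) \<in> Irr C" using C by (auto simp: Irr_def)
  then have "h (iso_class A (unit_ob A)) = iso_class C (unit_ob C)"
    using f(2) g(2) bij_betw_inv_into_left[OF g(1)] by (metis comp_apply h_def)
  moreover have "fusion_rule C (h x) (h y) (h z) = fusion_rule A x y z"
    if "x \<in> Irr A" "y \<in> Irr A" "z \<in> Irr A" for x y z
    using that f(3) g(3)[of "h x" "h y" "h z"] gh by simp
  ultimately show ?thesis unfolding grothendieck_equivalent_def using h by blast
qed

section \<open>Equivariantizations\<close>

context linear_category
begin

lemma inv_arr_natural:
  assumes O: "A \<in> Ob C" "B \<in> Ob C" "A' \<in> Ob C" "B' \<in> Ob C"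
    and a: "iso_arr C A B a" and b: "iso_arr C A' B' b" and f: "f \<in> Hom C A A'" and h: "h \<in> Hom C B B'"
    and e: "b \<odot> f = h \<odot> a"
  shows "inv_arr C A' B' b \<odot> h = f \<odot> inv_arr C A B a"
proof -
  note ia = inv_arr[OF O(1,2) a] and ib = inv_arr[OF O(3,4) b]
  note aH = iso_arr_Hom[OF a] and bH = iso_arr_Hom[OF b]
  have "inv_arr C A' B' b \<odot> h = inv_arr C A' B' b \<odot> (h \<odot> (a \<odot> inv_arr C A B a))"
    using idn_right[OF O(2,4) h] ia by simp
  also have "\<dots> = inv_arr C A' B' b \<odot> (h \<odot> a \<odot> inv_arr C A B a)"
    using cmp_assoc[OF O(2,1,2,4) ia(1) aH h] by simp
  also have "\<dots> = inv_arr C A' B' b \<odot> (b \<odot> f \<odot> inv_arr C A B a)" using e by simp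
  also have "\<dots> = inv_arr C A' B' b \<odot> (b \<odot> (f \<odot> inv_arr C A B a))"
    using cmp_assoc[OF O(2,1,3,4) ia(1) f bH] by simp
  also have "\<dots> = f \<odot> inv_arr C A B a"
    using cmp_assoc[OF O(2,3,4,3) cmp_in[OF O(2,1,3) ia(1) f] bH ib(1)] ib
      idn_left[OF O(2,3) cmp_in[OF O(2,1,3) ia(1) f]] by simp
  finally show ?thesis .
qed

end

locale equivariant_action = G: group G + linear_monoidal_category D + tensor_action G D \<rho> \<gamma> \<upsilon>
  for G :: "('g, 'm) monoid_scheme" and D :: "('o, 'a::ab_group_add, 'k::field) tensor_category" (structure)
    and \<rho> \<gamma> \<upsilon>
begin

abbreviation E :: "('o \<times> ('g \<Rightarrow> 'a), 'a, 'k) tensor_category"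
  where "E \<equiv> equivariantization G D \<rho> \<gamma> \<upsilon>"

lemma action_functor: "g \<in> carrier G \<Longrightarrow> is_tensor_functor D D (\<rho> g)"
  using autoequivalence by (simp add: is_tensor_equivalence_def)

lemmas act_Ob = is_tensor_functor.fob_in[OF action_functor]
  and act_Hom = is_tensor_functor.far_in[OF action_functor]
  and act_idn = is_tensor_functor.far_idn[OF action_functor]
  and act_cmp = is_tensor_functor.far_cmp[OF action_functor]
  and act_add = is_tensor_functor.far_add[OF action_functor]
  and act_scl = is_tensor_functor.far_scl[OF action_functor]
  and act_ten = is_tensor_functor.ften_iso[OF action_functor]
  and act_ten_natural = is_tensor_functor.ften_natural[OF action_functor]

text \<open>Sources and targets of the structure maps are what composing and inverting equivariant
  arrows requires. Unlike membership in \<open>Ob E\<close>, this passes to tensor products and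
  twists without computing with the coherence maps of the action.\<close>

definition structure_map :: "'o \<Rightarrow> ('g \<Rightarrow> 'a) \<Rightarrow> bool" where
  "structure_map X \<mu> \<longleftrightarrow> X \<in> Ob D \<and> (\<forall>g\<in>carrier G. \<mu> g \<in> Hom D (fob (\<rho> g) X) X)"

lemma Ob_E: "(X, \<mu>) \<in> Ob E \<longleftrightarrow> X \<in> Ob D \<and> \<mu> \<in> extensional (carrier G) \<and>
     (\<forall>g \<in> carrier G. iso_arr D (fob (\<rho> g) X) X (\<mu> g)) \<and>
     (\<forall>g \<in> carrier G. \<forall>h \<in> carrier G.
        \<mu> g \<odot> far (\<rho> g) (fob (\<rho> h) X) X (\<mu> h) = \<mu> (g \<otimes>\<^bsub>G\<^esub> h) \<odot> \<gamma> g h X) \<and>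
     \<mu> \<one>\<^bsub>G\<^esub> \<odot> \<upsilon> X = idn D X"
  by (simp add: equivariantization_def equivariant_obs_def)

lemma Ob_E_structure_map: "(X, \<mu>) \<in> Ob E \<Longrightarrow> structure_map X \<mu>"
  by (simp add: Ob_E structure_map_def iso_arr_Hom)

lemma Hom_E: "Hom E (X, \<mu>) (Y, \<nu>) = {f \<in> Hom D X Y. \<forall>g \<in> carrier G. f \<odot> \<mu> g = \<nu> g \<odot> far (\<rho> g) X Y f}"
  by (simp add: equivariantization_def)

lemma cmp_E: "cmp E = cmp D" and idn_E: "idn E (X, \<mu>) = idn D X" and scl_E: "scl E = scl D"
  and tob_E: "(X, \<mu>) \<boxtimes>\<^bsub>E\<^esub> (Y, \<nu>) = (X \<boxtimes> Y, \<lambda>g\<in>carrier G. (\<mu> g \<star> \<nu> g) \<odot>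
        inv_arr D (fob (\<rho> g) X \<boxtimes> fob (\<rho> g) Y) (fob (\<rho> g) (X \<boxtimes> Y)) (ften (\<rho> g) X Y))"
  and fst_tob_E: "fst (A \<boxtimes>\<^bsub>E\<^esub> B) = fst A \<boxtimes> fst B"
  and fst_unit_E: "fst (unit_ob E) = unit_ob D"
  by (simp_all add: equivariantization_def split_beta)

lemma iso_arr_E_D: "iso_arr E (X, \<mu>) (Y, \<nu>) f \<Longrightarrow> iso_arr D X Y f"
  by (auto simp: iso_arr_def Hom_E cmp_E idn_E)

lemma isomorphic_E_D: "isomorphic E A B \<Longrightarrow> isomorphic D (fst A) (fst B)"
  by (cases A; cases B) (auto simp: isomorphic_def dest: iso_arr_E_D)

lemma direct_sum_E_D:
  assumes "direct_sum E I Y X"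
  shows "direct_sum D I (\<lambda>i. fst (Y i)) (fst X)"
proof -
  obtain inc prj where "biproduct E I Y X inc prj"
    using assms unfolding direct_sum_biproduct by blast
  note d = biproductD[OF this]
  have Ob: "fst A \<in> Ob D" if "A \<in> Ob E" for A using that by (cases A) (simp add: Ob_E)
  have Hom: "f \<in> Hom D (fst A) (fst B)" if "f \<in> Hom E A B" for f A B using that by (cases A; cases B) (simp add: Hom_E)
  have idn: "idn E A = idn D (fst A)" for A by (cases A) (simp add: idn_E)
  have "biproduct D I (\<lambda>i. fst (Y i)) (fst X) inc prj"
    unfolding biproduct_def using d Ob Hom by (auto simp: idn cmp_E)
  then show ?thesis unfolding direct_sum_biproduct by blast
qed

text \<open>The inverse of an equivariant isomorphism is equivariant by naturality of inverses, so
  isomorphisms of equivariant objects can be looked for in D.\<close>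

lemma iso_arr_E_I:
  assumes X: "structure_map X \<mu>" and Y: "structure_map Y \<nu>"
    and f: "f \<in> Hom E (X, \<mu>) (Y, \<nu>)" and iso: "iso_arr D X Y f"
  shows "iso_arr E (X, \<mu>) (Y, \<nu>) f"
proof -
  have O: "X \<in> Ob D" "Y \<in> Ob D" using X Y by (auto simp: structure_map_def)
  note i = inv_arr[OF O iso]
  have "inv_arr D X Y f \<odot> \<nu> g = \<mu> g \<odot> far (\<rho> g) Y X (inv_arr D X Y f)" if g: "g \<in> carrier G" for g
  proof -
    have O': "fob (\<rho> g) X \<in> Ob D" "fob (\<rho> g) Y \<in> Ob D" using act_Ob g O by auto
    have iso': "iso_arr D (fob (\<rho> g) X) (fob (\<rho> g) Y) (far (\<rho> g) X Y f)"
      by (rule functor_iso_arr[OF action_functor[OF g] O iso])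
    have "inv_arr D (fob (\<rho> g) X) (fob (\<rho> g) Y) (far (\<rho> g) X Y f) = far (\<rho> g) Y X (inv_arr D X Y f)"
    proof (rule inv_arr_eq)
      show "far (\<rho> g) Y X (inv_arr D X Y f) \<odot> far (\<rho> g) X Y f = idn D (fob (\<rho> g) X)"
        using act_cmp[OF g O(1,2,1), of f "inv_arr D X Y f"] i iso_arr_Hom[OF iso] act_idn g O by simp
      show "far (\<rho> g) X Y f \<odot> far (\<rho> g) Y X (inv_arr D X Y f) = idn D (fob (\<rho> g) Y)"
        using act_cmp[OF g O(2,1,2), of "inv_arr D X Y f" f] i iso_arr_Hom[OF iso] act_idn g O by simp
    qed (use O O' act_Hom g i iso_arr_Hom[OF iso] in auto)
    moreover have "inv_arr D X Y f \<odot> \<nu> g = \<mu> g \<odot> inv_arr D (fob (\<rho> g) X) (fob (\<rho> g) Y) (far (\<rho> g) X Y f)"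
      by (rule inv_arr_natural[OF O' O iso' iso]) (use X Y f g in \<open>auto simp: structure_map_def Hom_E\<close>)
    ultimately show ?thesis by simp
  qed
  then have "inv_arr D X Y f \<in> Hom E (Y, \<nu>) (X, \<mu>)" using i by (simp add: Hom_E)
  then show ?thesis using f i by (intro iso_arrI[of _ _ _ _ "inv_arr D X Y f"]) (simp_all add: cmp_E idn_E)
qed

lemma cmp_in_E:
  assumes X: "structure_map X \<mu>" and Y: "structure_map Y \<nu>" and Z: "structure_map Z \<xi>"
    and f: "f \<in> Hom E (X, \<mu>) (Y, \<nu>)" and h: "h \<in> Hom E (Y, \<nu>) (Z, \<xi>)"
  shows "h \<odot> f \<in> Hom E (X, \<mu>) (Z, \<xi>)"
proof -
  have O: "X \<in> Ob D" "Y \<in> Ob D" "Z \<in> Ob D" using X Y Z by (auto simp: structure_map_def)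
  have fh: "f \<in> Hom D X Y" "h \<in> Hom D Y Z" using f h by (auto simp: Hom_E)
  have "h \<odot> f \<odot> \<mu> g = \<xi> g \<odot> far (\<rho> g) X Z (h \<odot> f)" if g: "g \<in> carrier G" for g
  proof -
    have O': "fob (\<rho> g) X \<in> Ob D" "fob (\<rho> g) Y \<in> Ob D" "fob (\<rho> g) Z \<in> Ob D" using act_Ob g O by auto
    have m: "\<mu> g \<in> Hom D (fob (\<rho> g) X) X" "\<nu> g \<in> Hom D (fob (\<rho> g) Y) Y" "\<xi> g \<in> Hom D (fob (\<rho> g) Z) Z"
      using X Y Z g by (auto simp: structure_map_def)
    have r: "far (\<rho> g) X Y f \<in> Hom D (fob (\<rho> g) X) (fob (\<rho> g) Y)" "far (\<rho> g) Y Z h \<in> Hom D (fob (\<rho> g) Y) (fob (\<rho> g) Z)"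
      using act_Hom[OF g] O fh by auto
    have "h \<odot> f \<odot> \<mu> g = h \<odot> (f \<odot> \<mu> g)" using cmp_assoc[OF O'(1) O m(1) fh] by simp
    also have "\<dots> = h \<odot> (\<nu> g \<odot> far (\<rho> g) X Y f)" using f g by (simp add: Hom_E)
    also have "\<dots> = h \<odot> \<nu> g \<odot> far (\<rho> g) X Y f" using cmp_assoc[OF O'(1,2) O(2,3) r(1) m(2) fh(2)] by simp
    also have "\<dots> = \<xi> g \<odot> far (\<rho> g) Y Z h \<odot> far (\<rho> g) X Y f" using h g by (simp add: Hom_E)
    also have "\<dots> = \<xi> g \<odot> (far (\<rho> g) Y Z h \<odot> far (\<rho> g) X Y f)" using cmp_assoc[OF O'(1,2,3) O(3) r m(3)] by simp
    also have "\<dots> = \<xi> g \<odot> far (\<rho> g) X Z (h \<odot> f)" using act_cmp[OF g O fh] by simp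
    finally show ?thesis .
  qed
  then show ?thesis using cmp_in[OF O fh] by (simp add: Hom_E)
qed

lemma isomorphic_E_iff:
  assumes "structure_map X \<mu>" "structure_map Y \<nu>"
  shows "isomorphic E (X, \<mu>) (Y, \<nu>) \<longleftrightarrow> (\<exists>f. f \<in> Hom E (X, \<mu>) (Y, \<nu>) \<and> iso_arr D X Y f)"
  unfolding isomorphic_def using iso_arr_E_I[OF assms] iso_arr_E_D iso_arr_Hom by metis

lemma isomorphic_E_trans:
  assumes X: "structure_map X \<mu>" and Y: "structure_map Y \<nu>" and Z: "structure_map Z \<xi>"
    and f: "isomorphic E (X, \<mu>) (Y, \<nu>)" and h: "isomorphic E (Y, \<nu>) (Z, \<xi>)"
  shows "isomorphic E (X, \<mu>) (Z, \<xi>)"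
proof -
  have O: "X \<in> Ob D" "Y \<in> Ob D" "Z \<in> Ob D" using X Y Z by (auto simp: structure_map_def)
  obtain a where a: "a \<in> Hom E (X, \<mu>) (Y, \<nu>)" "iso_arr D X Y a" using f isomorphic_E_iff[OF X Y] by blast
  obtain b where b: "b \<in> Hom E (Y, \<nu>) (Z, \<xi>)" "iso_arr D Y Z b" using h isomorphic_E_iff[OF Y Z] by blast
  show ?thesis unfolding isomorphic_E_iff[OF X Z]
    using cmp_in_E[OF X Y Z a(1) b(1)] iso_arr_cmp[OF O a(2) b(2)] by blast
qed

lemma isomorphic_E_sym: "isomorphic E A B \<Longrightarrow> isomorphic E B A"
  by (auto simp: isomorphic_def iso_arr_def)

abbreviation inv_ten :: "'g \<Rightarrow> 'o \<Rightarrow> 'o \<Rightarrow> 'a" where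
  "inv_ten g X Y \<equiv> inv_arr D (fob (\<rho> g) X \<boxtimes> fob (\<rho> g) Y) (fob (\<rho> g) (X \<boxtimes> Y)) (ften (\<rho> g) X Y)"

lemma inv_ten_in:
  assumes "g \<in> carrier G" "X \<in> Ob D" "Y \<in> Ob D"
  shows "inv_ten g X Y \<in> Hom D (fob (\<rho> g) (X \<boxtimes> Y)) (fob (\<rho> g) X \<boxtimes> fob (\<rho> g) Y)"
  using inv_arr(1)[OF _ _ act_ten] assms act_Ob tob_in by simp

lemma inv_ten_natural:
  assumes g: "g \<in> carrier G" and O: "X \<in> Ob D" "X' \<in> Ob D" "Y \<in> Ob D" "Y' \<in> Ob D"
    and f: "f \<in> Hom D X X'" and h: "h \<in> Hom D Y Y'"
  shows "inv_ten g X' Y' \<odot> far (\<rho> g) (X \<boxtimes> Y) (X' \<boxtimes> Y') (f \<star> h)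
    = (far (\<rho> g) X X' f \<star> far (\<rho> g) Y Y' h) \<odot> inv_ten g X Y"
  by (rule inv_arr_natural)
    (use g O f h act_Ob act_Hom tob_in tar_in act_ten act_ten_natural in auto)

text \<open>Hypothesis \<open>e\<close> compares tensor products instead of the two factors because
  \<open>f\<close> and \<open>h\<close> may each fail to be equivariant by a scalar while the
  scalars cancel. This happens in \<open>tob_E_commute\<close>.\<close>

lemma tar_tob_structure:
  assumes g: "g \<in> carrier G" and O: "X \<in> Ob D" "X' \<in> Ob D" "Y \<in> Ob D" "Y' \<in> Ob D"
    and f: "f \<in> Hom D X X'" and h: "h \<in> Hom D Y Y'"
    and m: "\<mu> \<in> Hom D (fob (\<rho> g) X) X" "\<nu> \<in> Hom D (fob (\<rho> g) Y) Y"
      "\<mu>' \<in> Hom D (fob (\<rho> g) X') X'" "\<nu>' \<in> Hom D (fob (\<rho> g) Y') Y'"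
    and e: "(f \<odot> \<mu>) \<star> (h \<odot> \<nu>) = (\<mu>' \<odot> far (\<rho> g) X X' f) \<star> (\<nu>' \<odot> far (\<rho> g) Y Y' h)"
  shows "(f \<star> h) \<odot> ((\<mu> \<star> \<nu>) \<odot> inv_ten g X Y) 
    = (\<mu>' \<star> \<nu>') \<odot> inv_ten g X' Y' \<odot> far (\<rho> g) (X \<boxtimes> Y) (X' \<boxtimes> Y') (f \<star> h)"
proof -
  let ?R = "\<lambda>X. fob (\<rho> g) X"
  let ?f = "far (\<rho> g) X X' f" and ?h = "far (\<rho> g) Y Y' h"
  have O': "?R X \<in> Ob D" "?R X' \<in> Ob D" "?R Y \<in> Ob D" "?R Y' \<in> Ob D" using act_Ob[OF g] O by auto
  have T: "X \<boxtimes> Y \<in> Ob D" "X' \<boxtimes> Y' \<in> Ob D" "?R (X \<boxtimes> Y) \<in> Ob D" "?R (X' \<boxtimes> Y') \<in> Ob D" 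
    "?R X \<boxtimes> ?R Y \<in> Ob D" "?R X' \<boxtimes> ?R Y' \<in> Ob D" using act_Ob[OF g] tob_in O O' by auto
  have r: "?f \<in> Hom D (?R X) (?R X')" "?h \<in> Hom D (?R Y) (?R Y')" using act_Hom[OF g] O f h by auto
  have t: "f \<star> h \<in> Hom D (X \<boxtimes> Y) (X' \<boxtimes> Y')" "\<mu> \<star> \<nu> \<in> Hom D (?R X \<boxtimes> ?R Y) (X \<boxtimes> Y)"
    "\<mu>' \<star> \<nu>' \<in> Hom D (?R X' \<boxtimes> ?R Y') (X' \<boxtimes> Y')" "?f \<star> ?h \<in> Hom D (?R X \<boxtimes> ?R Y) (?R X' \<boxtimes> ?R Y')"
    using tar_in O O' f h m r by auto
  note i = inv_ten_in[OF g O(1,3)] inv_ten_in[OF g O(2,4)]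
  have "(f \<star> h) \<odot> ((\<mu> \<star> \<nu>) \<odot> inv_ten g X Y) = (f \<star> h) \<odot> (\<mu> \<star> \<nu>) \<odot> inv_ten g X Y"
    by (rule cmp_assoc[OF T(3,5,1,2) i(1) t(2,1)])
  also have "(f \<star> h) \<odot> (\<mu> \<star> \<nu>) = (f \<odot> \<mu>) \<star> (h \<odot> \<nu>)"
    using tar_cmp[OF O'(1) O(1,2) O'(3) O(3,4) m(1) f m(2) h] by simp
  also have "\<dots> = (\<mu>' \<odot> ?f) \<star> (\<nu>' \<odot> ?h)" by (rule e)
  also have "\<dots> = (\<mu>' \<star> \<nu>') \<odot> (?f \<star> ?h)"
    by (rule tar_cmp[OF O'(1,2) O(2) O'(3,4) O(4) r(1) m(3) r(2) m(4)])
  also have "\<dots> \<odot> inv_ten g X Y = (\<mu>' \<star> \<nu>') \<odot> ((?f \<star> ?h) \<odot> inv_ten g X Y)"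
    by (rule cmp_assoc[OF T(3,5,6,2) i(1) t(4,3), symmetric])
  also have "(?f \<star> ?h) \<odot> inv_ten g X Y = inv_ten g X' Y' \<odot> far (\<rho> g) (X \<boxtimes> Y) (X' \<boxtimes> Y') (f \<star> h)"
    by (rule inv_ten_natural[OF g O f h, symmetric])
  also have "(\<mu>' \<star> \<nu>') \<odot> \<dots> = (\<mu>' \<star> \<nu>') \<odot> inv_ten g X' Y' \<odot> far (\<rho> g) (X \<boxtimes> Y) (X' \<boxtimes> Y') (f \<star> h)"
    by (rule cmp_assoc[OF T(3,4,6,2) act_Hom[OF g T(1,2) t(1)] i(2) t(3)])
  finally show ?thesis .
qed

lemma structure_map_tob:
  assumes X: "structure_map X \<mu>" and Y: "structure_map Y \<nu>"
  shows "structure_map (X \<boxtimes> Y) (\<lambda>g\<in>carrier G. (\<mu> g \<star> \<nu> g) \<odot> inv_ten g X Y)"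
proof -
  have O: "X \<in> Ob D" "Y \<in> Ob D" using X Y by (auto simp: structure_map_def)
  have "(\<mu> g \<star> \<nu> g) \<odot> inv_ten g X Y \<in> Hom D (fob (\<rho> g) (X \<boxtimes> Y)) (X \<boxtimes> Y)" if g: "g \<in> carrier G" for g
    by (rule cmp_in[of _ "fob (\<rho> g) X \<boxtimes> fob (\<rho> g) Y"])
      (use X Y g O act_Ob tob_in tar_in inv_ten_in in \<open>auto simp: structure_map_def\<close>)
  then show ?thesis using O tob_in by (simp add: structure_map_def)
qed

lemma isomorphic_E_tob:
  assumes X: "structure_map X \<mu>" and Y: "structure_map Y \<nu>" and X': "structure_map X' \<mu>'" and Y': "structure_map Y' \<nu>'"
    and f: "isomorphic E (X, \<mu>) (X', \<mu>')" and h: "isomorphic E (Y, \<nu>) (Y', \<nu>')"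
  shows "isomorphic E ((X, \<mu>) \<boxtimes>\<^bsub>E\<^esub> (Y, \<nu>)) ((X', \<mu>') \<boxtimes>\<^bsub>E\<^esub> (Y', \<nu>'))"
proof -
  have O: "X \<in> Ob D" "X' \<in> Ob D" "Y \<in> Ob D" "Y' \<in> Ob D" using X Y X' Y' by (auto simp: structure_map_def)
  obtain a where a: "a \<in> Hom E (X, \<mu>) (X', \<mu>')" "iso_arr D X X' a" using f isomorphic_E_iff[OF X X'] by blast
  obtain b where b: "b \<in> Hom E (Y, \<nu>) (Y', \<nu>')" "iso_arr D Y Y' b" using h isomorphic_E_iff[OF Y Y'] by blast
  have "iso_arr D (X \<boxtimes> Y) (X' \<boxtimes> Y') (a \<star> b)" by (rule iso_arr_tar(1)[OF O a(2) b(2)])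
  moreover have "(a \<star> b) \<odot> ((\<mu> g \<star> \<nu> g) \<odot> inv_ten g X Y) 
    = (\<mu>' g \<star> \<nu>' g) \<odot> inv_ten g X' Y' \<odot> far (\<rho> g) (X \<boxtimes> Y) (X' \<boxtimes> Y') (a \<star> b)" if g: "g \<in> carrier G" for g
    by (rule tar_tob_structure[OF g O]) (use X Y X' Y' a b g in \<open>auto simp: structure_map_def Hom_E\<close>)
  ultimately show ?thesis
    unfolding tob_E isomorphic_E_iff[OF structure_map_tob[OF X Y] structure_map_tob[OF X' Y']]
    by (intro exI[of _ "a \<star> b"]) (simp add: Hom_E iso_arr_Hom)
qed

text \<open>Transported along the isomorphism \<open>a\<close>, the structure of X differs from that
  of the brick Y by a scalar c for each g. For the inverse \<open>b\<close> of \<open>a\<close> the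
  discrepancy is the reciprocal one, so \<open>a \<star> b\<close> is equivariant although
  \<open>a\<close> and \<open>b\<close> need not be. This makes the kernel of the forgetful map on
  invertible objects commutative.\<close>

lemma tob_E_commute:
  assumes X: "(X, \<mu>) \<in> Ob E" and Y: "(Y, \<nu>) \<in> Ob E" and br: "brick D Y" and iso: "isomorphic D X Y"
  shows "isomorphic E ((X, \<mu>) \<boxtimes>\<^bsub>E\<^esub> (Y, \<nu>)) ((Y, \<nu>) \<boxtimes>\<^bsub>E\<^esub> (X, \<mu>))"
proof -
  note X' = Ob_E_structure_map[OF X] and Y' = Ob_E_structure_map[OF Y]
  have O: "X \<in> Ob D" "Y \<in> Ob D" using X' Y' by (auto simp: structure_map_def)
  obtain a where a: "iso_arr D X Y a" using iso by (auto simp: isomorphic_def)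
  define b where "b = inv_arr D X Y a"
  note ib = inv_arr[OF O a, folded b_def] and aH = iso_arr_Hom[OF a]
  have "(a \<star> b) \<odot> ((\<mu> g \<star> \<nu> g) \<odot> inv_ten g X Y) 
    = (\<nu> g \<star> \<mu> g) \<odot> inv_ten g Y X \<odot> far (\<rho> g) (X \<boxtimes> Y) (Y \<boxtimes> X) (a \<star> b)" if g: "g \<in> carrier G" for g
  proof (rule tar_tob_structure[OF g O O(2,1) aH ib(1)])
    show m: "\<mu> g \<in> Hom D (fob (\<rho> g) X) X" "\<nu> g \<in> Hom D (fob (\<rho> g) Y) Y"
      "\<nu> g \<in> Hom D (fob (\<rho> g) Y) Y" "\<mu> g \<in> Hom D (fob (\<rho> g) X) X"
      using X' Y' g by (auto simp: structure_map_def)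
    let ?X = "fob (\<rho> g) X" and ?Y = "fob (\<rho> g) Y"
    let ?a = "far (\<rho> g) X Y a" and ?b = "far (\<rho> g) Y X b"
    have O': "?X \<in> Ob D" "?Y \<in> Ob D" using act_Ob[OF g] O by auto
    have r: "?a \<in> Hom D ?X ?Y" "?b \<in> Hom D ?Y ?X" using act_Hom[OF g] O aH ib by auto
    have ab: "?a \<odot> ?b = idn D ?Y" using act_cmp[OF g O(2,1,2) ib(1) aH] ib act_idn[OF g O(2)] by simp
    have isoY: "iso_arr D ?Y Y (\<nu> g)" and isoX: "iso_arr D ?X X (\<mu> g)" using X Y g by (auto simp: Ob_E)
    have iso1: "iso_arr D ?X Y (\<nu> g \<odot> ?a)"
      by (rule iso_arr_cmp[OF O' O(2) functor_iso_arr[OF action_functor[OF g] O a] isoY])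
    note i1 = inv_arr[OF O'(1) O(2) iso1]
    have am: "a \<odot> \<mu> g \<in> Hom D ?X Y" by (rule cmp_in[OF O'(1) O m(1) aH])
    have na: "\<nu> g \<odot> ?a \<in> Hom D ?X Y" by (rule cmp_in[OF O' O(2) r(1) m(2)])
    \<comment> \<open>The failure of \<open>a\<close> to be equivariant, read as an endomorphism of
      the brick Y.\<close>
    obtain c where c: "a \<odot> \<mu> g \<odot> inv_arr D ?X Y (\<nu> g \<odot> ?a) = scl D c (idn D Y)"
      using br cmp_in[OF O(2) O'(1) O(2) i1(1) am] by (auto simp: brick_def)
    have c1: "a \<odot> \<mu> g = scl D c (\<nu> g \<odot> ?a)"
    proof -
      have "a \<odot> \<mu> g = a \<odot> \<mu> g \<odot> (inv_arr D ?X Y (\<nu> g \<odot> ?a) \<odot> (\<nu> g \<odot> ?a))"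
        using i1 idn_right[OF O'(1) O(2) am] by simp
      also have "\<dots> = scl D c (idn D Y) \<odot> (\<nu> g \<odot> ?a)"
        using cmp_assoc[OF O'(1) O(2) O'(1) O(2) na i1(1) am] c by simp
      also have "\<dots> = scl D c (\<nu> g \<odot> ?a)"
        using cmp_scl_left[OF O'(1) O(2,2) na idn_in[OF O(2)]] idn_left[OF O'(1) O(2) na] by simp
      finally show ?thesis .
    qed
    have c2: "\<mu> g \<odot> ?b = scl D c (b \<odot> \<nu> g)"
    proof -
      have mb: "\<mu> g \<odot> ?b \<in> Hom D ?Y X" by (rule cmp_in[OF O'(2,1) O(1) r(2) m(1)])
      have "\<mu> g \<odot> ?b = b \<odot> (a \<odot> (\<mu> g \<odot> ?b))"
        using cmp_assoc[OF O'(2) O(1,2,1) mb aH ib(1)] ib idn_left[OF O'(2) O(1) mb] by simp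
      also have "a \<odot> (\<mu> g \<odot> ?b) = a \<odot> \<mu> g \<odot> ?b" by (rule cmp_assoc[OF O'(2,1) O r(2) m(1) aH])
      also have "\<dots> = scl D c (\<nu> g \<odot> ?a \<odot> ?b)" unfolding c1 by (rule cmp_scl_left[OF O'(2,1) O(2) r(2) na])
      also have "\<nu> g \<odot> ?a \<odot> ?b = \<nu> g"
        using cmp_assoc[OF O'(2,1,2) O(2) r(2,1) m(2)] ab idn_right[OF O'(2) O(2) m(2)] by simp
      also have "b \<odot> scl D c (\<nu> g) = scl D c (b \<odot> \<nu> g)" by (rule cmp_scl_right[OF O'(2) O(2,1) m(2) ib(1)])
      finally show ?thesis .
    qed
    have bn: "b \<odot> \<nu> g \<in> Hom D ?Y X" by (rule cmp_in[OF O'(2) O(2,1) m(2) ib(1)])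
    show "(a \<odot> \<mu> g) \<star> (b \<odot> \<nu> g) = (\<nu> g \<odot> ?a) \<star> (\<mu> g \<odot> ?b)"
      unfolding c1 c2 using tar_scl_left[OF O'(1) O(2) O'(2) O(1) na bn] tar_scl_right[OF O'(1) O(2) O'(2) O(1) na bn] by simp
  qed
  then have "a \<star> b \<in> Hom E ((X, \<mu>) \<boxtimes>\<^bsub>E\<^esub> (Y, \<nu>)) ((Y, \<nu>) \<boxtimes>\<^bsub>E\<^esub> (X, \<mu>))"
    unfolding tob_E using tar_in[OF O O(2,1) aH ib(1)] by (simp add: Hom_E)
  moreover have "iso_arr D (X \<boxtimes> Y) (Y \<boxtimes> X) (a \<star> b)" by (rule iso_arr_tar(1)[OF O O(2,1) a ib(4)])
  ultimately show ?thesis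
    unfolding tob_E isomorphic_E_iff[OF structure_map_tob[OF X' Y'] structure_map_tob[OF Y' X']] by blast
qed

text \<open>For a character \<open>\<zeta>\<close> this is the tensor product with the corresponding
  one-dimensional representation of the group.\<close>

definition twist :: "('g \<Rightarrow> 'k) \<Rightarrow> 'o \<times> ('g \<Rightarrow> 'a) \<Rightarrow> 'o \<times> ('g \<Rightarrow> 'a)" where
  "twist \<zeta> A = (fst A, \<lambda>g\<in>carrier G. scl D (\<zeta> g) (snd A g))"

lemma structure_map_twist: "structure_map X \<mu> \<Longrightarrow> structure_map X (\<lambda>g\<in>carrier G. scl D (\<zeta> g) (\<mu> g))"
  by (simp add: structure_map_def scl_in act_Ob)

lemma twist_Ob:
  assumes A: "A \<in> Ob E" and \<zeta>: "\<And>g h. g \<in> carrier G \<Longrightarrow> h \<in> carrier G \<Longrightarrow> \<zeta> (g \<otimes>\<^bsub>G\<^esub> h) = \<zeta> g * \<zeta> h" "\<zeta> \<one>\<^bsub>G\<^esub> = 1"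
  shows "twist \<zeta> A \<in> Ob E"
proof -
  obtain X \<mu> where [simp]: "A = (X, \<mu>)" by (cases A)
  have X: "(X, \<mu>) \<in> Ob E" using A by simp
  have O: "X \<in> Ob D" using X by (simp add: Ob_E)
  have nz: "\<zeta> g \<noteq> 0" if "g \<in> carrier G" for g using \<zeta>(1)[of g "inv\<^bsub>G\<^esub> g"] \<zeta>(2) that by auto
  have m: "\<mu> g \<in> Hom D (fob (\<rho> g) X) X" "iso_arr D (fob (\<rho> g) X) X (\<mu> g)" if "g \<in> carrier G" for g
    using X that by (auto simp: Ob_E iso_arr_Hom)
  have iso: "iso_arr D (fob (\<rho> g) X) X (scl D (\<zeta> g) (\<mu> g))" if g: "g \<in> carrier G" for g
  proof -
    have R: "fob (\<rho> g) X \<in> Ob D" by (rule act_Ob[OF g O])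
    note i = inv_arr[OF R O m(2)[OF g]]
    show ?thesis
      by (rule iso_arrI[of _ _ _ _ "scl D (inverse (\<zeta> g)) (inv_arr D (fob (\<rho> g) X) X (\<mu> g))"])
        (use i nz[OF g] R O m(1)[OF g] scl_in in
          \<open>auto simp: cmp_scl_left[of _ X] cmp_scl_left[of _ "fob (\<rho> g) X"] cmp_scl_right[of _ X] cmp_scl_right[of _ "fob (\<rho> g) X"]\<close>)
  qed
  have gam: "\<gamma> g h X \<in> Hom D (fob (\<rho> g) (fob (\<rho> h) X)) (fob (\<rho> (g \<otimes>\<^bsub>G\<^esub> h)) X)" if "g \<in> carrier G" "h \<in> carrier G" for g h
    using mult_iso[OF that] O by (auto simp: tensor_natural_iso_def comp_functor_def iso_arr_Hom)
  have ups: "\<upsilon> X \<in> Hom D X (fob (\<rho> \<one>\<^bsub>G\<^esub>) X)"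
    using one_iso O by (auto simp: tensor_natural_iso_def id_functor_def iso_arr_Hom)
  have coh: "scl D (\<zeta> g) (\<mu> g) \<odot> far (\<rho> g) (fob (\<rho> h) X) X (scl D (\<zeta> h) (\<mu> h)) = scl D (\<zeta> (g \<otimes>\<^bsub>G\<^esub> h)) (\<mu> (g \<otimes>\<^bsub>G\<^esub> h)) \<odot> \<gamma> g h X"
    if g: "g \<in> carrier G" and h: "h \<in> carrier G" for g h
  proof -
    have R: "fob (\<rho> g) X \<in> Ob D" "fob (\<rho> h) X \<in> Ob D" "fob (\<rho> g) (fob (\<rho> h) X) \<in> Ob D" "fob (\<rho> (g \<otimes>\<^bsub>G\<^esub> h)) X \<in> Ob D"
      using act_Ob g h O by auto
    let ?r = "far (\<rho> g) (fob (\<rho> h) X) X (\<mu> h)"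
    have r: "?r \<in> Hom D (fob (\<rho> g) (fob (\<rho> h) X)) (fob (\<rho> g) X)" by (rule act_Hom[OF g R(2) O m(1)[OF h]])
    have "scl D (\<zeta> g) (\<mu> g) \<odot> far (\<rho> g) (fob (\<rho> h) X) X (scl D (\<zeta> h) (\<mu> h)) = scl D (\<zeta> g) (\<mu> g) \<odot> scl D (\<zeta> h) ?r"
      using act_scl[OF g R(2) O m(1)[OF h]] by simp
    also have "\<dots> = scl D (\<zeta> g) (\<mu> g \<odot> scl D (\<zeta> h) ?r)"
      by (rule cmp_scl_left[OF R(3,1) O scl_in[OF R(3,1) r] m(1)[OF g]])
    also have "\<mu> g \<odot> scl D (\<zeta> h) ?r = scl D (\<zeta> h) (\<mu> g \<odot> ?r)" by (rule cmp_scl_right[OF R(3,1) O r m(1)[OF g]])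
    also have "\<mu> g \<odot> ?r = \<mu> (g \<otimes>\<^bsub>G\<^esub> h) \<odot> \<gamma> g h X" using X g h by (simp add: Ob_E)
    also have "scl D (\<zeta> g) (scl D (\<zeta> h) \<dots>) = scl D (\<zeta> (g \<otimes>\<^bsub>G\<^esub> h)) \<dots>" using \<zeta> g h by simp
    also have "\<dots> = scl D (\<zeta> (g \<otimes>\<^bsub>G\<^esub> h)) (\<mu> (g \<otimes>\<^bsub>G\<^esub> h)) \<odot> \<gamma> g h X"
      by (rule cmp_scl_left[OF R(3,4) O gam[OF g h] m(1), symmetric]) (use g h in simp)
    finally show ?thesis .
  qed
  show ?thesis
    using O iso coh X \<zeta>(2) by (simp add: twist_def Ob_E)
qed

lemma twist_Hom:
  assumes X: "structure_map X \<mu>" and Y: "structure_map Y \<nu>" and f: "f \<in> Hom E (X, \<mu>) (Y, \<nu>)"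
  shows "f \<in> Hom E (twist \<zeta> (X, \<mu>)) (twist \<zeta> (Y, \<nu>))"
proof -
  have O: "X \<in> Ob D" "Y \<in> Ob D" using X Y by (auto simp: structure_map_def)
  have fD: "f \<in> Hom D X Y" using f by (simp add: Hom_E)
  have "f \<odot> scl D (\<zeta> g) (\<mu> g) = scl D (\<zeta> g) (\<nu> g) \<odot> far (\<rho> g) X Y f" if g: "g \<in> carrier G" for g
    using cmp_scl_right[OF act_Ob[OF g O(1)] O _ fD] cmp_scl_left[OF act_Ob[OF g O(1)] act_Ob[OF g O(2)] O(2) act_Hom[OF g O fD]]
      X Y f g by (simp add: structure_map_def Hom_E)
  then show ?thesis using fD by (simp add: twist_def Hom_E)
qed

lemma twist_isomorphic:
  assumes X: "structure_map X \<mu>" and Y: "structure_map Y \<nu>" and f: "isomorphic E (X, \<mu>) (Y, \<nu>)"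
  shows "isomorphic E (twist \<zeta> (X, \<mu>)) (twist \<zeta> (Y, \<nu>))"
  using f twist_Hom[OF X Y] unfolding isomorphic_E_iff[OF X Y]
  by (auto simp: twist_def isomorphic_E_iff structure_map_twist X Y)

lemma twist_tob:
  assumes X: "structure_map X \<mu>" and Y: "structure_map Y \<nu>"
  shows "twist \<zeta> (X, \<mu>) \<boxtimes>\<^bsub>E\<^esub> (Y, \<nu>) = twist \<zeta> ((X, \<mu>) \<boxtimes>\<^bsub>E\<^esub> (Y, \<nu>))"
    and "(X, \<mu>) \<boxtimes>\<^bsub>E\<^esub> twist \<zeta> (Y, \<nu>) = twist \<zeta> ((X, \<mu>) \<boxtimes>\<^bsub>E\<^esub> (Y, \<nu>))"
proof -
  have O: "X \<in> Ob D" "Y \<in> Ob D" using X Y by (auto simp: structure_map_def)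
  have *: "(scl D (\<zeta> g) (\<mu> g) \<star> \<nu> g) \<odot> inv_ten g X Y = scl D (\<zeta> g) ((\<mu> g \<star> \<nu> g) \<odot> inv_ten g X Y)"
    "(\<mu> g \<star> scl D (\<zeta> g) (\<nu> g)) \<odot> inv_ten g X Y = scl D (\<zeta> g) ((\<mu> g \<star> \<nu> g) \<odot> inv_ten g X Y)" if g: "g \<in> carrier G" for g
  proof -
    have R: "fob (\<rho> g) X \<in> Ob D" "fob (\<rho> g) Y \<in> Ob D" using act_Ob g O by auto
    have m: "\<mu> g \<in> Hom D (fob (\<rho> g) X) X" "\<nu> g \<in> Hom D (fob (\<rho> g) Y) Y" using X Y g by (auto simp: structure_map_def)
    have T: "fob (\<rho> g) (X \<boxtimes> Y) \<in> Ob D" "fob (\<rho> g) X \<boxtimes> fob (\<rho> g) Y \<in> Ob D" "X \<boxtimes> Y \<in> Ob D" using tob_in act_Ob g R O by auto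
    show "(scl D (\<zeta> g) (\<mu> g) \<star> \<nu> g) \<odot> inv_ten g X Y = scl D (\<zeta> g) ((\<mu> g \<star> \<nu> g) \<odot> inv_ten g X Y)"
      unfolding tar_scl_left[OF R(1) O(1) R(2) O(2) m]
      by (rule cmp_scl_left[OF T inv_ten_in[OF g O] tar_in[OF R(1) O(1) R(2) O(2) m]])
    show "(\<mu> g \<star> scl D (\<zeta> g) (\<nu> g)) \<odot> inv_ten g X Y = scl D (\<zeta> g) ((\<mu> g \<star> \<nu> g) \<odot> inv_ten g X Y)"
      unfolding tar_scl_right[OF R(1) O(1) R(2) O(2) m]
      by (rule cmp_scl_left[OF T inv_ten_in[OF g O] tar_in[OF R(1) O(1) R(2) O(2) m]])
  qed
  show "twist \<zeta> (X, \<mu>) \<boxtimes>\<^bsub>E\<^esub> (Y, \<nu>) = twist \<zeta> ((X, \<mu>) \<boxtimes>\<^bsub>E\<^esub> (Y, \<nu>))"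
    "(X, \<mu>) \<boxtimes>\<^bsub>E\<^esub> twist \<zeta> (Y, \<nu>) = twist \<zeta> ((X, \<mu>) \<boxtimes>\<^bsub>E\<^esub> (Y, \<nu>))"
    using * by (auto simp: twist_def tob_E fun_eq_iff)
qed

lemma twist_twist: "twist \<zeta> (twist \<xi> A) = twist (\<lambda>g. \<zeta> g * \<xi> g) A"
  by (auto simp: twist_def fun_eq_iff)

text \<open>At the unit of the group the structure map is inverse to \<open>\<upsilon>\<close>,
  which is natural. For a group of order two, equivariance therefore has to be checked at the other
  element only.\<close>

lemma structure_one_natural:
  assumes X: "(X, \<mu>) \<in> Ob E" and Y: "(Y, \<nu>) \<in> Ob E" and f: "f \<in> Hom D X Y"
  shows "f \<odot> \<mu> \<one>\<^bsub>G\<^esub> = \<nu> \<one>\<^bsub>G\<^esub> \<odot> far (\<rho> \<one>\<^bsub>G\<^esub>) X Y f"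
proof -
  let ?e = "\<one>\<^bsub>G\<^esub>"
  have e: "?e \<in> carrier G" by simp
  have O: "X \<in> Ob D" "Y \<in> Ob D" using X Y by (auto simp: Ob_E)
  have R: "fob (\<rho> ?e) X \<in> Ob D" "fob (\<rho> ?e) Y \<in> Ob D" using act_Ob O by auto
  have u: "iso_arr D X (fob (\<rho> ?e) X) (\<upsilon> X)" "iso_arr D Y (fob (\<rho> ?e) Y) (\<upsilon> Y)"
    using one_iso O by (auto simp: tensor_natural_iso_def id_functor_def)
  note uH = iso_arr_Hom[OF u(1)] iso_arr_Hom[OF u(2)]
  have nat: "\<upsilon> Y \<odot> f = far (\<rho> ?e) X Y f \<odot> \<upsilon> X"
    using one_iso O f by (auto simp: tensor_natural_iso_def id_functor_def)
  have m: "\<mu> ?e \<in> Hom D (fob (\<rho> ?e) X) X" "\<nu> ?e \<in> Hom D (fob (\<rho> ?e) Y) Y" "\<mu> ?e \<odot> \<upsilon> X = idn D X" "\<nu> ?e \<odot> \<upsilon> Y = idn D Y"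
    using X Y e by (auto simp: Ob_E iso_arr_Hom)
  note r = act_Hom[OF e O f]
  have "f \<odot> \<mu> ?e \<odot> \<upsilon> X = f" using cmp_assoc[OF O(1) R(1) O uH(1) m(1) f] m idn_right[OF O f] by simp
  also have "\<dots> = \<nu> ?e \<odot> (\<upsilon> Y \<odot> f)" using cmp_assoc[OF O R(2) O(2) f uH(2) m(2)] m idn_left[OF O f] by simp
  also have "\<dots> = \<nu> ?e \<odot> far (\<rho> ?e) X Y f \<odot> \<upsilon> X" unfolding nat by (rule cmp_assoc[OF O(1) R O(2) uH(1) r m(2)])
  finally show ?thesis
    by (rule iso_cancel_right[OF O(1) R(1) O(2) u(1) cmp_in[OF R(1) O m(1) f] cmp_in[OF R O(2) r m(2)]])
qed

text \<open>Conjugation with the structure maps, which sends f to \<open>k\<close>, is an involution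
  on the arrows from X to Y in D. Its eigenspaces for 1 and -1 are the equivariant arrows to Y and
  to the twist of Y; the two summands are the eigencomponents of f.\<close>

lemma Hom_D_split:
  assumes X: "(X, \<mu>) \<in> Ob E" and Y: "(Y, \<nu>) \<in> Ob E" and f: "f \<in> Hom D X Y"
    and G: "carrier G = {\<one>\<^bsub>G\<^esub>, g}" "g \<otimes>\<^bsub>G\<^esub> g = \<one>\<^bsub>G\<^esub>" and \<zeta>: "\<zeta> \<one>\<^bsub>G\<^esub> = 1" "\<zeta> g = -1" and two: "(2::'k) \<noteq> 0"
  shows "\<exists>a b. a \<in> Hom E (X, \<mu>) (Y, \<nu>) \<and> b \<in> Hom E (X, \<mu>) (twist \<zeta> (Y, \<nu>)) \<and> f = a + b"
proof -
  have g: "g \<in> carrier G" using G by simp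
  let ?R = "fob (\<rho> g)"
  have O: "X \<in> Ob D" "Y \<in> Ob D" using X Y by (auto simp: Ob_E)
  have R: "?R X \<in> Ob D" "?R Y \<in> Ob D" "?R (?R X) \<in> Ob D" "?R (?R Y) \<in> Ob D" using act_Ob[OF g] O by auto
  have m: "iso_arr D (?R X) X (\<mu> g)" "iso_arr D (?R Y) Y (\<nu> g)" using X Y g by (auto simp: Ob_E)
  note mH = iso_arr_Hom[OF m(1)] iso_arr_Hom[OF m(2)] and im = inv_arr[OF R(1) O(1) m(1)]
  have m1: "iso_arr D (fob (\<rho> \<one>\<^bsub>G\<^esub>) X) X (\<mu> \<one>\<^bsub>G\<^esub>)" "iso_arr D (fob (\<rho> \<one>\<^bsub>G\<^esub>) Y) Y (\<nu> \<one>\<^bsub>G\<^esub>)" using X Y by (auto simp: Ob_E)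
  have R1: "fob (\<rho> \<one>\<^bsub>G\<^esub>) X \<in> Ob D" "fob (\<rho> \<one>\<^bsub>G\<^esub>) Y \<in> Ob D" using act_Ob O by auto
  let ?f = "far (\<rho> g) X Y f"
  have fH: "?f \<in> Hom D (?R X) (?R Y)" by (rule act_Hom[OF g O f])
  have nf: "\<nu> g \<odot> ?f \<in> Hom D (?R X) Y" by (rule cmp_in[OF R(1,2) O(2) fH mH(2)])
  define k where "k = \<nu> g \<odot> ?f \<odot> inv_arr D (?R X) X (\<mu> g)"
  have k: "k \<in> Hom D X Y" unfolding k_def by (rule cmp_in[OF O(1) R(1) O(2) im(1) nf])
  let ?k = "far (\<rho> g) X Y k"
  have kH: "?k \<in> Hom D (?R X) (?R Y)" by (rule act_Hom[OF g O k])
  have km: "k \<odot> \<mu> g = \<nu> g \<odot> ?f"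
    unfolding k_def using cmp_assoc[OF R(1) O(1) R(1) O(2) mH(1) im(1) nf] im idn_right[OF R(1) O(2) nf] by simp
  let ?m = "far (\<rho> g) (?R X) X (\<mu> g)" and ?n = "far (\<rho> g) (?R Y) Y (\<nu> g)" and ?ff = "far (\<rho> g) (?R X) (?R Y) ?f"
  have mm: "?m \<in> Hom D (?R (?R X)) (?R X)" "?n \<in> Hom D (?R (?R Y)) (?R Y)" "?ff \<in> Hom D (?R (?R X)) (?R (?R Y))"
    using act_Hom[OF g] R O mH fH by auto
  have mmi: "iso_arr D (?R (?R X)) (?R X) ?m" by (rule functor_iso_arr[OF action_functor[OF g] R(1) O(1) m(1)])
  have ga: "\<gamma> g g X \<in> Hom D (?R (?R X)) (fob (\<rho> \<one>\<^bsub>G\<^esub>) X)" "\<gamma> g g Y \<in> Hom D (?R (?R Y)) (fob (\<rho> \<one>\<^bsub>G\<^esub>) Y)"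
    "\<gamma> g g Y \<odot> ?ff = far (\<rho> \<one>\<^bsub>G\<^esub>) X Y f \<odot> \<gamma> g g X"
    using mult_iso[OF g g] O f by (auto simp: G tensor_natural_iso_def comp_functor_def iso_arr_Hom)
  have coh: "\<mu> g \<odot> ?m = \<mu> \<one>\<^bsub>G\<^esub> \<odot> \<gamma> g g X" "\<nu> g \<odot> ?n = \<nu> \<one>\<^bsub>G\<^esub> \<odot> \<gamma> g g Y"
    using X Y g unfolding Ob_E G(2)[symmetric] by metis+
  have f1: "far (\<rho> \<one>\<^bsub>G\<^esub>) X Y f \<in> Hom D (fob (\<rho> \<one>\<^bsub>G\<^esub>) X) (fob (\<rho> \<one>\<^bsub>G\<^esub>) Y)" using act_Hom O f by auto
  \<comment> \<open>The involution property: conjugating \<open>k\<close> gives back f. It rests on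
    the cocycle conditions of both objects at (g, g), where the product is 1, and on naturality of
    \<open>\<gamma> g g\<close>.\<close>
  have kn: "f \<odot> \<mu> g = \<nu> g \<odot> ?k"
  proof -
    have "?k \<odot> ?m = far (\<rho> g) (?R X) Y (k \<odot> \<mu> g)" using act_cmp[OF g R(1) O mH(1) k] by simp
    also have "\<dots> = ?n \<odot> ?ff" unfolding km using act_cmp[OF g R(1,2) O(2) fH mH(2)] by simp
    finally have kk: "?k \<odot> ?m = ?n \<odot> ?ff" .
    have "\<nu> g \<odot> ?k \<odot> ?m = \<nu> g \<odot> (?k \<odot> ?m)" using cmp_assoc[OF R(3,1,2) O(2) mm(1) kH mH(2)] by simp
    also have "\<dots> = \<nu> g \<odot> ?n \<odot> ?ff" unfolding kk by (rule cmp_assoc[OF R(3,4,2) O(2) mm(3,2) mH(2)])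
    also have "\<dots> = \<nu> \<one>\<^bsub>G\<^esub> \<odot> (\<gamma> g g Y \<odot> ?ff)" unfolding coh 
      by (rule cmp_assoc[OF R(3,4) R1(2) O(2) mm(3) ga(2) iso_arr_Hom[OF m1(2)], symmetric])
    also have "\<dots> = \<nu> \<one>\<^bsub>G\<^esub> \<odot> far (\<rho> \<one>\<^bsub>G\<^esub>) X Y f \<odot> \<gamma> g g X" unfolding ga(3)
      by (rule cmp_assoc[OF R(3) R1 O(2) ga(1) f1 iso_arr_Hom[OF m1(2)]])
    also have "\<dots> = f \<odot> \<mu> \<one>\<^bsub>G\<^esub> \<odot> \<gamma> g g X" using structure_one_natural[OF X Y f] by simp
    also have "\<dots> = f \<odot> (\<mu> g \<odot> ?m)" unfolding coh
      by (rule cmp_assoc[OF R(3) R1(1) O ga(1) iso_arr_Hom[OF m1(1)] f, symmetric])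
    also have "\<dots> = f \<odot> \<mu> g \<odot> ?m" by (rule cmp_assoc[OF R(3,1) O mm(1) mH(1) f])
    finally have "\<nu> g \<odot> ?k \<odot> ?m = f \<odot> \<mu> g \<odot> ?m" .
    then show ?thesis
      using iso_cancel_right[OF R(3,1) O(2) mmi cmp_in[OF R(1,2) O(2) kH mH(2)] cmp_in[OF R(1) O mH(1) f]] by simp
  qed
  let ?h = "inverse 2 :: 'k"
  define a where "a = scl D ?h (f + k)"
  define b where "b = scl D ?h (f - k)"
  have ab: "f = a + b"
  proof -
    have "a + b = scl D ?h (f + f)" unfolding a_def b_def by (simp add: scale_right_distrib[symmetric])
    also have "f + f = scl D 2 f" using scale_left_distrib[of 1 1 f] by (simp add: one_add_one)
    also have "scl D ?h (scl D 2 f) = f" using two by simp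
    finally show ?thesis by simp
  qed
  have fk: "f + k \<in> Hom D X Y" "f - k \<in> Hom D X Y" using add_in[OF O f k] diff_in[OF O f k] by auto
  have abH: "a \<in> Hom D X Y" "b \<in> Hom D X Y" unfolding a_def b_def using scl_in[OF O] fk by auto
  have km': "scl D (- 1) x = - x" for x by simp
  have act_diff: "far (\<rho> g) X Y (f - k) = ?f - ?k"
    using act_add[OF g O fk(2) k] by (simp add: algebra_simps)
  have "a \<odot> \<mu> g = scl D ?h ((f \<odot> \<mu> g) + (k \<odot> \<mu> g))" unfolding a_def
    using cmp_scl_left[OF R(1) O mH(1) fk(1)] cmp_add_left[OF R(1) O mH(1) f k] by simp
  moreover have "\<nu> g \<odot> far (\<rho> g) X Y a = scl D ?h ((\<nu> g \<odot> ?f) + (\<nu> g \<odot> ?k))" unfolding a_def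
    using act_scl[OF g O fk(1)] act_add[OF g O f k] cmp_scl_right[OF R(1,2) O(2) add_in[OF R(1,2) fH kH] mH(2)]
      cmp_add_right[OF R(1,2) O(2) fH kH mH(2)] by simp
  ultimately have ag: "a \<odot> \<mu> g = \<nu> g \<odot> far (\<rho> g) X Y a" using km kn by (simp add: add.commute)
  have "b \<odot> \<mu> g = scl D ?h ((f \<odot> \<mu> g) - (k \<odot> \<mu> g))" unfolding b_def
    using cmp_scl_left[OF R(1) O mH(1) fk(2)] cmp_diff_left[OF R(1) O mH(1) f k] by simp
  moreover have "\<nu> g \<odot> far (\<rho> g) X Y b = scl D ?h ((\<nu> g \<odot> ?f) - (\<nu> g \<odot> ?k))" unfolding b_def
    using act_scl[OF g O fk(2)] act_diff cmp_scl_right[OF R(1,2) O(2) diff_in[OF R(1,2) fH kH] mH(2)]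
      cmp_diff_right[OF R(1,2) O(2) fH kH mH(2)] by simp
  moreover have "scl D (-1) (\<nu> g) \<odot> far (\<rho> g) X Y b = scl D (-1) (\<nu> g \<odot> far (\<rho> g) X Y b)"
    by (rule cmp_scl_left[OF R(1,2) O(2) act_Hom[OF g O abH(2)] mH(2)])
  ultimately have bg: "b \<odot> \<mu> g = scl D (-1) (\<nu> g) \<odot> far (\<rho> g) X Y b"
    using km kn by (simp add: scale_right_diff_distrib)
  have "a \<in> Hom E (X, \<mu>) (Y, \<nu>)" using abH ag structure_one_natural[OF X Y] by (simp add: Hom_E G(1))
  moreover have "b \<in> Hom E (X, \<mu>) (twist \<zeta> (Y, \<nu>))"
    using abH bg structure_one_natural[OF X Y] \<zeta> by (simp add: twist_def Hom_E G(1))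
  ultimately show ?thesis using ab by blast
qed

end

section \<open>The group of invertible objects of a solvable fusion category\<close>

lemma linear_category_full_subcategory:
  assumes "linear_category C" "A \<subseteq> Ob C"
  shows "linear_category (C\<lparr>Ob := A\<rparr>)"
proof -
  interpret linear_category C by (rule assms(1))
  have O: "X \<in> A \<Longrightarrow> X \<in> Ob C" for X using assms(2) by auto
  show ?thesis
    by (unfold_locales; simp)
      (auto simp: O subspace_Hom idn_in idn_left[OF O O] idn_right[OF O O] scale_right_distrib scale_left_distrib
        intro: cmp_in[OF O O O] cmp_assoc[OF O O O O] cmp_add_left[OF O O O] cmp_add_right[OF O O O]
          cmp_scl_left[OF O O O] cmp_scl_right[OF O O O])
qed

text \<open>The groups of a solvable chain are cyclic, hence commutative, and commutativity makes
  degrees trivial on commutators.\<close>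

locale graded_category = semisimple_monoidal_category C + G: comm_group G
  for C :: "('o, 'a::ab_group_add, 'k::field) tensor_category" and G :: "('g, 'm) monoid_scheme" +
  fixes \<A> :: "'g \<Rightarrow> 'o set"
  assumes decomposition: "direct_sum_decomposition (carrier G) C \<A>"
    and component_nonzero: "g \<in> carrier G \<Longrightarrow> \<exists>X\<in>\<A> g. \<not> zero_ob C X"
    and component_tob: "\<lbrakk>g \<in> carrier G; h \<in> carrier G; X \<in> \<A> g; Y \<in> \<A> h\<rbrakk> \<Longrightarrow> X \<boxtimes>\<^bsub>C\<^esub> Y \<in> \<A> (g \<otimes>\<^bsub>G\<^esub> h)"
begin

lemma component_Ob: "g \<in> carrier G \<Longrightarrow> X \<in> \<A> g \<Longrightarrow> X \<in> Ob C"
  using decomposition by (auto simp: direct_sum_decomposition_def)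

lemma component_iso: "\<lbrakk>g \<in> carrier G; X \<in> \<A> g; Y \<in> Ob C; isomorphic C X Y\<rbrakk> \<Longrightarrow> Y \<in> \<A> g"
  using decomposition unfolding direct_sum_decomposition_def by blast

lemma component_Hom: "\<lbrakk>g \<in> carrier G; h \<in> carrier G; g \<noteq> h; X \<in> \<A> g; Y \<in> \<A> h\<rbrakk> \<Longrightarrow> Hom C X Y = {0}"
  using decomposition unfolding direct_sum_decomposition_def by blast

text \<open>Meaningful for bricks: a brick cannot be spread over several components, since one
  summand of its decomposition is already isomorphic to it.\<close>

definition deg :: "'o \<Rightarrow> 'g" where "deg X = (THE g. g \<in> carrier G \<and> X \<in> \<A> g)"

lemma deg_eq:
  assumes "brick C X" "g \<in> carrier G" "X \<in> \<A> g"
  shows "deg X = g"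
  unfolding deg_def
proof (rule the_equality)
  fix h assume h: "h \<in> carrier G \<and> X \<in> \<A> h"
  show "h = g"
  proof (rule ccontr)
    assume "h \<noteq> g"
    then have "Hom C X X = {0}" using component_Hom h assms by blast
    then show False using idn_in[OF brick_Ob[OF assms(1)]] assms(1) by (auto simp: brick_def)
  qed
qed (use assms in simp)

lemma deg_in:
  assumes "brick C X"
  shows "deg X \<in> carrier G" "X \<in> \<A> (deg X)"
proof -
  obtain Y where Y: "\<forall>g\<in>carrier G. Y g \<in> \<A> g" "direct_sum C (carrier G) Y X"
    using decomposition brick_Ob[OF assms] unfolding direct_sum_decomposition_def by blast
  obtain g where g: "g \<in> carrier G" "isomorphic C (Y g) X" using brick_summand[OF assms Y(2)] by blast
  then have "X \<in> \<A> g" using component_iso[OF g(1) _ brick_Ob[OF assms] g(2)] Y by blast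
  then show "deg X \<in> carrier G" "X \<in> \<A> (deg X)" using deg_eq[OF assms g(1)] g by auto
qed

lemma deg_iso: "\<lbrakk>brick C X; brick C Y; isomorphic C X Y\<rbrakk> \<Longrightarrow> deg Y = deg X"
  by (rule deg_eq) (auto simp: deg_in brick_Ob intro: component_iso[of _ X])

lemma deg_Hom:
  assumes "brick C Z" "g \<in> carrier G" "X \<in> \<A> g" "Hom C Z X \<noteq> {0}"
  shows "deg Z = g"
  using component_Hom[of "deg Z" g Z X] deg_in[OF assms(1)] assms by blast

lemma deg_tob:
  assumes "brick C X" "brick C Y" "brick C Z" "Hom C Z (X \<boxtimes>\<^bsub>C\<^esub> Y) \<noteq> {0}"
  shows "deg Z = deg X \<otimes>\<^bsub>G\<^esub> deg Y"
  by (rule deg_Hom[OF assms(3) _ component_tob assms(4)]) (use deg_in assms in auto)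

lemma deg_tob_brick:
  assumes "brick C X" "brick C Y" "brick C (X \<boxtimes>\<^bsub>C\<^esub> Y)"
  shows "deg (X \<boxtimes>\<^bsub>C\<^esub> Y) = deg X \<otimes>\<^bsub>G\<^esub> deg Y"
  using deg_tob[OF assms] idn_in[OF brick_Ob[OF assms(3)]] assms(3) by (auto simp: brick_def)

lemma deg_unit: "deg (unit_ob C) = \<one>\<^bsub>G\<^esub>"
proof -
  let ?u = "unit_ob C"
  have i: "isomorphic C (?u \<boxtimes>\<^bsub>C\<^esub> ?u) ?u" by (rule isomorphicI[OF lunit_iso[OF unit_in]])
  have b: "brick C (?u \<boxtimes>\<^bsub>C\<^esub> ?u)" by (rule brick_iso[OF brick_unit tob_in[OF unit_in unit_in] isomorphic_sym[OF i]])
  have "deg ?u = deg ?u \<otimes>\<^bsub>G\<^esub> deg ?u"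
    using deg_iso[OF b brick_unit i] deg_tob_brick[OF brick_unit brick_unit b] by simp
  then show ?thesis using G.r_cancel_one[of "deg ?u" "deg ?u"] deg_in(1)[OF brick_unit] by metis
qed

text \<open>A nonzero object of the component of g contains a brick, and as Hom vanishes between
  different components, this brick has degree g.\<close>

lemma not_all_deg_one:
  assumes "g \<in> carrier G" "g \<noteq> \<one>\<^bsub>G\<^esub>"
  shows "\<exists>X. brick C X \<and> deg X \<noteq> \<one>\<^bsub>G\<^esub>"
proof -
  obtain X where X: "X \<in> \<A> g" "\<not> zero_ob C X" using component_nonzero[OF assms(1)] by blast
  obtain M where M: "decomp C X M" using decomposable[OF component_Ob[OF assms(1) X(1)]] by blast
  then have "M \<noteq> {#}" using decomp_empty X by metis
  then obtain Z where Z: "brick C Z" "iso_class C Z \<in># M" using decomp_mem[OF M] by fastforce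
  then have "Hom C Z X \<noteq> {0}" using Hom_nonzero_iff[OF M] by simp
  then show ?thesis using deg_Hom[OF Z(1) assms(1) X(1)] assms Z by metis
qed

end

lemma extension_graded:
  fixes C :: "('o, 'a::ab_group_add, 'k::alg_closed_field) tensor_category"
  assumes "fusion_category C" "comm_group G" "is_extension G C D"
  obtains \<A> where "graded_category C G \<A>" "tensor_equivalent (C\<lparr>Ob := \<A> \<one>\<^bsub>G\<^esub>\<rparr>) D"
  using assms unfolding is_extension_def graded_category_def graded_category_axioms_def
  by (metis fusion_semisimple_monoidal)

lemma unit_group_solvable_extension:
  fixes C :: "('o, 'a::ab_group_add, 'k::alg_closed_field) tensor_category"
    and D :: "('p, 'b::ab_group_add, 'k) tensor_category"
  assumes fC: "fusion_category C" and fD: "fusion_category D" and G: "comm_group G" and ext: "is_extension G C D"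
    and sol: "solvable (unit_group D)"
  shows "solvable (unit_group C)"
proof -
  obtain \<A> where gr: "graded_category C G \<A>" and eq: "tensor_equivalent (C\<lparr>Ob := \<A> \<one>\<^bsub>G\<^esub>\<rparr>) D"
    by (rule extension_graded[OF fC G ext])
  interpret graded_category C G \<A> by (rule gr)
  interpret D: semisimple_monoidal_category D by (rule fusion_semisimple_monoidal[OF fD])
  let ?S = "\<A> \<one>\<^bsub>G\<^esub>"
  let ?C = "C\<lparr>Ob := ?S\<rparr>"
  obtain F where F: "is_tensor_equivalence ?C D F" using eq by (auto simp: tensor_equivalent_def)
  then interpret F: is_tensor_functor ?C D F by (simp add: is_tensor_equivalence_def)
  have F': "is_tensor_functor ?C D F" by unfold_locales
  have SO: "?S \<subseteq> Ob C" using component_Ob by auto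
  interpret C1: linear_category ?C
    by (rule linear_category_full_subcategory[OF _ SO]) unfold_locales
  have iso: "isomorphic ?C X Y \<longleftrightarrow> isomorphic C X Y" for X Y by (simp add: isomorphic_def iso_arr_def)
  have uS: "unit_ob C \<in> ?S" using deg_in(2)[OF brick_unit] deg_unit by simp
  interpret tm: tensor_map C D ?S "fob F"
  proof
    show "isomorphic D (fob F X) (fob F Y)" if "X \<in> ?S" "Y \<in> ?S" "isomorphic C X Y" for X Y
      using C1.functor_isomorphic[OF F', of X Y] that iso by simp
    show "isomorphic D (fob F X \<boxtimes>\<^bsub>D\<^esub> fob F Y) (fob F (X \<boxtimes>\<^bsub>C\<^esub> Y))" if "X \<in> ?S" "Y \<in> ?S" for X Y
      using isomorphicI[OF F.ften_iso[of X Y]] that by simp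
    show "isomorphic D (unit_ob D) (fob F (unit_ob C))" using isomorphicI[OF F.funi_iso] by simp
    show "Y \<in> ?S" if "X \<in> ?S" "Y \<in> Ob C" "isomorphic C X Y" for X Y
      by (rule component_iso[OF G.one_closed that])
    show "X \<boxtimes>\<^bsub>C\<^esub> Y \<in> ?S" if "X \<in> ?S" "Y \<in> ?S" for X Y
      using component_tob[OF G.one_closed G.one_closed that] by simp
    show "fob F X \<in> Ob D" if "X \<in> ?S" for X using F.fob_in[of X] that by simp
  qed (rule SO, rule uS)
  interpret U: group "unit_group C" by (rule unit_group_is_group)
  define d where "d x = deg (rep_ob x)" for x
  have rep: "brick C (rep_ob x)" "iso_class C (rep_ob x) = x" "rep_ob x \<in> Ob C" if x: "x \<in> carrier (unit_group C)" for x
  proof -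
    obtain X where X: "X \<in> Ob C" "x = iso_class C X" using unit_group_classE[OF x] .
    note r = rep_ob_iso_class[OF X(1)]
    show "iso_class C (rep_ob x) = x" "rep_ob x \<in> Ob C" using r X by auto
    then show "brick C (rep_ob x)" using Units_brick[of x "rep_ob x"] x by (simp add: units_of_carrier)
  qed
  interpret d: group_hom "unit_group C" G d
  proof (unfold_locales, rule homI)
    fix x y assume x: "x \<in> carrier (unit_group C)" and y: "y \<in> carrier (unit_group C)"
    show "d x \<in> carrier G" using deg_in(1)[OF rep(1)[OF x]] by (simp add: d_def)
    have xy: "x \<otimes>\<^bsub>unit_group C\<^esub> y \<in> carrier (unit_group C)" using x y by simp
    have T: "rep_ob x \<boxtimes>\<^bsub>C\<^esub> rep_ob y \<in> Ob C" using tob_in rep x y by simp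
    have e: "x \<otimes>\<^bsub>unit_group C\<^esub> y = iso_class C (rep_ob x \<boxtimes>\<^bsub>C\<^esub> rep_ob y)"
      using iso_monoid_mult[OF rep(3)[OF x] rep(3)[OF y]] rep(2)[OF x] rep(2)[OF y] by (simp add: units_of_mult)
    have b: "brick C (rep_ob x \<boxtimes>\<^bsub>C\<^esub> rep_ob y)"
      using Units_brick[OF _ T e] xy by (simp add: units_of_carrier)
    have "isomorphic C (rep_ob x \<boxtimes>\<^bsub>C\<^esub> rep_ob y) (rep_ob (x \<otimes>\<^bsub>unit_group C\<^esub> y))"
      using rep_ob_iso_class(2)[OF T] e by simp
    from deg_iso[OF b rep(1)[OF xy] this]
    show "d (x \<otimes>\<^bsub>unit_group C\<^esub> y) = d x \<otimes>\<^bsub>G\<^esub> d y"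
      using deg_tob_brick[OF rep(1)[OF x] rep(1)[OF y] b] by (simp add: d_def)
  qed
  let ?K = "kernel (unit_group C) G d"
  have K: "subgroup ?K (unit_group C)" by (rule d.subgroup_kernel)
  have KS: "?K \<subseteq> iso_class C ` ?S"
  proof
    fix x assume "x \<in> ?K"
    then have x: "x \<in> carrier (unit_group C)" "deg (rep_ob x) = \<one>\<^bsub>G\<^esub>" by (auto simp: kernel_def d_def)
    then have "rep_ob x \<in> ?S" using deg_in(2)[OF rep(1)[OF x(1)]] by simp
    then show "x \<in> iso_class C ` ?S" using rep(2)[OF x(1)] by (metis imageI)
  qed
  interpret h: group_hom "(unit_group C)\<lparr>carrier := ?K\<rparr>" "unit_group D" tm.class_map
    by (rule tm.class_map_hom[OF K KS])
  \<comment> \<open>On classes of degree 1 the class map has trivial kernel because the equivalence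
    reflects isomorphisms.\<close>
  have one: "x = \<one>\<^bsub>unit_group C\<^esub>" if x: "x \<in> kernel ((unit_group C)\<lparr>carrier := ?K\<rparr>) (unit_group D) tm.class_map" for x
  proof -
    have xK: "x \<in> ?K" and x1: "tm.class_map x = \<one>\<^bsub>iso_monoid D\<^esub>" using x by (auto simp: kernel_def units_of_one)
    obtain X where X: "X \<in> ?S" "x = iso_class C X" using xK KS by blast
    have "iso_class D (fob F X) = iso_class D (fob F (unit_ob C))"
      using x1 tm.class_map_iso_class[OF X(1)] tm.class_map_one tm.class_map_iso_class[OF uS] X by simp
    then have "isomorphic D (fob F X) (fob F (unit_ob C))"
      using D.iso_class_eq tm.map_Ob X uS by simp
    then have "isomorphic C X (unit_ob C)"
      using C1.equivalence_reflects_iso[OF F, of X "unit_ob C"] X uS iso by simp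
    moreover have "X \<in> Ob C" using X SO by auto
    ultimately show ?thesis using X(2) unit_in by (simp add: units_of_one iso_monoid_one iso_class_eq)
  qed
  have "solvable ((unit_group C)\<lparr>carrier := ?K\<rparr>)"
    by (rule h.solvable_abelian_kernel[OF sol]) (use one in auto)
  \<comment> \<open>The grading group is commutative, so commutators have degree 1.\<close>
  moreover have "derived (unit_group C) (carrier (unit_group C)) \<subseteq> ?K"
    unfolding derived_def
  proof (rule U.generate_subgroup_incl[OF _ K], rule subsetI)
    fix z assume "z \<in> derived_set (unit_group C) (carrier (unit_group C))"
    then obtain x y where xy: "x \<in> carrier (unit_group C)" "y \<in> carrier (unit_group C)"
      "z = x \<otimes>\<^bsub>unit_group C\<^esub> y \<otimes>\<^bsub>unit_group C\<^esub> inv\<^bsub>unit_group C\<^esub> x \<otimes>\<^bsub>unit_group C\<^esub> inv\<^bsub>unit_group C\<^esub> y" by blast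
    then have dd: "d x \<in> carrier G" "d y \<in> carrier G" by auto
    have "d z = d x \<otimes>\<^bsub>G\<^esub> d y \<otimes>\<^bsub>G\<^esub> inv\<^bsub>G\<^esub> d x \<otimes>\<^bsub>G\<^esub> inv\<^bsub>G\<^esub> d y" using xy by simp
    also have "\<dots> = \<one>\<^bsub>G\<^esub>"
      using dd by (metis G.inv_closed G.m_assoc G.m_closed G.m_comm G.r_inv G.r_one)
    finally show "z \<in> ?K" using xy by (simp add: kernel_def)
  qed
  ultimately show ?thesis using U.solvable_derived_le[OF K] by blast
qed

locale fusion_equivariantization =
  equivariant_action G D \<rho> \<gamma> \<upsilon> + semisimple_monoidal_category D + C: semisimple_monoidal_category C
  for G :: "('g, 'm) monoid_scheme" and D :: "('o, 'a::ab_group_add, 'k::field) tensor_category" (structure)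
    and \<rho> \<gamma> \<upsilon> and C :: "('p, 'b::ab_group_add, 'k) tensor_category" +
  fixes F
  assumes equivalence: "is_tensor_equivalence C E F"
begin

abbreviation forget :: "'p \<Rightarrow> 'o" where "forget X \<equiv> fst (fob F X)"

abbreviation E_object :: "'o \<times> ('g \<Rightarrow> 'a) \<Rightarrow> bool" where "E_object A \<equiv> structure_map (fst A) (snd A)"

lemmas F_functor = C.equivalence_functor[OF equivalence]

lemma F_Ob: "X \<in> Ob C \<Longrightarrow> fob F X \<in> Ob E"
  using is_tensor_functor.fob_in[OF F_functor] .

lemma E_object_Ob: "A \<in> Ob E \<Longrightarrow> E_object A"
  by (cases A) (simp add: Ob_E_structure_map)

lemma E_object_F: "X \<in> Ob C \<Longrightarrow> E_object (fob F X)"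
  by (rule E_object_Ob[OF F_Ob])

lemma E_object_tob: "E_object A \<Longrightarrow> E_object B \<Longrightarrow> E_object (A \<boxtimes>\<^bsub>E\<^esub> B)"
  using structure_map_tob[of "fst A" "snd A" "fst B" "snd B"] tob_E[of "fst A" "snd A" "fst B" "snd B"] by simp

lemma E_object_twist: "E_object A \<Longrightarrow> E_object (twist \<zeta> A)"
  using structure_map_twist[of "fst A" "snd A" \<zeta>] by (simp add: twist_def)

lemma E_trans: "\<lbrakk>E_object A; E_object B; E_object B'; isomorphic E A B; isomorphic E B B'\<rbrakk> \<Longrightarrow> isomorphic E A B'"
  using isomorphic_E_trans[of "fst A" "snd A" "fst B" "snd B" "fst B'" "snd B'"] by simp

lemma F_tob: "\<lbrakk>X \<in> Ob C; Y \<in> Ob C\<rbrakk> \<Longrightarrow> isomorphic E (fob F X \<boxtimes>\<^bsub>E\<^esub> fob F Y) (fob F (X \<boxtimes>\<^bsub>C\<^esub> Y))"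
  using isomorphicI[OF is_tensor_functor.ften_iso[OF F_functor]] .

lemma forget_Ob: "X \<in> Ob C \<Longrightarrow> forget X \<in> Ob D"
  using E_object_F by (simp add: structure_map_def)

lemma forget_iso: "\<lbrakk>X \<in> Ob C; Y \<in> Ob C; isomorphic C X Y\<rbrakk> \<Longrightarrow> isomorphic D (forget X) (forget Y)"
  using isomorphic_E_D[OF C.functor_isomorphic[OF F_functor]] by blast

lemma forget_direct_sum: "direct_sum C I Y X \<Longrightarrow> direct_sum D I (\<lambda>i. forget (Y i)) (forget X)"
  by (rule direct_sum_E_D[OF C.functor_direct_sum[OF F_functor]])

lemma forget_tob: "\<lbrakk>X \<in> Ob C; Y \<in> Ob C\<rbrakk> \<Longrightarrow> isomorphic D (forget X \<boxtimes> forget Y) (forget (X \<boxtimes>\<^bsub>C\<^esub> Y))"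
  using isomorphic_E_D[OF F_tob] by (simp add: fst_tob_E)

lemma forget_unit: "isomorphic D (unit_ob D) (forget (unit_ob C))"
  using isomorphic_E_D[OF isomorphicI[OF is_tensor_functor.funi_iso[OF F_functor]]] by (simp add: fst_unit_E)

sublocale forget: tensor_map C D "Ob C" forget
  by unfold_locales (use C.tob_in C.unit_in forget_Ob forget_iso forget_tob forget_unit in auto)

text \<open>Classes in the kernel are equivariant structures on objects isomorphic to the unit of D,
  which is a brick; so they commute by \<open>tob_E_commute\<close>.\<close>

lemma unit_group_solvable:
  assumes "solvable (unit_group D)"
  shows "solvable (unit_group C)"
proof -
  interpret U: group "unit_group C" by (rule C.unit_group_is_group)
  have "group_hom ((unit_group C)\<lparr>carrier := carrier (unit_group C)\<rparr>) (unit_group D) forget.class_map"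
    by (rule forget.class_map_hom[OF U.subgroup_self]) (auto elim: C.unit_group_classE)
  then interpret h: group_hom "unit_group C" "unit_group D" forget.class_map by simp
  show ?thesis
  proof (rule h.solvable_abelian_kernel[OF assms])
    fix x y assume "x \<in> kernel (unit_group C) (unit_group D) forget.class_map" "y \<in> kernel (unit_group C) (unit_group D) forget.class_map"
    then have x: "x \<in> carrier (unit_group C)" "forget.class_map x = \<one>\<^bsub>iso_monoid D\<^esub>"
      and y: "y \<in> carrier (unit_group C)" "forget.class_map y = \<one>\<^bsub>iso_monoid D\<^esub>" by (auto simp: kernel_def units_of_one)
    obtain X where X: "X \<in> Ob C" "x = iso_class C X" using C.unit_group_classE[OF x(1)] .
    obtain Y where Y: "Y \<in> Ob C" "y = iso_class C Y" using C.unit_group_classE[OF y(1)] .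
    have "isomorphic D (forget X) (forget Y)" 
      using x(2) y(2) X Y forget_Ob by (simp add: forget.class_map_iso_class iso_class_eq[symmetric])
    moreover have "isomorphic D (forget Y) (unit_ob D)"
      using y(2) Y forget_Ob unit_in by (simp add: forget.class_map_iso_class iso_monoid_one iso_class_eq[symmetric])
    then have "brick D (forget Y)" by (rule brick_iso[OF brick_unit forget_Ob[OF Y(1)] isomorphic_sym])
    ultimately have "isomorphic E (fob F X \<boxtimes>\<^bsub>E\<^esub> fob F Y) (fob F Y \<boxtimes>\<^bsub>E\<^esub> fob F X)"
      using tob_E_commute[of "forget X" "snd (fob F X)" "forget Y" "snd (fob F Y)"] F_Ob X Y by simp
    then have "isomorphic E (fob F (X \<boxtimes>\<^bsub>C\<^esub> Y)) (fob F (Y \<boxtimes>\<^bsub>C\<^esub> X))"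
      using E_trans[OF _ _ _ isomorphic_E_sym[OF F_tob[OF X(1) Y(1)]] E_trans[OF _ _ _ _ F_tob[OF Y(1) X(1)]]]
        E_object_F E_object_tob C.tob_in X Y by simp
    then have "isomorphic C (X \<boxtimes>\<^bsub>C\<^esub> Y) (Y \<boxtimes>\<^bsub>C\<^esub> X)"
      using C.equivalence_reflects_iso[OF equivalence] C.tob_in X Y by simp
    then show "x \<otimes>\<^bsub>unit_group C\<^esub> y = y \<otimes>\<^bsub>unit_group C\<^esub> x"
      using X Y C.tob_in by (simp add: units_of_mult C.iso_monoid_mult C.iso_class_eq)
  qed
qed

end

lemma equivariantization_locale:
  fixes C :: "('o, 'a::ab_group_add, 'k::alg_closed_field) tensor_category"
    and D :: "('p, 'b::ab_group_add, 'k) tensor_category"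
  assumes fC: "fusion_category C" and fD: "fusion_category D" and G: "group G" and eq: "is_equivariantization G C D"
  obtains \<rho> \<gamma> \<upsilon> F where "fusion_equivariantization G D \<rho> \<gamma> \<upsilon> C F"
proof -
  interpret D: semisimple_monoidal_category D by (rule fusion_semisimple_monoidal[OF fD])
  interpret C: semisimple_monoidal_category C by (rule fusion_semisimple_monoidal[OF fC])
  interpret G: group G by (rule G)
  obtain \<rho> \<gamma> \<upsilon> F where a: "tensor_action G D \<rho> \<gamma> \<upsilon>" "is_tensor_equivalence C (equivariantization G D \<rho> \<gamma> \<upsilon>) F"
    using eq unfolding is_equivariantization_def tensor_equivalent_def by blast
  interpret tensor_action G D \<rho> \<gamma> \<upsilon> by (rule a(1))
  have "fusion_equivariantization G D \<rho> \<gamma> \<upsilon> C F" by unfold_locales (rule a(2))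
  then show ?thesis by (rule that)
qed

text \<open>Bricks go to nonempty bases, and an elementary matrix is a nonzero arrow between any two
  of these. It comes from a nonzero arrow of C, where Schur's lemma applies.\<close>

lemma Vect_equivalent_brick_unit:
  fixes C :: "('o, 'a::ab_group_add, 'k::alg_closed_field) tensor_category"
  assumes fC: "fusion_category C" and eq: "tensor_equivalent C Vect" and X: "brick C X"
  shows "isomorphic C (unit_ob C) X"
proof -
  interpret C: semisimple_monoidal_category C by (rule fusion_semisimple_monoidal[OF fC])
  obtain F where F: "is_tensor_equivalence C Vect F" using eq by (auto simp: tensor_equivalent_def)
  note F' = C.equivalence_functor[OF F]
  have ne: "fob F Y \<noteq> {}" if Y: "brick C Y" for Y
  proof
    assume e: "fob F Y = {}"
    have YO: "Y \<in> Ob C" using Y by (rule C.brick_Ob)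
    have "far F Y Y (idn C Y) = 0"
      using is_tensor_functor.far_idn[OF F' YO] e by (simp add: Vect_def mat_idn_def fun_eq_iff)
    then have "far F Y Y (idn C Y) = far F Y Y 0" using C.far_zero[OF F' YO YO] by simp
    then have "idn C Y = 0"
      using C.equivalence_Hom(2)[OF F YO YO] C.idn_in[OF YO] C.zero_in[OF YO YO] by (simp add: inj_on_eq_iff)
    then show False using Y by (simp add: brick_def)
  qed
  have O: "unit_ob C \<in> Ob C" "X \<in> Ob C" using C.unit_in X C.brick_Ob by auto
  obtain a b where ab: "a \<in> fob F (unit_ob C)" "b \<in> fob F X" using ne[OF C.brick_unit] ne[OF X] by blast
  let ?m = "\<lambda>i j. of_bool (i = b \<and> j = a) :: 'k"
  have "?m \<in> Hom Vect (fob F (unit_ob C)) (fob F X)" using ab by (auto simp: Vect_def)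
  then obtain f where f: "f \<in> Hom C (unit_ob C) X" "?m = far F (unit_ob C) X f"
    using C.equivalence_Hom(1)[OF F O] by blast
  have "f \<noteq> 0"
  proof
    assume "f = 0"
    then have "?m = 0" using f(2) C.far_zero[OF F' O] by simp
    from fun_cong[OF fun_cong[OF this, of b], of a] show False by simp
  qed
  then show ?thesis by (intro isomorphicI[OF C.schur[OF C.brick_unit X f(1)]])
qed

theorem solvable_chain_unit_group:
  fixes \<C> :: "nat \<Rightarrow> ('p, 'b::ab_group_add, 'k::alg_closed_field) tensor_category" and \<G> :: "nat \<Rightarrow> int monoid"
  assumes fus: "\<forall>i\<le>n. fusion_category (\<C> i)" and base: "tensor_equivalent (\<C> 0) Vect"
    and step: "\<forall>i\<in>{1..n}. group (\<G> i) \<and> cyclic_group (\<G> i) \<and> prime (order (\<G> i)) \<and>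
           (is_equivariantization (\<G> i) (\<C> i) (\<C> (i - 1)) \<or> is_extension (\<G> i) (\<C> i) (\<C> (i - 1)))"
    and "i \<le> n"
  shows "solvable (unit_group (\<C> i))"
  using \<open>i \<le> n\<close>
proof (induction i)
  case 0
  have f: "fusion_category (\<C> 0)" using fus by simp
  interpret C: semisimple_monoidal_category "\<C> 0" by (rule fusion_semisimple_monoidal[OF f])
  interpret U: group "unit_group (\<C> 0)" by (rule C.unit_group_is_group)
  have "x = \<one>\<^bsub>unit_group (\<C> 0)\<^esub>" if x: "x \<in> carrier (unit_group (\<C> 0))" for x
  proof -
    obtain X where X: "X \<in> Ob (\<C> 0)" "x = iso_class (\<C> 0) X" using C.unit_group_classE[OF x] .
    then have "brick (\<C> 0) X" using C.Units_brick x by (simp add: units_of_carrier)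
    then have "isomorphic (\<C> 0) (unit_ob (\<C> 0)) X" by (rule Vect_equivalent_brick_unit[OF f base])
    then show ?thesis using X C.unit_in C.isomorphic_sym
      by (simp add: units_of_one C.iso_monoid_one C.iso_class_eq)
  qed
  then have "carrier (unit_group (\<C> 0)) = {\<one>\<^bsub>unit_group (\<C> 0)\<^esub>}" using U.one_closed by blast
  then have "(derived (unit_group (\<C> 0)) ^^ 0) (carrier (unit_group (\<C> 0))) = {\<one>\<^bsub>unit_group (\<C> 0)\<^esub>}" by simp
  then show ?case using U.solvable_iff_trivial_derived_seq by blast
next
  case (Suc i)
  have f: "fusion_category (\<C> (Suc i))" "fusion_category (\<C> i)" using fus Suc.prems by auto
  have s: "group (\<G> (Suc i))" "cyclic_group (\<G> (Suc i))"
    "is_equivariantization (\<G> (Suc i)) (\<C> (Suc i)) (\<C> i) \<or> is_extension (\<G> (Suc i)) (\<C> (Suc i)) (\<C> i)"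
    using bspec[OF step, of "Suc i"] Suc.prems by auto
  have IH: "solvable (unit_group (\<C> i))" using Suc by simp
  from s(3) show ?case
  proof
    assume "is_equivariantization (\<G> (Suc i)) (\<C> (Suc i)) (\<C> i)"
    then obtain \<rho> \<gamma> \<upsilon> F where "fusion_equivariantization (\<G> (Suc i)) (\<C> i) \<rho> \<gamma> \<upsilon> (\<C> (Suc i)) F"
      using equivariantization_locale[OF f s(1)] by blast
    then show ?thesis using fusion_equivariantization.unit_group_solvable IH by blast
  next
    assume e: "is_extension (\<G> (Suc i)) (\<C> (Suc i)) (\<C> i)"
    have "comm_group (\<G> (Suc i))" using group.cyclic_imp_abelian_group[OF s(1,2)] .
    then show ?thesis using unit_group_solvable_extension[OF f _ e IH] by blast
  qed
qed

section \<open>Representations\<close>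

text \<open>The composite in the other order is a scalar c on the brick, and c fixes the nonzero
  arrow g, so c = 1.\<close>

lemma (in linear_category) iso_of_split_brick:
  assumes X: "brick C X" and V: "V \<in> Ob C" "idn C V \<noteq> 0" and f: "f \<in> Hom C X V" and g: "g \<in> Hom C V X"
    and fg: "f \<odot> g = idn C V"
  shows "isomorphic C V X"
proof -
  have XO: "X \<in> Ob C" using X by (rule brick_Ob)
  obtain c where c: "g \<odot> f = scl C c (idn C X)" using X cmp_in[OF XO V(1) XO f g] by (auto simp: brick_def)
  have "scl C c g = g \<odot> f \<odot> g" unfolding c
    using cmp_scl_left[OF V(1) XO XO g idn_in[OF XO]] idn_left[OF V(1) XO g] by simp
  also have "\<dots> = g" using cmp_assoc[OF V(1) XO V(1) XO g f g] fg idn_right[OF V(1) XO g] by simp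
  finally have "scl C (c - 1) g = 0" by (simp add: scale_left_diff_distrib)
  moreover have "g \<noteq> 0" using fg V cmp_zero_right[OF V(1) XO V(1) f] by auto
  ultimately have "c = 1" by simp
  then show ?thesis using c fg f g by (intro isomorphicI[of _ _ _ g] iso_arrI[of _ _ _ _ f]) auto
qed

text \<open>Stands in for the theory of semisimple algebras. If every nonzero object has a member of
  \<open>L\<close> as a retract, then a brick is isomorphic to such a retract, arrows between bricks
  reduce to arrows between members of \<open>L\<close>, and a simple object is isomorphic to its
  retract.\<close>

lemma (in linear_category) schur_of_representatives:
  assumes L: "\<And>V. V \<in> L \<Longrightarrow> brick C V"
    and dich: "\<And>V W. V \<in> L \<Longrightarrow> W \<in> L \<Longrightarrow> isomorphic C V W \<or> Hom C V W = {0}"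
    and split: "\<And>X. X \<in> Ob C \<Longrightarrow> idn C X \<noteq> 0 \<Longrightarrow> \<exists>V\<in>L. \<exists>f\<in>Hom C X V. \<exists>g\<in>Hom C V X. f \<odot> g = idn C V"
  shows "schur_category C" and "\<And>X. simple_ob C X \<longleftrightarrow> brick C X"
    and "\<And>X. brick C X \<Longrightarrow> \<exists>V\<in>L. isomorphic C V X"
proof -
  show rep: "\<exists>V\<in>L. isomorphic C V X" if X: "brick C X" for X
  proof -
    obtain V f g where V: "V \<in> L" "f \<in> Hom C X V" "g \<in> Hom C V X" "f \<odot> g = idn C V"
      using split[of X] X by (auto simp: brick_def)
    then have "isomorphic C V X" using iso_of_split_brick[OF X _ _ V(2,3,4)] L[OF V(1)] by (auto simp: brick_def)
    then show ?thesis using V by blast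
  qed
  \<comment> \<open>A nonzero arrow makes the representatives of X and Y isomorphic by the
    dichotomy. Then X and Y are isomorphic, and since X has scalar endomorphisms, f is a nonzero
    multiple of an isomorphism \<open>u\<close>.\<close>
  have schur: "iso_arr C X Y f" if X: "brick C X" and Y: "brick C Y" and f: "f \<in> Hom C X Y" "f \<noteq> 0" for X Y f
  proof -
    obtain V W where V: "V \<in> L" "isomorphic C V X" and W: "W \<in> L" "isomorphic C W Y" using rep X Y by blast
    have O: "X \<in> Ob C" "Y \<in> Ob C" "V \<in> Ob C" "W \<in> Ob C" using X Y L V W brick_Ob by auto
    obtain a where a: "iso_arr C V X a" using V by (auto simp: isomorphic_def)
    obtain b where b: "iso_arr C Y W b" using isomorphic_sym[OF W(2)] by (auto simp: isomorphic_def)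
    note aH = iso_arr_Hom[OF a] and bH = iso_arr_Hom[OF b]
    have fa: "f \<odot> a \<in> Hom C V Y" by (rule cmp_in[OF O(3,1,2) aH f(1)])
    have bfa: "b \<odot> (f \<odot> a) \<in> Hom C V W" by (rule cmp_in[OF O(3,2,4) fa bH])
    have "f \<odot> a \<noteq> 0"
      using iso_cancel_right[OF O(3,1,2) a f(1) zero_in[OF O(1,2)]] cmp_zero_left[OF O(3,1,2) aH] f(2) by auto
    then have "b \<odot> (f \<odot> a) \<noteq> 0"
      using iso_cancel_left[OF O(3,2,4) b fa zero_in[OF O(3,2)]] cmp_zero_right[OF O(3,2,4) bH] by auto
    then have "isomorphic C V W" using dich[OF V(1) W(1)] bfa by auto
    then have "isomorphic C X W" by (rule isomorphic_trans[OF O(1,3,4) isomorphic_sym[OF V(2)]])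
    then have "isomorphic C X Y" using isomorphic_trans[OF O(1,4,2) _ W(2)] by simp
    then obtain u where u: "iso_arr C X Y u" by (auto simp: isomorphic_def)
    note i = inv_arr[OF O(1,2) u] and uH = iso_arr_Hom[OF u]
    obtain c where c: "inv_arr C X Y u \<odot> f = scl C c (idn C X)"
      using X cmp_in[OF O(1,2,1) f(1) i(1)] by (auto simp: brick_def)
    have "f = u \<odot> (inv_arr C X Y u \<odot> f)"
      using cmp_assoc[OF O(1,2,1,2) f(1) i(1) uH] i idn_left[OF O(1,2) f(1)] by simp
    then have fu: "f = scl C c u" unfolding c
      using cmp_scl_right[OF O(1,1,2) idn_in[OF O(1)] uH] idn_right[OF O(1,2) uH] by simp
    then have "c \<noteq> 0" using f by auto
    show ?thesis
      by (rule iso_arrI[of _ _ _ _ "scl C (inverse c) (inv_arr C X Y u)"])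
        (use fu f(1) i O uH scl_in[OF O(2,1) i(1)] \<open>c \<noteq> 0\<close> scl_in[OF O(1,2) uH]
          cmp_scl_left[OF O(1,2,1) _ i(1)] cmp_scl_right[OF O(1,2,1) uH i(1)]
          cmp_scl_left[OF O(2,1,2) _ uH] cmp_scl_right[OF O(2,1,2) i(1) uH] in auto)
  qed
  show "schur_category C" by unfold_locales (rule schur)
  show "simple_ob C X \<longleftrightarrow> brick C X" for X
  proof
    assume X: "simple_ob C X"
    then have XO: "X \<in> Ob C" "idn C X \<noteq> 0" by (auto simp: simple_ob_def zero_ob_def)
    obtain V f g where V: "V \<in> L" "f \<in> Hom C X V" "g \<in> Hom C V X" "f \<odot> g = idn C V" using split[OF XO] by blast
    have VO: "V \<in> Ob C" using L V brick_Ob by auto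
    have "mono_arr C V X g" unfolding mono_arr_def
    proof (intro conjI ballI impI)
      fix W h k assume W: "W \<in> Ob C" "h \<in> Hom C W V" "k \<in> Hom C W V" "g \<odot> h = g \<odot> k"
      have "h = f \<odot> (g \<odot> h)" "k = f \<odot> (g \<odot> k)"
        using cmp_assoc[OF W(1) VO XO(1) VO W(2) V(3,2)] cmp_assoc[OF W(1) VO XO(1) VO W(3) V(3,2)] V(4)
          idn_left[OF W(1) VO W(2)] idn_left[OF W(1) VO W(3)] by simp_all
      then show "h = k" using W(4) by metis
    qed (rule V)
    then have "isomorphic C V X" using X VO brick_not_zero[OF L[OF V(1)]] isomorphicI unfolding simple_ob_def by metis
    then show "brick C X" by (rule brick_iso[OF L[OF V(1)] XO(1)])
  next
    assume X: "brick C X"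
    have XO: "X \<in> Ob C" using X by (rule brick_Ob)
    have "zero_ob C Y \<or> iso_arr C Y X f" if Y: "Y \<in> Ob C" and f: "mono_arr C Y X f" for Y f
    proof (cases "zero_ob C Y")
      case False
      then have Y0: "idn C Y \<noteq> 0" using Y by (simp add: zero_ob_def)
      have fH: "f \<in> Hom C Y X" using f by (simp add: mono_arr_def)
      obtain V p g where V: "V \<in> L" "p \<in> Hom C Y V" "g \<in> Hom C V Y" "p \<odot> g = idn C V" using split[OF Y Y0] by blast
      have VO: "V \<in> Ob C" and V0: "idn C V \<noteq> 0" using L V by (auto simp: brick_def)
      have g0: "g \<noteq> 0" using V V0 cmp_zero_right[OF VO Y VO V(2)] by auto
      have fg: "f \<odot> g \<in> Hom C V X" by (rule cmp_in[OF VO Y XO V(3) fH])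
      have "f \<odot> g \<noteq> f \<odot> 0" using f VO V(3) g0 zero_in[OF VO Y] by (auto simp: mono_arr_def)
      then have "f \<odot> g \<noteq> 0" using cmp_zero_right[OF VO Y XO fH] by simp
      then have iso: "iso_arr C V X (f \<odot> g)" by (rule schur[OF L[OF V(1)] X fg])
      note i = inv_arr[OF VO XO iso]
      define k where "k = g \<odot> inv_arr C V X (f \<odot> g)"
      have k: "k \<in> Hom C X Y" unfolding k_def by (rule cmp_in[OF XO VO Y i(1) V(3)])
      have fk: "f \<odot> k = idn C X" unfolding k_def using cmp_assoc[OF XO VO Y XO i(1) V(3) fH] i by simp
      have "f \<odot> (k \<odot> f) = f \<odot> idn C Y"
        using cmp_assoc[OF Y XO Y XO fH k fH] fk idn_left[OF Y XO fH] idn_right[OF Y XO fH] by simp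
      then have "k \<odot> f = idn C Y" using f Y cmp_in[OF Y XO Y fH k] idn_in[OF Y] by (auto simp: mono_arr_def)
      then show ?thesis using iso_arrI[OF fH k] fk by simp
    qed simp
    then show "simple_ob C X" using XO brick_not_zero[OF X] by (simp add: simple_ob_def)
  qed
qed

subsection \<open>Matrices\<close>

lemma mat_cmp_sum:
  assumes "finite B" "\<And>p. T p j \<noteq> 0 \<Longrightarrow> p \<in> B"
  shows "mat_cmp S T i j = (\<Sum>p\<in>B. S i p * T p j)"
  unfolding mat_cmp_def by (rule sum.mono_neutral_left) (use assms in auto)

lemma Hom_Vect: "S \<in> Hom Vect A B \<longleftrightarrow> (\<forall>i j. S i j \<noteq> 0 \<longrightarrow> i \<in> B \<and> j \<in> A)"
  by (simp add: Vect_def)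

lemma mat_cmp_Hom:
  assumes "T \<in> Hom Vect A B" "finite B"
  shows "mat_cmp S T i j = (\<Sum>p\<in>B. S i p * T p j)"
  by (rule mat_cmp_sum) (use assms in \<open>auto simp: Hom_Vect\<close>)

lemma mat_cmp_in: "S \<in> Hom Vect B C \<Longrightarrow> T \<in> Hom Vect A B \<Longrightarrow> mat_cmp S T \<in> Hom Vect A C"
  unfolding Hom_Vect mat_cmp_def
proof (intro allI impI)
  fix i j assume S: "\<forall>i j. S i j \<noteq> 0 \<longrightarrow> i \<in> C \<and> j \<in> B" and T: "\<forall>i j. T i j \<noteq> 0 \<longrightarrow> i \<in> B \<and> j \<in> A"
    and "(\<Sum>p | T p j \<noteq> 0. S i p * T p j) \<noteq> 0"
  then obtain p where "S i p * T p j \<noteq> 0" by (meson sum.not_neutral_contains_not_neutral)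
  then show "i \<in> C \<and> j \<in> A" using S T by auto
qed

lemma mat_cmp_assoc:
  assumes "finite B" "finite C" "R \<in> Hom Vect A B" "S \<in> Hom Vect B C"
  shows "mat_cmp T (mat_cmp S R) = mat_cmp (mat_cmp T S) R"
proof (intro ext)
  fix i j
  have "mat_cmp T (mat_cmp S R) i j = (\<Sum>p\<in>C. T i p * (\<Sum>q\<in>B. S p q * R q j))"
    using mat_cmp_Hom[OF mat_cmp_in[OF assms(4,3)] assms(2)] mat_cmp_Hom[OF assms(3,1)] by simp
  also have "\<dots> = (\<Sum>q\<in>B. (\<Sum>p\<in>C. T i p * S p q) * R q j)"
    by (simp add: sum_distrib_left sum_distrib_right mult.assoc) (rule sum.swap)
  also have "\<dots> = mat_cmp (mat_cmp T S) R i j"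
    using mat_cmp_Hom[OF assms(3,1)] mat_cmp_Hom[OF assms(4,2)] by simp
  finally show "mat_cmp T (mat_cmp S R) i j = mat_cmp (mat_cmp T S) R i j" .
qed

text \<open>The sum in \<open>mat_cmp\<close> runs over the support of a column of the right factor.
  Hence linearity in the left factor is unconditional, while linearity in the right factor needs a
  common finite index set.\<close>

lemma mat_cmp_add_left: "mat_cmp (S + S') T = mat_cmp S T + mat_cmp S' T"
  by (intro ext) (simp add: mat_cmp_def sum.distrib distrib_right)

lemma mat_cmp_scl_left: "mat_cmp (mat_scl c S) T = mat_scl c (mat_cmp S T)"
  by (intro ext) (simp add: mat_cmp_def mat_scl_def sum_distrib_left mult.assoc)

lemma Hom_Vect_add: "S \<in> Hom Vect A B \<Longrightarrow> T \<in> Hom Vect A B \<Longrightarrow> S + T \<in> Hom Vect A B"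
  unfolding Hom_Vect by (metis add.right_neutral plus_fun_apply)

lemma Hom_Vect_scl: "S \<in> Hom Vect A B \<Longrightarrow> mat_scl c S \<in> Hom Vect A B"
  unfolding Hom_Vect by (auto simp: mat_scl_def)

lemma Hom_Vect_0: "0 \<in> Hom Vect A B"
  by (simp add: Hom_Vect)

lemma Hom_Vect_sum: "(\<And>i. i \<in> I \<Longrightarrow> S i \<in> Hom Vect A B) \<Longrightarrow> sum S I \<in> Hom Vect A B"
  by (induction I rule: infinite_finite_induct) (auto simp: Hom_Vect_0 Hom_Vect_add)

lemma mat_idn_in: "mat_idn A \<in> Hom Vect A A"
  by (auto simp: Hom_Vect mat_idn_def)

lemma mat_cmp_add_right:
  assumes "finite B" "T \<in> Hom Vect A B" "T' \<in> Hom Vect A B"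
  shows "mat_cmp S (T + T') = mat_cmp S T + mat_cmp S T'"
  by (intro ext)
    (simp add: mat_cmp_Hom[OF assms(2,1)] mat_cmp_Hom[OF assms(3,1)] mat_cmp_Hom[OF Hom_Vect_add[OF assms(2,3)] assms(1)]
      sum.distrib distrib_left)

lemma mat_scl_apply: "mat_scl c S i j = c * S i j" by (simp add: mat_scl_def)

lemma mat_cmp_scl_right:
  assumes "finite B" "T \<in> Hom Vect A B"
  shows "mat_cmp S (mat_scl c T) = mat_scl c (mat_cmp S T)"
  by (intro ext)
    (simp add: mat_cmp_Hom[OF assms(2,1)] mat_cmp_Hom[OF Hom_Vect_scl[OF assms(2)] assms(1)] mat_scl_apply
      sum_distrib_left mult.left_commute)

lemma mat_cmp_sum_left: "mat_cmp (sum S I) T = (\<Sum>i\<in>I. mat_cmp (S i) T)"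
proof (induction I rule: infinite_finite_induct)
  case (insert i I)
  then show ?case by (simp only: sum.insert[OF insert.hyps(1,2)] mat_cmp_add_left)
qed (auto simp: mat_cmp_def fun_eq_iff)

lemma mat_cmp_sum_right:
  assumes "finite B" "\<And>i. i \<in> I \<Longrightarrow> T i \<in> Hom Vect A B"
  shows "mat_cmp S (sum T I) = (\<Sum>i\<in>I. mat_cmp S (T i))"
  using assms(2)
proof (induction I rule: infinite_finite_induct)
  case (insert i I)
  have "mat_cmp S (T i + sum T I) = mat_cmp S (T i) + mat_cmp S (sum T I)"
    by (rule mat_cmp_add_right[OF assms(1)]) (use insert.prems in \<open>auto intro: Hom_Vect_sum\<close>)
  moreover have "mat_cmp S (sum T I) = (\<Sum>i\<in>I. mat_cmp S (T i))" by (rule insert.IH) (use insert.prems in auto)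
  ultimately show ?case by (simp only: sum.insert[OF insert.hyps(1,2)])
qed (auto simp: mat_cmp_def fun_eq_iff)

lemma mat_cmp_idn_left: 
  assumes "finite B" "T \<in> Hom Vect A B" 
  shows "mat_cmp (mat_idn B) T = T"
proof (intro ext)
  fix i j
  have "mat_cmp (mat_idn B) T i j = (\<Sum>p\<in>B. if p = i then T i j else 0)"
    unfolding mat_cmp_Hom[OF assms(2,1)] by (rule sum.cong) (auto simp: mat_idn_def)
  then show "mat_cmp (mat_idn B) T i j = T i j" using assms by (auto simp: Hom_Vect)
qed

lemma mat_cmp_idn_right:
  assumes "finite A" "T \<in> Hom Vect A B" 
  shows "mat_cmp T (mat_idn A) = T"
proof (intro ext)
  fix i j
  have "mat_cmp T (mat_idn A) i j = (\<Sum>p\<in>A. if p = j then T i j else 0)"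
    unfolding mat_cmp_Hom[OF mat_idn_in assms(1)] by (rule sum.cong) (auto simp: mat_idn_def)
  then show "mat_cmp T (mat_idn A) i j = T i j" using assms by (auto simp: Hom_Vect)
qed

lemma mat_tar_in:
  assumes "S \<in> Hom Vect A B" "T \<in> Hom Vect A' B'"
  shows "mat_tar S T \<in> Hom Vect (mat_tob A A') (mat_tob B B')"
  unfolding Hom_Vect
proof (intro allI impI)
  fix i j assume nz: "mat_tar S T i j \<noteq> 0"
  obtain a b c d where ij: "i = prod_encode (a, b)" "j = prod_encode (c, d)" by (metis prod.exhaust prod_decode_inverse)
  have "S a c \<noteq> 0" "T b d \<noteq> 0" using nz by (auto simp: mat_tar_def ij)
  then show "i \<in> mat_tob B B' \<and> j \<in> mat_tob A A'" using assms by (simp add: Hom_Vect mat_tob_def ij)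
qed

lemma mat_tar_idn: "mat_tar (mat_idn A) (mat_idn B) = mat_idn (mat_tob A B)"
proof (intro ext)
  fix i j
  obtain a b c d where "i = prod_encode (a, b)" "j = prod_encode (c, d)" by (metis prod.exhaust prod_decode_inverse)
  then show "mat_tar (mat_idn A) (mat_idn B) i j = mat_idn (mat_tob A B) i j"
    by (auto simp: mat_tar_def mat_idn_def mat_tob_def)
qed

lemma mat_tar_cmp:
  assumes "finite B" "finite B'" "T \<in> Hom Vect A B" "T' \<in> Hom Vect A' B'"
  shows "mat_cmp (mat_tar S S') (mat_tar T T') = mat_tar (mat_cmp S T) (mat_cmp S' T')"
proof (intro ext)
  fix i j
  obtain a b c d where ij: "i = prod_encode (a, b)" "j = prod_encode (c, d)" by (metis prod.exhaust prod_decode_inverse)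
  have f: "finite (mat_tob B B')" using assms by (simp add: mat_tob_def)
  have inj: "inj_on prod_encode (B \<times> B')" by (simp add: inj_prod_encode)
  have "mat_cmp (mat_tar S S') (mat_tar T T') i j = (\<Sum>p\<in>mat_tob B B'. mat_tar S S' i p * mat_tar T T' p j)"
    by (rule mat_cmp_Hom[OF mat_tar_in[OF assms(3,4)] f])
  also have "\<dots> = (\<Sum>(p, q)\<in>B \<times> B'. (S a p * S' b q) * (T p c * T' q d))"
    unfolding mat_tob_def sum.reindex[OF inj] by (rule sum.cong) (auto simp: mat_tar_def ij)
  also have "\<dots> = (\<Sum>p\<in>B. S a p * T p c) * (\<Sum>q\<in>B'. S' b q * T' q d)"
    by (simp add: sum_product sum.cartesian_product mult_ac)
  also have "\<dots> = mat_tar (mat_cmp S T) (mat_cmp S' T') i j"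
    by (simp add: mat_tar_def ij mat_cmp_Hom[OF assms(3,1)] mat_cmp_Hom[OF assms(4,2)])
  finally show "mat_cmp (mat_tar S S') (mat_tar T T') i j = mat_tar (mat_cmp S T) (mat_cmp S' T') i j" .
qed

interpretation mat: vector_space "mat_scl :: 'k::field \<Rightarrow> _"
  by unfold_locales (auto simp: mat_scl_def fun_eq_iff algebra_simps)

subsection \<open>The category of representations\<close>

lemma Rep_simps: "Ob (Rep H) = reps H" "scl (Rep H) = mat_scl" "cmp (Rep H) = mat_cmp" "idn (Rep H) (A, \<rho>) = mat_idn A"
  "tar (Rep H) = mat_tar"
  by (simp_all add: Rep_def)

lemma Hom_Rep: "S \<in> Hom (Rep H) (A, \<rho>) (B, \<sigma>) \<longleftrightarrow> S \<in> Hom Vect A B \<and> (\<forall>b \<in> hbas H. mat_cmp S (\<rho> b) = mat_cmp (\<sigma> b) S)"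
  by (simp add: Rep_def)

lemma repsD:
  assumes "(A, \<rho>) \<in> reps H"
  shows "finite A" "b \<in> hbas H \<Longrightarrow> \<rho> b \<in> Hom Vect A A"
  using assms by (auto simp: reps_def)

lemma linear_category_Rep: "linear_category (Rep H :: (_, _, 'k::field) tensor_category)"
proof -
  have V: "vector_space (scl (Rep H) :: 'k \<Rightarrow> _)" unfolding Rep_simps by (rule mat.vector_space_axioms)
  show ?thesis
  proof (intro linear_category.intro[OF V] linear_category_axioms.intro)
    fix X Y assume O: "X \<in> Ob (Rep H)" "Y \<in> Ob (Rep H)"
    obtain A \<rho> B \<sigma> where [simp]: "X = (A, \<rho>)" "Y = (B, \<sigma>)" by (metis surj_pair)
    have f: "finite A" "finite B" using O repsD(1) by (auto simp: Rep_simps)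
    have \<rho>: "b \<in> hbas H \<Longrightarrow> \<rho> b \<in> Hom Vect A A" for b using O repsD(2) by (auto simp: Rep_simps)
    show "module.subspace (scl (Rep H)) (Hom (Rep H) X Y)"
      unfolding Rep_simps
    proof (rule mat.subspaceI)
      have "mat_cmp 0 T = (0 :: nat \<Rightarrow> nat \<Rightarrow> 'k)" "mat_cmp T 0 = (0 :: nat \<Rightarrow> nat \<Rightarrow> 'k)" for T
        by (auto simp: mat_cmp_def fun_eq_iff)
      then show "0 \<in> Hom (Rep H) X Y" by (simp only: Hom_Rep Hom_Vect_0 \<open>X = _\<close> \<open>Y = _\<close>) simp
    next
      fix S T assume S: "S \<in> Hom (Rep H) X Y" and T: "T \<in> Hom (Rep H) X Y"
      have "mat_cmp (S + T) (\<rho> b) = mat_cmp (\<sigma> b) (S + T)" if "b \<in> hbas H" for b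
        using S T that mat_cmp_add_right[OF f(2), of S A T "\<sigma> b"]
        by (simp only: mat_cmp_add_left Hom_Rep \<open>X = _\<close> \<open>Y = _\<close>)
      then show "S + T \<in> Hom (Rep H) X Y" 
        using S T Hom_Vect_add[of S A B T] by (simp only: Hom_Rep \<open>X = _\<close> \<open>Y = _\<close>) blast
    next
      fix c S assume S: "S \<in> Hom (Rep H) X Y"
      then have "mat_cmp (mat_scl c S) (\<rho> b) = mat_cmp (\<sigma> b) (mat_scl c S)" if "b \<in> hbas H" for b
        using that mat_cmp_scl_right[OF f(2), of S A "\<sigma> b"] by (simp add: mat_cmp_scl_left Hom_Rep)
      then show "mat_scl c S \<in> Hom (Rep H) X Y" using S by (simp add: Hom_Rep Hom_Vect_scl)
    qed
    fix S assume S: "S \<in> Hom (Rep H) X Y"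
    show "idn (Rep H) Y \<odot>\<^bsub>Rep H\<^esub> S = S" "S \<odot>\<^bsub>Rep H\<^esub> idn (Rep H) X = S"
      using S mat_cmp_idn_left[OF f(2), of S A] mat_cmp_idn_right[OF f(1), of S B] by (simp_all add: Rep_simps Hom_Rep)
  next
    fix X assume O: "X \<in> Ob (Rep H)"
    obtain A \<rho> where [simp]: "X = (A, \<rho>)" by fastforce
    show "idn (Rep H) X \<in> Hom (Rep H) X X"
    proof -
      have r: "(A, \<rho>) \<in> reps H" using O by (simp add: Rep_simps)
      show ?thesis
        by (simp add: Rep_simps Hom_Rep mat_idn_in)
          (simp add: mat_cmp_idn_left[OF repsD(1)[OF r] repsD(2)[OF r]] mat_cmp_idn_right[OF repsD(1)[OF r] repsD(2)[OF r]])
    qed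
  next
    fix X Y Z S T assume O: "X \<in> Ob (Rep H)" "Y \<in> Ob (Rep H)" "Z \<in> Ob (Rep H)" 
      and S: "S \<in> Hom (Rep H) X Y" and T: "T \<in> Hom (Rep H) Y Z"
    obtain A \<rho> B \<sigma> C \<tau> where [simp]: "X = (A, \<rho>)" "Y = (B, \<sigma>)" "Z = (C, \<tau>)" by (metis surj_pair)
    have f: "finite A" "finite B" "finite C" using O repsD(1) by (auto simp: Rep_simps)
    have r: "b \<in> hbas H \<Longrightarrow> \<rho> b \<in> Hom Vect A A \<and> \<sigma> b \<in> Hom Vect B B \<and> \<tau> b \<in> Hom Vect C C" for b
      using O repsD(2) by (auto simp: Rep_simps)
    have ST: "S \<in> Hom Vect A B" "T \<in> Hom Vect B C" using S T by (auto simp: Hom_Rep)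
    have "mat_cmp (mat_cmp T S) (\<rho> b) = mat_cmp (\<tau> b) (mat_cmp T S)" if b: "b \<in> hbas H" for b
    proof -
      have "mat_cmp (mat_cmp T S) (\<rho> b) = mat_cmp T (mat_cmp S (\<rho> b))"
        using mat_cmp_assoc[of A B "\<rho> b" A S T] f r[OF b] ST by simp
      also have "\<dots> = mat_cmp T (mat_cmp (\<sigma> b) S)" using S b by (simp add: Hom_Rep)
      also have "\<dots> = mat_cmp (mat_cmp T (\<sigma> b)) S"
        using mat_cmp_assoc[of B B S A "\<sigma> b" T] f r[OF b] ST by simp
      also have "\<dots> = mat_cmp (mat_cmp (\<tau> b) T) S" using T b by (simp add: Hom_Rep)
      also have "\<dots> = mat_cmp (\<tau> b) (mat_cmp T S)"
        using mat_cmp_assoc[of B C S A T "\<tau> b"] f r[OF b] ST by simp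
      finally show ?thesis .
    qed
    then show "T \<odot>\<^bsub>Rep H\<^esub> S \<in> Hom (Rep H) X Z"
      using ST mat_cmp_in by (auto simp: Rep_simps Hom_Rep)
    fix c
    show "scl (Rep H) c T \<odot>\<^bsub>Rep H\<^esub> S = scl (Rep H) c (T \<odot>\<^bsub>Rep H\<^esub> S)" by (simp add: Rep_simps mat_cmp_scl_left)
    show "T \<odot>\<^bsub>Rep H\<^esub> scl (Rep H) c S = scl (Rep H) c (T \<odot>\<^bsub>Rep H\<^esub> S)"
      using mat_cmp_scl_right[OF f(2) ST(1)] by (simp add: Rep_simps)
    fix T' show "(T + T') \<odot>\<^bsub>Rep H\<^esub> S = (T \<odot>\<^bsub>Rep H\<^esub> S) + (T' \<odot>\<^bsub>Rep H\<^esub> S)" by (simp add: Rep_simps mat_cmp_add_left)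
    fix S' assume "S' \<in> Hom (Rep H) X Y"
    then show "T \<odot>\<^bsub>Rep H\<^esub> (S + S') = (T \<odot>\<^bsub>Rep H\<^esub> S) + (T \<odot>\<^bsub>Rep H\<^esub> S')"
      using mat_cmp_add_right[OF f(2) ST(1)] by (simp add: Rep_simps Hom_Rep)
  next
    fix W X Y Z R S T assume O: "W \<in> Ob (Rep H)" "X \<in> Ob (Rep H)" "Y \<in> Ob (Rep H)" "Z \<in> Ob (Rep H)" 
      and H: "R \<in> Hom (Rep H) W X" "S \<in> Hom (Rep H) X Y" "T \<in> Hom (Rep H) Y Z"
    obtain A \<rho> B \<sigma> C \<tau> where [simp]: "W = (A, \<rho>)" "X = (B, \<sigma>)" "Y = (C, \<tau>)" by (metis surj_pair)
    obtain E \<theta> where [simp]: "Z = (E, \<theta>)" by fastforce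
    have f: "finite B" "finite C" using O repsD(1) by (auto simp: Rep_simps)
    show "T \<odot>\<^bsub>Rep H\<^esub> (S \<odot>\<^bsub>Rep H\<^esub> R) = T \<odot>\<^bsub>Rep H\<^esub> S \<odot>\<^bsub>Rep H\<^esub> R"
      using H mat_cmp_assoc[OF f, of R A S T] by (simp add: Rep_simps Hom_Rep)
  qed
qed

lemma tob_Rep: "(A, \<rho>) \<boxtimes>\<^bsub>Rep H\<^esub> (B, \<sigma>) = (mat_tob A B, \<lambda>b. if b \<in> hbas H
        then \<Sum>c \<in> hbas H. \<Sum>d \<in> hbas H. mat_scl (hcom H b c d) (mat_tar (\<rho> c) (\<sigma> d)) else 0)"
  by (simp add: Rep_def)

lemma mat_tar_Rep:
  assumes O: "(A, \<rho>) \<in> reps H" "(A', \<rho>') \<in> reps H" "(B, \<sigma>) \<in> reps H" "(B', \<sigma>') \<in> reps H"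
    and S: "S \<in> Hom (Rep H) (A, \<rho>) (A', \<rho>')" and T: "T \<in> Hom (Rep H) (B, \<sigma>) (B', \<sigma>')"
  shows "mat_tar S T \<in> Hom (Rep H) ((A, \<rho>) \<boxtimes>\<^bsub>Rep H\<^esub> (B, \<sigma>)) ((A', \<rho>') \<boxtimes>\<^bsub>Rep H\<^esub> (B', \<sigma>'))"
proof -
  have ST: "S \<in> Hom Vect A A'" "T \<in> Hom Vect B B'" using S T by (auto simp: Hom_Rep)
  note f = repsD(1)[OF O(1)] repsD(1)[OF O(2)] repsD(1)[OF O(3)] repsD(1)[OF O(4)]
  note r = repsD(2)[OF O(1)] repsD(2)[OF O(2)] repsD(2)[OF O(3)] repsD(2)[OF O(4)]
  have F: "finite (mat_tob A B)" "finite (mat_tob A' B')" using f by (simp_all add: mat_tob_def)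
  have cs: "mat_cmp (mat_tar S T) (mat_scl c M) = mat_scl c (mat_cmp (mat_tar S T) M)" 
    if "M \<in> Hom Vect (mat_tob A B) (mat_tob A B)" for c M using mat_cmp_scl_right[OF F(1) that] .
  have 1: "mat_cmp (mat_tar S T) (\<Sum>c \<in> hbas H. \<Sum>d \<in> hbas H. mat_scl (hcom H b c d) (mat_tar (\<rho> c) (\<sigma> d)))
     = (\<Sum>c \<in> hbas H. \<Sum>d \<in> hbas H. mat_scl (hcom H b c d) (mat_tar (mat_cmp S (\<rho> c)) (mat_cmp T (\<sigma> d))))" for b
  proof -
    have "mat_cmp (mat_tar S T) (\<Sum>c \<in> hbas H. \<Sum>d \<in> hbas H. mat_scl (hcom H b c d) (mat_tar (\<rho> c) (\<sigma> d)))
      = (\<Sum>c \<in> hbas H. mat_cmp (mat_tar S T) (\<Sum>d \<in> hbas H. mat_scl (hcom H b c d) (mat_tar (\<rho> c) (\<sigma> d))))"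
      by (rule mat_cmp_sum_right[OF F(1), of _ _ "mat_tob A B"]) (use r in \<open>auto intro!: Hom_Vect_sum Hom_Vect_scl mat_tar_in\<close>)
    also have "\<dots> = (\<Sum>c \<in> hbas H. \<Sum>d \<in> hbas H. mat_scl (hcom H b c d) (mat_tar (mat_cmp S (\<rho> c)) (mat_cmp T (\<sigma> d))))"
    proof (rule sum.cong[OF refl])
      fix c assume c: "c \<in> hbas H"
      have "mat_cmp (mat_tar S T) (\<Sum>d \<in> hbas H. mat_scl (hcom H b c d) (mat_tar (\<rho> c) (\<sigma> d)))
        = (\<Sum>d \<in> hbas H. mat_cmp (mat_tar S T) (mat_scl (hcom H b c d) (mat_tar (\<rho> c) (\<sigma> d))))"
        by (rule mat_cmp_sum_right[OF F(1), of _ _ "mat_tob A B"]) (use r c in \<open>auto intro!: Hom_Vect_scl mat_tar_in\<close>)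
      also have "\<dots> = (\<Sum>d \<in> hbas H. mat_scl (hcom H b c d) (mat_tar (mat_cmp S (\<rho> c)) (mat_cmp T (\<sigma> d))))"
        by (rule sum.cong[OF refl]) (simp add: cs mat_tar_in mat_tar_cmp[OF f(1,3) r(1)[OF c] r(3)] r c)
      finally show "mat_cmp (mat_tar S T) (\<Sum>d \<in> hbas H. mat_scl (hcom H b c d) (mat_tar (\<rho> c) (\<sigma> d))) = \<dots>" .
    qed
    finally show ?thesis .
  qed
  have 2: "mat_cmp (\<Sum>c \<in> hbas H. \<Sum>d \<in> hbas H. mat_scl (hcom H b c d) (mat_tar (\<rho>' c) (\<sigma>' d))) (mat_tar S T)
     = (\<Sum>c \<in> hbas H. \<Sum>d \<in> hbas H. mat_scl (hcom H b c d) (mat_tar (mat_cmp (\<rho>' c) S) (mat_cmp (\<sigma>' d) T)))" for b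
    by (simp add: mat_cmp_sum_left mat_cmp_scl_left mat_tar_cmp[OF f(2,4) ST])
  show ?thesis
    unfolding tob_Rep Hom_Rep using S T
    by (auto simp: mat_tar_in ST 1 2 Hom_Rep intro!: sum.cong)
qed

lemma isomorphic_Rep_tob:
  assumes O: "X \<in> Ob (Rep H)" "X' \<in> Ob (Rep H)" "Y \<in> Ob (Rep H)" "Y' \<in> Ob (Rep H)"
    and iso: "isomorphic (Rep H) X X'" "isomorphic (Rep H) Y Y'"
  shows "isomorphic (Rep H) (X \<boxtimes>\<^bsub>Rep H\<^esub> Y) (X' \<boxtimes>\<^bsub>Rep H\<^esub> Y')"
proof -
  obtain A \<rho> A' \<rho>' B \<sigma> where XY: "X = (A, \<rho>)" "X' = (A', \<rho>')" "Y = (B, \<sigma>)" by (metis surj_pair)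
  obtain B' \<sigma>' where XY': "Y' = (B', \<sigma>')" by fastforce
  note O' = O[unfolded Rep_simps XY XY']
  obtain S S' where S: "S \<in> Hom (Rep H) X X'" "S' \<in> Hom (Rep H) X' X" "mat_cmp S' S = mat_idn A" "mat_cmp S S' = mat_idn A'"
    using iso(1) by (auto simp: isomorphic_def iso_arr_def Rep_simps XY)
  obtain T T' where T: "T \<in> Hom (Rep H) Y Y'" "T' \<in> Hom (Rep H) Y' Y" "mat_cmp T' T = mat_idn B" "mat_cmp T T' = mat_idn B'"
    using iso(2) by (auto simp: isomorphic_def iso_arr_def Rep_simps XY XY')
  have V: "S \<in> Hom Vect A A'" "S' \<in> Hom Vect A' A" "T \<in> Hom Vect B B'" "T' \<in> Hom Vect B' B"
    using S T by (auto simp: XY XY' Hom_Rep)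
  note f = repsD(1)[OF O'(1)] repsD(1)[OF O'(2)] repsD(1)[OF O'(3)] repsD(1)[OF O'(4)]
  have idn: "idn (Rep H) (X \<boxtimes>\<^bsub>Rep H\<^esub> Y) = mat_idn (mat_tob A B)" "idn (Rep H) (X' \<boxtimes>\<^bsub>Rep H\<^esub> Y') = mat_idn (mat_tob A' B')"
    unfolding XY XY' tob_Rep by (simp_all add: Rep_simps)
  show ?thesis
  proof (rule isomorphicI[OF iso_arrI])
    show "mat_tar S T \<in> Hom (Rep H) (X \<boxtimes>\<^bsub>Rep H\<^esub> Y) (X' \<boxtimes>\<^bsub>Rep H\<^esub> Y')"
      using mat_tar_Rep[OF O'] S T by (simp add: XY XY')
    show "mat_tar S' T' \<in> Hom (Rep H) (X' \<boxtimes>\<^bsub>Rep H\<^esub> Y') (X \<boxtimes>\<^bsub>Rep H\<^esub> Y)"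
      using mat_tar_Rep[OF O'(2,1,4,3)] S T by (simp add: XY XY')
    show "mat_tar S' T' \<odot>\<^bsub>Rep H\<^esub> mat_tar S T = idn (Rep H) (X \<boxtimes>\<^bsub>Rep H\<^esub> Y)"
      unfolding idn Rep_simps mat_tar_cmp[OF f(2,4) V(1,3)] S T mat_tar_idn ..
    show "mat_tar S T \<odot>\<^bsub>Rep H\<^esub> mat_tar S' T' = idn (Rep H) (X' \<boxtimes>\<^bsub>Rep H\<^esub> Y')"
      unfolding idn Rep_simps mat_tar_cmp[OF f(1,3) V(2,4)] S T mat_tar_idn ..
  qed
qed

section \<open>Representations of the bismash product\<close>

text \<open>The action of the nontrivial element of C_2, defined on arbitrary functions so that its
  rules carry no side conditions.\<close>

definition flip :: "(nat \<Rightarrow> nat) \<Rightarrow> nat \<Rightarrow> nat" where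
  "flip s = transpose 1 2 \<circ> s \<circ> transpose 1 2"

lemma flip_flip [simp]: "flip (flip s) = s"
  by (simp add: flip_def fun_eq_iff)

lemma flip_eq_flip [simp]: "flip s = flip u \<longleftrightarrow> s = u"
  by (metis flip_flip)

lemma flip_comp: "flip (s \<circ> u) = flip s \<circ> flip u"
  by (simp add: flip_def fun_eq_iff)

lemma flip_id [simp]: "flip id = id"
  by (simp add: flip_def fun_eq_iff)

lemma sum_apply2: "(\<Sum>s\<in>S. f s) i j = (\<Sum>s\<in>S. f s i j)"
proof (induction S rule: infinite_finite_induct)
  case (insert s S)
  then show ?case by (simp only: sum.insert[OF insert.hyps(1,2)] plus_fun_apply)
qed auto

text \<open>Monomial matrices: column j has its only entry in row \<open>\<phi> j\<close>. The
  actions and most intertwiners below have this form, and composition with such a matrix on the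
  right is a substitution.\<close>

definition mono_mat :: "(nat \<Rightarrow> nat) \<Rightarrow> (nat \<Rightarrow> 'k::field) \<Rightarrow> nat set \<Rightarrow> nat \<Rightarrow> nat \<Rightarrow> 'k" where
  "mono_mat \<phi> a B = (\<lambda>i j. if j \<in> B \<and> i = \<phi> j then a j else 0)"

lemma mat_cmp_mono: "mat_cmp S (mono_mat \<phi> a B) i j = (if j \<in> B then S i (\<phi> j) * a j else 0)"
proof -
  have "mat_cmp S (mono_mat \<phi> a B) i j = (\<Sum>p\<in>{\<phi> j}. S i p * mono_mat \<phi> a B p j)"
    by (rule mat_cmp_sum) (auto simp: mono_mat_def split: if_splits)
  then show ?thesis by (simp add: mono_mat_def)
qed

lemma mono_mat_in: "(\<And>j. j \<in> A \<Longrightarrow> a j \<noteq> 0 \<Longrightarrow> \<phi> j \<in> B) \<Longrightarrow> mono_mat \<phi> a A \<in> Hom Vect A B"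
  by (auto simp: Hom_Vect mono_mat_def split: if_splits)

lemma sum_times_singleton: "sum f (S \<times> {y}) = (\<Sum>s\<in>S. f (s, y))"
  by (rule sum.reindex_bij_witness[of _ "\<lambda>s. (s, y)" fst]) auto

lemma mat_scl_of_bool: "mat_scl (of_bool P) M = (if P then M else 0)"
  by (auto simp: mat_scl_def fun_eq_iff)

locale bismash_degree =
  fixes n :: nat
  assumes n2: "n \<ge> 2"
begin

abbreviation "A \<equiv> carrier (alt_group n)"
abbreviation "K \<equiv> {id, transpose 1 2 :: nat \<Rightarrow> nat}"

lemma C2_eq: "C2 n = K"
proof
  have t: "transpose 1 2 \<in> carrier (sym_group n)" using n2 by (auto simp: sym_group_carrier intro!: permutes_swap_id)
  have "x \<in> K" if "x \<in> C2 n" for x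
    using that unfolding C2_def
  proof (induction rule: generate.induct)
    case (eng x y)
    then show ?case by (auto simp: sym_group_mult)
  qed (use t in \<open>auto simp: sym_group_one sym_group_inv_equality\<close>)
  then show "C2 n \<subseteq> K" by auto
  show "K \<subseteq> C2 n" using C2_id[OF n2] by (auto simp: C2_def intro: generate.incl)
qed

lemma transpose_not_id: "transpose 1 (2::nat) \<noteq> id"
  by (metis id_apply one_eq_numeral_iff semiring_norm(85) transpose_apply_first)

definition cj :: "(nat \<Rightarrow> nat) \<Rightarrow> (nat \<Rightarrow> nat) \<Rightarrow> nat \<Rightarrow> nat" where
  "cj x s = (if x = id then s else flip s)"

lemma conj_act_cj: "x \<in> K \<Longrightarrow> conj_act n s x = cj x s"
  using conj_eq[OF n2, of x s] by (auto simp: C2_eq cj_def flip_def inv_swap_id)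

lemma A_finite: "finite A"
  by (auto simp: alt_group_carrier intro: finite_subset[of _ "{p. p permutes {1..n}}"] finite_permutations)

lemma A_comp: "s \<in> A \<Longrightarrow> u \<in> A \<Longrightarrow> s \<circ> u \<in> A" by (rule alt_comp[OF n2])

lemma A_id: "id \<in> A" by (rule alt_id[OF n2])

lemma A_flip: "s \<in> A \<Longrightarrow> flip s \<in> A"
  using conj_in[OF n2, of "transpose 1 2" s] conj_act_cj[of "transpose 1 2" s] transpose_not_id
  by (simp add: C2_eq cj_def)

lemma hbas_H: "hbas (bismash n) = A \<times> K" by (simp add: bismash_def C2_eq)

lemma K_comp: "x \<in> K \<Longrightarrow> y \<in> K \<Longrightarrow> x \<circ> y \<in> K" by auto

lemma hmul_sum:
  assumes "s \<in> A" "x \<in> K" "u \<in> A" "y \<in> K"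
  shows "(\<Sum>d\<in>A \<times> K. mat_scl (hmul (bismash n) (s, x) (u, y) d :: 'k::field) (\<rho> d))
    = (if u = cj x s then \<rho> (s, x \<circ> y) else 0)"
proof -
  have m: "hmul (bismash n) (s, x) (u, y) d = (of_bool (u = cj x s \<and> d = (s, x \<circ> y)) :: 'k)" for d
    using conj_act_cj[OF assms(2)] by (cases d) (auto simp: bismash_def sym_group_mult)
  have "(\<Sum>d\<in>A \<times> K. mat_scl (hmul (bismash n) (s, x) (u, y) d :: 'k) (\<rho> d))
    = mat_scl (hmul (bismash n) (s, x) (u, y) (s, x \<circ> y)) (\<rho> (s, x \<circ> y))"
    using assms K_comp[of x y] A_finite
    by (intro sum_single) (simp_all add: m mat_scl_of_bool)
  then show ?thesis by (simp add: m mat_scl_of_bool)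
qed

lemma hone_sum: "(\<Sum>b\<in>A \<times> K. mat_scl (hone (bismash n) b :: 'k::field) (\<rho> b)) = (\<Sum>s\<in>A. \<rho> (s, id))"
proof -
  have "(\<Sum>b\<in>A \<times> K. mat_scl (hone (bismash n) b :: 'k) (\<rho> b))
    = (\<Sum>b\<in>A \<times> {id}. mat_scl (hone (bismash n) b) (\<rho> b))"
    using A_finite
    by (intro sum.mono_neutral_right) (auto simp: bismash_def sym_group_one mat_scl_def fun_eq_iff)
  also have "\<dots> = (\<Sum>b\<in>A \<times> {id}. \<rho> b)"
    by (rule sum.cong) (auto simp: bismash_def sym_group_one mat_scl_def)
  also have "\<dots> = (\<Sum>s\<in>A. \<rho> (s, id))"
    by (rule sum_times_singleton)
  finally show ?thesis .
qed

text \<open>A signed \<open>C\<^sub>2\<close>-set \<open>(B, \<pi>, \<epsilon>)\<close> with an equivariant map \<open>d\<close> to the alternating group gives a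
  representation on the span of \<open>B\<close>.\<close>

definition act :: "(nat \<Rightarrow> nat) \<Rightarrow> (nat \<Rightarrow> nat) \<Rightarrow> nat \<Rightarrow> nat" where
  "act \<pi> x j = (if x = id then j else \<pi> j)"

definition sgn_mat :: "nat set \<Rightarrow> (nat \<Rightarrow> nat \<Rightarrow> nat) \<Rightarrow> (nat \<Rightarrow> nat) \<Rightarrow> (nat \<Rightarrow> 'k::field) \<Rightarrow> 
    (nat \<Rightarrow> nat) \<times> (nat \<Rightarrow> nat) \<Rightarrow> nat \<Rightarrow> nat \<Rightarrow> 'k" where
  "sgn_mat B d \<pi> \<epsilon> = (\<lambda>(u, x). if u \<in> A \<and> x \<in> K
     then mono_mat (act \<pi> x) (\<lambda>j. if d (act \<pi> x j) = u then (if x = id then 1 else \<epsilon> j) else 0) B else 0)"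

definition sgn_rep :: "nat set \<Rightarrow> (nat \<Rightarrow> nat \<Rightarrow> nat) \<Rightarrow> (nat \<Rightarrow> nat) \<Rightarrow> (nat \<Rightarrow> 'k::field) \<Rightarrow> 
    nat set \<times> ((nat \<Rightarrow> nat) \<times> (nat \<Rightarrow> nat) \<Rightarrow> nat \<Rightarrow> nat \<Rightarrow> 'k)" where
  "sgn_rep B d \<pi> \<epsilon> = (B, sgn_mat B d \<pi> \<epsilon>)"

definition signed_set :: "nat set \<Rightarrow> (nat \<Rightarrow> nat \<Rightarrow> nat) \<Rightarrow> (nat \<Rightarrow> nat) \<Rightarrow> (nat \<Rightarrow> 'k::field) \<Rightarrow> bool" where
  "signed_set B d \<pi> \<epsilon> \<longleftrightarrow> finite B \<and> (\<forall>j\<in>B. \<pi> j \<in> B \<and> \<pi> (\<pi> j) = j \<and> d j \<in> A \<and> d (\<pi> j) = flip (d j) \<and> \<epsilon> j * \<epsilon> (\<pi> j) = 1)"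

lemma sgn_mat_apply:
  "u \<in> A \<Longrightarrow> x \<in> K \<Longrightarrow> sgn_mat B d \<pi> \<epsilon> (u, x) i j =
    (if j \<in> B \<and> i = act \<pi> x j \<and> d i = u then (if x = id then 1 else \<epsilon> j) else 0)"
  by (auto simp: sgn_mat_def mono_mat_def)

text \<open>The condition \<open>\<epsilon> j * \<epsilon> (\<pi> j) = 1\<close> makes the
  transposition act as an involution, and equivariance of \<open>d\<close> is the relation of the
  smash product between the transposition and the projections to the degrees.\<close>

lemma sgn_rep_Ob:
  assumes "signed_set B d \<pi> \<epsilon>"
  shows "sgn_rep B d \<pi> \<epsilon> \<in> Ob (Rep (bismash n))"
proof -
  have B: "finite B" "\<And>j. j \<in> B \<Longrightarrow> \<pi> j \<in> B" "\<And>j. j \<in> B \<Longrightarrow> \<pi> (\<pi> j) = j" "\<And>j. j \<in> B \<Longrightarrow> d j \<in> A"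
    "\<And>j. j \<in> B \<Longrightarrow> d (\<pi> j) = flip (d j)" "\<And>j. j \<in> B \<Longrightarrow> \<epsilon> j * \<epsilon> (\<pi> j) = 1"
    using assms by (auto simp: signed_set_def)
  let ?m = "sgn_mat B d \<pi> \<epsilon>"
  have in_Vect: "?m b \<in> Hom Vect B B" if "b \<in> A \<times> K" for b
    using that B by (auto simp: sgn_mat_def act_def intro!: mono_mat_in)
  have mult: "mat_cmp (?m (s, x)) (?m (u, y)) = (if u = cj x s then ?m (s, x \<circ> y) else 0)"
    if i: "s \<in> A" "x \<in> K" "u \<in> A" "y \<in> K" for s x u y
  proof (intro ext)
    fix i j
    have a: "act \<pi> x (act \<pi> y j) = act \<pi> (x \<circ> y) j" if "j \<in> B" for j
      using that i B transpose_not_id by (auto simp: act_def)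
    have da: "d (act \<pi> x j) = cj x (d j)" "act \<pi> x j \<in> B" if "j \<in> B" for x j using that B by (auto simp: act_def cj_def)
    have cc: "cj x (cj x s) = s" for s by (simp add: cj_def)
    have e: "(if x = id then 1 else \<epsilon> (act \<pi> y j)) * (if y = id then 1 else \<epsilon> j) = (if x \<circ> y = id then 1 else \<epsilon> j)" if "j \<in> B"
      using that i B(6)[OF that] transpose_not_id by (auto simp: act_def mult.commute)
    have xy: "x \<circ> y \<in> K" using K_comp i by blast
    have "mat_cmp (?m (s, x)) (?m (u, y)) i j = (if j \<in> B then 
      ?m (s, x) i (act \<pi> y j) * (if d (act \<pi> y j) = u then (if y = id then 1 else \<epsilon> j) else 0) else 0)"
      using i by (subst (2) sgn_mat_def) (simp add: mat_cmp_mono)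
    also have "\<dots> = (if u = cj x s then ?m (s, x \<circ> y) else 0) i j"
    proof (cases "j \<in> B")
      case True
      define q where "q = act \<pi> y j"
      have q: "q \<in> B" "act \<pi> x q = act \<pi> (x \<circ> y) j" "d (act \<pi> x q) = cj x (d q)"
        unfolding q_def by (rule da(2)[OF True] a[OF True] da(1)[OF da(2)[OF True]])+
      have eq: "(if x = id then 1 else \<epsilon> q) * (if y = id then 1 else \<epsilon> j) = (if x \<circ> y = id then 1 else \<epsilon> j)"
        unfolding q_def by (rule e[OF True])
      have l: "?m (s, x) i q = (if i = act \<pi> (x \<circ> y) j \<and> d i = s then (if x = id then 1 else \<epsilon> q) else 0)"
        using q by (simp add: sgn_mat_apply[OF i(1,2)])
      have r: "?m (s, x \<circ> y) i j = (if i = act \<pi> (x \<circ> y) j \<and> d i = s then (if x \<circ> y = id then 1 else \<epsilon> j) else 0)"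
        using True by (simp add: sgn_mat_apply[OF i(1) xy])
      have k: "d q = u \<longleftrightarrow> u = cj x s" if "i = act \<pi> (x \<circ> y) j" "d i = s"
        using that q cc by metis
      show ?thesis
      proof (cases "i = act \<pi> (x \<circ> y) j \<and> d i = s")
        case c: True
        then have k': "d q = u \<longleftrightarrow> u = cj x s" using k by blast
        show ?thesis
        proof (cases "u = cj x s")
          case u: True
          then have "(if d q = u then (if y = id then 1 else \<epsilon> j) else 0) = (if y = id then 1 else \<epsilon> j)" using k' by simp
          moreover have "?m (s, x) i q = (if x = id then 1 else \<epsilon> q)" "?m (s, x \<circ> y) i j = (if x \<circ> y = id then 1 else \<epsilon> j)"
            by (rule trans[OF l if_P[OF c]], rule trans[OF r if_P[OF c]])
          ultimately show ?thesis using True u eq unfolding q_def[symmetric] by presburger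
        next
          case False
          then show ?thesis using k' by (simp add: q_def[symmetric])
        qed
      next
        case False
        then have "?m (s, x) i q = 0" "?m (s, x \<circ> y) i j = 0"
          by (rule trans[OF l if_not_P], rule trans[OF r if_not_P])
        then show ?thesis unfolding q_def[symmetric] by (simp only: mult_zero_left if_cancel zero_fun_apply split: if_split) simp
      qed
    next
      case False
      then have "?m (s, x \<circ> y) i j = 0" by (intro trans[OF sgn_mat_apply[OF i(1) xy] if_not_P]) simp
      then show ?thesis using False by simp
    qed
    finally show "mat_cmp (?m (s, x)) (?m (u, y)) i j = (if u = cj x s then ?m (s, x \<circ> y) else 0) i j" .
  qed
  have one: "(\<Sum>s\<in>A. ?m (s, id)) = mat_idn B"
  proof (intro ext)
    fix i j
    have "(\<Sum>s\<in>A. ?m (s, id)) i j = (\<Sum>s\<in>A. if s = d i then of_bool (j \<in> B \<and> i = j) else 0)"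
      unfolding sum_apply2 by (rule sum.cong) (auto simp: sgn_mat_apply act_def)
    also have "\<dots> = mat_idn B i j" using A_finite B(4) by (auto simp: mat_idn_def)
    finally show "(\<Sum>s\<in>A. ?m (s, id)) i j = mat_idn B i j" .
  qed
  have z: "?m b = 0" if "b \<notin> A \<times> K" for b using that by (cases b) (auto simp: sgn_mat_def)
  have "(B, ?m) \<in> reps (bismash n)"
    unfolding reps_def hbas_H
  proof (clarify, intro conjI ballI allI impI)
    fix b c assume "b \<in> A \<times> K" "c \<in> A \<times> K"
    then obtain s x u y where "b = (s, x)" "c = (u, y)" and i: "s \<in> A" "x \<in> K" "u \<in> A" "y \<in> K" by auto
    then show "mat_cmp (?m b) (?m c) = (\<Sum>d\<in>A \<times> K. mat_scl (hmul (bismash n) b c d) (?m d))"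
      using mult[OF i] hmul_sum[OF i, of ?m] by simp
  next
    show "(\<Sum>b\<in>A \<times> K. mat_scl (hone (bismash n) b) (?m b)) = mat_idn B" unfolding hone_sum by (rule one)
  qed (use B(1) in_Vect z in auto)
  then show ?thesis by (simp add: sgn_rep_def Rep_simps)
qed

text \<open>Compatibility with degrees, involutions and signs is asked for where the coefficient is
  nonzero, so that projections to a part of a signed set are covered too.\<close>

lemma mono_mat_Hom:
  assumes X: "signed_set B d \<pi> \<epsilon>" and Y: "signed_set B' d' \<pi>' \<epsilon>'"
    and f: "\<And>b. b \<in> B \<Longrightarrow> a b \<noteq> 0 \<Longrightarrow> f b \<in> B' \<and> d' (f b) = d b \<and> f (\<pi> b) = \<pi>' (f b) \<and> a (\<pi> b) * \<epsilon> b = \<epsilon>' (f b) * a b"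
    and z: "\<And>b. b \<in> B \<Longrightarrow> a b = 0 \<Longrightarrow> a (\<pi> b) = 0"
  shows "mono_mat f a B \<in> Hom (Rep (bismash n)) (sgn_rep B d \<pi> \<epsilon>) (sgn_rep B' d' \<pi>' (\<epsilon>' :: nat \<Rightarrow> 'k::field))"
proof -
  have "mat_cmp (mono_mat f a B) (sgn_mat B d \<pi> \<epsilon> (u, x)) = mat_cmp (sgn_mat B' d' \<pi>' \<epsilon>' (u, x)) (mono_mat f a B)"
    if u: "u \<in> A" "x \<in> K" for u x
  proof (intro ext)
    fix i j
    have l: "mat_cmp (mono_mat f a B) (sgn_mat B d \<pi> \<epsilon> (u, x)) i j = (if j \<in> B then mono_mat f a B i (act \<pi> x j) *
      (if d (act \<pi> x j) = u then (if x = id then 1 else \<epsilon> j) else 0) else 0)"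
      unfolding sgn_mat_def using u by (simp add: mat_cmp_mono)
    have r: "mat_cmp (sgn_mat B' d' \<pi>' \<epsilon>' (u, x)) (mono_mat f a B) i j = (if j \<in> B then
      sgn_mat B' d' \<pi>' \<epsilon>' (u, x) i (f j) * a j else 0)" by (rule mat_cmp_mono)
    show "mat_cmp (mono_mat f a B) (sgn_mat B d \<pi> \<epsilon> (u, x)) i j = mat_cmp (sgn_mat B' d' \<pi>' \<epsilon>' (u, x)) (mono_mat f a B) i j"
    proof (cases "j \<in> B \<and> a j \<noteq> 0")
      case True
      then have fj: "f j \<in> B'" "d' (f j) = d j" "f (\<pi> j) = \<pi>' (f j)" "a (\<pi> j) * \<epsilon> j = \<epsilon>' (f j) * a j" and j: "j \<in> B" "\<pi> j \<in> B"
        using f X by (auto simp: signed_set_def)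
      have "d' (\<pi>' (f j)) = d (\<pi> j)" using fj j X Y by (auto simp: signed_set_def)
      then show ?thesis unfolding l r sgn_mat_apply[OF u] using fj j by (auto simp: mono_mat_def act_def)
    next
      case False
      then show ?thesis unfolding l r using z[of j] by (auto simp: mono_mat_def act_def)
    qed
  qed
  moreover have "mono_mat f a B \<in> Hom Vect B B'" using f by (intro mono_mat_in) auto
  ultimately show ?thesis unfolding sgn_rep_def Hom_Rep hbas_H by auto
qed

text \<open>Here \<open>\<iota> b\<close> is the index of the piece that contains b,
  \<open>\<psi>\<close> and \<open>\<phi> i\<close> identify the pieces with their models, and
  \<open>c\<close> rescales basis vectors to adjust signs. As \<open>c b * c b = 1\<close>, the same
  \<open>c\<close> serves for inclusions and projections.\<close>

lemma sgn_rep_direct_sum: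
  fixes c :: "nat \<Rightarrow> 'k::field"
  assumes X: "signed_set B d \<pi> \<epsilon>" and I: "finite I" and Y: "\<And>i. i \<in> I \<Longrightarrow> signed_set (B' i) (d' i) (\<pi>' i) (\<epsilon>' i)"
    and B: "\<And>b. b \<in> B \<Longrightarrow> \<iota> b \<in> I \<and> \<psi> b \<in> B' (\<iota> b) \<and> \<phi> (\<iota> b) (\<psi> b) = b"
    and B': "\<And>i p. i \<in> I \<Longrightarrow> p \<in> B' i \<Longrightarrow> \<phi> i p \<in> B \<and> \<iota> (\<phi> i p) = i \<and> \<psi> (\<phi> i p) = p"
    and eqv: "\<And>b. b \<in> B \<Longrightarrow> d' (\<iota> b) (\<psi> b) = d b \<and> \<iota> (\<pi> b) = \<iota> b \<and> \<psi> (\<pi> b) = \<pi>' (\<iota> b) (\<psi> b) \<and> c b * c b = 1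
      \<and> c (\<pi> b) * \<epsilon> b = \<epsilon>' (\<iota> b) (\<psi> b) * c b"
  shows "direct_sum (Rep (bismash n)) I (\<lambda>i. sgn_rep (B' i) (d' i) (\<pi>' i) (\<epsilon>' i)) (sgn_rep B d \<pi> \<epsilon>)"
proof -
  interpret R: linear_category "Rep (bismash n) :: (_, _, 'k) tensor_category" by (rule linear_category_Rep)
  let ?prj = "\<lambda>i. mono_mat \<psi> (\<lambda>b. if \<iota> b = i then c b else 0) B"
  let ?inc = "\<lambda>i. mono_mat (\<phi> i) (\<lambda>p. c (\<phi> i p)) (B' i)"
  have c0: "c b \<noteq> 0" if "b \<in> B" for b using eqv[OF that] by auto
  have pi: "\<pi> b \<in> B" "\<pi> (\<pi> b) = b" if "b \<in> B" for b using X that by (auto simp: signed_set_def)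
  have phi_pi: "\<phi> i (\<pi>' i p) = \<pi> (\<phi> i p)" if "i \<in> I" "p \<in> B' i" for i p
  proof -
    have b: "\<phi> i p \<in> B" "\<iota> (\<phi> i p) = i" "\<psi> (\<phi> i p) = p" using B' that by auto
    then have "\<pi>' i p = \<psi> (\<pi> (\<phi> i p))" "\<iota> (\<pi> (\<phi> i p)) = i" using eqv[OF b(1)] by auto
    then show ?thesis using B[OF pi(1)[OF b(1)]] by simp
  qed
  show ?thesis
  proof (rule R.direct_sumI[of _ _ _ ?inc ?prj])
    show "finite I" by (rule I)
    show "sgn_rep B d \<pi> \<epsilon> \<in> Ob (Rep (bismash n))" by (rule sgn_rep_Ob[OF X])
    fix i assume i: "i \<in> I"
    show "sgn_rep (B' i) (d' i) (\<pi>' i) (\<epsilon>' i) \<in> Ob (Rep (bismash n))" by (rule sgn_rep_Ob[OF Y[OF i]])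
    show "?prj i \<in> Hom (Rep (bismash n)) (sgn_rep B d \<pi> \<epsilon>) (sgn_rep (B' i) (d' i) (\<pi>' i) (\<epsilon>' i))"
      by (rule mono_mat_Hom[OF X Y[OF i]]) (use B eqv c0 in \<open>auto split: if_splits\<close>)
    show "?inc i \<in> Hom (Rep (bismash n)) (sgn_rep (B' i) (d' i) (\<pi>' i) (\<epsilon>' i)) (sgn_rep B d \<pi> \<epsilon>)"
    proof (rule mono_mat_Hom[OF Y[OF i] X])
      fix p assume p: "p \<in> B' i"
      then have b: "\<phi> i p \<in> B" "\<iota> (\<phi> i p) = i" "\<psi> (\<phi> i p) = p" using B' i by auto
      note e = eqv[OF b(1), unfolded b]
      have cc: "c (\<pi> (\<phi> i p)) * c (\<pi> (\<phi> i p)) = 1" "c (\<phi> i p) * c (\<phi> i p) = 1" using e eqv[OF pi(1)[OF b(1)]] by auto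
      have "c (\<pi> (\<phi> i p)) * \<epsilon>' i p = c (\<pi> (\<phi> i p)) * (\<epsilon>' i p * c (\<phi> i p)) * c (\<phi> i p)" using cc by (simp add: mult.assoc)
      also have "\<dots> = c (\<pi> (\<phi> i p)) * (c (\<pi> (\<phi> i p)) * \<epsilon> (\<phi> i p)) * c (\<phi> i p)" using e by simp
      also have "\<dots> = \<epsilon> (\<phi> i p) * c (\<phi> i p)" using cc(1) by (simp add: mult.assoc[symmetric])
      finally have "c (\<pi> (\<phi> i p)) * \<epsilon>' i p = \<epsilon> (\<phi> i p) * c (\<phi> i p)" .
      then show "\<phi> i p \<in> B \<and> d (\<phi> i p) = d' i p \<and> \<phi> i (\<pi>' i p) = \<pi> (\<phi> i p) \<and> c (\<phi> i (\<pi>' i p)) * \<epsilon>' i p = \<epsilon> (\<phi> i p) * c (\<phi> i p)"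
        using e b phi_pi[OF i p] by simp
      assume "c (\<phi> i p) = 0"
      then show "c (\<phi> i (\<pi>' i p)) = 0" using c0[OF b(1)] by simp
    qed
    fix j assume j: "j \<in> I"
    show "?prj j \<odot>\<^bsub>Rep (bismash n)\<^esub> ?inc i = (if i = j then idn (Rep (bismash n)) (sgn_rep (B' i) (d' i) (\<pi>' i) (\<epsilon>' i)) else 0)"
    proof (intro ext)
      fix a p
      have "(?prj j \<odot>\<^bsub>Rep (bismash n)\<^esub> ?inc i) a p = (if p \<in> B' i then ?prj j a (\<phi> i p) * c (\<phi> i p) else 0)"
        unfolding Rep_simps by (rule mat_cmp_mono)
      also have "\<dots> = (if i = j then mat_idn (B' i) else 0) a p"
        using B'[OF i, of p] eqv[of "\<phi> i p"] by (auto simp: mat_idn_def mono_mat_def)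
      finally show "(?prj j \<odot>\<^bsub>Rep (bismash n)\<^esub> ?inc i) a p = (if i = j then idn (Rep (bismash n)) (sgn_rep (B' i) (d' i) (\<pi>' i) (\<epsilon>' i)) else 0) a p"
        by (simp only: Rep_simps sgn_rep_def)
    qed
  next
    show "(\<Sum>i\<in>I. ?inc i \<odot>\<^bsub>Rep (bismash n)\<^esub> ?prj i) = idn (Rep (bismash n)) (sgn_rep B d \<pi> \<epsilon>)"
    proof (intro ext)
      fix a b
      have "(\<Sum>i\<in>I. ?inc i \<odot>\<^bsub>Rep (bismash n)\<^esub> ?prj i) a b = (\<Sum>i\<in>I. if i = \<iota> b then of_bool (b \<in> B \<and> a = b) else 0)"
        unfolding sum_apply2
      proof (rule sum.cong[OF refl])
        fix i assume "i \<in> I"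
        have "(?inc i \<odot>\<^bsub>Rep (bismash n)\<^esub> ?prj i) a b = (if b \<in> B then ?inc i a (\<psi> b) * (if \<iota> b = i then c b else 0) else 0)"
          unfolding Rep_simps by (rule mat_cmp_mono)
        also have "\<dots> = (if i = \<iota> b then of_bool (b \<in> B \<and> a = b) else 0)"
          using B[of b] eqv[of b] by (auto simp: mono_mat_def)
        finally show "(?inc i \<odot>\<^bsub>Rep (bismash n)\<^esub> ?prj i) a b = (if i = \<iota> b then of_bool (b \<in> B \<and> a = b) else 0)" .
      qed
      then show "(\<Sum>i\<in>I. ?inc i \<odot>\<^bsub>Rep (bismash n)\<^esub> ?prj i) a b = idn (Rep (bismash n)) (sgn_rep B d \<pi> \<epsilon>) a b"
        using I B[of b] by (auto simp: Rep_simps sgn_rep_def mat_idn_def)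
    qed
  qed
qed

lemma sgn_rep_isomorphic:
  fixes c :: "nat \<Rightarrow> 'k::field"
  assumes X: "signed_set B d \<pi> \<epsilon>" and Y: "signed_set B' d' \<pi>' \<epsilon>'"
    and B: "\<And>b. b \<in> B \<Longrightarrow> \<psi> b \<in> B' \<and> \<phi> (\<psi> b) = b"
    and B': "\<And>p. p \<in> B' \<Longrightarrow> \<phi> p \<in> B \<and> \<psi> (\<phi> p) = p"
    and eqv: "\<And>b. b \<in> B \<Longrightarrow> d' (\<psi> b) = d b \<and> \<psi> (\<pi> b) = \<pi>' (\<psi> b) \<and> c b * c b = 1 \<and> c (\<pi> b) * \<epsilon> b = \<epsilon>' (\<psi> b) * c b"
  shows "isomorphic (Rep (bismash n)) (sgn_rep B d \<pi> \<epsilon>) (sgn_rep B' d' \<pi>' \<epsilon>')"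
proof -
  interpret R: linear_category "Rep (bismash n) :: (_, _, 'k) tensor_category" by (rule linear_category_Rep)
  have "direct_sum (Rep (bismash n)) {()} (\<lambda>_. sgn_rep B' d' \<pi>' \<epsilon>') (sgn_rep B d \<pi> \<epsilon>)"
    by (rule sgn_rep_direct_sum[where \<psi> = \<psi> and \<phi> = "\<lambda>_. \<phi>" and c = c]) (use assms in auto)
  moreover have "direct_sum (Rep (bismash n)) {()} (\<lambda>_. sgn_rep B' d' \<pi>' \<epsilon>') (sgn_rep B' d' \<pi>' \<epsilon>')"
    by (rule R.direct_sum_one) (use sgn_rep_Ob[OF Y] R.isomorphic_refl in auto)
  ultimately show ?thesis by (rule R.direct_sum_unique)
qed

section \<open>Tensor products of signed sets\<close>

lemma hcom_sum:
  assumes "u \<in> A" "x \<in> K"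
  shows "(\<Sum>c\<in>A \<times> K. \<Sum>d\<in>A \<times> K. mat_scl (hcom (bismash n) (u, x) c d :: 'k::field) (mat_tar (\<rho> c) (\<sigma> d))) i j
    = (\<Sum>g\<in>A. \<Sum>h\<in>A. of_bool (g \<circ> h = u) * (mat_tar (\<rho> (g, x)) (\<sigma> (h, x)) i j))"
proof -
  have m: "hcom (bismash n) (u, x) (g, y) (h, z) = (of_bool (g \<circ> h = u \<and> y = x \<and> z = x) :: 'k)" for g y h z
    by (auto simp: bismash_def alt_group_mult)
  have inner: "(\<Sum>d\<in>A \<times> K. mat_scl (hcom (bismash n) (u, x) (g, y) d :: 'k) (mat_tar (\<rho> (g, y)) (\<sigma> d))) i j
    = (if y = x then \<Sum>h\<in>A. of_bool (g \<circ> h = u) * (mat_tar (\<rho> (g, x)) (\<sigma> (h, x)) i j) else 0)" for g y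
  proof -
    have "(\<Sum>d\<in>A \<times> K. mat_scl (hcom (bismash n) (u, x) (g, y) d :: 'k) (mat_tar (\<rho> (g, y)) (\<sigma> d))) i j
      = (\<Sum>d\<in>A \<times> K. mat_scl (hcom (bismash n) (u, x) (g, y) d :: 'k) (mat_tar (\<rho> (g, y)) (\<sigma> d)) i j)"
      unfolding sum_apply2 ..
    also have "\<dots> = (\<Sum>d\<in>A \<times> {x}. mat_scl (hcom (bismash n) (u, x) (g, y) d :: 'k) (mat_tar (\<rho> (g, y)) (\<sigma> d)) i j)"
    proof (intro sum.mono_neutral_right ballI)
      fix d assume "d \<in> A \<times> K - A \<times> {x}"
      then have "hcom (bismash n) (u, x) (g, y) d = (0 :: 'k)" using m[of g y "fst d" "snd d"] by (cases d) auto
      then show "mat_scl (hcom (bismash n) (u, x) (g, y) d :: 'k) (mat_tar (\<rho> (g, y)) (\<sigma> d)) i j = 0" by (simp add: mat_scl_apply)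
    qed (use A_finite assms in auto)
    also have "\<dots> = (\<Sum>h\<in>A. mat_scl (hcom (bismash n) (u, x) (g, y) (h, x) :: 'k) (mat_tar (\<rho> (g, y)) (\<sigma> (h, x))) i j)"
      by (rule sum_times_singleton)
    also have "\<dots> = (if y = x then \<Sum>h\<in>A. of_bool (g \<circ> h = u) * (mat_tar (\<rho> (g, x)) (\<sigma> (h, x)) i j) else 0)"
      by (auto simp: m mat_scl_def intro!: sum.cong)
    finally show ?thesis .
  qed
  have "(\<Sum>c\<in>A \<times> K. \<Sum>d\<in>A \<times> K. mat_scl (hcom (bismash n) (u, x) c d :: 'k) (mat_tar (\<rho> c) (\<sigma> d))) i j
    = (\<Sum>c\<in>A \<times> K. (\<Sum>d\<in>A \<times> K. mat_scl (hcom (bismash n) (u, x) c d :: 'k) (mat_tar (\<rho> c) (\<sigma> d))) i j)"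
    by (rule sum_apply2)
  also have "\<dots> = (\<Sum>c\<in>A \<times> {x}. (\<Sum>d\<in>A \<times> K. mat_scl (hcom (bismash n) (u, x) c d :: 'k) (mat_tar (\<rho> c) (\<sigma> d))) i j)"
  proof (intro sum.mono_neutral_right ballI)
    fix c assume "c \<in> A \<times> K - A \<times> {x}"
    then show "(\<Sum>d\<in>A \<times> K. mat_scl (hcom (bismash n) (u, x) c d :: 'k) (mat_tar (\<rho> c) (\<sigma> d))) i j = 0"
      using inner[of "fst c" "snd c"] by (cases c) auto
  qed (use A_finite assms in auto)
  also have "\<dots> = (\<Sum>g\<in>A. (\<Sum>d\<in>A \<times> K. mat_scl (hcom (bismash n) (u, x) (g, x) d :: 'k) (mat_tar (\<rho> (g, x)) (\<sigma> d))) i j)"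
    by (rule sum_times_singleton)
  also have "\<dots> = (\<Sum>g\<in>A. \<Sum>h\<in>A. of_bool (g \<circ> h = u) * (mat_tar (\<rho> (g, x)) (\<sigma> (h, x)) i j))"
    by (simp only: inner) simp
  finally show ?thesis .
qed

definition pair_map :: "(nat \<Rightarrow> nat) \<Rightarrow> (nat \<Rightarrow> nat) \<Rightarrow> nat \<Rightarrow> nat" where
  "pair_map \<pi> \<pi>' p = prod_encode (\<pi> (fst (prod_decode p)), \<pi>' (snd (prod_decode p)))"

text \<open>Degrees are multiplied as the comultiplication demands. The product being again a signed
  set, decomposing tensor products amounts to splitting finite sets into orbits.\<close>

lemma sgn_rep_tob:
  assumes X: "signed_set B d \<pi> \<epsilon>" and Y: "signed_set B' d' \<pi>' (\<epsilon>' :: nat \<Rightarrow> 'k::field)"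
  shows "sgn_rep B d \<pi> \<epsilon> \<boxtimes>\<^bsub>Rep (bismash n)\<^esub> sgn_rep B' d' \<pi>' \<epsilon>'
    = sgn_rep (mat_tob B B') (\<lambda>p. d (fst (prod_decode p)) \<circ> d' (snd (prod_decode p))) (pair_map \<pi> \<pi>')
        (\<lambda>p. \<epsilon> (fst (prod_decode p)) * \<epsilon>' (snd (prod_decode p)))" (is "_ = sgn_rep ?B ?d ?\<pi> ?\<epsilon>")
    and "signed_set (mat_tob B B') (\<lambda>p. d (fst (prod_decode p)) \<circ> d' (snd (prod_decode p))) (pair_map \<pi> \<pi>')
        (\<lambda>p. \<epsilon> (fst (prod_decode p)) * \<epsilon>' (snd (prod_decode p)))"
proof -
  show "signed_set ?B ?d ?\<pi> ?\<epsilon>"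
    unfolding signed_set_def
  proof (intro conjI ballI)
    show "finite ?B" using X Y by (simp add: signed_set_def mat_tob_def)
    fix p assume "p \<in> ?B"
    then obtain a b where p: "p = prod_encode (a, b)" "a \<in> B" "b \<in> B'" by (auto simp: mat_tob_def)
    have a: "\<pi> a \<in> B" "\<pi> (\<pi> a) = a" "d a \<in> A" "d (\<pi> a) = flip (d a)" "\<epsilon> a * \<epsilon> (\<pi> a) = 1" using X p by (auto simp: signed_set_def)
    have b: "\<pi>' b \<in> B'" "\<pi>' (\<pi>' b) = b" "d' b \<in> A" "d' (\<pi>' b) = flip (d' b)" "\<epsilon>' b * \<epsilon>' (\<pi>' b) = 1" using Y p by (auto simp: signed_set_def)
    show "?\<pi> p \<in> ?B" using a b p by (simp add: pair_map_def mat_tob_def)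
    show "?\<pi> (?\<pi> p) = p" using a b p by (simp add: pair_map_def)
    show "?d p \<in> A" using a b p A_comp by simp
    show "?d (?\<pi> p) = flip (?d p)" using a b p by (simp add: pair_map_def flip_comp)
    have "?\<epsilon> p * ?\<epsilon> (?\<pi> p) = (\<epsilon> a * \<epsilon> (\<pi> a)) * (\<epsilon>' b * \<epsilon>' (\<pi>' b))" using p by (simp add: pair_map_def mult_ac)
    then show "?\<epsilon> p * ?\<epsilon> (?\<pi> p) = 1" using a b by simp
  qed
  have "(\<Sum>c\<in>A \<times> K. \<Sum>d1\<in>A \<times> K. mat_scl (hcom (bismash n) b c d1) (mat_tar (sgn_mat B d \<pi> \<epsilon> c) (sgn_mat B' d' \<pi>' \<epsilon>' d1)))
    = sgn_mat ?B ?d ?\<pi> ?\<epsilon> b" if b: "b \<in> A \<times> K" for b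
  proof (intro ext)
    fix i j
    obtain u x where [simp]: "b = (u, x)" and u: "u \<in> A" "x \<in> K" using b by auto
    obtain i1 i2 j1 j2 where [simp]: "i = prod_encode (i1, i2)" "j = prod_encode (j1, j2)" by (metis prod.exhaust prod_decode_inverse)
    have J: "j \<in> ?B \<longleftrightarrow> j1 \<in> B \<and> j2 \<in> B'" by (auto simp: mat_tob_def)
    have dA: "d (act \<pi> x j1) \<in> A" if "j1 \<in> B" using X that by (auto simp: signed_set_def act_def)
    have dA': "d' (act \<pi>' x j2) \<in> A" if "j2 \<in> B'" using Y that by (auto simp: signed_set_def act_def)
    let ?c = "if j1 \<in> B \<and> j2 \<in> B' \<and> i1 = act \<pi> x j1 \<and> i2 = act \<pi>' x j2 then (if x = id then 1 else \<epsilon> j1 * \<epsilon>' j2) else 0"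
    have aux: "(if p \<and> q \<and> e = g then a else 0) * (if p' \<and> q' \<and> e' = h then a' else 0)
        = (if h = e' then (if g = e then (if p \<and> p' \<and> q \<and> q' then a * a' else 0) else 0) else 0)"
      for p q p' q' and e g e' h :: "nat \<Rightarrow> nat" and a a' :: 'k by auto
    have ab: "(if x = id then 1 else \<epsilon> j1) * (if x = id then 1 else \<epsilon>' j2) = (if x = id then 1 else \<epsilon> j1 * \<epsilon>' j2)" by simp
    have "(\<Sum>c\<in>A \<times> K. \<Sum>d1\<in>A \<times> K. mat_scl (hcom (bismash n) b c d1) (mat_tar (sgn_mat B d \<pi> \<epsilon> c) (sgn_mat B' d' \<pi>' \<epsilon>' d1))) i j
      = (\<Sum>g\<in>A. \<Sum>h\<in>A. of_bool (g \<circ> h = u) * (mat_tar (sgn_mat B d \<pi> \<epsilon> (g, x)) (sgn_mat B' d' \<pi>' \<epsilon>' (h, x)) i j))"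
      unfolding \<open>b = _\<close> by (rule hcom_sum[OF u])
    also have "\<dots> = (\<Sum>g\<in>A. \<Sum>h\<in>A. if h = d' i2 then (if g = d i1 then of_bool (g \<circ> h = u) * ?c else 0) else 0)"
    proof (intro sum.cong refl)
      fix g h assume gh: "g \<in> A" "h \<in> A"
      have "mat_tar (sgn_mat B d \<pi> \<epsilon> (g, x)) (sgn_mat B' d' \<pi>' \<epsilon>' (h, x)) i j
        = sgn_mat B d \<pi> \<epsilon> (g, x) i1 j1 * sgn_mat B' d' \<pi>' \<epsilon>' (h, x) i2 j2" by (simp add: mat_tar_def)
      also have "\<dots> = (if h = d' i2 then (if g = d i1 then ?c else 0) else 0)"
        unfolding sgn_mat_apply[OF gh(1) u(2)] sgn_mat_apply[OF gh(2) u(2)] aux ab by (rule refl)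
      finally show "of_bool (g \<circ> h = u) * mat_tar (sgn_mat B d \<pi> \<epsilon> (g, x)) (sgn_mat B' d' \<pi>' \<epsilon>' (h, x)) i j
        = (if h = d' i2 then (if g = d i1 then of_bool (g \<circ> h = u) * ?c else 0) else 0)" by simp
    qed
    also have "\<dots> = (\<Sum>g\<in>A. if g = d i1 then of_bool (g \<circ> d' i2 = u) * ?c else 0)"
    proof (intro sum.cong refl)
      fix g
      show "(\<Sum>h\<in>A. if h = d' i2 then (if g = d i1 then of_bool (g \<circ> h = u) * ?c else 0) else 0)
        = (if g = d i1 then of_bool (g \<circ> d' i2 = u) * ?c else 0)"
        unfolding sum.delta[OF A_finite] using dA' by simp
    qed
    also have "\<dots> = of_bool (d i1 \<circ> d' i2 = u) * ?c"
      unfolding sum.delta[OF A_finite] using dA by simp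
    also have "\<dots> = sgn_mat ?B ?d ?\<pi> ?\<epsilon> b i j"
      unfolding \<open>b = _\<close> sgn_mat_apply[OF u] J by (auto simp: act_def pair_map_def)
    finally show "(\<Sum>c\<in>A \<times> K. \<Sum>d1\<in>A \<times> K. mat_scl (hcom (bismash n) b c d1) (mat_tar (sgn_mat B d \<pi> \<epsilon> c) (sgn_mat B' d' \<pi>' \<epsilon>' d1))) i j
      = sgn_mat ?B ?d ?\<pi> ?\<epsilon> b i j" .
  qed
  moreover have "sgn_mat ?B ?d ?\<pi> ?\<epsilon> b = 0" if "b \<notin> A \<times> K" for b
    using that by (cases b) (auto simp: sgn_mat_def)
  ultimately show "sgn_rep B d \<pi> \<epsilon> \<boxtimes>\<^bsub>Rep (bismash n)\<^esub> sgn_rep B' d' \<pi>' \<epsilon>' = sgn_rep ?B ?d ?\<pi> ?\<epsilon>"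
    unfolding sgn_rep_def tob_Rep hbas_H by auto
qed

end

section \<open>Representations attached to orbits of conjugation with (1 2)\<close>

context bismash_degree
begin

lemma transpose_12_not_id [simp]: "transpose (Suc 0) 2 \<noteq> id" "id \<noteq> transpose (Suc 0) 2"
  using transpose_not_id by auto

text \<open>A free orbit on two points, of degrees s and \<open>flip s\<close>. The case
  \<open>flip s = s\<close>, in which the representation is reducible, is included because it keeps
  the product formula for orbits uniform.\<close>

definition orb :: "(nat \<Rightarrow> nat) \<Rightarrow> nat set \<times> ((nat \<Rightarrow> nat) \<times> (nat \<Rightarrow> nat) \<Rightarrow> nat \<Rightarrow> nat \<Rightarrow> 'k::field)" where
  "orb s = sgn_rep {0, 1} (\<lambda>j. if j = 0 then s else flip s) (\<lambda>j. 1 - j) (\<lambda>_. 1)"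

definition pt :: "(nat \<Rightarrow> nat) \<Rightarrow> 'k::field \<Rightarrow> nat set \<times> ((nat \<Rightarrow> nat) \<times> (nat \<Rightarrow> nat) \<Rightarrow> nat \<Rightarrow> nat \<Rightarrow> 'k)" where
  "pt h e = sgn_rep {0} (\<lambda>_. h) (\<lambda>j. j) (\<lambda>_. e)"

lemma orb_signed_set: "s \<in> A \<Longrightarrow> signed_set {0, 1} (\<lambda>j. if j = 0 then s else flip s) (\<lambda>j. 1 - j) (\<lambda>_. 1)"
  by (auto simp: signed_set_def A_flip)

lemma pt_signed_set: "h \<in> A \<Longrightarrow> flip h = h \<Longrightarrow> e * e = 1 \<Longrightarrow> signed_set {0} (\<lambda>_. h) (\<lambda>j. j) (\<lambda>_. e)"
  by (auto simp: signed_set_def)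

lemma orb_Ob: "s \<in> A \<Longrightarrow> orb s \<in> Ob (Rep (bismash n))"
  unfolding orb_def by (rule sgn_rep_Ob[OF orb_signed_set])

lemma pt_Ob: "h \<in> A \<Longrightarrow> flip h = h \<Longrightarrow> e * e = 1 \<Longrightarrow> pt h e \<in> Ob (Rep (bismash n))"
  unfolding pt_def by (rule sgn_rep_Ob[OF pt_signed_set])

text \<open>The involution acts freely on the four points of the product, with the diagonal and the
  antidiagonal as its orbits.\<close>

lemma orb_tob_orb:
  assumes s: "s \<in> A" and u: "u \<in> A"
  shows "direct_sum (Rep (bismash n)) {0::nat, 1} (\<lambda>i. orb (if i = 0 then s \<circ> u else s \<circ> flip u))
    (orb s \<boxtimes>\<^bsub>Rep (bismash n)\<^esub> (orb u :: _ \<times> (_ \<Rightarrow> _ \<Rightarrow> _ \<Rightarrow> 'k::field)))"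
  unfolding orb_def sgn_rep_tob(1)[OF orb_signed_set[OF s] orb_signed_set[OF u]]
  by (rule sgn_rep_direct_sum[OF sgn_rep_tob(2)[OF orb_signed_set[OF s] orb_signed_set[OF u]],
        where \<iota> = "\<lambda>p. if fst (prod_decode p) = snd (prod_decode p) then 0 else 1"
          and \<psi> = "\<lambda>p. fst (prod_decode p)" and \<phi> = "\<lambda>i p. prod_encode (p, if i = 0 then p else 1 - p)" and c = "\<lambda>_. 1"])
    (use s u in \<open>auto simp: mat_tob_def pair_map_def flip_comp signed_set_def A_flip A_comp split: if_splits\<close>)

text \<open>On a free orbit a sign is removed by rescaling one of the two basis vectors, so the sign
  of the one-dimensional factor leaves no trace.\<close>

lemma pt_tob_orb:
  assumes h: "h \<in> A" "flip h = h" "e * e = (1 :: 'k::field)" and u: "u \<in> A"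
  shows "isomorphic (Rep (bismash n)) (pt h e \<boxtimes>\<^bsub>Rep (bismash n)\<^esub> orb u) (orb (h \<circ> u))"
    "isomorphic (Rep (bismash n)) (orb u \<boxtimes>\<^bsub>Rep (bismash n)\<^esub> pt h e) (orb (u \<circ> h))"
proof -
  note sh = pt_signed_set[OF h] and su = orb_signed_set[OF u]
  show "isomorphic (Rep (bismash n)) (pt h e \<boxtimes>\<^bsub>Rep (bismash n)\<^esub> orb u) (orb (h \<circ> u))"
    unfolding orb_def pt_def sgn_rep_tob(1)[OF sh su]
    by (rule sgn_rep_isomorphic[OF sgn_rep_tob(2)[OF sh su] orb_signed_set[OF A_comp[OF h(1) u]],
        where \<psi> = "\<lambda>p. snd (prod_decode p)" and \<phi> = "\<lambda>p. prod_encode (0, p)" and c = "\<lambda>p. if snd (prod_decode p) = 0 then 1 else e"])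
      (use h in \<open>auto simp: mat_tob_def pair_map_def flip_comp\<close>)
  show "isomorphic (Rep (bismash n)) (orb u \<boxtimes>\<^bsub>Rep (bismash n)\<^esub> pt h e) (orb (u \<circ> h))"
    unfolding orb_def pt_def sgn_rep_tob(1)[OF su sh]
    by (rule sgn_rep_isomorphic[OF sgn_rep_tob(2)[OF su sh] orb_signed_set[OF A_comp[OF u h(1)]],
        where \<psi> = "\<lambda>p. fst (prod_decode p)" and \<phi> = "\<lambda>p. prod_encode (p, 0)" and c = "\<lambda>p. if fst (prod_decode p) = 0 then 1 else e"])
      (use h in \<open>auto simp: mat_tob_def pair_map_def flip_comp\<close>)
qed

lemma pt_tob_pt:
  assumes h: "h \<in> A" "flip h = h" "e * e = (1 :: 'k::field)" and u: "u \<in> A" "flip u = u" "e' * e' = 1"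
  shows "isomorphic (Rep (bismash n)) (pt h e \<boxtimes>\<^bsub>Rep (bismash n)\<^esub> pt u e') (pt (h \<circ> u) (e * e'))"
proof -
  note sh = pt_signed_set[OF h] and su = pt_signed_set[OF u]
  have "(e * e') * (e * e') = (e * e) * (e' * e')" by (simp add: mult_ac)
  then have "(e * e') * (e * e') = 1" using h u by simp
  then have shu: "signed_set {0} (\<lambda>_. h \<circ> u) (\<lambda>j. j) (\<lambda>_. e * e')"
    using h u by (intro pt_signed_set) (simp_all add: A_comp flip_comp)
  show ?thesis
    unfolding pt_def sgn_rep_tob(1)[OF sh su]
    by (rule sgn_rep_isomorphic[OF sgn_rep_tob(2)[OF sh su] shu,
        where \<psi> = "\<lambda>p. 0" and \<phi> = "\<lambda>p. prod_encode (0, 0)" and c = "\<lambda>p. 1"])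
      (auto simp: mat_tob_def pair_map_def)
qed

lemma orb_flip: "s \<in> A \<Longrightarrow> isomorphic (Rep (bismash n)) (orb s) (orb (flip s) :: _ \<times> (_ \<Rightarrow> _ \<Rightarrow> _ \<Rightarrow> 'k::field))"
  unfolding orb_def
  by (rule sgn_rep_isomorphic[OF orb_signed_set orb_signed_set[OF A_flip],
        where \<psi> = "\<lambda>p. 1 - p" and \<phi> = "\<lambda>p. 1 - p" and c = "\<lambda>_. 1"]) auto

text \<open>The vectors (1, 1) and (1, -1) are eigenvectors of the involution, and projecting to
  them needs 1/2.\<close>

lemma orb_fixed:
  assumes h: "h \<in> A" "flip h = h" and two: "(2 :: 'k::field) \<noteq> 0"
  shows "direct_sum (Rep (bismash n)) {0::nat, 1} (\<lambda>i. pt h (if i = 0 then 1 else -1)) (orb h :: _ \<times> (_ \<Rightarrow> _ \<Rightarrow> _ \<Rightarrow> 'k))"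
proof -
  interpret R: linear_category "Rep (bismash n) :: (_, _, 'k) tensor_category" by (rule linear_category_Rep)
  define e where "e i = (if i = (0::nat) then 1 else - 1 :: 'k)" for i
  have ee: "e i * e i = 1" for i by (simp add: e_def)
  let ?inc = "\<lambda>i y j. if j = (0::nat) \<and> y = 0 then 1 else if j = 0 \<and> y = (1::nat) then e i else 0"
  let ?prj = "\<lambda>i. mono_mat (\<lambda>_. 0) (\<lambda>y. inverse 2 * (if y = 0 then 1 else e i)) {0, 1}"
  have inc: "?inc i \<in> Hom (Rep (bismash n)) (pt h (e i)) (orb h)" for i
    unfolding pt_def orb_def sgn_rep_def Hom_Rep hbas_H
  proof (intro conjI ballI)
    show V: "?inc i \<in> Hom Vect {0} {0, 1}" by (auto simp: Hom_Vect)
    fix b assume "b \<in> A \<times> K"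
    then obtain u x where b: "b = (u, x)" and u: "u \<in> A" "x \<in> K" by auto
    show "mat_cmp (?inc i) (sgn_mat {0} (\<lambda>_. h) (\<lambda>j. j) (\<lambda>_. e i) b) =
      mat_cmp (sgn_mat {0, 1} (\<lambda>j. if j = 0 then h else flip h) (\<lambda>j. 1 - j) (\<lambda>_. 1) b) (?inc i)"
    proof (intro ext)
      fix y j
      have "mat_cmp (?inc i) (sgn_mat {0} (\<lambda>_. h) (\<lambda>j. j) (\<lambda>_. e i) b) y j =
        (if j = 0 then ?inc i y 0 * (if h = u then (if x = id then 1 else e i) else 0) else 0)"
        unfolding b sgn_mat_def using u by (simp add: mat_cmp_mono act_def)
      also have "\<dots> = (\<Sum>p\<in>{0, 1}. sgn_mat {0, 1} (\<lambda>j. if j = 0 then h else flip h) (\<lambda>j. 1 - j) (\<lambda>_. 1) b y p * ?inc i p j)"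
        unfolding b sgn_mat_apply[OF u] using h u ee[of i] by (auto simp: act_def)
      also have "\<dots> = mat_cmp (sgn_mat {0, 1} (\<lambda>j. if j = 0 then h else flip h) (\<lambda>j. 1 - j) (\<lambda>_. 1) b) (?inc i) y j"
        by (rule mat_cmp_Hom[OF V, symmetric]) simp
      finally show "mat_cmp (?inc i) (sgn_mat {0} (\<lambda>_. h) (\<lambda>j. j) (\<lambda>_. e i) b) y j =
        mat_cmp (sgn_mat {0, 1} (\<lambda>j. if j = 0 then h else flip h) (\<lambda>j. 1 - j) (\<lambda>_. 1) b) (?inc i) y j" .
    qed
  qed
  have prj: "?prj i \<in> Hom (Rep (bismash n)) (orb h) (pt h (e i))" for i
    unfolding pt_def orb_def
    by (rule mono_mat_Hom[OF orb_signed_set[OF h(1)] pt_signed_set[OF h ee]])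
      (use h two ee[of i] in \<open>auto simp: e_def\<close>)
  have "direct_sum (Rep (bismash n)) {0::nat, 1} (\<lambda>i. pt h (e i)) (orb h)"
  proof (rule R.direct_sumI[of _ _ _ ?inc ?prj])
    show "orb h \<in> Ob (Rep (bismash n))" by (rule orb_Ob[OF h(1)])
    show "pt h (e i) \<in> Ob (Rep (bismash n))" for i by (rule pt_Ob[OF h ee])
    show "?prj j \<odot>\<^bsub>Rep (bismash n)\<^esub> ?inc i = (if i = j then idn (Rep (bismash n)) (pt h (e i)) else 0)"
      if "i \<in> {0, 1}" "j \<in> {0, 1}" for i j
    proof (intro ext)
      fix y z
      have V: "?inc i \<in> Hom Vect {0} {0, 1}" by (auto simp: Hom_Vect)
      have "(?prj j \<odot>\<^bsub>Rep (bismash n)\<^esub> ?inc i) y z = (\<Sum>p\<in>{0, 1}. ?prj j y p * ?inc i p z)"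
        unfolding Rep_simps by (rule mat_cmp_Hom[OF V]) simp
      also have "\<dots> = (if i = j then mat_idn {0} y z else 0)"
        using that two by (auto simp: mono_mat_def mat_idn_def e_def field_simps)
      finally show "(?prj j \<odot>\<^bsub>Rep (bismash n)\<^esub> ?inc i) y z = (if i = j then idn (Rep (bismash n)) (pt h (e i)) else 0) y z"
        by (simp add: Rep_simps pt_def sgn_rep_def)
    qed
    show "(\<Sum>i\<in>{0::nat, 1}. ?inc i \<odot>\<^bsub>Rep (bismash n)\<^esub> ?prj i) = idn (Rep (bismash n)) (orb h)"
    proof (intro ext)
      fix y z
      have "(\<Sum>i\<in>{0::nat, 1}. ?inc i \<odot>\<^bsub>Rep (bismash n)\<^esub> ?prj i) y z
        = (\<Sum>i\<in>{0::nat, 1}. if z \<in> {0, 1} then ?inc i y 0 * (inverse 2 * (if z = 0 then 1 else e i)) else 0)"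
        unfolding sum_apply2 Rep_simps mat_cmp_mono ..
      also have "\<dots> = mat_idn {0, 1} y z" using two by (auto simp: mat_idn_def e_def field_simps)
      finally show "(\<Sum>i\<in>{0::nat, 1}. ?inc i \<odot>\<^bsub>Rep (bismash n)\<^esub> ?prj i) y z = idn (Rep (bismash n)) (orb h) y z"
        by (simp add: Rep_simps orb_def sgn_rep_def)
    qed
  qed (use inc prj in auto)
  then show ?thesis by (simp only: e_def)
qed

lemma unit_Rep: "unit_ob (Rep (bismash n)) = pt id (1 :: 'k::field)"
proof -
  have "(\<lambda>b. if b \<in> A \<times> K then mat_scl (hcou (bismash n) b) (mat_idn {0}) else 0) = sgn_mat {0} (\<lambda>_. id) (\<lambda>j. j) (\<lambda>_. 1 :: 'k)"
  proof (intro ext)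
    fix b i j
    show "(if b \<in> A \<times> K then mat_scl (hcou (bismash n) b) (mat_idn {0}) else 0) i j = sgn_mat {0} (\<lambda>_. id) (\<lambda>j. j) (\<lambda>_. 1 :: 'k) b i j"
    proof (cases "b \<in> A \<times> K")
      case True
      then obtain u x where b: "b = (u, x)" and u: "u \<in> A" "x \<in> K" by auto
      show ?thesis unfolding b sgn_mat_apply[OF u] using u
        by (auto simp: mat_scl_apply bismash_def alt_group_one mat_idn_def act_def)
    next
      case False
      then show ?thesis by (cases b) (auto simp: sgn_mat_def)
    qed
  qed
  then show ?thesis by (simp add: Rep_def pt_def sgn_rep_def hbas_H)
qed

subsection \<open>Irreducible representations\<close>

text \<open>The elements \<open>e\<^sub>u # 1\<close> force an intertwiner to preserve degrees, and
  the transposition relates its entries at a pair of points and at the images of this pair.\<close>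

lemma sgn_Hom:
  assumes X: "signed_set B d \<pi> \<epsilon>" and Y: "signed_set B' d' \<pi>' (\<epsilon>' :: nat \<Rightarrow> 'k::field)"
    and S: "S \<in> Hom (Rep (bismash n)) (sgn_rep B d \<pi> \<epsilon>) (sgn_rep B' d' \<pi>' \<epsilon>')"
  shows "S i j \<noteq> 0 \<Longrightarrow> i \<in> B' \<and> j \<in> B \<and> d' i = d j"
    and "i \<in> B' \<Longrightarrow> j \<in> B \<Longrightarrow> S (\<pi>' i) (\<pi> j) * \<epsilon> j = \<epsilon>' i * S i j"
proof -
  have V: "S \<in> Hom Vect B B'" and comm: "\<And>u x. u \<in> A \<Longrightarrow> x \<in> K \<Longrightarrow> mat_cmp S (sgn_mat B d \<pi> \<epsilon> (u, x)) = mat_cmp (sgn_mat B' d' \<pi>' \<epsilon>' (u, x)) S"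
    using S by (auto simp: sgn_rep_def Hom_Rep hbas_H)
  have f: "finite B'" using Y by (simp add: signed_set_def)
  have l: "mat_cmp S (sgn_mat B d \<pi> \<epsilon> (u, x)) i j = (if j \<in> B then S i (act \<pi> x j) * (if d (act \<pi> x j) = u then (if x = id then 1 else \<epsilon> j) else 0) else 0)"
    if "u \<in> A" "x \<in> K" for u x i j unfolding sgn_mat_def using that by (simp add: mat_cmp_mono)
  have r: "mat_cmp (sgn_mat B' d' \<pi>' \<epsilon>' (u, x)) S i j = (\<Sum>p\<in>B'. (if p \<in> B' \<and> i = act \<pi>' x p \<and> d' i = u then (if x = id then 1 else \<epsilon>' p) else 0) * S p j)"
    if u: "u \<in> A" "x \<in> K" for u x i j
    unfolding mat_cmp_Hom[OF V f] sgn_mat_apply[OF u] ..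
  have deg: "i \<in> B' \<and> j \<in> B \<and> d' i = d j" if nz: "S i j \<noteq> 0" for i j
  proof -
    have ij: "i \<in> B'" "j \<in> B" using V nz by (auto simp: Hom_Vect)
    have u: "d j \<in> A" "id \<in> K" using X ij by (auto simp: signed_set_def)
    have "S i j = mat_cmp S (sgn_mat B d \<pi> \<epsilon> (d j, id)) i j" unfolding l[OF u] using ij by (simp add: act_def)
    also have "\<dots> = mat_cmp (sgn_mat B' d' \<pi>' \<epsilon>' (d j, id)) S i j" using comm[OF u] by simp
    also have "\<dots> = (\<Sum>p\<in>B'. if p = i then (if d' i = d j then S i j else 0) else 0)"
      unfolding r[OF u] by (rule sum.cong) (auto simp: act_def)
    also have "\<dots> = (if d' i = d j then S i j else 0)" using f ij by simp
    finally show ?thesis using nz ij by (auto split: if_splits)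
  qed
  then show "S i j \<noteq> 0 \<Longrightarrow> i \<in> B' \<and> j \<in> B \<and> d' i = d j" .
  assume ij: "i \<in> B'" "j \<in> B"
  have pi: "\<pi> j \<in> B" "\<pi> (\<pi> j) = j" "d (\<pi> j) = flip (d j)" "d j \<in> A" using X ij by (auto simp: signed_set_def)
  have pi': "\<pi>' i \<in> B'" "\<pi>' (\<pi>' i) = i" "d' (\<pi>' i) = flip (d' i)" using Y ij by (auto simp: signed_set_def)
  show "S (\<pi>' i) (\<pi> j) * \<epsilon> j = \<epsilon>' i * S i j"
  proof (cases "d' i = d j")
    case True
    have u: "flip (d j) \<in> A" "transpose 1 2 \<in> K" using pi A_flip by auto
    have "S (\<pi>' i) (\<pi> j) * \<epsilon> j = mat_cmp S (sgn_mat B d \<pi> \<epsilon> (flip (d j), transpose 1 2)) (\<pi>' i) j"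
      unfolding l[OF u] using ij pi by (simp add: act_def)
    also have "\<dots> = mat_cmp (sgn_mat B' d' \<pi>' \<epsilon>' (flip (d j), transpose 1 2)) S (\<pi>' i) j" using comm[OF u] by simp
    also have "\<dots> = (\<Sum>p\<in>B'. if p = i then \<epsilon>' i * S i j else 0)"
      unfolding r[OF u]
    proof (rule sum.cong[OF refl])
      fix p assume p: "p \<in> B'"
      have "\<pi>' i = \<pi>' p \<longleftrightarrow> p = i" using Y ij p by (metis signed_set_def)
      then show "(if p \<in> B' \<and> \<pi>' i = act \<pi>' (transpose 1 2) p \<and> d' (\<pi>' i) = flip (d j) then (if transpose 1 2 = (id :: nat \<Rightarrow> nat) then 1 else \<epsilon>' p) else 0) * S p j
        = (if p = i then \<epsilon>' i * S i j else 0)" using p pi' True by (simp add: act_def)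
    qed
    also have "\<dots> = \<epsilon>' i * S i j" using f ij by simp
    finally show ?thesis .
  next
    case False
    then have "flip (d' i) \<noteq> flip (d j)" by (metis flip_flip)
    then have "S i j = 0" "S (\<pi>' i) (\<pi> j) = 0" using deg[of i j] deg[of "\<pi>' i" "\<pi> j"] False pi pi' by auto
    then show ?thesis by simp
  qed
qed

text \<open>The two points have different degrees, so an endomorphism is diagonal, and the
  involution equates its two entries.\<close>

lemma orb_brick:
  assumes s: "s \<in> A" "flip s \<noteq> s"
  shows "brick (Rep (bismash n)) (orb s :: _ \<times> (_ \<Rightarrow> _ \<Rightarrow> _ \<Rightarrow> 'k::field))"
proof -
  interpret R: linear_category "Rep (bismash n) :: (_, _, 'k) tensor_category" by (rule linear_category_Rep)
  let ?O = "orb s :: _ \<times> (_ \<Rightarrow> _ \<Rightarrow> _ \<Rightarrow> 'k)"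
  have idn: "idn (Rep (bismash n)) ?O = mat_idn {0, 1}" by (simp add: orb_def sgn_rep_def Rep_simps)
  have "mat_idn {0, 1} 0 0 = (1 :: 'k)" by (simp add: mat_idn_def)
  then have "mat_idn {0, 1} \<noteq> (0 :: nat \<Rightarrow> nat \<Rightarrow> 'k)" by (metis zero_fun_apply zero_neq_one)
  moreover have "S \<in> range (\<lambda>c. mat_scl c (mat_idn {0, 1}))" if S: "S \<in> Hom (Rep (bismash n)) ?O ?O" for S
  proof -
    note f = sgn_Hom[OF orb_signed_set[OF s(1)] orb_signed_set[OF s(1)] S[unfolded orb_def]]
    have "S = mat_scl (S 0 0) (mat_idn {0, 1})"
    proof (intro ext)
      fix i j
      have e: "S 1 1 = S 0 0" using f(2)[of 0 0] by simp
      show "S i j = mat_scl (S 0 0) (mat_idn {0, 1}) i j"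
      proof (cases "S i j = 0")
        case True
        then show ?thesis using e by (cases "j = 0") (auto simp: mat_scl_apply mat_idn_def)
      next
        case False
        from f(1)[OF this] s(2) e show ?thesis by (auto simp: mat_scl_apply mat_idn_def split: if_splits)
      qed
    qed
    then show ?thesis by blast
  qed
  moreover have "mat_scl c (mat_idn {0, 1}) \<in> Hom (Rep (bismash n)) ?O ?O" for c
    using R.scl_in[OF orb_Ob[OF s(1)] orb_Ob[OF s(1)] R.idn_in[OF orb_Ob[OF s(1)]], of c] idn by (simp add: Rep_simps)
  ultimately show ?thesis unfolding brick_def idn using orb_Ob[OF s(1)] by (auto simp: Rep_simps)
qed

lemma pt_brick:
  assumes h: "h \<in> A" "flip h = h" "e * e = (1 :: 'k::field)"
  shows "brick (Rep (bismash n)) (pt h e)"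
proof -
  interpret R: linear_category "Rep (bismash n) :: (_, _, 'k) tensor_category" by (rule linear_category_Rep)
  have idn: "idn (Rep (bismash n)) (pt h e) = mat_idn {0}" by (simp add: pt_def sgn_rep_def Rep_simps)
  have "mat_idn {0} 0 0 = (1 :: 'k)" by (simp add: mat_idn_def)
  then have "mat_idn {0} \<noteq> (0 :: nat \<Rightarrow> nat \<Rightarrow> 'k)" by (metis zero_fun_apply zero_neq_one)
  moreover have "S \<in> range (\<lambda>c. mat_scl c (mat_idn {0}))" if S: "S \<in> Hom (Rep (bismash n)) (pt h e) (pt h e)" for S
  proof -
    note f = sgn_Hom[OF pt_signed_set[OF h] pt_signed_set[OF h] S[unfolded pt_def]]
    have "S = mat_scl (S 0 0) (mat_idn {0})"
    proof (intro ext)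
      fix i j
      show "S i j = mat_scl (S 0 0) (mat_idn {0}) i j"
        using f(1)[of i j] by (auto simp: mat_scl_apply mat_idn_def)
    qed
    then show ?thesis by blast
  qed
  moreover have "mat_scl c (mat_idn {0}) \<in> Hom (Rep (bismash n)) (pt h e) (pt h e)" for c
    using R.scl_in[OF pt_Ob[OF h] pt_Ob[OF h] R.idn_in[OF pt_Ob[OF h]], of c] idn by (simp add: Rep_simps)
  ultimately show ?thesis unfolding brick_def idn using pt_Ob[OF h] by (auto simp: Rep_simps)
qed

lemma Hom_orb_orb:
  assumes "s \<in> A" "u \<in> A" "S \<in> Hom (Rep (bismash n)) (orb s) (orb u :: _ \<times> (_ \<Rightarrow> _ \<Rightarrow> _ \<Rightarrow> 'k::field))" "S \<noteq> 0"
  shows "u = s \<or> u = flip s"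
proof -
  obtain i j where "S i j \<noteq> 0" using assms(4) by (auto simp: fun_eq_iff)
  from sgn_Hom(1)[OF orb_signed_set[OF assms(1)] orb_signed_set[OF assms(2)] assms(3)[unfolded orb_def] this]
  show ?thesis by (auto split: if_splits)
qed

lemma Hom_pt_pt:
  assumes h: "h \<in> A" "flip h = h" "e * e = (1 :: 'k::field)" and u: "u \<in> A" "flip u = u" "e' * e' = 1"
    and S: "S \<in> Hom (Rep (bismash n)) (pt h e) (pt u e')" "S \<noteq> 0"
  shows "u = h \<and> e' = e"
proof -
  note f = sgn_Hom[OF pt_signed_set[OF h] pt_signed_set[OF u] S(1)[unfolded pt_def]]
  obtain i j where ij: "S i j \<noteq> 0" using S(2) by (auto simp: fun_eq_iff)
  from f(1)[OF this] have "i = 0" "j = 0" "u = h" by auto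
  moreover have "S 0 0 * e = e' * S 0 0" using f(2)[of 0 0] by simp
  ultimately show ?thesis using ij by (simp add: mult.commute)
qed

lemma Hom_orb_pt:
  assumes s: "s \<in> A" "flip s \<noteq> s" and h: "h \<in> A" "flip h = h" "e * e = (1 :: 'k::field)"
  shows "Hom (Rep (bismash n)) (orb s) (pt h e) = {0}" "Hom (Rep (bismash n)) (pt h e) (orb s) = {0}"
proof -
  interpret R: linear_category "Rep (bismash n) :: (_, _, 'k) tensor_category" by (rule linear_category_Rep)
  have ne: "s \<noteq> h" "flip s \<noteq> h" using s h by (metis flip_flip)+
  have "S = 0" if S: "S \<in> Hom (Rep (bismash n)) (orb s) (pt h e)" for S
  proof (rule ccontr)
    assume "S \<noteq> 0"
    then obtain i j where "S i j \<noteq> 0" by (auto simp: fun_eq_iff)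
    from sgn_Hom(1)[OF orb_signed_set[OF s(1)] pt_signed_set[OF h] S[unfolded orb_def pt_def] this]
    show False using ne by (auto split: if_splits)
  qed
  moreover have "S = 0" if S: "S \<in> Hom (Rep (bismash n)) (pt h e) (orb s)" for S
  proof (rule ccontr)
    assume "S \<noteq> 0"
    then obtain i j where "S i j \<noteq> 0" by (auto simp: fun_eq_iff)
    from sgn_Hom(1)[OF pt_signed_set[OF h] orb_signed_set[OF s(1)] S[unfolded orb_def pt_def] this]
    show False using ne by (auto split: if_splits)
  qed
  ultimately show "Hom (Rep (bismash n)) (orb s) (pt h e) = {0}" "Hom (Rep (bismash n)) (pt h e) (orb s) = {0}"
    using R.zero_in[OF orb_Ob[OF s(1)] pt_Ob[OF h]] R.zero_in[OF pt_Ob[OF h] orb_Ob[OF s(1)]] by auto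
qed

text \<open>Both \<open>orb s\<close> and \<open>orb (flip s)\<close> are listed although they are
  isomorphic; \<open>schur_of_representatives\<close> allows such repetitions.\<close>

definition irreps :: "(nat set \<times> ((nat \<Rightarrow> nat) \<times> (nat \<Rightarrow> nat) \<Rightarrow> nat \<Rightarrow> nat \<Rightarrow> 'k::field)) set" where
  "irreps = {orb s |s. s \<in> A \<and> flip s \<noteq> s} \<union> {pt h e |h e. h \<in> A \<and> flip h = h \<and> e \<in> {1, -1}}"

lemma reps_relations:
  assumes "(B, \<rho>) \<in> reps (bismash n :: (_, 'k::field) hopf_algebra_data)"
  shows "finite B" "\<And>u x. u \<in> A \<Longrightarrow> x \<in> K \<Longrightarrow> \<rho> (u, x) \<in> Hom Vect B B"
    "\<And>s x u y. \<lbrakk>s \<in> A; x \<in> K; u \<in> A; y \<in> K\<rbrakk> \<Longrightarrow> mat_cmp (\<rho> (s, x)) (\<rho> (u, y)) = (if u = cj x s then \<rho> (s, x \<circ> y) else 0)"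
    "(\<Sum>s\<in>A. \<rho> (s, id)) = mat_idn B"
proof -
  show "finite B" "\<And>u x. u \<in> A \<Longrightarrow> x \<in> K \<Longrightarrow> \<rho> (u, x) \<in> Hom Vect B B"
    using repsD[OF assms] by (auto simp: hbas_H)
  show "mat_cmp (\<rho> (s, x)) (\<rho> (u, y)) = (if u = cj x s then \<rho> (s, x \<circ> y) else 0)"
    if i: "s \<in> A" "x \<in> K" "u \<in> A" "y \<in> K" for s x u y
  proof -
    have "mat_cmp (\<rho> (s, x)) (\<rho> (u, y)) = (\<Sum>d \<in> hbas (bismash n :: (_, 'k) hopf_algebra_data). mat_scl (hmul (bismash n) (s, x) (u, y) d) (\<rho> d))"
      using assms i unfolding reps_def hbas_H by blast
    then show ?thesis unfolding hbas_H hmul_sum[OF i] .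
  qed
  show "(\<Sum>s\<in>A. \<rho> (s, id)) = mat_idn B"
    using assms hone_sum[of \<rho>] unfolding reps_def hbas_H by auto
qed

text \<open>Takes the place of Maschke's theorem. Starting from a nonzero entry of some
  \<open>\<rho> (s, id)\<close>, a row of suitable matrices of the representation is an arrow to an
  irreducible one, a column is an arrow from it, and their composite is a nonzero multiple of the
  identity.\<close>

lemma reps_split:
  assumes X: "X \<in> Ob (Rep (bismash n))" and X0: "idn (Rep (bismash n)) X \<noteq> 0" and two: "(2 :: 'k::field) \<noteq> 0"
  shows "\<exists>V\<in>irreps. \<exists>f\<in>Hom (Rep (bismash n)) X V. \<exists>g\<in>Hom (Rep (bismash n)) V X. 
    f \<odot>\<^bsub>Rep (bismash n)\<^esub> g = idn (Rep (bismash n)) (V :: _ \<times> (_ \<Rightarrow> _ \<Rightarrow> _ \<Rightarrow> 'k))"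
proof -
  interpret R: linear_category "Rep (bismash n) :: (_, _, 'k) tensor_category" by (rule linear_category_Rep)
  obtain B \<rho> where XB: "X = (B, \<rho>)" by fastforce
  note r = reps_relations[OF X[unfolded XB Rep_simps]]
  have "\<exists>s\<in>A. \<rho> (s, id) \<noteq> 0"
  proof (rule ccontr)
    assume "\<not> ?thesis"
    then have "(\<Sum>s\<in>A. \<rho> (s, id)) = 0" by (intro sum.neutral) auto
    then show False using r(4) X0 by (simp add: XB Rep_simps)
  qed
  then obtain s i0 j0 where s: "s \<in> A" and nz: "\<rho> (s, id) i0 j0 \<noteq> 0" by (auto simp: fun_eq_iff)
  have finish: "\<exists>V\<in>irreps. \<exists>f\<in>Hom (Rep (bismash n)) X V. \<exists>g\<in>Hom (Rep (bismash n)) V X. 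
    f \<odot>\<^bsub>Rep (bismash n)\<^esub> g = idn (Rep (bismash n)) (V :: _ \<times> (_ \<Rightarrow> _ \<Rightarrow> _ \<Rightarrow> 'k))"
    if V: "V \<in> irreps" "V \<in> Ob (Rep (bismash n))" and f: "f \<in> Hom (Rep (bismash n)) X V" and g: "g \<in> Hom (Rep (bismash n)) V X" 
      and fg: "mat_cmp f g = mat_scl c (idn (Rep (bismash n)) V)" and c: "c \<noteq> 0" for V f g c
  proof -
    have g': "mat_scl (inverse c) g \<in> Hom (Rep (bismash n)) V X" using R.scl_in[OF V(2) X g] by (simp add: Rep_simps)
    have "f \<odot>\<^bsub>Rep (bismash n)\<^esub> mat_scl (inverse c) g = mat_scl (inverse c) (mat_scl c (idn (Rep (bismash n)) V))"
      using R.cmp_scl_right[OF V(2) X V(2) g f, of "inverse c"] fg by (simp add: Rep_simps)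
    also have "\<dots> = idn (Rep (bismash n)) V" using c by (simp add: mat_scl_def fun_eq_iff)
    finally show ?thesis using V(1) f g' by blast
  qed
  show ?thesis
  proof (cases "flip s = s")
    case fixed: True
    let ?P = "\<rho> (s, id)" and ?T = "\<rho> (s, transpose 1 2)"
    \<comment> \<open>If the entry of \<open>?P + ?T\<close> vanishes, that of
      \<open>?P - ?T\<close> is twice the nonzero entry of \<open>?P\<close>.\<close>
    obtain e where e: "e \<in> {1, -1 :: 'k}" and Q0: "?P i0 j0 + e * ?T i0 j0 \<noteq> 0"
    proof (cases "?P i0 j0 + 1 * ?T i0 j0 = 0")
      case True
      then have "?P i0 j0 + (-1) * ?T i0 j0 = 2 * ?P i0 j0" by (simp add: algebra_simps add_eq_0_iff)
      then show ?thesis using that[of "-1"] nz two by simp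
    qed (use that[of 1] in auto)
    have ee: "e * e = 1" using e by auto
    \<comment> \<open>Twice the projection to those vectors of degree s on which the transposition
      acts by e.\<close>
    define Q where "Q = ?P + mat_scl e ?T"
    have Q: "Q i j = ?P i j + e * ?T i j" for i j by (simp add: Q_def mat_scl_apply)
    have QV: "Q \<in> Hom Vect B B" unfolding Q_def using r(2) s by (intro Hom_Vect_add Hom_Vect_scl) auto
    have cjs: "cj x s = s" for x using fixed by (simp add: cj_def)
    have QR: "mat_cmp Q (\<rho> (u, x)) i j = (if u = s then (if x = id then 1 else e) * Q i j else 0)"
      if u: "u \<in> A" "x \<in> K" for u x i j
    proof -
      have "mat_cmp Q (\<rho> (u, x)) = mat_cmp ?P (\<rho> (u, x)) + mat_scl e (mat_cmp ?T (\<rho> (u, x)))"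
        unfolding Q_def by (simp only: mat_cmp_add_left mat_cmp_scl_left)
      also have "mat_cmp ?P (\<rho> (u, x)) = (if u = s then \<rho> (s, x) else 0)" using r(3)[OF s _ u, of id] cjs by simp
      also have "mat_cmp ?T (\<rho> (u, x)) = (if u = s then \<rho> (s, transpose 1 2 \<circ> x) else 0)" using r(3)[OF s _ u, of "transpose 1 2"] cjs by simp
      finally have "mat_cmp Q (\<rho> (u, x)) i j = (if u = s then \<rho> (s, x) i j + e * \<rho> (s, transpose 1 2 \<circ> x) i j else 0)"
        by (simp add: mat_scl_apply)
      also have "\<dots> = (if u = s then (if x = id then 1 else e) * Q i j else 0)"
        using u ee by (auto simp: Q distrib_left mult.assoc[symmetric])
      finally show ?thesis .
    qed
    have RQ: "mat_cmp (\<rho> (u, x)) Q i j = (if u = s then (if x = id then 1 else e) * Q i j else 0)"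
      if u: "u \<in> A" "x \<in> K" for u x i j
    proof -
      have su: "s = cj x u \<longleftrightarrow> u = s" using cjs[of x] by (metis cj_def flip_flip)
      have PV: "?P \<in> Hom Vect B B" "?T \<in> Hom Vect B B" using r(2) s by auto
      have "mat_cmp (\<rho> (u, x)) Q = mat_cmp (\<rho> (u, x)) ?P + mat_scl e (mat_cmp (\<rho> (u, x)) ?T)"
        unfolding Q_def by (simp only: mat_cmp_add_right[OF r(1) PV(1) Hom_Vect_scl[OF PV(2)]] mat_cmp_scl_right[OF r(1) PV(2)])
      also have "mat_cmp (\<rho> (u, x)) ?P = (if u = s then \<rho> (s, x) else 0)" using r(3)[OF u s, of id] su by simp
      also have "mat_cmp (\<rho> (u, x)) ?T = (if u = s then \<rho> (s, x \<circ> transpose 1 2) else 0)" using r(3)[OF u s, of "transpose 1 2"] su by simp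
      finally have "mat_cmp (\<rho> (u, x)) Q i j = (if u = s then \<rho> (s, x) i j + e * \<rho> (s, x \<circ> transpose 1 2) i j else 0)"
        by (simp add: mat_scl_apply)
      also have "\<dots> = (if u = s then (if x = id then 1 else e) * Q i j else 0)"
        using u ee by (auto simp: Q distrib_left mult.assoc[symmetric])
      finally show ?thesis .
    qed
    have QQ: "mat_cmp Q Q i j = 2 * Q i j" for i j
    proof -
      have PV: "?P \<in> Hom Vect B B" "?T \<in> Hom Vect B B" using r(2) s by auto
      have "mat_cmp Q Q = mat_cmp Q ?P + mat_scl e (mat_cmp Q ?T)"
        by (subst (2) Q_def) (simp only: mat_cmp_add_right[OF r(1) PV(1) Hom_Vect_scl[OF PV(2)]] mat_cmp_scl_right[OF r(1) PV(2)])
      then have "mat_cmp Q Q i j = Q i j + e * (e * Q i j)"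
        using QR[OF s, of id i j] QR[OF s, of "transpose 1 2" i j] by (simp add: mat_scl_apply)
      then show ?thesis using ee by (simp add: mult.assoc[symmetric])
    qed
    let ?V = "pt s e"
    note sV = pt_signed_set[OF s fixed ee]
    have V: "?V \<in> irreps" "?V \<in> Ob (Rep (bismash n))" using s fixed e ee pt_Ob by (auto simp: irreps_def)
    \<comment> \<open>Row i0 and column j0 of \<open>Q\<close>; the composite is an entry of the
      square of \<open>Q\<close>, which is \<open>2 * Q\<close>.\<close>
    let ?f = "\<lambda>y j. if y = (0::nat) then Q i0 j else 0" and ?g = "\<lambda>i y. if y = (0::nat) then Q i j0 else 0"
    have fV: "?f \<in> Hom Vect B {0}" "?g \<in> Hom Vect {0} B" using QV by (auto simp: Hom_Vect)
    have "?f \<in> Hom (Rep (bismash n)) X ?V"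
      unfolding XB pt_def sgn_rep_def Hom_Rep hbas_H
    proof (intro conjI ballI)
      fix b assume "b \<in> A \<times> K"
      then obtain u x where b: "b = (u, x)" and u: "u \<in> A" "x \<in> K" by auto
      show "mat_cmp ?f (\<rho> b) = mat_cmp (sgn_mat {0} (\<lambda>_. s) (\<lambda>j. j) (\<lambda>_. e) b) ?f"
      proof (intro ext)
        fix y j
        have "mat_cmp ?f (\<rho> b) y j = (if y = 0 then mat_cmp Q (\<rho> b) i0 j else 0)"
          by (auto simp: mat_cmp_def)
        also have "\<dots> = (\<Sum>p\<in>{0}. sgn_mat {0} (\<lambda>_. s) (\<lambda>j. j) (\<lambda>_. e) b y p * ?f p j)"
          unfolding b QR[OF u] sgn_mat_apply[OF u] by (auto simp: act_def)
        also have "\<dots> = mat_cmp (sgn_mat {0} (\<lambda>_. s) (\<lambda>j. j) (\<lambda>_. e) b) ?f y j"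
          by (rule mat_cmp_Hom[OF fV(1), symmetric]) simp
        finally show "mat_cmp ?f (\<rho> b) y j = mat_cmp (sgn_mat {0} (\<lambda>_. s) (\<lambda>j. j) (\<lambda>_. e) b) ?f y j" .
      qed
    qed (rule fV)
    moreover have "?g \<in> Hom (Rep (bismash n)) ?V X"
      unfolding XB pt_def sgn_rep_def Hom_Rep hbas_H
    proof (intro conjI ballI)
      fix b assume "b \<in> A \<times> K"
      then obtain u x where b: "b = (u, x)" and u: "u \<in> A" "x \<in> K" by auto
      show "mat_cmp ?g (sgn_mat {0} (\<lambda>_. s) (\<lambda>j. j) (\<lambda>_. e) b) = mat_cmp (\<rho> b) ?g"
      proof (intro ext)
        fix i y
        have "mat_cmp (\<rho> b) ?g i y = (if y = 0 then mat_cmp (\<rho> b) Q i j0 else 0)"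
          by (auto simp: mat_cmp_def)
        also have "\<dots> = mat_cmp ?g (sgn_mat {0} (\<lambda>_. s) (\<lambda>j. j) (\<lambda>_. e) b) i y"
          unfolding b RQ[OF u] unfolding sgn_mat_def using u by (auto simp: mat_cmp_mono act_def mult.commute)
        finally show "mat_cmp ?g (sgn_mat {0} (\<lambda>_. s) (\<lambda>j. j) (\<lambda>_. e) b) i y = mat_cmp (\<rho> b) ?g i y" by simp
      qed
    qed (rule fV)
    moreover have "mat_cmp ?f ?g = mat_scl (2 * Q i0 j0) (idn (Rep (bismash n)) ?V)"
    proof (intro ext)
      fix y z
      have "mat_cmp ?f ?g y z = (if y = 0 \<and> z = 0 then mat_cmp Q Q i0 j0 else 0)"
        by (auto simp: mat_cmp_def)
      then show "mat_cmp ?f ?g y z = mat_scl (2 * Q i0 j0) (idn (Rep (bismash n)) ?V) y z"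
        unfolding QQ by (auto simp: mat_scl_apply Rep_simps pt_def sgn_rep_def mat_idn_def)
    qed
    moreover have "2 * Q i0 j0 \<noteq> 0" using Q0 two unfolding Q mult_eq_0_iff by blast
    ultimately show ?thesis by (rule finish[OF V])
  next
    case moved: False
    \<comment> \<open>Now \<open>X y\<close> is the group element that relates the point 0 of the
      orbit to the point y, and \<open>d y\<close> is the degree of y. The name shadows the given
      representation, which is written (B, \<rho>) from here on.\<close>
    define X where "X y = (if y = (0::nat) then id else transpose 1 (2::nat))" for y
    define d where "d y = (if y = (0::nat) then s else flip s)" for y
    have XK: "X y \<in> K" and dA: "d y \<in> A" and dcj: "cj (X y) s = d y" for y
      using s A_flip transpose_not_id by (auto simp: X_def d_def cj_def)
    let ?V = "orb s :: _ \<times> (_ \<Rightarrow> _ \<Rightarrow> _ \<Rightarrow> 'k)"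
    have V: "?V \<in> irreps" "?V \<in> Ob (Rep (bismash n))" using s moved orb_Ob by (auto simp: irreps_def)
    \<comment> \<open>Row i0 of the matrices that end in degree s, and column j0 of those that start
      in degree s.\<close>
    let ?f = "\<lambda>y j. if y \<in> {0, 1} then \<rho> (s, X y) i0 j else 0" and ?g = "\<lambda>i y. if y \<in> {0, 1} then \<rho> (d y, X y) i j0 else 0"
    have fV: "?f \<in> Hom Vect B {0, 1}" "?g \<in> Hom Vect {0, 1} B"
      using r(2)[OF s XK] r(2)[OF dA XK] by (auto simp: Hom_Vect)
    have orb: "?V = sgn_rep {0, 1} d (\<lambda>j. 1 - j) (\<lambda>_. 1)" by (simp add: orb_def d_def[abs_def])
    let ?m = "sgn_mat {0, 1} d (\<lambda>j. 1 - j) (\<lambda>_. 1 :: 'k)"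
    have "?f \<in> Hom (Rep (bismash n)) (B, \<rho>) ?V"
      unfolding orb sgn_rep_def Hom_Rep hbas_H
    proof (intro conjI ballI)
      fix b assume "b \<in> A \<times> K"
      then obtain u x where b: "b = (u, x)" and u: "u \<in> A" "x \<in> K" by auto
      show "mat_cmp ?f (\<rho> b) = mat_cmp (?m b) ?f"
      proof (intro ext)
        fix y j
        have "mat_cmp ?f (\<rho> b) y j = (if y \<in> {0, 1} then mat_cmp (\<rho> (s, X y)) (\<rho> b) i0 j else 0)"
          by (auto simp: mat_cmp_def)
        also have "\<dots> = (if y \<in> {0, 1} then if u = d y then \<rho> (s, X y \<circ> x) i0 j else 0 else 0)"
          unfolding b r(3)[OF s XK u] dcj by simp
        also have "\<dots> = (\<Sum>p\<in>{0, 1}. ?m b y p * ?f p j)"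
          unfolding b sgn_mat_apply[OF u] using u by (auto simp: act_def X_def)
        also have "\<dots> = mat_cmp (?m b) ?f y j"
          by (rule mat_cmp_Hom[OF fV(1), symmetric]) simp
        finally show "mat_cmp ?f (\<rho> b) y j = mat_cmp (?m b) ?f y j" .
      qed
    qed (rule fV)
    moreover have "?g \<in> Hom (Rep (bismash n)) ?V (B, \<rho>)"
      unfolding orb sgn_rep_def Hom_Rep hbas_H
    proof (intro conjI ballI)
      fix b assume "b \<in> A \<times> K"
      then obtain u x where b: "b = (u, x)" and u: "u \<in> A" "x \<in> K" by auto
      show "mat_cmp ?g (?m b) = mat_cmp (\<rho> b) ?g"
      proof (intro ext)
        fix i y
        have fl: "flip s = u \<longleftrightarrow> s = flip u" by (metis flip_flip)
        have "mat_cmp (\<rho> b) ?g i y = (if y \<in> {0, 1} then mat_cmp (\<rho> b) (\<rho> (d y, X y)) i j0 else 0)"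
          by (auto simp: mat_cmp_def)
        also have "\<dots> = (if y \<in> {0, 1} then if d y = cj x u then \<rho> (u, x \<circ> X y) i j0 else 0 else 0)"
          unfolding b r(3)[OF u dA XK] by simp
        also have "\<dots> = mat_cmp ?g (?m b) i y"
          unfolding b sgn_mat_def using u fl by (auto simp: mat_cmp_mono act_def X_def d_def cj_def)
        finally show "mat_cmp ?g (?m b) i y = mat_cmp (\<rho> b) ?g i y" by simp
      qed
    qed (rule fV)
    moreover have "mat_cmp ?f ?g = mat_scl (\<rho> (s, id) i0 j0) (idn (Rep (bismash n)) ?V)"
    proof (intro ext)
      fix y z
      have "mat_cmp ?f ?g y z = (if y \<in> {0, 1} \<and> z \<in> {0, 1} then mat_cmp (\<rho> (s, X y)) (\<rho> (d z, X z)) i0 j0 else 0)"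
        by (auto simp: mat_cmp_def)
      also have "\<dots> = (if y \<in> {0, 1} \<and> z \<in> {0, 1} then (if d z = d y then \<rho> (s, X y \<circ> X z) i0 j0 else 0) else 0)"
        unfolding r(3)[OF s XK dA XK] dcj by simp
      also have "\<dots> = mat_scl (\<rho> (s, id) i0 j0) (idn (Rep (bismash n)) ?V) y z"
        using moved by (auto simp: mat_scl_apply Rep_simps orb_def sgn_rep_def mat_idn_def d_def X_def)
      finally show "mat_cmp ?f ?g y z = mat_scl (\<rho> (s, id) i0 j0) (idn (Rep (bismash n)) ?V) y z" .
    qed
    ultimately show ?thesis using finish[OF V _ _ _ nz] unfolding XB by blast
  qed
qed

end

section \<open>Fusion rules of the bismash product\<close>

text \<open>Turns the numerical fusion rules back into decompositions in C: multiplicities determine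
  a multiset of simple classes.\<close>

lemma grothendieck_decomp:
  fixes C :: "('o, 'a::ab_group_add, 'k::alg_closed_field) tensor_category"
  assumes fC: "fusion_category C" and f: "bij_betw f (Irr R) (Irr C)"
    and rule: "\<And>x y z. x \<in> Irr R \<Longrightarrow> y \<in> Irr R \<Longrightarrow> z \<in> Irr R \<Longrightarrow> fusion_rule C (f x) (f y) (f z) = fusion_rule R x y z"
    and x: "x \<in> Irr R" and y: "y \<in> Irr R" and M: "set_mset M \<subseteq> Irr R" "\<And>z. z \<in> Irr R \<Longrightarrow> fusion_rule R x y z = count M z"
  shows "decomp C (rep_ob (f x) \<boxtimes>\<^bsub>C\<^esub> rep_ob (f y)) (image_mset f M)"
proof -
  interpret C: semisimple_monoidal_category C by (rule fusion_semisimple_monoidal[OF fC])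
  have fI: "f z \<in> Irr C" if "z \<in> Irr R" for z using f that by (auto simp: bij_betw_def)
  have inj: "inj_on f (Irr R)" using f by (simp add: bij_betw_def)
  have O: "rep_ob (f x) \<in> Ob C" "rep_ob (f y) \<in> Ob C" using fusion_rep_brick(1)[OF fC fI] x y C.brick_Ob by auto
  obtain N where N: "decomp C (rep_ob (f x) \<boxtimes>\<^bsub>C\<^esub> rep_ob (f y)) N" using C.decomposable C.tob_in O by blast
  have "N = image_mset f M"
  proof (rule multiset_eqI)
    fix u
    show "count N u = count (image_mset f M) u"
    proof (cases "u \<in> Irr C")
      case True
      then obtain z where z: "z \<in> Irr R" "u = f z" using f by (auto simp: bij_betw_def)
      have "count N u = fusion_rule C (f x) (f y) u"
        unfolding fusion_rule_def using C.decomp_count[OF N fusion_rep_brick(1)[OF fC True]] fusion_rep_brick(2)[OF fC True] by simp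
      also have "\<dots> = count M z" using rule[OF x y z(1)] M(2)[OF z(1)] z by simp
      also have "\<dots> = count (image_mset f M) u"
      proof -
        have s: "f -` {f z} \<inter> set_mset M \<subseteq> {z}" using inj M(1) z by (auto simp: inj_on_def)
        have "count (image_mset f M) (f z) = (\<Sum>u\<in>f -` {f z} \<inter> set_mset M. count M u)" by (simp add: count_image_mset)
        also have "\<dots> = (\<Sum>u\<in>{z}. count M u)"
          by (rule sum.mono_neutral_left) (use s in \<open>auto simp: not_in_iff\<close>)
        finally show ?thesis using z by simp
      qed
      finally show ?thesis .
    next
      case False
      then have "count N u = 0" using C.decomp_mem[OF N, of u] by (auto simp: Irr_bricks[OF fC] not_in_iff[symmetric])
      moreover have "u \<notin># image_mset f M" using False M(1) fI by auto
      then have "count (image_mset f M) u = 0" by (simp only: not_in_iff)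
      ultimately show ?thesis by simp
    qed
  qed
  then show ?thesis using N by simp
qed

text \<open>\<open>fusion_rule\<close> evaluates tensor products on arbitrary representatives of the
  classes. That such a product is a representation is carried over from a product of listed
  irreducibles by conjugation with an isomorphism.\<close>

lemma reps_transport:
  assumes X: "(A, \<rho>) \<in> reps H" and B: "finite B" and \<tau>: "\<And>b. b \<in> hbas H \<Longrightarrow> \<tau> b \<in> Hom Vect B B" "\<And>b. b \<notin> hbas H \<Longrightarrow> \<tau> b = 0"
    and S: "S \<in> Hom Vect A B" "S' \<in> Hom Vect B A" "mat_cmp S S' = mat_idn B" "mat_cmp S' S = mat_idn A"
    and comm: "\<And>b. b \<in> hbas H \<Longrightarrow> mat_cmp S (\<rho> b) = mat_cmp (\<tau> b) S"
  shows "(B, \<tau>) \<in> reps H"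
proof -
  note A = repsD(1)[OF X] and \<rho> = repsD(2)[OF X]
  have \<rho>mult: "mat_cmp (\<rho> b) (\<rho> c) = (\<Sum>d \<in> hbas H. mat_scl (hmul H b c d) (\<rho> d))" if "b \<in> hbas H" "c \<in> hbas H" for b c
    using X that unfolding reps_def by blast
  have \<rho>one: "(\<Sum>b \<in> hbas H. mat_scl (hone H b) (\<rho> b)) = mat_idn A"
    using X unfolding reps_def by blast
  define cnj where "cnj M = mat_cmp (mat_cmp S M) S'" for M
  have cnj_sum: "cnj (\<Sum>d \<in> hbas H. mat_scl (f d) (\<rho> d)) = (\<Sum>d \<in> hbas H. mat_scl (f d) (cnj (\<rho> d)))" for f
    unfolding cnj_def using A \<rho>
    by (subst mat_cmp_sum_right[of A _ _ A]) (auto simp: Hom_Vect_scl mat_cmp_sum_left mat_cmp_scl_left mat_cmp_scl_right[of A _ A] intro!: sum.cong)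
  have \<tau>_eq: "\<tau> b = cnj (\<rho> b)" if b: "b \<in> hbas H" for b
  proof -
    have "cnj (\<rho> b) = mat_cmp (\<tau> b) (mat_cmp S S')"
      unfolding cnj_def comm[OF b] by (rule mat_cmp_assoc[OF A B S(2,1), symmetric])
    then show ?thesis using S mat_cmp_idn_right[OF B \<tau>(1)[OF b]] by simp
  qed
  have cnj_mult: "mat_cmp (cnj M) (cnj N) = cnj (mat_cmp M N)" if M: "M \<in> Hom Vect A A" and N: "N \<in> Hom Vect A A" for M N
  proof -
    have "mat_cmp (cnj M) (cnj N) = mat_cmp (mat_cmp (cnj M) (mat_cmp S N)) S'"
      unfolding cnj_def[of N] by (rule mat_cmp_assoc[OF A B S(2) mat_cmp_in[OF S(1) N]])
    also have "mat_cmp (cnj M) (mat_cmp S N) = mat_cmp (mat_cmp (cnj M) S) N" by (rule mat_cmp_assoc[OF A B N S(1)])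
    also have "mat_cmp (cnj M) S = mat_cmp (mat_cmp S M) (mat_cmp S' S)"
      unfolding cnj_def by (rule mat_cmp_assoc[OF B A S(1,2), symmetric])
    also have "\<dots> = mat_cmp S M" using S mat_cmp_idn_right[OF A mat_cmp_in[OF S(1) M]] by simp
    also have "mat_cmp \<dots> N = mat_cmp S (mat_cmp M N)" by (rule mat_cmp_assoc[OF A A N M, symmetric])
    finally show ?thesis by (simp add: cnj_def)
  qed
  have "mat_cmp (\<tau> b) (\<tau> c) = (\<Sum>d \<in> hbas H. mat_scl (hmul H b c d) (\<tau> d))" if "b \<in> hbas H" "c \<in> hbas H" for b c
  proof -
    have "mat_cmp (\<tau> b) (\<tau> c) = cnj (mat_cmp (\<rho> b) (\<rho> c))"
      using cnj_mult[OF \<rho>[OF that(1)] \<rho>[OF that(2)]] that by (simp add: \<tau>_eq)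
    also have "\<dots> = (\<Sum>d \<in> hbas H. mat_scl (hmul H b c d) (cnj (\<rho> d)))" unfolding \<rho>mult[OF that] by (rule cnj_sum)
    also have "\<dots> = (\<Sum>d \<in> hbas H. mat_scl (hmul H b c d) (\<tau> d))" by (rule sum.cong) (simp_all add: \<tau>_eq)
    finally show ?thesis .
  qed
  moreover have "(\<Sum>b \<in> hbas H. mat_scl (hone H b) (\<tau> b)) = mat_idn B"
  proof -
    have "(\<Sum>b \<in> hbas H. mat_scl (hone H b) (\<tau> b)) = (\<Sum>b \<in> hbas H. mat_scl (hone H b) (cnj (\<rho> b)))"
      by (rule sum.cong) (simp_all add: \<tau>_eq)
    also have "\<dots> = cnj (mat_idn A)" unfolding cnj_sum[symmetric] \<rho>one ..
    also have "\<dots> = mat_idn B" unfolding cnj_def mat_cmp_idn_right[OF A S(1)] by (rule S(3))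
    finally show ?thesis .
  qed
  ultimately show ?thesis using B \<tau> unfolding reps_def by blast
qed

lemma Rep_tob_iso_closed:
  assumes O: "X \<in> Ob (Rep H)" "X' \<in> Ob (Rep H)" "Y \<in> Ob (Rep H)" "Y' \<in> Ob (Rep H)"
    and iso: "isomorphic (Rep H) X X'" "isomorphic (Rep H) Y Y'" and XY: "X \<boxtimes>\<^bsub>Rep H\<^esub> Y \<in> Ob (Rep H)"
  shows "X' \<boxtimes>\<^bsub>Rep H\<^esub> Y' \<in> Ob (Rep H)"
proof -
  obtain S S' where S: "S \<in> Hom (Rep H) (X \<boxtimes>\<^bsub>Rep H\<^esub> Y) (X' \<boxtimes>\<^bsub>Rep H\<^esub> Y')" "S' \<in> Hom (Rep H) (X' \<boxtimes>\<^bsub>Rep H\<^esub> Y') (X \<boxtimes>\<^bsub>Rep H\<^esub> Y)"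
    "mat_cmp S' S = idn (Rep H) (X \<boxtimes>\<^bsub>Rep H\<^esub> Y)" "mat_cmp S S' = idn (Rep H) (X' \<boxtimes>\<^bsub>Rep H\<^esub> Y')"
    using isomorphic_Rep_tob[OF O iso] by (auto simp: isomorphic_def iso_arr_def Rep_simps)
  obtain A \<rho> where A: "X \<boxtimes>\<^bsub>Rep H\<^esub> Y = (A, \<rho>)" by fastforce
  obtain B \<tau> where B: "X' \<boxtimes>\<^bsub>Rep H\<^esub> Y' = (B, \<tau>)" by fastforce
  obtain A' \<rho>' B' \<sigma>' where X': "X' = (A', \<rho>')" "Y' = (B', \<sigma>')" by (metis surj_pair)
  note r = O(2)[unfolded X' Rep_simps] O(4)[unfolded X' Rep_simps]
  have B': "B = mat_tob A' B'" "\<tau> = (\<lambda>b. if b \<in> hbas H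
        then \<Sum>c \<in> hbas H. \<Sum>d \<in> hbas H. mat_scl (hcom H b c d) (mat_tar (\<rho>' c) (\<sigma>' d)) else 0)"
    using B unfolding X' tob_Rep by auto
  have "(B, \<tau>) \<in> reps H"
  proof (rule reps_transport)
    show "(A, \<rho>) \<in> reps H" using XY A by (simp add: Rep_simps)
    show "finite B" using repsD(1)[OF r(1)] repsD(1)[OF r(2)] by (simp add: B' mat_tob_def)
    show "\<tau> b \<in> Hom Vect B B" if "b \<in> hbas H" for b
      unfolding B' using that repsD(2)[OF r(1)] repsD(2)[OF r(2)] by (auto intro!: Hom_Vect_sum Hom_Vect_scl mat_tar_in)
    show "\<tau> b = 0" if "b \<notin> hbas H" for b using that by (simp add: B')
    show "S \<in> Hom Vect A B" "S' \<in> Hom Vect B A" "mat_cmp S S' = mat_idn B" "mat_cmp S' S = mat_idn A"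
      using S by (auto simp: A B Hom_Rep Rep_simps)
    show "mat_cmp S (\<rho> b) = mat_cmp (\<tau> b) S" if "b \<in> hbas H" for b
      using S(1) that by (simp add: A B Hom_Rep)
  qed
  then show ?thesis using B by (simp add: Rep_simps)
qed

text \<open>The fusion rules in the form in which they are used from now on. \<open>V s\<close>
  corresponds to the orbit of s or, if \<open>flip s = s\<close>, to the point s with sign 1, and
  \<open>W h\<close> to the point h with sign -1. In a product of two orbits a fixed degree t
  contributes \<open>V t\<close> together with \<open>W t\<close>.\<close>

locale bismash_fusion = bismash_degree n + semisimple_monoidal_category C
  for n and C :: "('o, 'a::ab_group_add, 'k::field) tensor_category" (structure) +
  fixes V W :: "(nat \<Rightarrow> nat) \<Rightarrow> 'o"
  assumes V_brick: "s \<in> A \<Longrightarrow> brick C (V s)"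
    and W_brick: "\<lbrakk>h \<in> A; flip h = h\<rbrakk> \<Longrightarrow> brick C (W h)"
    and V_iso: "\<lbrakk>s \<in> A; u \<in> A\<rbrakk> \<Longrightarrow> isomorphic C (V s) (V u) \<longleftrightarrow> u = s \<or> u = flip s"
    and V_W_iso: "\<lbrakk>s \<in> A; h \<in> A; flip h = h\<rbrakk> \<Longrightarrow> \<not> isomorphic C (V s) (W h)"
    and W_iso: "\<lbrakk>h \<in> A; flip h = h; u \<in> A; flip u = u; isomorphic C (W h) (W u)\<rbrakk> \<Longrightarrow> h = u"
    and V_id: "isomorphic C (V id) (unit_ob C)"
    and brick_cases: "brick C X \<Longrightarrow> (\<exists>s\<in>A. isomorphic C X (V s)) \<or> (\<exists>h\<in>A. flip h = h \<and> isomorphic C X (W h))"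
    and V_fixed_tob_V: "\<lbrakk>h \<in> A; flip h = h; u \<in> A\<rbrakk> \<Longrightarrow> isomorphic C (V h \<boxtimes> V u) (V (h \<circ> u))"
    and V_tob_V_fixed: "\<lbrakk>h \<in> A; flip h = h; u \<in> A\<rbrakk> \<Longrightarrow> isomorphic C (V u \<boxtimes> V h) (V (u \<circ> h))"
    and W_tob_V_moved: "\<lbrakk>h \<in> A; flip h = h; u \<in> A; flip u \<noteq> u\<rbrakk> \<Longrightarrow> isomorphic C (W h \<boxtimes> V u) (V (h \<circ> u))"
    and V_moved_tob_W: "\<lbrakk>h \<in> A; flip h = h; u \<in> A; flip u \<noteq> u\<rbrakk> \<Longrightarrow> isomorphic C (V u \<boxtimes> W h) (V (u \<circ> h))"
    and W_tob_V_fixed: "\<lbrakk>h \<in> A; flip h = h; u \<in> A; flip u = u\<rbrakk> \<Longrightarrow> isomorphic C (W h \<boxtimes> V u) (W (h \<circ> u))"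
    and V_fixed_tob_W: "\<lbrakk>h \<in> A; flip h = h; u \<in> A; flip u = u\<rbrakk> \<Longrightarrow> isomorphic C (V u \<boxtimes> W h) (W (u \<circ> h))"
    and W_tob_W: "\<lbrakk>h \<in> A; flip h = h; u \<in> A; flip u = u\<rbrakk> \<Longrightarrow> isomorphic C (W h \<boxtimes> W u) (V (h \<circ> u))"
    and V_moved_tob_V_moved: "\<lbrakk>s \<in> A; flip s \<noteq> s; u \<in> A; flip u \<noteq> u\<rbrakk> \<Longrightarrow> decomp C (V s \<boxtimes> V u)
      ((if flip (s \<circ> u) = s \<circ> u then {#iso_class C (V (s \<circ> u)), iso_class C (W (s \<circ> u))#} else {#iso_class C (V (s \<circ> u))#}) +
       (if flip (s \<circ> flip u) = s \<circ> flip u then {#iso_class C (V (s \<circ> flip u)), iso_class C (W (s \<circ> flip u))#}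
        else {#iso_class C (V (s \<circ> flip u))#}))"

section \<open>Tensor products of the irreducible representations\<close>

context bismash_degree
begin

lemma flip_comp_fixed:
  assumes "h \<in> A" "flip h = h" "u \<in> A"
  shows "flip (h \<circ> u) = h \<circ> u \<longleftrightarrow> flip u = u" "flip (u \<circ> h) = u \<circ> h \<longleftrightarrow> flip u = u"
proof -
  have i: "inv' h \<circ> h = id" "h \<circ> inv' h = id" using alt_inv[OF n2 assms(1)] by auto
  have "flip u = u" if "h \<circ> flip u = h \<circ> u" using that i by (metis comp_assoc id_comp)
  then show "flip (h \<circ> u) = h \<circ> u \<longleftrightarrow> flip u = u" using assms(2) by (auto simp: flip_comp)
  have "flip u = u" if "flip u \<circ> h = u \<circ> h" using that i by (metis comp_assoc comp_id)
  then show "flip (u \<circ> h) = u \<circ> h \<longleftrightarrow> flip u = u" using assms(2) by (auto simp: flip_comp)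
qed

definition repV :: "(nat \<Rightarrow> nat) \<Rightarrow> nat set \<times> ((nat \<Rightarrow> nat) \<times> (nat \<Rightarrow> nat) \<Rightarrow> nat \<Rightarrow> nat \<Rightarrow> 'k::field)" where
  "repV s = (if flip s = s then pt s 1 else orb s)"

definition repW :: "(nat \<Rightarrow> nat) \<Rightarrow> nat set \<times> ((nat \<Rightarrow> nat) \<times> (nat \<Rightarrow> nat) \<Rightarrow> nat \<Rightarrow> nat \<Rightarrow> 'k::field)" where
  "repW h = pt h (-1)"

lemma irreps_cases:
  assumes "X \<in> irreps"
  obtains (V) s where "s \<in> A" "X = repV s" | (W) h where "h \<in> A" "flip h = h" "X = repW h"
  using assms unfolding irreps_def repV_def repW_def by (auto split: if_splits)

lemma repV_irreps: "s \<in> A \<Longrightarrow> repV s \<in> irreps" and repW_irreps: "h \<in> A \<Longrightarrow> flip h = h \<Longrightarrow> repW h \<in> irreps"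
  by (auto simp: irreps_def repV_def repW_def)

context
  fixes R :: "(nat set \<times> ((nat \<Rightarrow> nat) \<times> (nat \<Rightarrow> nat) \<Rightarrow> nat \<Rightarrow> nat \<Rightarrow> 'k), nat \<Rightarrow> nat \<Rightarrow> 'k, 'k::field_char_0) tensor_category"
  assumes R_def: "R = Rep (bismash n)"
begin

interpretation R: linear_category R unfolding R_def by (rule linear_category_Rep)

lemma repV_brick: "s \<in> A \<Longrightarrow> brick R (repV s)"
  unfolding repV_def R_def by (cases "flip s = s") (simp_all add: orb_brick pt_brick)

lemma repW_brick: "h \<in> A \<Longrightarrow> flip h = h \<Longrightarrow> brick R (repW h)"
  unfolding repW_def R_def by (rule pt_brick) simp_all

lemma Hom_V_V: 
  assumes "s \<in> A" "u \<in> A" "S \<in> Hom R (repV s) (repV u)" "S \<noteq> 0"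
  shows "u = s \<or> u = flip s"
  using assms Hom_orb_orb[of s u S] Hom_pt_pt[of s 1 u 1 S] Hom_orb_pt[of s u 1] Hom_orb_pt[of u s 1]
  unfolding repV_def R_def by (auto split: if_splits)

lemma Hom_V_W:
  assumes "s \<in> A" "h \<in> A" "flip h = h"
  shows "Hom R (repV s) (repW h) = {0}" "Hom R (repW h) (repV s) = {0}"
proof -
  have ne: "(1::'k) \<noteq> -1" "-1 \<noteq> (1::'k)" by (metis one_neq_neg_one)+
  have O: "repV s \<in> Ob R" "repW h \<in> Ob R" using repV_brick repW_brick assms R.brick_Ob by auto
  have "S = 0" if "S \<in> Hom R (repV s) (repW h)" for S
    using that assms ne Hom_pt_pt[of s 1 h "-1" S] Hom_orb_pt[of s h "-1"]
    unfolding repV_def repW_def R_def by (auto split: if_splits)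
  moreover have "S = 0" if "S \<in> Hom R (repW h) (repV s)" for S
    using that assms ne Hom_pt_pt[of h "-1" s 1 S] Hom_orb_pt[of s h "-1"]
    unfolding repV_def repW_def R_def by (auto split: if_splits)
  ultimately show "Hom R (repV s) (repW h) = {0}" "Hom R (repW h) (repV s) = {0}"
    using R.zero_in[OF O] R.zero_in[OF O(2,1)] by auto
qed

lemma Hom_W_W:
  assumes "h \<in> A" "flip h = h" "u \<in> A" "flip u = u" "S \<in> Hom R (repW h) (repW u)" "S \<noteq> 0"
  shows "u = h"
  using assms Hom_pt_pt[of h "-1" u "-1" S] unfolding repW_def R_def by simp

lemma repV_flip: "s \<in> A \<Longrightarrow> isomorphic R (repV s) (repV (flip s))"
  using orb_flip[of s] R.isomorphic_refl[OF R.brick_Ob[OF repV_brick[of s]]] unfolding repV_def R_def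
  by (cases "flip s = s") auto

lemma irreps_brick: "X \<in> irreps \<Longrightarrow> brick R X"
  by (erule irreps_cases) (auto simp: repV_brick repW_brick)

lemma irreps_dichotomy:
  assumes "X \<in> irreps" "Y \<in> irreps"
  shows "isomorphic R X Y \<or> Hom R X Y = {0}"
proof (rule disjCI)
  assume "Hom R X Y \<noteq> {0}"
  moreover have O: "X \<in> Ob R" "Y \<in> Ob R" using assms irreps_brick R.brick_Ob by auto
  ultimately obtain S where S: "S \<in> Hom R X Y" "S \<noteq> 0" using R.zero_in[OF O] by blast
  note refl = R.isomorphic_refl[OF O(1)]
  show "isomorphic R X Y"
  proof (cases rule: irreps_cases[OF assms(1)])
    case (1 s)
    show ?thesis
    proof (cases rule: irreps_cases[OF assms(2)])
      case (1 u)
      then show ?thesis using Hom_V_V[of s u S] S \<open>s \<in> A\<close> \<open>X = repV s\<close> repV_flip[of s] refl by auto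
    next
      case (2 h)
      then show ?thesis using Hom_V_W(1)[of s h] S \<open>s \<in> A\<close> \<open>X = repV s\<close> by auto
    qed
  next
    case (2 h)
    show ?thesis
    proof (cases rule: irreps_cases[OF assms(2)])
      case (1 u)
      then show ?thesis using Hom_V_W(2)[of u h] S 2 by auto
    next
      case (2 u)
      then show ?thesis using Hom_W_W[of h u S] S \<open>h \<in> A\<close> \<open>flip h = h\<close> \<open>X = repW h\<close> refl by auto
    qed
  qed
qed

lemma irreps_split:
  "X \<in> Ob R \<Longrightarrow> idn R X \<noteq> 0 \<Longrightarrow> \<exists>V\<in>irreps. \<exists>f\<in>Hom R X V. \<exists>g\<in>Hom R V X. f \<odot>\<^bsub>R\<^esub> g = idn R V"
  unfolding R_def by (rule reps_split) simp_all

lemma Rep_schur: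
  shows "schur_category R" "simple_ob R X \<longleftrightarrow> brick R X" "brick R X \<Longrightarrow> \<exists>V\<in>irreps. isomorphic R V X"
  using R.schur_of_representatives[of irreps, OF irreps_brick irreps_dichotomy irreps_split] by blast+

interpretation R: schur_category R by (rule Rep_schur(1))

lemma Rep_simple_iff_brick: "simple_ob R X \<longleftrightarrow> brick R X" by (rule Rep_schur(2))

lemma Irr_Rep: "Irr R = iso_class R ` {X. brick R X}"
  by (simp add: Irr_def Rep_simple_iff_brick)

lemma Rep_rep_ob:
  assumes "brick R X"
  shows "brick R (rep_ob (iso_class R X))"
  using R.brick_iso[OF assms R.rep_ob_iso_class(1,2)[OF R.brick_Ob[OF assms]]] .

lemma Rep_tob_in:
  assumes "X \<in> irreps" "Y \<in> irreps"
  shows "X \<boxtimes>\<^bsub>R\<^esub> Y \<in> Ob R"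
proof -
  have "\<exists>B d \<pi> \<epsilon>. X = sgn_rep B d \<pi> \<epsilon> \<and> signed_set B d \<pi> \<epsilon>" if "X \<in> irreps" for X :: "_ \<times> (_ \<Rightarrow> _ \<Rightarrow> _ \<Rightarrow> 'k)"
    using that unfolding irreps_def
  proof (elim UnE CollectE exE conjE)
    fix s assume "X = orb s" "s \<in> A"
    then show ?thesis using orb_signed_set[of s] unfolding orb_def by blast
  next
    fix h and e :: 'k assume "X = pt h e" "h \<in> A" "flip h = h" "e \<in> {1, -1}"
    moreover have "e * e = 1" using \<open>e \<in> {1, -1}\<close> by auto
    ultimately show ?thesis using pt_signed_set[of h e] unfolding pt_def by blast
  qed
  then obtain B d \<pi> \<epsilon> B' d' \<pi>' \<epsilon>' where "X = sgn_rep B d \<pi> \<epsilon>" "signed_set B d \<pi> \<epsilon>" "Y = sgn_rep B' d' \<pi>' \<epsilon>'" "signed_set B' d' \<pi>' \<epsilon>'"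
    using assms by meson
  then show ?thesis unfolding R_def using sgn_rep_tob[of B d \<pi> \<epsilon> B' d' \<pi>' \<epsilon>'] sgn_rep_Ob by simp
qed

lemma Rep_fusion_rule:
  assumes X: "X \<in> irreps" and Y: "Y \<in> irreps" and M: "decomp R (X \<boxtimes>\<^bsub>R\<^esub> Y) M" and z: "z \<in> Irr R"
  shows "fusion_rule R (iso_class R X) (iso_class R Y) z = count M z"
proof -
  note bX = irreps_brick[OF X] and bY = irreps_brick[OF Y]
  note OX = R.brick_Ob[OF bX] and OY = R.brick_Ob[OF bY]
  note rX = R.rep_ob_iso_class[OF OX] and rY = R.rep_ob_iso_class[OF OY]
  obtain Z where Z: "brick R Z" "z = iso_class R Z" using z by (auto simp: Irr_Rep)
  note rZ = R.rep_ob_iso_class[OF R.brick_Ob[OF Z(1)]]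
  have iso: "isomorphic R (X \<boxtimes>\<^bsub>R\<^esub> Y) (rep_ob (iso_class R X) \<boxtimes>\<^bsub>R\<^esub> rep_ob (iso_class R Y))"
    using isomorphic_Rep_tob[of X "bismash n" "rep_ob (iso_class R X)" Y "rep_ob (iso_class R Y)"] OX OY rX rY unfolding R_def by simp
  have T: "rep_ob (iso_class R X) \<boxtimes>\<^bsub>R\<^esub> rep_ob (iso_class R Y) \<in> Ob R"
    using Rep_tob_iso_closed[of X "bismash n" "rep_ob (iso_class R X)" Y "rep_ob (iso_class R Y)"] OX OY rX rY
      Rep_tob_in[OF X Y] unfolding R_def by simp
  have br: "brick R (rep_ob z)" using Rep_rep_ob Z by simp
  have "fusion_rule R (iso_class R X) (iso_class R Y) z = R.dim (Hom R (rep_ob z) (rep_ob (iso_class R X) \<boxtimes>\<^bsub>R\<^esub> rep_ob (iso_class R Y)))"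
    by (simp add: fusion_rule_def)
  also have "\<dots> = count M (iso_class R (rep_ob z))" by (rule R.decomp_count[OF R.decomp_iso[OF M T iso] br])
  also have "\<dots> = count M z" using rZ Z by simp
  finally show ?thesis .
qed

lemma Rep_decomp_single:
  assumes "X \<in> irreps" "Y \<in> irreps" "isomorphic R (X \<boxtimes>\<^bsub>R\<^esub> Y) Z" "brick R Z"
  shows "decomp R (X \<boxtimes>\<^bsub>R\<^esub> Y) {#iso_class R Z#}"
  by (rule R.decomp_iso[OF R.decomp_brick[OF assms(4)] Rep_tob_in[OF assms(1,2)] R.isomorphic_sym[OF assms(3)]])

lemma orb_decomp:
  assumes s: "s \<in> A"
  shows "decomp R (orb s) (if flip s = s then {#iso_class R (repV s), iso_class R (repW s)#} else {#iso_class R (repV s)#})"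
proof (cases "flip s = s")
  case True
  have "decomp R (orb s) (\<Sum>i\<in>{0::nat, 1}. {#iso_class R (pt s (if i = 0 then 1 else -1))#})"
  proof (rule R.decomp_sum)
    show "direct_sum R {0::nat, 1} (\<lambda>i. pt s (if i = 0 then 1 else -1)) (orb s)"
      unfolding R_def by (rule orb_fixed[OF s True]) simp
    show "decomp R (pt s (if i = 0 then 1 else -1)) {#iso_class R (pt s (if i = 0 then 1 else -1))#}" if "i \<in> {0, 1}" for i :: nat
      unfolding R_def by (rule linear_category.decomp_brick[OF linear_category_Rep], rule pt_brick[OF s True]) simp
  qed
  then show ?thesis using True by (simp add: repV_def repW_def add_mset_commute)
next
  case False
  then show ?thesis using R.decomp_brick[OF repV_brick[OF s]] by (simp add: repV_def)
qed

lemma iso_repV_iff: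
  assumes "s \<in> A" "u \<in> A"
  shows "isomorphic R (repV s) (repV u) \<longleftrightarrow> u = s \<or> u = flip s"
proof
  assume "isomorphic R (repV s) (repV u)"
  then obtain S where S: "iso_arr R (repV s) (repV u) S" by (auto simp: isomorphic_def)
  have "S \<noteq> 0"
  proof
    assume "S = 0"
    then obtain T where "T \<in> Hom R (repV u) (repV s)" "T \<odot>\<^bsub>R\<^esub> 0 = idn R (repV s)" using S by (auto simp: iso_arr_def)
    moreover have "repV s \<in> Ob R" "repV u \<in> Ob R" using assms repV_brick R.brick_Ob by auto
    ultimately show False using R.cmp_zero_right[of "repV s" "repV u" "repV s" T] repV_brick[OF assms(1)] by (simp add: brick_def)
  qed
  then show "u = s \<or> u = flip s" using Hom_V_V[OF assms iso_arr_Hom[OF S]] by simp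
next
  assume "u = s \<or> u = flip s"
  then show "isomorphic R (repV s) (repV u)"
    using repV_flip[OF assms(1)] R.isomorphic_refl[OF R.brick_Ob[OF repV_brick[OF assms(1)]]] by auto
qed

lemma not_iso_Hom_zero:
  assumes "brick R X" "brick R Y" "Hom R X Y = {0}"
  shows "\<not> isomorphic R X Y"
proof
  assume "isomorphic R X Y"
  then obtain S T where "S \<in> Hom R X Y" "T \<in> Hom R Y X" "T \<odot>\<^bsub>R\<^esub> S = idn R X" by (auto simp: isomorphic_def iso_arr_def)
  then show False using assms R.cmp_zero_right[of X Y X T] R.brick_Ob by (auto simp: brick_def)
qed

lemma iso_repW:
  assumes "h \<in> A" "flip h = h" "u \<in> A" "flip u = u" "isomorphic R (repW h) (repW u)"
  shows "h = u"
proof (rule ccontr)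
  assume "h \<noteq> u"
  have O: "repW h \<in> Ob R" "repW u \<in> Ob R" using assms repW_brick R.brick_Ob by auto
  have "Hom R (repW h) (repW u) = {0}" using Hom_W_W[OF assms(1-4)] \<open>h \<noteq> u\<close> R.zero_in[OF O] by blast
  then show False using not_iso_Hom_zero[OF repW_brick[OF assms(1,2)] repW_brick[OF assms(3,4)]] assms(5) by simp
qed

lemma Rep_tensor_rules:
  shows "\<lbrakk>h \<in> A; flip h = h; u \<in> A\<rbrakk> \<Longrightarrow> isomorphic R (repV h \<boxtimes>\<^bsub>R\<^esub> repV u) (repV (h \<circ> u))"
    "\<lbrakk>h \<in> A; flip h = h; u \<in> A\<rbrakk> \<Longrightarrow> isomorphic R (repV u \<boxtimes>\<^bsub>R\<^esub> repV h) (repV (u \<circ> h))"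
    "\<lbrakk>h \<in> A; flip h = h; u \<in> A; flip u \<noteq> u\<rbrakk> \<Longrightarrow> isomorphic R (repW h \<boxtimes>\<^bsub>R\<^esub> repV u) (repV (h \<circ> u))"
    "\<lbrakk>h \<in> A; flip h = h; u \<in> A; flip u \<noteq> u\<rbrakk> \<Longrightarrow> isomorphic R (repV u \<boxtimes>\<^bsub>R\<^esub> repW h) (repV (u \<circ> h))"
    "\<lbrakk>h \<in> A; flip h = h; u \<in> A; flip u = u\<rbrakk> \<Longrightarrow> isomorphic R (repW h \<boxtimes>\<^bsub>R\<^esub> repV u) (repW (h \<circ> u))"
    "\<lbrakk>h \<in> A; flip h = h; u \<in> A; flip u = u\<rbrakk> \<Longrightarrow> isomorphic R (repV u \<boxtimes>\<^bsub>R\<^esub> repW h) (repW (u \<circ> h))"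
    "\<lbrakk>h \<in> A; flip h = h; u \<in> A; flip u = u\<rbrakk> \<Longrightarrow> isomorphic R (repW h \<boxtimes>\<^bsub>R\<^esub> repW u) (repV (h \<circ> u))"
proof -
  assume h: "h \<in> A" "flip h = h" and u: "u \<in> A"
  note fx = flip_comp_fixed[OF h u]
  have one: "(1::'k) * 1 = 1" "(-1::'k) * -1 = 1" by simp_all
  show "isomorphic R (repV h \<boxtimes>\<^bsub>R\<^esub> repV u) (repV (h \<circ> u))" "isomorphic R (repV u \<boxtimes>\<^bsub>R\<^esub> repV h) (repV (u \<circ> h))"
    using pt_tob_orb[OF h one(1) u] pt_tob_pt[OF h one(1) u _ one(1)] pt_tob_pt[OF u _ one(1) h one(1)] fx h
    unfolding repV_def R_def by (cases "flip u = u"; simp)+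
  show "isomorphic R (repW h \<boxtimes>\<^bsub>R\<^esub> repV u) (repV (h \<circ> u))" "isomorphic R (repV u \<boxtimes>\<^bsub>R\<^esub> repW h) (repV (u \<circ> h))"
    if "flip u \<noteq> u"
    using that pt_tob_orb[OF h one(2) u] fx unfolding repV_def repW_def R_def by simp_all
  show "isomorphic R (repW h \<boxtimes>\<^bsub>R\<^esub> repV u) (repW (h \<circ> u))" "isomorphic R (repV u \<boxtimes>\<^bsub>R\<^esub> repW h) (repW (u \<circ> h))"
    "isomorphic R (repW h \<boxtimes>\<^bsub>R\<^esub> repW u) (repV (h \<circ> u))"
    if "flip u = u"
    using that pt_tob_pt[OF h one(2) u _ one(1)] pt_tob_pt[OF u _ one(1) h one(2)] pt_tob_pt[OF h one(2) u _ one(2)] fx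
    unfolding repV_def repW_def R_def by simp_all
qed

text \<open>The product is a sum of two orbits, each of which is simple or splits into its two
  signed points.\<close>

lemma Rep_tensor_moved:
  assumes s: "s \<in> A" "flip s \<noteq> s" and u: "u \<in> A" "flip u \<noteq> u"
  shows "decomp R (repV s \<boxtimes>\<^bsub>R\<^esub> repV u)
      ((if flip (s \<circ> u) = s \<circ> u then {#iso_class R (repV (s \<circ> u)), iso_class R (repW (s \<circ> u))#} else {#iso_class R (repV (s \<circ> u))#}) +
       (if flip (s \<circ> flip u) = s \<circ> flip u then {#iso_class R (repV (s \<circ> flip u)), iso_class R (repW (s \<circ> flip u))#}
        else {#iso_class R (repV (s \<circ> flip u))#}))" (is "decomp R _ (?M (s \<circ> u) + ?M (s \<circ> flip u))")
proof -
  define t where "t i = (if i = (0::nat) then s \<circ> u else s \<circ> flip u)" for i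
  have "decomp R (orb s \<boxtimes>\<^bsub>R\<^esub> orb u) (\<Sum>i\<in>{0, 1}. ?M (t i))"
  proof (rule R.decomp_sum)
    show "direct_sum R {0, 1} (\<lambda>i. orb (t i)) (orb s \<boxtimes>\<^bsub>R\<^esub> orb u)"
      unfolding R_def t_def by (rule orb_tob_orb[OF s(1) u(1)])
    show "decomp R (orb (t i)) (?M (t i))" for i
      by (rule orb_decomp) (use s u A_comp A_flip in \<open>auto simp: t_def\<close>)
  qed
  moreover have t: "(\<Sum>i\<in>{0, 1}. M (t i)) = M (s \<circ> u) + M (s \<circ> flip u)"
    for M :: "(nat \<Rightarrow> nat) \<Rightarrow> 'c multiset" by (simp add: t_def)
  ultimately have "decomp R (orb s \<boxtimes>\<^bsub>R\<^esub> orb u) (?M (s \<circ> u) + ?M (s \<circ> flip u))" by (subst (asm) t)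
  then show ?thesis using s(2) u(2) unfolding repV_def by (simp only: if_False)
qed

end

text \<open>The listed irreducibles are sent through the given bijection of classes. A product with
  a single summand is determined up to isomorphism, and the products of two moved orbits keep their
  multisets.\<close>

lemma bismash_fusion_exists:
  fixes C :: "('o, 'a::ab_group_add, 'k::{alg_closed_field, field_char_0}) tensor_category"
  assumes fC: "fusion_category C" and ge: "grothendieck_equivalent (Rep (bismash n)) C"
  shows "\<exists>V W. bismash_fusion n C V W"
proof -
  interpret C: semisimple_monoidal_category C by (rule fusion_semisimple_monoidal[OF fC])
  define R :: "(nat set \<times> ((nat \<Rightarrow> nat) \<times> (nat \<Rightarrow> nat) \<Rightarrow> nat \<Rightarrow> nat \<Rightarrow> 'k), nat \<Rightarrow> nat \<Rightarrow> 'k, 'k) tensor_category" where "R = Rep (bismash n)"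
  interpret R: schur_category R by (rule Rep_schur(1)[OF R_def])
  obtain f where f: "bij_betw f (Irr R) (Irr C)" "f (iso_class R (unit_ob R)) = iso_class C (unit_ob C)"
    and rule: "\<And>x y z. x \<in> Irr R \<Longrightarrow> y \<in> Irr R \<Longrightarrow> z \<in> Irr R \<Longrightarrow> fusion_rule C (f x) (f y) (f z) = fusion_rule R x y z"
    using ge unfolding grothendieck_equivalent_def R_def by blast
  define \<Phi> where "\<Phi> X = rep_ob (f (iso_class R X))" for X
  have cI: "iso_class R X \<in> Irr R" if "brick R X" for X using that by (auto simp: Irr_Rep[OF R_def])
  have fI: "f x \<in> Irr C" if "x \<in> Irr R" for x using f(1) that by (auto simp: bij_betw_def)
  have \<Phi>: "brick C (\<Phi> X)" "iso_class C (\<Phi> X) = f (iso_class R X)" "\<Phi> X \<in> Ob C" if "brick R X" for X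
    using fusion_rep_brick[OF fC fI[OF cI[OF that]]] C.brick_Ob by (auto simp: \<Phi>_def)
  have iso: "isomorphic C (\<Phi> X) (\<Phi> Y) \<longleftrightarrow> isomorphic R X Y" if X: "brick R X" and Y: "brick R Y" for X Y
  proof -
    have "isomorphic C (\<Phi> X) (\<Phi> Y) \<longleftrightarrow> f (iso_class R X) = f (iso_class R Y)"
      using \<Phi>[OF X] \<Phi>[OF Y] C.iso_class_eq by metis
    also have "\<dots> \<longleftrightarrow> iso_class R X = iso_class R Y"
      using f(1) cI[OF X] cI[OF Y] by (auto simp: bij_betw_def inj_on_def)
    also have "\<dots> \<longleftrightarrow> isomorphic R X Y" by (rule R.iso_class_eq[OF R.brick_Ob[OF X] R.brick_Ob[OF Y]])
    finally show ?thesis .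
  qed
  note irb = irreps_brick[OF R_def]
  have dec: "decomp C (\<Phi> X \<boxtimes>\<^bsub>C\<^esub> \<Phi> Y) (image_mset f M)"
    if X: "X \<in> irreps" and Y: "Y \<in> irreps" and M: "decomp R (X \<boxtimes>\<^bsub>R\<^esub> Y) M" for X Y M
    unfolding \<Phi>_def
  proof (rule grothendieck_decomp[OF fC f(1) rule cI[OF irb[OF X]] cI[OF irb[OF Y]]])
    show "set_mset M \<subseteq> Irr R" using R.decomp_mem[OF M] cI by blast
    show "fusion_rule R (iso_class R X) (iso_class R Y) z = count M z" if "z \<in> Irr R" for z
      by (rule Rep_fusion_rule[OF R_def X Y M that])
  qed
  have single: "isomorphic C (\<Phi> X \<boxtimes>\<^bsub>C\<^esub> \<Phi> Y) (\<Phi> Z)"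
    if X: "X \<in> irreps" and Y: "Y \<in> irreps" and Z: "Z \<in> irreps" and i: "isomorphic R (X \<boxtimes>\<^bsub>R\<^esub> Y) Z" for X Y Z
  proof -
    have "decomp C (\<Phi> X \<boxtimes>\<^bsub>C\<^esub> \<Phi> Y) {#iso_class C (\<Phi> Z)#}"
      using dec[OF X Y Rep_decomp_single[OF R_def X Y i irb[OF Z]]] \<Phi>(2)[OF irb[OF Z]] by simp
    then show ?thesis using C.decomp_single(1) \<Phi>(3)[OF irb[OF Z]] by blast
  qed
  note VI = repV_irreps and WI = repW_irreps
  note vb = repV_brick[OF R_def] and wb = repW_brick[OF R_def]
  note rules = Rep_tensor_rules[OF R_def]
  have "bismash_fusion n C (\<lambda>s. \<Phi> (repV s)) (\<lambda>h. \<Phi> (repW h))"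
  proof
    show "brick C (\<Phi> (repV s))" if "s \<in> A" for s using \<Phi>(1)[OF vb[OF that]] .
    show "brick C (\<Phi> (repW h))" if "h \<in> A" "flip h = h" for h using \<Phi>(1)[OF wb[OF that]] .
    show "isomorphic C (\<Phi> (repV s)) (\<Phi> (repV u)) \<longleftrightarrow> u = s \<or> u = flip s" if "s \<in> A" "u \<in> A" for s u
      using iso[OF vb[OF that(1)] vb[OF that(2)]] iso_repV_iff[OF R_def that] by simp
    show "\<not> isomorphic C (\<Phi> (repV s)) (\<Phi> (repW h))" if "s \<in> A" "h \<in> A" "flip h = h" for s h
      using iso[OF vb[OF that(1)] wb[OF that(2,3)]] not_iso_Hom_zero[OF R_def vb[OF that(1)] wb[OF that(2,3)]]
        Hom_V_W(1)[OF R_def that] by simp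
    show "h = u" if "h \<in> A" "flip h = h" "u \<in> A" "flip u = u" "isomorphic C (\<Phi> (repW h)) (\<Phi> (repW u))" for h u
      using iso[OF wb[OF that(1,2)] wb[OF that(3,4)]] iso_repW[OF R_def that(1-4)] that(5) by simp
    show "isomorphic C (\<Phi> (repV id)) (unit_ob C)"
    proof -
      have "f (iso_class R (repV id)) = iso_class C (unit_ob C)" using f(2) unit_Rep[where 'k = 'k] by (simp add: R_def repV_def)
      then have "iso_class C (\<Phi> (repV id)) = iso_class C (unit_ob C)" using \<Phi>(2)[OF vb[OF A_id]] by simp
      then show ?thesis using C.iso_class_eq[OF \<Phi>(3)[OF vb[OF A_id]] C.unit_in] by simp
    qed
    show "(\<exists>s\<in>A. isomorphic C X (\<Phi> (repV s))) \<or> (\<exists>h\<in>A. flip h = h \<and> isomorphic C X (\<Phi> (repW h)))" if X: "brick C X" for X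
    proof -
      have "iso_class C X \<in> Irr C" using X by (auto simp: Irr_bricks[OF fC])
      then obtain z where z: "z \<in> Irr R" "iso_class C X = f z" using f(1) by (auto simp: bij_betw_def)
      then obtain Z where Z: "brick R Z" "z = iso_class R Z" by (auto simp: Irr_Rep[OF R_def])
      obtain Y where Y: "Y \<in> irreps" "isomorphic R Y Z" using Rep_schur(3)[OF R_def Z(1)] by blast
      have "iso_class R Y = z" using Y Z R.iso_class_eq[OF R.brick_Ob[OF irb[OF Y(1)]] R.brick_Ob[OF Z(1)]] by simp
      then have "iso_class C X = iso_class C (\<Phi> Y)" using z \<Phi>(2)[OF irb[OF Y(1)]] by simp
      then have "isomorphic C X (\<Phi> Y)" using C.iso_class_eq[OF C.brick_Ob[OF X] \<Phi>(3)[OF irb[OF Y(1)]]] by simp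
      with Y(1) show ?thesis by (elim irreps_cases) auto
    qed
    fix h u assume h: "h \<in> A" "flip h = h" and u: "u \<in> A"
    have hu: "h \<circ> u \<in> A" "u \<circ> h \<in> A" using A_comp h u by auto
    note fx = flip_comp_fixed[OF h u]
    show "isomorphic C (\<Phi> (repV h) \<boxtimes>\<^bsub>C\<^esub> \<Phi> (repV u)) (\<Phi> (repV (h \<circ> u)))"
      by (rule single[OF VI[OF h(1)] VI[OF u] VI[OF hu(1)] rules(1)[OF h u]])
    show "isomorphic C (\<Phi> (repV u) \<boxtimes>\<^bsub>C\<^esub> \<Phi> (repV h)) (\<Phi> (repV (u \<circ> h)))"
      by (rule single[OF VI[OF u] VI[OF h(1)] VI[OF hu(2)] rules(2)[OF h u]])
    {
      assume m: "flip u \<noteq> u"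
      show "isomorphic C (\<Phi> (repW h) \<boxtimes>\<^bsub>C\<^esub> \<Phi> (repV u)) (\<Phi> (repV (h \<circ> u)))"
        by (rule single[OF WI[OF h] VI[OF u] VI[OF hu(1)] rules(3)[OF h u m]])
      show "isomorphic C (\<Phi> (repV u) \<boxtimes>\<^bsub>C\<^esub> \<Phi> (repW h)) (\<Phi> (repV (u \<circ> h)))"
        by (rule single[OF VI[OF u] WI[OF h] VI[OF hu(2)] rules(4)[OF h u m]])
    next
      assume m: "flip u = u"
      show "isomorphic C (\<Phi> (repW h) \<boxtimes>\<^bsub>C\<^esub> \<Phi> (repV u)) (\<Phi> (repW (h \<circ> u)))"
        by (rule single[OF WI[OF h] VI[OF u] WI[OF hu(1) fx(1)[THEN iffD2, OF m]] rules(5)[OF h u m]])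
      show "isomorphic C (\<Phi> (repV u) \<boxtimes>\<^bsub>C\<^esub> \<Phi> (repW h)) (\<Phi> (repW (u \<circ> h)))"
        by (rule single[OF VI[OF u] WI[OF h] WI[OF hu(2) fx(2)[THEN iffD2, OF m]] rules(6)[OF h u m]])
      show "isomorphic C (\<Phi> (repW h) \<boxtimes>\<^bsub>C\<^esub> \<Phi> (repW u)) (\<Phi> (repV (h \<circ> u)))"
        by (rule single[OF WI[OF h] WI[OF u m] VI[OF hu(1)] rules(7)[OF h u m]])
    }
  next
    fix s u assume s: "s \<in> A" "flip s \<noteq> s" and u: "u \<in> A" "flip u \<noteq> u"
    let ?M = "\<lambda>t. if flip t = t then {#iso_class C (\<Phi> (repV t)), iso_class C (\<Phi> (repW t))#} else {#iso_class C (\<Phi> (repV t))#}"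
    let ?N = "\<lambda>t. if flip t = t then {#iso_class R (repV t), iso_class R (repW t)#} else {#iso_class R (repV t)#}"
    have N: "image_mset f (?N t) = ?M t" if "t \<in> A" for t using \<Phi>(2)[OF vb[OF that]] \<Phi>(2)[OF wb[OF that]] by simp
    have t: "s \<circ> u \<in> A" "s \<circ> flip u \<in> A" using s u A_comp A_flip by auto
    show "decomp C (\<Phi> (repV s) \<boxtimes>\<^bsub>C\<^esub> \<Phi> (repV u)) (?M (s \<circ> u) + ?M (s \<circ> flip u))"
      using dec[OF VI[OF s(1)] VI[OF u(1)] Rep_tensor_moved[OF R_def s u]]
      unfolding image_mset_union N[OF t(1)] N[OF t(2)] .
  qed
  then show ?thesis by blast
qed

end

section \<open>Twisted homomorphisms on the alternating group\<close>

context bismash_degree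
begin

lemma A_inv: "a \<in> A \<Longrightarrow> inv' a \<in> A" "a \<in> A \<Longrightarrow> inv' a \<circ> a = id" "a \<in> A \<Longrightarrow> a \<circ> inv' a = id"
  using alt_group_inv_closed alt_inv[OF n2] by auto

text \<open>The cycle (3 4 5) avoids 1 and 2, so (1 2) is free to correct the parity of a
  conjugating permutation; n \<ge> 5 provides the room for this.\<close>

lemma three_cycle_conjugate:
  assumes n5: "n \<ge> 5" and cs: "cycle cs" "length cs = 3" "set cs \<subseteq> {1..n}"
  shows "\<exists>a\<in>A. cycle_of_list cs = inv' a \<circ> cycle_of_list [3, 4, 5] \<circ> a"
proof -
  obtain x y z where xyz: "cs = [x, y, z]" using stupid_lemma[OF cs(2)] by blast
  then have d: "x \<noteq> y" "y \<noteq> z" "x \<noteq> z" and i: "x \<in> {1..n}" "y \<in> {1..n}" "z \<in> {1..n}" using cs by auto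
  \<comment> \<open>x, y and z are moved to 3, 4 and 5 one after another; y' is where y stands after
    the first transposition, z' where z stands after the first two.\<close>
  define y' where "y' = transpose x 3 y"
  define z' where "z' = transpose 4 y' (transpose x 3 z)"
  define q where "q = transpose 5 z' \<circ> (transpose 4 y' \<circ> transpose x 3)"
  have i': "y' \<in> {1..n}" "z' \<in> {1..n}" using i n5 by (auto simp: y'_def z'_def transpose_def)
  have y': "y' \<noteq> 3" using d by (auto simp: y'_def transpose_def)
  have z': "z' \<noteq> 3" "z' \<noteq> 4"
    using d y' by (auto simp: z'_def y'_def transpose_def split: if_splits)
  have q: "q x = 3" "q y = 4" "q z = 5"
    using y' z'
    by (simp_all add: q_def z'_def[symmetric] y'_def[symmetric])
  have qp: "q permutes {1..n}" unfolding q_def using i i' n5 by (intro permutes_compose permutes_swap_id) auto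
  \<comment> \<open>Composition with (1 2) changes the parity and leaves the values 3, 4, 5 in
    place.\<close>
  define a where "a = (if evenperm q then q else transpose 1 2 \<circ> q)"
  have t: "transpose 1 2 permutes {1..n}" using n5 by (intro permutes_swap_id) auto
  have perm: "permutation q" "permutation (transpose 1 (2 :: nat))"
    using permutes_imp_permutation[OF _ qp] permutation_swap_id by simp_all
  have "\<not> evenperm (transpose 1 (2 :: nat))" by (simp add: evenperm_swap)
  then have "evenperm (transpose 1 2 \<circ> q)" if "\<not> evenperm q" using evenperm_comp[OF perm(2,1)] that by simp
  then have a: "a \<in> A" using qp permutes_compose[OF qp t] by (simp add: a_def alt_group_carrier)
  have ax: "a x = 3" "a y = 4" "a z = 5" using q by (auto simp: a_def)
  have ba: "bij a" using a by (auto simp: alt_group_carrier intro: permutes_bij)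
  then have ia: "inv' a 3 = x" "inv' a 4 = y" "inv' a 5 = z" using ax by (auto simp: bij_def intro!: inv_f_eq)
  have "inv' a \<circ> cycle_of_list [3, 4, 5] \<circ> inv' (inv' a) = cycle_of_list (map (inv' a) [3, 4, 5])"
    by (rule conjugation_of_cycle) (use ba in \<open>auto simp: bij_imp_bij_inv\<close>)
  then show ?thesis using a ia ba by (auto simp: xyz inv_inv_eq intro!: bexI[of _ a])
qed

text \<open>The 3-cycles generate the alternating group and are conjugate to (3 4 5). Closure under
  products suffices because the inverse of a 3-cycle is its square.\<close>

lemma A_induct_three_cycles:
  assumes n5: "n \<ge> 5" and M: "M \<subseteq> A" "id \<in> M" "\<And>s u. s \<in> M \<Longrightarrow> u \<in> M \<Longrightarrow> s \<circ> u \<in> M"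
    and conj: "\<And>a. a \<in> A \<Longrightarrow> inv' a \<circ> cycle_of_list [3, 4, 5] \<circ> a \<in> M" and s: "s \<in> A"
  shows "s \<in> M"
proof -
  have c3: "p \<in> M" if "p \<in> three_cycles n" for p
  proof -
    from that obtain cs where cs: "p = cycle_of_list cs" "cycle cs" "length cs = 3" "set cs \<subseteq> {1..n}" by blast
    obtain a where "a \<in> A" "cycle_of_list cs = inv' a \<circ> cycle_of_list [3, 4, 5] \<circ> a"
      using three_cycle_conjugate[OF n5 cs(2-4)] by blast
    then show ?thesis using conj[of a] cs(1) by (simp del: cycle_of_list.simps)
  qed
  have "s \<in> generate (alt_group n) (three_cycles n)" using s alt_group_carrier_as_three_cycles by simp
  then show ?thesis
  proof induction
    case (inv p)
    then obtain cs where cs: "cycle cs" "length cs = 3" "p = cycle_of_list cs" by auto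
    have pA: "p \<in> A" using inv three_cycles_incl by auto
    have "p ^^ 3 = id" using cycle_is_id_root[OF cs(1)] cs(2,3) by simp
    then have "p \<circ> (p \<circ> p) = id" by (simp add: numeral_3_eq_3)
    then have "inv' p = p \<circ> p" using A_inv(2)[OF pA] by (metis comp_assoc comp_id id_comp)
    then show ?case using M(3)[OF c3[OF inv] c3[OF inv]] pA by (simp only: alt_group_inv_equality)
  next
    case one
    show ?case unfolding alt_group_one by (rule M(2))
  next
    case (incl p)
    then show ?case by (rule c3)
  next
    case (eng p q)
    show ?case unfolding alt_group_mult by (rule M(3)[OF eng.IH])
  qed
qed

text \<open>Conjugation with h = (1 2)(3 4) inverts c, so the commutator of h and c is the inverse
  square of c, that is c. The factor (1 2) makes h even.\<close>

lemma fixed_three_cycle: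
  assumes n5: "n \<ge> 5"
  defines "c \<equiv> cycle_of_list [3, 4, 5 :: nat]"
  defines "h \<equiv> transpose 1 2 \<circ> transpose 3 (4 :: nat)"
  shows "c \<in> A" "flip c = c" "h \<in> A" "flip h = h" "c \<circ> c \<circ> c = id" "h \<circ> c \<circ> inv' h \<circ> inv' c = c"
proof -
  show cA: "c \<in> A" 
    unfolding c_def by (rule set_mp[OF three_cycles_incl], rule CollectI, rule exI[of _ "[3, 4, 5]"]) (use n5 in auto)
  have t: "transpose 1 2 permutes {1..n}" "transpose 3 4 permutes {1..n}" using n5 by (auto intro!: permutes_swap_id)
  have "permutation (transpose 1 (2::nat))" "permutation (transpose 3 (4::nat))" by (auto simp: permutation_swap_id)
  then show hA: "h \<in> A" using t by (simp add: h_def alt_group_carrier permutes_compose evenperm_comp evenperm_swap)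
  show "flip c = c" "flip h = h" by (auto simp: flip_def c_def h_def fun_eq_iff transpose_def)
  show ccc: "c \<circ> c \<circ> c = id" by (auto simp: c_def fun_eq_iff transpose_def)
  have hh: "h \<circ> h = id" by (auto simp: h_def fun_eq_iff transpose_def)
  have "inv' h = h" using A_inv(2)[OF hA] hh by (metis comp_assoc comp_id id_comp)
  moreover have "inv' c = c \<circ> c" using A_inv(2)[OF cA] ccc by (metis comp_assoc comp_id id_comp)
  moreover have "h \<circ> c \<circ> h \<circ> (c \<circ> c) = c"
  proof
    fix x :: nat
    consider "x = 1" | "x = 2" | "x = 3" | "x = 4" | "x = 5" | "x \<noteq> 1" "x \<noteq> 2" "x \<noteq> 3" "x \<noteq> 4" "x \<noteq> 5" by blast
    then show "(h \<circ> c \<circ> h \<circ> (c \<circ> c)) x = c x" by cases (simp_all add: h_def c_def transpose_def)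
  qed
  ultimately show "h \<circ> c \<circ> inv' h \<circ> inv' c = c" by simp
qed

text \<open>By induction all values of \<open>q\<close> lie in each derived subgroup \<open>H\<close> of \<open>U\<close>: the elements with
  value in \<open>derived U H\<close> form a subgroup of \<open>A\<close> which contains the 3-cycle \<open>c = (3 4 5)\<close>, a commutator of
  elements fixed by \<open>flip\<close>. For \<open>a \<in> A\<close> it contains \<open>a\<inverse> c a\<close> or \<open>a\<inverse> c (flip a)\<close>, and in the latter
  case also \<open>a\<inverse> c (flip a) (flip a)\<inverse> c a = a\<inverse> c\<^sup>2 a\<close> and the square of this element, which
  is \<open>a\<inverse> c a\<close>.\<close>

lemma twisted_hom_not_solvable:
  fixes U (structure)
  assumes n5: "n \<ge> 5" and U: "group U" and \<sigma>: "\<sigma> \<in> hom U U"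
    and q: "\<And>s. s \<in> A \<Longrightarrow> q s \<in> carrier U" and \<sigma>\<sigma>: "\<And>s. s \<in> A \<Longrightarrow> \<sigma> (\<sigma> (q s)) = q s"
    and q_comp: "\<And>s u. s \<in> A \<Longrightarrow> u \<in> A \<Longrightarrow> \<exists>x\<in>{q s, \<sigma> (q s)}. \<exists>y\<in>{q u, \<sigma> (q u)}. q (s \<circ> u) = x \<otimes> y"
    and q_prod: "\<And>s u x y. s \<in> A \<Longrightarrow> u \<in> A \<Longrightarrow> x \<in> {q s, \<sigma> (q s)} \<Longrightarrow> y \<in> {q u, \<sigma> (q u)}
      \<Longrightarrow> x \<otimes> y \<in> {q (s \<circ> u), \<sigma> (q (s \<circ> u)), q (s \<circ> flip u), \<sigma> (q (s \<circ> flip u))}"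
    and q_flip: "\<And>s. s \<in> A \<Longrightarrow> q (flip s) \<in> {q s, \<sigma> (q s)}"
    and q_fixed: "\<And>h. h \<in> A \<Longrightarrow> flip h = h \<Longrightarrow> \<sigma> (q h) = q h"
    and q_id: "q id = \<one>" and nontriv: "\<exists>s\<in>A. q s \<noteq> \<one>"
  shows "\<not> solvable U"
proof
  assume sol: "solvable U"
  interpret group U by (rule U)
  interpret \<sigma>: group_hom U U \<sigma> by unfold_locales (use \<sigma> in simp)
  note fc = fixed_three_cycle[OF n5]
  define c where "c = cycle_of_list [3, 4, 5 :: nat]"
  define h where "h = transpose 1 2 \<circ> transpose 3 (4 :: nat)"
  note fc = fc[folded c_def h_def]
  have step: "q s \<in> derived U H" if H: "subgroup H U" "\<sigma> ` H \<subseteq> H" and qH: "\<And>s. s \<in> A \<Longrightarrow> q s \<in> H" and s: "s \<in> A" for H s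
  proof -
    define N where "N = derived U H"
    note HU = subgroup.subset[OF H(1)]
    have N: "subgroup N U" unfolding N_def by (rule derived_is_subgroup[OF HU])
    have "\<sigma> ` N = derived U (\<sigma> ` H)" unfolding N_def by (rule \<sigma>.derived_img[OF HU, symmetric])
    then have \<sigma>N: "\<sigma> x \<in> N" if "x \<in> N" for x using mono_derived[OF H(2)] that by (auto simp: N_def)
    have q\<sigma>: "\<sigma> (q s) \<in> N \<longleftrightarrow> q s \<in> N" if "s \<in> A" for s using \<sigma>N \<sigma>\<sigma>[OF that] by metis
    have q\<sigma>H: "x \<in> H" if "s \<in> A" "x \<in> {q s, \<sigma> (q s)}" for s x using qH H(2) that by auto
    have comm: "x \<otimes> y \<otimes> inv x \<otimes> inv y \<in> N" if "x \<in> H" "y \<in> H" for x y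
      unfolding N_def derived_def by (rule generate.incl) (use that in auto)
    \<comment> \<open>The derived subgroup is normal in \<open>H\<close>, so it is stable under
      conjugation with values of \<open>q\<close> and their images under
      \<open>\<sigma>\<close>.\<close>
    have Nconj: "x \<otimes> y \<otimes> inv x \<in> N" if x: "x \<in> H" and y: "y \<in> N" for x y
    proof -
      have yH: "y \<in> H" using y derived_incl[OF _ H(1)] by (auto simp: N_def)
      have "x \<otimes> y \<otimes> inv x \<otimes> inv y \<otimes> y \<in> N" by (rule subgroup.m_closed[OF N comm[OF x yH] y])
      then show ?thesis using x yH HU by (auto simp: subset_iff m_assoc)
    qed
    define M where "M = {s \<in> A. q s \<in> N}"
    \<comment> \<open>On elements fixed by \<open>flip\<close> the two candidates for a value
      coincide, and \<open>q\<close> is multiplicative there.\<close>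
    have fix_mult: "q (u \<circ> v) = q u \<otimes> q v" if "u \<in> A" "flip u = u" "v \<in> A" "flip v = v" for u v
      using q_comp[OF that(1,3)] q_fixed that by auto
    have fix_inv: "q (inv' u) = inv (q u)" if u: "u \<in> A" "flip u = u" for u
    proof -
      have "flip (inv' u) \<circ> u = inv' u \<circ> u" using flip_comp[of "inv' u" u] A_inv(2)[OF u(1)] u by simp
      then have "flip (inv' u) = inv' u" using A_inv(3)[OF u(1)] by (metis comp_assoc comp_id)
      then have "q (inv' u) \<otimes> q u = \<one>" using fix_mult[OF A_inv(1)[OF u(1)] _ u] A_inv(2)[OF u(1)] q_id by simp
      then show ?thesis using inv_equality q u A_inv(1) by metis
    qed
    have M_comp: "u \<circ> v \<in> M" if "u \<in> M" "v \<in> M" for u v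
    proof -
      have uv: "u \<in> A" "v \<in> A" "q u \<in> N" "q v \<in> N" using that by (auto simp: M_def)
      have "q (u \<circ> v) \<in> N"
        using q_comp[OF uv(1,2)] q\<sigma>[OF uv(1)] q\<sigma>[OF uv(2)] uv subgroup.m_closed[OF N] by auto
      then show ?thesis using uv A_comp by (simp add: M_def)
    qed
    have M_flip: "flip u \<in> M" if "u \<in> M" for u
      using that q_flip[of u] q\<sigma>[of u] A_flip by (auto simp: M_def)
    have id_M: "id \<in> M" using subgroup.one_closed[OF N] A_id by (simp add: M_def q_id)
    have "q c = q h \<otimes> q c \<otimes> inv (q h) \<otimes> inv (q c)"
    proof -
      have hi: "flip (inv' u) = inv' u" if u: "u \<in> A" "flip u = u" for u
      proof -
        have "flip (inv' u) \<circ> u = inv' u \<circ> u" using flip_comp[of "inv' u" u] A_inv(2)[OF u(1)] u by simp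
        then show ?thesis using A_inv(3)[OF u(1)] by (metis comp_assoc comp_id)
      qed
      have "q (h \<circ> c \<circ> inv' h \<circ> inv' c) = q h \<otimes> q c \<otimes> q (inv' h) \<otimes> q (inv' c)"
        using fix_mult fc(1-4) A_comp A_inv(1) hi by (simp add: flip_comp)
      then show ?thesis using fc fix_inv by simp
    qed
    then have cM: "c \<in> M" using comm[OF qH[OF fc(3)] qH[OF fc(1)]] fc(1) by (simp add: M_def)
    have conj: "inv' a \<circ> c \<circ> a \<in> M" if a: "a \<in> A" for a
    proof -
      note ia = A_inv[OF a]
      have caA: "c \<circ> a \<in> A" and iacA: "inv' a \<circ> c \<circ> a \<in> A" "inv' a \<circ> c \<circ> flip a \<in> A"
        using A_comp A_flip fc(1) a ia(1) by auto
      \<comment> \<open>The values at the inverse of a and at a may have to be replaced by their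
        images under \<open>\<sigma>\<close> before they become inverse to each other.\<close>
      obtain x y where x: "x \<in> {q (inv' a), \<sigma> (q (inv' a))}" and y: "y \<in> {q a, \<sigma> (q a)}" and xy: "x \<otimes> y = \<one>"
        using q_comp[OF ia(1) a] unfolding ia(2) q_id by metis
      have xH: "x \<in> H" and yH: "y \<in> H" using q\<sigma>H[OF ia(1) x] q\<sigma>H[OF a y] by auto
      have cU: "q c \<in> carrier U" by (rule q[OF fc(1)])
      have xyU: "x \<in> carrier U" "y \<in> carrier U" using xH yH HU by auto
      have "y = inv x" using xy xyU by (metis inv_equality inv_inv)
      have "q (c \<circ> a) = q c \<otimes> q a \<or> q (c \<circ> a) = q c \<otimes> \<sigma> (q a)"
        using q_comp[OF fc(1) a] q_fixed[OF fc(1,2)] by auto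
      \<comment> \<open>\<open>\<sigma>\<close> fixes \<open>q c\<close> and exchanges the two
        candidates at a, so multiplying \<open>q c\<close> by either of them gives a candidate at
        \<open>c \<circ> a\<close>.\<close>
      then have "q c \<otimes> y \<in> {q (c \<circ> a), \<sigma> (q (c \<circ> a))}"
        using y \<sigma>\<sigma>[OF a] q_fixed[OF fc(1,2)] q[OF a] cU by (auto simp: \<sigma>.hom_mult)
      from q_prod[OF ia(1) caA x this]
      have "x \<otimes> (q c \<otimes> y) \<in> {q (inv' a \<circ> c \<circ> a), \<sigma> (q (inv' a \<circ> c \<circ> a)),
          q (inv' a \<circ> c \<circ> flip a), \<sigma> (q (inv' a \<circ> c \<circ> flip a))}"
        using fc(2) by (simp add: flip_comp comp_assoc)
      moreover have "x \<otimes> (q c \<otimes> y) \<in> N"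
        using Nconj[OF xH, of "q c"] cM xyU cU \<open>y = inv x\<close> by (simp add: M_def m_assoc)
      ultimately have "q (inv' a \<circ> c \<circ> a) \<in> N \<or> q (inv' a \<circ> c \<circ> flip a) \<in> N"
        using q\<sigma>[OF iacA(1)] q\<sigma>[OF iacA(2)] by auto
      then show ?thesis
      proof
        assume "q (inv' a \<circ> c \<circ> a) \<in> N"
        then show ?thesis using iacA by (simp add: M_def)
      next
        assume "q (inv' a \<circ> c \<circ> flip a) \<in> N"
        then have m: "inv' a \<circ> c \<circ> flip a \<in> M" using iacA by (simp add: M_def)
        have cancel: "a \<circ> (inv' a \<circ> f) = f" "flip a \<circ> (flip (inv' a) \<circ> f) = f" for f
          using ia(3) flip_comp[of a "inv' a"] by (simp_all add: comp_assoc[symmetric])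
        have ccc: "c \<circ> (c \<circ> (c \<circ> f)) = f" for f using fc(5) by (metis comp_assoc id_comp)
        have "inv' a \<circ> c \<circ> flip a \<circ> flip (inv' a \<circ> c \<circ> flip a) \<in> M" by (rule M_comp[OF m M_flip[OF m]])
        then have m2: "inv' a \<circ> (c \<circ> (c \<circ> a)) \<in> M" using fc(2) by (simp add: flip_comp comp_assoc cancel)
        show ?thesis using M_comp[OF m2 m2] by (simp add: comp_assoc cancel ccc)
      qed
    qed
    have "s \<in> M"
      by (rule A_induct_three_cycles[OF n5 _ id_M M_comp _ s]) (use conj in \<open>auto simp: M_def c_def\<close>)
    then show ?thesis by (simp add: M_def N_def)
  qed
  have "subgroup ((derived U ^^ i) (carrier U)) U \<and> \<sigma> ` (derived U ^^ i) (carrier U) \<subseteq> (derived U ^^ i) (carrier U)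
      \<and> (\<forall>s\<in>A. q s \<in> (derived U ^^ i) (carrier U))" for i
  proof (induction i)
    case 0
    then show ?case using subgroup_self \<sigma>.hom_closed q by auto
  next
    case (Suc i)
    let ?H = "(derived U ^^ i) (carrier U)"
    have "\<sigma> ` derived U ?H = derived U (\<sigma> ` ?H)"
      using Suc by (intro \<sigma>.derived_img[symmetric] subgroup.subset) auto
    moreover have "\<dots> \<subseteq> derived U ?H" using Suc by (intro mono_derived) auto
    moreover have "subgroup (derived U ?H) U" using Suc by (intro derived_is_subgroup subgroup.subset) auto
    ultimately show ?case using step[of ?H] Suc by simp
  qed
  moreover obtain i where "(derived U ^^ i) (carrier U) = {\<one>}" using sol solvable_iff_trivial_derived_seq by blast
  ultimately show False using nontriv by (metis singletonD)
qed

end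

section \<open>Gradings\<close>

text \<open>With p the order of the group, a root w of the polynomial 1 + w + ... + w^(p-1) exists
  by algebraic closedness. It is a p-th root of unity, and it differs from 1 because p is nonzero in
  characteristic 0.\<close>

lemma prime_cyclic_character:
  assumes G: "group G" "cyclic_group G" "prime (order G)"
  shows "\<exists>\<zeta> :: 'g \<Rightarrow> 'k::{alg_closed_field, field_char_0}. (\<forall>x\<in>carrier G. \<forall>y\<in>carrier G. \<zeta> (x \<otimes>\<^bsub>G\<^esub> y) = \<zeta> x * \<zeta> y) \<and>
    \<zeta> \<one>\<^bsub>G\<^esub> = 1 \<and> (\<exists>g\<in>carrier G. \<zeta> g \<noteq> 1)"
proof -
  interpret group G by (rule G(1))
  define p where "p = order G"
  have p: "p > 1" unfolding p_def by (rule prime_gt_1_nat[OF G(3)])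
  obtain w :: 'k where w0: "(\<Sum>k\<le>p - 1. 1 * w ^ k) = 0" using alg_closed[of "p - 1" "\<lambda>_. 1"] p by auto
  have "{..p - 1} = {..<p}" using p by auto
  with w0 have w: "(\<Sum>k<p. w ^ k) = 0" by simp
  have "w ^ p - 1 = (w - 1) * (\<Sum>k<p. w ^ k)" by (rule power_diff_1_eq)
  then have wp: "w ^ p = 1" using w by simp
  have w1: "w \<noteq> 1" using w p by auto
  have wn: "w \<noteq> 0" using wp p by (auto simp: power_0_left)
  obtain x where x: "x \<in> carrier G" "carrier G = range (\<lambda>n::int. x [^]\<^bsub>G\<^esub> n)" using G(2) cyclic_group by auto
  have "x \<noteq> \<one>\<^bsub>G\<^esub>"
  proof
    assume "x = \<one>\<^bsub>G\<^esub>"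
    then have "carrier G = {\<one>\<^bsub>G\<^esub>}" using x by auto
    then show False using p by (simp add: p_def order_def)
  qed
  then have "ord x \<noteq> 1" using ord_eq_1[OF x(1)] by simp
  moreover have "ord x dvd p" unfolding p_def by (rule ord_dvd_group_order[OF x(1)])
  ultimately have ord: "ord x = p" using G(3) by (auto simp: p_def prime_nat_iff)
  \<comment> \<open>A discrete logarithm to the base of the generator x. It is determined modulo p
    only, which is enough for a power of w.\<close>
  define e where "e y = (SOME n::int. y = x [^]\<^bsub>G\<^esub> n)" for y
  define \<zeta> where "\<zeta> y = w powi e y" for y
  have e: "y = x [^]\<^bsub>G\<^esub> e y" if "y \<in> carrier G" for y
    unfolding e_def by (rule someI_ex) (use that x in auto)
  have \<zeta>: "\<zeta> (x [^]\<^bsub>G\<^esub> m) = w powi m" for m :: int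
  proof -
    have "x [^]\<^bsub>G\<^esub> m = x [^]\<^bsub>G\<^esub> e (x [^]\<^bsub>G\<^esub> m)" by (rule e) (use x in auto)
    then have "int p dvd e (x [^]\<^bsub>G\<^esub> m) - m" using int_pow_eq[OF x(1)] ord by metis
    then obtain l where "e (x [^]\<^bsub>G\<^esub> m) = m + int p * l" by (metis add.commute diff_add_cancel dvd_def)
    then show ?thesis using wn wp by (simp add: \<zeta>_def power_int_add power_int_mult)
  qed
  have "\<zeta> (y \<otimes>\<^bsub>G\<^esub> z) = \<zeta> y * \<zeta> z" if "y \<in> carrier G" "z \<in> carrier G" for y z
  proof -
    have "y \<otimes>\<^bsub>G\<^esub> z = x [^]\<^bsub>G\<^esub> (e y + e z)" using e[OF that(1)] e[OF that(2)] x(1) by (metis int_pow_mult)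
    then show ?thesis using wn by (simp add: \<zeta> \<zeta>_def[of y] \<zeta>_def[of z] power_int_add)
  qed
  moreover have "\<zeta> \<one>\<^bsub>G\<^esub> = 1" using \<zeta>[of 0] by simp
  moreover have "\<zeta> x \<noteq> 1" using \<zeta>[of 1] w1 x by simp
  ultimately show ?thesis using x(1) by blast
qed

section \<open>Permutations moved by conjugation with (1 2), and those that commute up to this
  conjugation\<close>

context bismash_degree
begin

text \<open>These 3-cycles move 1 and fix 2, while their conjugates by (1 2) move 2 and fix
  1.\<close>

lemma moved_cycle:
  assumes "n \<ge> 5" "x \<in> {3..n}" "y \<in> {3..n}" "x \<noteq> y"
  defines "c \<equiv> cycle_of_list [1, x, y]"
  shows "c \<in> A" "flip c \<noteq> c" "c 1 = x" "c x = y" "c y = 1" "c 2 = 2" "flip c 1 = 1" "flip c 2 = x"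
proof -
  show "c \<in> A"
    unfolding c_def by (rule set_mp[OF three_cycles_incl], rule CollectI, rule exI[of _ "[1, x, y]"]) (use assms in auto)
  show v: "c 1 = x" "c x = y" "c y = 1" "c 2 = 2" and f: "flip c 1 = 1" "flip c 2 = x"
    using assms by (auto simp: c_def flip_def transpose_def)
  show "flip c \<noteq> c" using v f assms by auto
qed

lemma moved_exists: "n \<ge> 5 \<Longrightarrow> \<exists>s\<in>A. flip s \<noteq> s"
  using moved_cycle(1,2)[of 3 4] by force

lemma A_inv_moved: "s \<in> A \<Longrightarrow> flip (inv' s) = inv' s \<longleftrightarrow> flip s = s"
proof -
  assume s: "s \<in> A"
  note i = A_inv[OF s]
  have "flip (inv' s) \<circ> flip s = id" "flip s \<circ> flip (inv' s) = id"
    using flip_comp[of "inv' s" s] flip_comp[of s "inv' s"] i by simp_all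
  then show ?thesis using i by (metis comp_assoc comp_id id_comp)
qed

text \<open>Since \<open>flip\<close> fixes h, it permutes 1 and 2. For x in {3..n} the hypothesis
  at a cycle (1 x y) expresses h x as the value of this cycle at 1 or at 2, that is, as x or 2, and
  injectivity excludes 2. What remains is the identity or (1 2), and (1 2) is odd.\<close>

lemma twisted_central_id:
  assumes n5: "n \<ge> 5" and h: "h \<in> A" "flip h = h"
    and comm: "\<And>u. u \<in> A \<Longrightarrow> flip u \<noteq> u \<Longrightarrow> u \<circ> h = h \<circ> u \<or> u \<circ> h = h \<circ> flip u"
  shows "h = id"
proof -
  have hp: "h permutes {1..n}" and ev: "evenperm h" using h by (auto simp: alt_group_carrier)
  have inj: "h a = h b \<longleftrightarrow> a = b" for a b using permutes_inj[OF hp] by (auto simp: inj_def)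
  have "transpose 1 2 (h (transpose 1 2 1)) = h 1" using h(2) unfolding flip_def by (metis comp_apply)
  then have h12: "transpose 1 2 (h 2) = h 1" by simp
  have "h 1 \<in> {1, 2}" using h12 inj[of 2 1] by (cases "h 2 \<in> {1, 2}") (auto simp: transpose_def split: if_splits)
  moreover have "h 2 \<in> {1, 2}" using h12 inj[of 2 1] by (cases "h 2 \<in> {1, 2}") (auto simp: transpose_def split: if_splits)
  moreover have "h 1 \<noteq> h 2" by (simp add: inj)
  ultimately have cases: "h 1 = 1 \<and> h 2 = 2 \<or> h 1 = 2 \<and> h 2 = 1" by auto
  have hx: "h x = x" if x: "x \<in> {3..n}" for x
  proof -
    obtain y where y: "y \<in> {3..n}" "x \<noteq> y"
    proof (cases "x = 3")
      case True
      then show ?thesis using that[of 4] n5 by auto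
    next
      case False
      then show ?thesis using that[of 3] n5 by auto
    qed
    define c where "c = cycle_of_list [1, x, y]"
    note c = moved_cycle[OF n5 x y, folded c_def]
    have ne: "h x \<noteq> h 1" "h x \<noteq> h 2" using x by (auto simp: inj)
    from comm[OF c(1,2)] show ?thesis
    proof
      assume "c \<circ> h = h \<circ> c"
      then have "c (h 1) = h (c 1)" by (metis comp_apply)
      then show ?thesis using cases ne c(3,6) by auto
    next
      assume "c \<circ> h = h \<circ> flip c"
      then have "c (h 2) = h (flip c 2)" by (metis comp_apply)
      then show ?thesis using cases ne c(3,6,8) by auto
    qed
  qed
  have h_out: "h x = x" if "x \<notin> {1, 2}" for x
    using hx[of x] permutes_not_in[OF hp, of x] that by (cases "x \<in> {3..n}") auto
  show "h = id"
  proof (cases "h 1 = 1")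
    case True
    then have "h x = x" for x using cases h_out[of x] by (cases "x \<in> {1, 2}") auto
    then show ?thesis by auto
  next
    case False
    then have "h x = transpose 1 2 x" for x using cases h_out[of x] by (cases "x \<in> {1, 2}") (auto simp: transpose_def)
    then have "h = transpose 1 2" by auto
    then show ?thesis using ev by (simp add: evenperm_swap)
  qed
qed

end

section \<open>Gradings and central objects of a category with these fusion rules\<close>

context bismash_fusion
begin

lemma V_Ob: "s \<in> A \<Longrightarrow> V s \<in> Ob C" by (rule brick_Ob[OF V_brick])

lemma W_Ob: "h \<in> A \<Longrightarrow> flip h = h \<Longrightarrow> W h \<in> Ob C" by (rule brick_Ob[OF W_brick])

lemma Hom_V_moved_tob:
  assumes "s \<in> A" "flip s \<noteq> s" "u \<in> A" "flip u \<noteq> u"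
  shows "Hom C (V (s \<circ> u)) (V s \<boxtimes> V u) \<noteq> {0}"
    and "flip (s \<circ> u) = s \<circ> u \<Longrightarrow> Hom C (W (s \<circ> u)) (V s \<boxtimes> V u) \<noteq> {0}"
  using Hom_nonzero_iff[OF V_moved_tob_V_moved[OF assms] V_brick[of "s \<circ> u"]]
    Hom_nonzero_iff[OF V_moved_tob_V_moved[OF assms] W_brick[of "s \<circ> u"]] A_comp[OF assms(1,3)] by auto

lemma not_graded:
  assumes n5: "n \<ge> 5" and gr: "graded_category C G \<A>" and g: "g \<in> carrier G" "g \<noteq> \<one>\<^bsub>G\<^esub>"
  shows False
proof -
  interpret gr: graded_category C G \<A> by (rule gr)
  have dV: "gr.deg (V (s \<circ> u)) = gr.deg (V s) \<otimes>\<^bsub>G\<^esub> gr.deg (V u)" if s: "s \<in> A" and u: "u \<in> A" for s u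
  proof -
    note b = V_brick[OF s] V_brick[OF u] V_brick[OF A_comp[OF s u]]
    have O: "V s \<boxtimes> V u \<in> Ob C" using tob_in V_Ob s u by simp
    have i: "gr.deg (V (s \<circ> u)) = gr.deg (V s) \<otimes>\<^bsub>G\<^esub> gr.deg (V u)" if i: "isomorphic C (V s \<boxtimes> V u) (V (s \<circ> u))"
    proof -
      have b': "brick C (V s \<boxtimes> V u)" by (rule brick_iso[OF b(3) O isomorphic_sym[OF i]])
      show ?thesis using gr.deg_iso[OF b' b(3) i] gr.deg_tob_brick[OF b(1,2) b'] by simp
    qed
    consider "flip s = s" | "flip u = u" | "flip s \<noteq> s" "flip u \<noteq> u" by blast
    then show ?thesis
    proof cases
      case 1
      then show ?thesis by (rule i[OF V_fixed_tob_V[OF s _ u]])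
    next
      case 2
      then show ?thesis by (rule i[OF V_tob_V_fixed[OF u _ s]])
    next
      case 3
      then show ?thesis by (intro gr.deg_tob[OF b Hom_V_moved_tob(1)[OF s _ u]])
    qed
  qed
  interpret h: group_hom "alt_group n" G "\<lambda>s. gr.deg (V s)"
    using alt_group_is_group gr.G.group_axioms gr.deg_in(1)[OF V_brick] dV
    by (auto simp: group_hom_def group_hom_axioms_def hom_def alt_group_mult)
  \<comment> \<open>For n \<ge> 5 the alternating group is its own derived subgroup, so its image in
    a commutative group is trivial.\<close>
  have "(\<lambda>s. gr.deg (V s)) ` derived (alt_group n) A = derived G ((\<lambda>s. gr.deg (V s)) ` A)"
    by (rule h.derived_img[symmetric]) simp
  also have "\<dots> = {\<one>\<^bsub>G\<^esub>}" by (rule gr.G.derived_eq_singleton) auto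
  finally have V1: "gr.deg (V s) = \<one>\<^bsub>G\<^esub>" if "s \<in> A" for s
    using that unfolding derived_alt_group_const[OF n5] by auto
  obtain s where s: "s \<in> A" "flip s \<noteq> s" using moved_exists[OF n5] by blast
  note si = A_inv[OF s(1)]
  have fis: "flip (inv' s) \<noteq> inv' s" using A_inv_moved[OF s(1)] s(2) by simp
  \<comment> \<open>\<open>s \<circ> inv' s\<close> is the identity, which \<open>flip\<close>
    fixes, so the product contains \<open>W id\<close> next to \<open>V id\<close>; this brings the
    degrees of the \<open>W h\<close> under control.\<close>
  have "Hom C (W id) (V s \<boxtimes> V (inv' s)) \<noteq> {0}"
    using Hom_V_moved_tob(2)[OF s si(1) fis] si by simp
  from gr.deg_tob[OF V_brick[OF s(1)] V_brick[OF si(1)] W_brick[OF A_id flip_id] this]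
  have W1: "gr.deg (W id) = \<one>\<^bsub>G\<^esub>" using V1 s si by simp
  have W: "gr.deg (W h) = \<one>\<^bsub>G\<^esub>" if h: "h \<in> A" "flip h = h" for h
  proof -
    have i: "isomorphic C (V h \<boxtimes> W id) (W h)" using V_fixed_tob_W[OF A_id flip_id h] by simp
    have O: "V h \<boxtimes> W id \<in> Ob C" using tob_in V_Ob W_Ob h A_id by simp
    have b: "brick C (V h \<boxtimes> W id)" by (rule brick_iso[OF W_brick[OF h] O isomorphic_sym[OF i]])
    show ?thesis using gr.deg_iso[OF b W_brick[OF h] i] gr.deg_tob_brick[OF V_brick[OF h(1)] W_brick[OF A_id flip_id] b] V1[OF h(1)] W1
      by simp
  qed
  obtain X where X: "brick C X" "gr.deg X \<noteq> \<one>\<^bsub>G\<^esub>" using gr.not_all_deg_one[OF g] by blast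
  from brick_cases[OF X(1)] show False
  proof
    assume "\<exists>s\<in>A. isomorphic C X (V s)"
    then show False using gr.deg_iso[OF X(1) V_brick] V1 X(2) by force
  next
    assume "\<exists>h\<in>A. flip h = h \<and> isomorphic C X (W h)"
    then show False using gr.deg_iso[OF X(1) W_brick] W X(2) by force
  qed
qed

text \<open>A moved \<open>V s\<close> is excluded because its square has at least two summands. For
  \<open>V h\<close> and \<open>W h\<close> with fixed h, commuting with the moved
  \<open>V u\<close> turns into the hypothesis of \<open>twisted_central_id\<close>, so h = id. Of
  \<open>V id\<close> and \<open>W id\<close> the first is the unit.\<close>

lemma central_object_W_id:
  assumes n5: "n \<ge> 5" and X: "brick C X" "brick C (X \<boxtimes> X)" "\<not> isomorphic C X (unit_ob C)"
    and comm: "\<And>Y. Y \<in> Ob C \<Longrightarrow> isomorphic C (X \<boxtimes> Y) (Y \<boxtimes> X)"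
  shows "isomorphic C X (W id)"
proof -
  note XO = brick_Ob[OF X(1)]
  \<comment> \<open>\<open>Z\<close> stands for \<open>V h\<close> or \<open>W h\<close>: both shift
    the moved objects by h.\<close>
  have id: "h = id" if h: "h \<in> A" "flip h = h" and Z: "Z \<in> Ob C" "isomorphic C X Z"
    and l: "\<And>u. u \<in> A \<Longrightarrow> flip u \<noteq> u \<Longrightarrow> isomorphic C (Z \<boxtimes> V u) (V (h \<circ> u))"
    and r: "\<And>u. u \<in> A \<Longrightarrow> flip u \<noteq> u \<Longrightarrow> isomorphic C (V u \<boxtimes> Z) (V (u \<circ> h))" for h Z
  proof (rule twisted_central_id[OF n5 h])
    fix u assume u: "u \<in> A" "flip u \<noteq> u"
    note uO = V_Ob[OF u(1)]
    have hu: "h \<circ> u \<in> A" "u \<circ> h \<in> A" using A_comp h(1) u(1) by auto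
    note huO = V_Ob[OF hu(1)] V_Ob[OF hu(2)]
    have XZ: "iso_class C X = iso_class C Z" using iso_class_eq[OF XO Z(1)] Z(2) by simp
    have "iso_class C (V (h \<circ> u)) = iso_class C (Z \<boxtimes> V u)"
      using iso_class_eq[OF tob_in[OF Z(1) uO] huO(1)] l[OF u] by simp
    also have "\<dots> = iso_class C (X \<boxtimes> V u)" using iso_monoid_mult[OF Z(1) uO] iso_monoid_mult[OF XO uO] XZ by simp
    also have "\<dots> = iso_class C (V u \<boxtimes> X)" using iso_class_eq[OF tob_in[OF XO uO] tob_in[OF uO XO]] comm[OF uO] by simp
    also have "\<dots> = iso_class C (V u \<boxtimes> Z)" using iso_monoid_mult[OF uO Z(1)] iso_monoid_mult[OF uO XO] XZ by simp
    also have "\<dots> = iso_class C (V (u \<circ> h))" using iso_class_eq[OF tob_in[OF uO Z(1)] huO(2)] r[OF u] by simp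
    finally show "u \<circ> h = h \<circ> u \<or> u \<circ> h = h \<circ> flip u"
      using iso_class_eq[OF huO] V_iso[OF hu] h(2) by (simp add: flip_comp)
  qed
  from brick_cases[OF X(1)] show ?thesis
  proof
    assume "\<exists>s\<in>A. isomorphic C X (V s)"
    then obtain s where s: "s \<in> A" "isomorphic C X (V s)" by blast
    note sO = V_Ob[OF s(1)]
    show ?thesis
    proof (cases "flip s = s")
      case True
      have "s = id" using id[OF s(1) True sO s(2)] V_fixed_tob_V[OF s(1) True] V_tob_V_fixed[OF s(1) True] by blast
      then have "isomorphic C X (unit_ob C)"
        using isomorphic_trans[OF XO sO unit_in s(2)] V_id by simp
      then show ?thesis using X(3) by simp
    next
      case False
      have "isomorphic C (X \<boxtimes> X) (V s \<boxtimes> V s)" by (rule isomorphic_tob[OF XO sO XO sO s(2) s(2)])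
      then have "decomp C (V s \<boxtimes> V s) {#iso_class C (X \<boxtimes> X)#}"
        by (rule decomp_iso[OF decomp_brick[OF X(2)] tob_in[OF sO sO]])
      from arg_cong[OF decomp_unique[OF this V_moved_tob_V_moved[OF s(1) False s(1) False]], of size]
      show ?thesis by (simp split: if_splits)
    qed
  next
    assume "\<exists>h\<in>A. flip h = h \<and> isomorphic C X (W h)"
    then obtain h where h: "h \<in> A" "flip h = h" "isomorphic C X (W h)" by blast
    have "h = id"
      using id[OF h(1,2) W_Ob[OF h(1,2)] h(3)] W_tob_V_moved[OF h(1,2)] V_moved_tob_W[OF h(1,2)] by blast
    then show ?thesis using h(3) by simp
  qed
qed

end

section \<open>Equivariantizations by the group of order two\<close>

context fusion_equivariantization
begin

lemma E_brick_Hom: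
  assumes "brick C X" "f \<in> Hom E (fob F X) (fob F X)"
  shows "\<exists>c. f = scl D c (idn D (forget X))"
proof -
  have "brick E (fob F X)" using C.equivalence_brick_iff[OF equivalence C.brick_Ob[OF assms(1)]] assms(1) by simp
  then have "f \<in> range (\<lambda>c. scl E c (idn E (fob F X)))" using assms(2) by (simp add: brick_def)
  then show ?thesis using idn_E[of "forget X" "snd (fob F X)"] by (auto simp: scl_E)
qed

lemma idn_forget_nonzero:
  assumes "brick C X"
  shows "idn D (forget X) \<noteq> 0"
proof -
  have "brick E (fob F X)" using C.equivalence_brick_iff[OF equivalence C.brick_Ob[OF assms]] assms by simp
  then show ?thesis using idn_E[of "forget X" "snd (fob F X)"] by (simp add: brick_def)
qed

text \<open>Equivariant endomorphisms are in particular endomorphisms in D, where all of them are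
  scalars.\<close>

lemma brick_of_brick_forget:
  assumes X: "X \<in> Ob C" and br: "brick D (forget X)"
  shows "brick C X"
proof -
  obtain X0 \<mu> where F: "fob F X = (X0, \<mu>)" by fastforce
  have idn: "far F X X (idn C X) = idn D X0" using is_tensor_functor.far_idn[OF F_functor X] by (simp add: F idn_E)
  have scl: "far F X X (scl C c (idn C X)) = scl D c (idn D X0)" for c
    using is_tensor_functor.far_scl[OF F_functor X X C.idn_in[OF X]] by (simp add: idn scl_E)
  have nz: "idn C X \<noteq> 0" using idn C.far_zero[OF F_functor X X] br by (auto simp: brick_def F)
  have "f \<in> range (\<lambda>c. scl C c (idn C X))" if f: "f \<in> Hom C X X" for f
  proof -
    have "far F X X f \<in> Hom D X0 X0" using is_tensor_functor.far_in[OF F_functor X X f] by (simp add: F Hom_E)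
    then obtain c where "far F X X f = scl D c (idn D X0)" using br by (auto simp: brick_def F)
    then have "far F X X f = far F X X (scl C c (idn C X))" by (simp add: scl)
    then have "f = scl C c (idn C X)"
      using C.equivalence_Hom(2)[OF equivalence X X] f C.scl_in[OF X X C.idn_in[OF X]] by (simp add: inj_on_eq_iff)
    then show ?thesis by (rule range_eqI)
  qed
  then show ?thesis using X nz C.scl_in[OF X X C.idn_in[OF X]] by (auto simp: brick_def)
qed

lemma structure_iso:
  assumes "X \<in> Ob C" "g \<in> carrier G"
  shows "fob (\<rho> g) (forget X) \<in> Ob D" "iso_arr D (fob (\<rho> g) (forget X)) (forget X) (snd (fob F X) g)"
    "snd (fob F X) g \<in> Hom D (fob (\<rho> g) (forget X)) (forget X)"
proof -
  show iso: "iso_arr D (fob (\<rho> g) (forget X)) (forget X) (snd (fob F X) g)"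
    using F_Ob[OF assms(1)] assms(2) Ob_E[of "forget X" "snd (fob F X)"] by simp
  show "fob (\<rho> g) (forget X) \<in> Ob D" by (rule act_Ob[OF assms(2) forget_Ob[OF assms(1)]])
  show "snd (fob F X) g \<in> Hom D (fob (\<rho> g) (forget X)) (forget X)" by (rule iso_arr_Hom[OF iso])
qed

lemma scl_two: "v + v = scl D 2 v"
  using scale_left_distrib[of 1 1 v] by (simp add: one_add_one)

text \<open>In D an isomorphism onto the twist is a nonzero scalar, because the object is a brick
  there. Such a scalar intertwines a structure map with a multiple of it only if the factor is 1.
  Objects that stay simple in D thus detect characters.\<close>

lemma twist_trivial:
  assumes X: "X \<in> Ob C" and br: "brick D (forget X)" and iso: "isomorphic E (fob F X) (twist \<zeta> (fob F X))" and g: "g \<in> carrier G"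
  shows "\<zeta> g = 1"
proof -
  obtain X0 \<mu> where F: "fob F X = (X0, \<mu>)" by fastforce
  note O = forget_Ob[OF X, unfolded F fst_conv]
  note R = structure_iso(1)[OF X g, unfolded F fst_conv] and mi = structure_iso(2)[OF X g, unfolded F fst_conv snd_conv]
    and mH = structure_iso(3)[OF X g, unfolded F fst_conv snd_conv]
  obtain f where f: "iso_arr E (X0, \<mu>) (X0, \<lambda>g\<in>carrier G. scl D (\<zeta> g) (\<mu> g)) f"
    using iso by (auto simp: isomorphic_def F twist_def)
  have fi: "iso_arr D X0 X0 f" by (rule iso_arr_E_D[OF f])
  have fE: "f \<odot> \<mu> g = scl D (\<zeta> g) (\<mu> g) \<odot> far (\<rho> g) X0 X0 f"
    using iso_arr_Hom[OF f] g by (simp add: Hom_E)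
  obtain c where c: "f = scl D c (idn D X0)" using br iso_arr_Hom[OF fi] by (auto simp: brick_def F)
  have nz: "idn D X0 \<noteq> 0" using br by (simp add: brick_def F)
  have c0: "c \<noteq> 0"
  proof
    assume "c = 0"
    then have "f = 0" using c by simp
    obtain f' where "f' \<in> Hom D X0 X0" "f \<odot> f' = idn D X0" using fi by (auto simp: iso_arr_def)
    then show False using \<open>f = 0\<close> cmp_zero_left[OF O O O] nz by simp
  qed
  have "\<mu> g \<noteq> 0"
  proof
    assume "\<mu> g = 0"
    then show False using inv_arr(3)[OF R O mi] cmp_zero_left[OF O R O inv_arr(1)[OF R O mi]] nz by simp
  qed
  have "far (\<rho> g) X0 X0 f = scl D c (idn D (fob (\<rho> g) X0))"
    unfolding c using act_scl[OF g O O idn_in[OF O]] act_idn[OF g O] by simp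
  then have "scl D c (\<mu> g) = scl D (\<zeta> g) (scl D c (\<mu> g))"
    using fE c cmp_scl_left[OF R O O mH idn_in[OF O]] idn_left[OF R O mH] idn_right[OF R O mH]
      cmp_scl_right[OF R R O idn_in[OF R] scl_in[OF R O mH]] idn_right[OF R O scl_in[OF R O mH]]
    by (simp add: mult.commute)
  then have "scl D ((1 - \<zeta> g) * c) (\<mu> g) = 0" by (simp add: algebra_simps scale_left_diff_distrib)
  then show ?thesis using c0 \<open>\<mu> g \<noteq> 0\<close> by simp
qed

lemma E_object_twist_iso:
  "E_object A \<Longrightarrow> E_object B \<Longrightarrow> isomorphic E A B \<Longrightarrow> isomorphic E (twist \<xi> A) (twist \<xi> B)"
  using twist_isomorphic[of "fst A" "snd A" "fst B" "snd B"] by simp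

lemma E_object_tob_iso:
  "\<lbrakk>E_object A; E_object B; E_object A'; E_object B'; isomorphic E A A'; isomorphic E B B'\<rbrakk>
    \<Longrightarrow> isomorphic E (A \<boxtimes>\<^bsub>E\<^esub> B) (A' \<boxtimes>\<^bsub>E\<^esub> B')"
  using isomorphic_E_tob[of "fst A" "snd A" "fst B" "snd B" "fst A'" "snd A'" "fst B'" "snd B'"] by simp

lemma twist_object_exists:
  assumes "\<And>x y. x \<in> carrier G \<Longrightarrow> y \<in> carrier G \<Longrightarrow> \<zeta> (x \<otimes>\<^bsub>G\<^esub> y) = \<zeta> x * \<zeta> y" "\<zeta> \<one>\<^bsub>G\<^esub> = (1::'k)"
  shows "\<exists>\<chi>\<in>Ob C. isomorphic E (fob F \<chi>) (twist \<zeta> (fob F (unit_ob C)))"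
proof -
  have "twist \<zeta> (fob F (unit_ob C)) \<in> Ob E" by (rule twist_Ob[OF F_Ob[OF C.unit_in]]) (use assms in auto)
  then show ?thesis using equivalence unfolding is_tensor_equivalence_def by blast
qed

text \<open>Tensoring with \<open>\<chi>\<close> from either side is twisting by
  \<open>\<zeta>\<close>; this is what makes \<open>\<chi>\<close> commute with all objects.\<close>

lemma twist_object_tob:
  assumes \<chi>: "\<chi> \<in> Ob C" "isomorphic E (fob F \<chi>) (twist \<zeta> (fob F (unit_ob C)))" and X: "X \<in> Ob C"
  shows "isomorphic E (fob F (X \<boxtimes>\<^bsub>C\<^esub> \<chi>)) (twist \<zeta> (fob F X))" "isomorphic E (fob F (\<chi> \<boxtimes>\<^bsub>C\<^esub> X)) (twist \<zeta> (fob F X))"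
proof -
  let ?u = "fob F (unit_ob C)"
  have O: "E_object (fob F X)" "E_object (fob F \<chi>)" "E_object ?u" "E_object (twist \<zeta> ?u)" "E_object (twist \<zeta> (fob F X))"
    using E_object_F E_object_twist X \<chi>(1) C.unit_in by auto
  note refl = C.functor_isomorphic[OF F_functor X X C.isomorphic_refl[OF X]]
  have U: "X \<boxtimes>\<^bsub>C\<^esub> unit_ob C \<in> Ob C" "unit_ob C \<boxtimes>\<^bsub>C\<^esub> X \<in> Ob C" using C.tob_in C.unit_in X by auto
  have tw: "fob F X \<boxtimes>\<^bsub>E\<^esub> twist \<zeta> ?u = twist \<zeta> (fob F X \<boxtimes>\<^bsub>E\<^esub> ?u)" "twist \<zeta> ?u \<boxtimes>\<^bsub>E\<^esub> fob F X = twist \<zeta> (?u \<boxtimes>\<^bsub>E\<^esub> fob F X)"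
    using twist_tob[of "forget X" "snd (fob F X)" "fst ?u" "snd ?u"] twist_tob[of "fst ?u" "snd ?u" "forget X" "snd (fob F X)"] O by simp_all
  have 1: "isomorphic E (fob F X \<boxtimes>\<^bsub>E\<^esub> ?u) (fob F X)"
    by (rule E_trans[OF _ _ _ F_tob[OF X C.unit_in] C.functor_isomorphic[OF F_functor U(1) X isomorphicI[OF C.runit_iso[OF X]]]])
      (use O U E_object_F E_object_tob in auto)
  have 2: "isomorphic E (?u \<boxtimes>\<^bsub>E\<^esub> fob F X) (fob F X)"
    by (rule E_trans[OF _ _ _ F_tob[OF C.unit_in X] C.functor_isomorphic[OF F_functor U(2) X isomorphicI[OF C.lunit_iso[OF X]]]])
      (use O U E_object_F E_object_tob in auto)
  have 3: "isomorphic E (fob F X \<boxtimes>\<^bsub>E\<^esub> fob F \<chi>) (twist \<zeta> (fob F X))"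
    by (rule E_trans[OF _ _ _ E_object_tob_iso[OF O(1,2,1,4) refl \<chi>(2)]])
      (use O E_object_tob E_object_twist E_object_twist_iso[OF _ _ 1] in \<open>auto simp: tw\<close>)
  show "isomorphic E (fob F (X \<boxtimes>\<^bsub>C\<^esub> \<chi>)) (twist \<zeta> (fob F X))"
    by (rule E_trans[OF _ _ _ isomorphic_E_sym[OF F_tob[OF X \<chi>(1)]] 3])
      (use O E_object_tob E_object_F C.tob_in X \<chi>(1) in auto)
  have 4: "isomorphic E (fob F \<chi> \<boxtimes>\<^bsub>E\<^esub> fob F X) (twist \<zeta> (fob F X))"
    by (rule E_trans[OF _ _ _ E_object_tob_iso[OF O(2,1,4,1) \<chi>(2) refl]])
      (use O E_object_tob E_object_twist E_object_twist_iso[OF _ _ 2] in \<open>auto simp: tw\<close>)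
  show "isomorphic E (fob F (\<chi> \<boxtimes>\<^bsub>C\<^esub> X)) (twist \<zeta> (fob F X))"
    by (rule E_trans[OF _ _ _ isomorphic_E_sym[OF F_tob[OF \<chi>(1) X]] 4])
      (use O E_object_tob E_object_F C.tob_in X \<chi>(1) in auto)
qed

end

locale order_two_equivariantization = fusion_equivariantization G D \<rho> \<gamma> \<upsilon> C F
  for G :: "('g, 'm) monoid_scheme" and D :: "('o, 'a::ab_group_add, 'k::field) tensor_category" (structure)
    and \<rho> \<gamma> \<upsilon> and C :: "('p, 'b::ab_group_add, 'k) tensor_category" and F +
  fixes \<zeta> :: "'g \<Rightarrow> 'k" and g
  assumes order_two: "carrier G = {\<one>\<^bsub>G\<^esub>, g}" "g \<otimes>\<^bsub>G\<^esub> g = \<one>\<^bsub>G\<^esub>"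
    and sign: "\<zeta> \<one>\<^bsub>G\<^esub> = 1" "\<zeta> g = -1" and two: "(2::'k) \<noteq> 0"
begin

lemma g_in: "g \<in> carrier G" by (simp add: order_two)

text \<open>Of the two eigencomponents of e, the equivariant one is a scalar since X is simple in
  C.\<close>

lemma self_split:
  assumes X: "brick C X" and e: "e \<in> Hom D (forget X) (forget X)"
  shows "\<exists>\<alpha> b. e = scl D \<alpha> (idn D (forget X)) + b \<and> b \<in> Hom E (fob F X) (twist \<zeta> (fob F X))"
  using Hom_D_split[of "forget X" "snd (fob F X)" "forget X" "snd (fob F X)" e g \<zeta>] F_Ob[OF C.brick_Ob[OF X]] e order_two sign two
    E_brick_Hom[OF X] by fastforce

text \<open>The idempotent \<open>e\<close> of the summand \<open>Y i\<close> is a scalar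
  \<open>\<alpha>\<close> plus an arrow that changes sign under conjugation, so the conjugate of
  \<open>e\<close> is \<open>2 * \<alpha> - e\<close>. If the component \<open>h\<close> from the
  image of \<open>Y i\<close> under g to \<open>Y j\<close> vanished, comparison at
  \<open>Y j\<close> would give \<open>\<alpha> = 0\<close>. Then the conjugate would be
  \<open>- e\<close> and idempotent like \<open>e\<close> itself, which forces 2 e = 0.\<close>

lemma summand_conjugate:
  assumes X: "brick C X" and bp: "biproduct D I Y (forget X) inc prj" and ij: "i \<in> I" "j \<in> I" "i \<noteq> j"
    and br: "brick D (Y i)" "brick D (Y j)"
  shows "isomorphic D (fob (\<rho> g) (Y i)) (Y j)"
proof -
  note XO = C.brick_Ob[OF X] and d = biproductD[OF bp]
  obtain X0 \<mu> where F: "fob F X = (X0, \<mu>)" by fastforce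
  note O = forget_Ob[OF XO, unfolded F fst_conv]
  note R = structure_iso(1)[OF XO g_in, unfolded F fst_conv] and mi = structure_iso(2)[OF XO g_in, unfolded F fst_conv snd_conv]
    and mH = structure_iso(3)[OF XO g_in, unfolded F fst_conv snd_conv]
  note d = d[unfolded F fst_conv]
  note YO = d(3)[OF ij(1)] d(3)[OF ij(2)]
  have RY: "fob (\<rho> g) (Y i) \<in> Ob D" "fob (\<rho> g) (Y j) \<in> Ob D" using act_Ob[OF g_in] YO by auto
  define e where "e = inc i \<odot> prj i"
  have eH: "e \<in> Hom D X0 X0" unfolding e_def by (rule cmp_in[OF O YO(1) O d(5)[OF ij(1)] d(4)[OF ij(1)]])
  let ?r = "far (\<rho> g) X0 X0 e" and ?i = "far (\<rho> g) (Y i) X0 (inc i)" and ?p = "far (\<rho> g) X0 (Y i) (prj i)"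
  have rH: "?r \<in> Hom D (fob (\<rho> g) X0) (fob (\<rho> g) X0)" by (rule act_Hom[OF g_in O O eH])
  have iH: "?i \<in> Hom D (fob (\<rho> g) (Y i)) (fob (\<rho> g) X0)" and pH: "?p \<in> Hom D (fob (\<rho> g) X0) (fob (\<rho> g) (Y i))"
    using act_Hom[OF g_in] O YO d(4,5) ij by auto
  have r: "?r = ?i \<odot> ?p" unfolding e_def by (rule act_cmp[OF g_in O YO(1) O d(5)[OF ij(1)] d(4)[OF ij(1)]])
  have ee: "e \<odot> e = e"
  proof -
    have "e \<odot> e = inc i \<odot> (prj i \<odot> e)"
      unfolding e_def by (rule cmp_assoc[OF O O YO(1) O eH[unfolded e_def] d(5)[OF ij(1)] d(4)[OF ij(1)], symmetric])
    also have "prj i \<odot> e = prj i \<odot> inc i \<odot> prj i"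
      unfolding e_def by (rule cmp_assoc[OF O YO(1) O YO(1) d(5)[OF ij(1)] d(4)[OF ij(1)] d(5)[OF ij(1)]])
    also have "\<dots> = prj i" using d(6)[OF ij(1,1)] idn_left[OF O YO(1) d(5)[OF ij(1)]] by simp
    finally show ?thesis by (simp add: e_def)
  qed
  have pe: "prj j \<odot> e = 0"
  proof -
    have "prj j \<odot> e = prj j \<odot> inc i \<odot> prj i"
      unfolding e_def by (rule cmp_assoc[OF O YO(1) O YO(2) d(5)[OF ij(1)] d(4)[OF ij(1)] d(5)[OF ij(2)]])
    then show ?thesis using d(6)[OF ij(1,2)] ij(3) cmp_zero_left[OF O YO d(5)[OF ij(1)]] by simp
  qed
  have e0: "e \<noteq> 0"
  proof
    assume "e = 0"
    have "e \<odot> inc i = inc i \<odot> (prj i \<odot> inc i)"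
      unfolding e_def by (rule cmp_assoc[OF YO(1) O YO(1) O d(4)[OF ij(1)] d(5)[OF ij(1)] d(4)[OF ij(1)], symmetric])
    then have "inc i = 0"
      using d(6)[OF ij(1,1)] idn_right[OF YO(1) O d(4)[OF ij(1)]] \<open>e = 0\<close> cmp_zero_left[OF YO(1) O O d(4)[OF ij(1)]] by simp
    then have "idn D (Y i) = 0" using d(6)[OF ij(1,1)] cmp_zero_right[OF YO(1) O YO(1) d(5)[OF ij(1)]] by simp
    then show False using br(1) by (simp add: brick_def)
  qed
  obtain \<alpha> b where ab: "e = scl D \<alpha> (idn D X0) + b" "b \<in> Hom E (X0, \<mu>) (X0, \<lambda>g\<in>carrier G. scl D (\<zeta> g) (\<mu> g))"
    using self_split[OF X, unfolded F fst_conv, OF eH] by (auto simp: twist_def)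
  have bH: "b \<in> Hom D X0 X0" using ab(2) by (simp add: Hom_E)
  have bm: "b \<odot> \<mu> g = - (\<mu> g \<odot> far (\<rho> g) X0 X0 b)"
    using ab(2) g_in sign cmp_scl_left[OF R R O act_Hom[OF g_in O O bH] mH, of "-1"] by (simp add: Hom_E)
  have aH: "scl D \<alpha> (idn D X0) \<in> Hom D X0 X0" by (rule scl_in[OF O O idn_in[OF O]])
  have "far (\<rho> g) X0 X0 (scl D \<alpha> (idn D X0)) = scl D \<alpha> (idn D (fob (\<rho> g) X0))"
    using act_scl[OF g_in O O idn_in[OF O]] act_idn[OF g_in O] by simp
  then have ar: "\<mu> g \<odot> far (\<rho> g) X0 X0 (scl D \<alpha> (idn D X0)) = scl D \<alpha> (\<mu> g)"
    using cmp_scl_right[OF R R O idn_in[OF R] mH] idn_right[OF R O mH] by simp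
  have am: "scl D \<alpha> (idn D X0) \<odot> \<mu> g = scl D \<alpha> (\<mu> g)"
    using cmp_scl_left[OF R O O mH idn_in[OF O]] idn_left[OF R O mH] by simp
  have em: "e \<odot> \<mu> g = scl D \<alpha> (\<mu> g) + (b \<odot> \<mu> g)"
    unfolding ab(1) using cmp_add_left[OF R O O mH aH bH] am by simp
  have "\<mu> g \<odot> ?r = scl D \<alpha> (\<mu> g) + (\<mu> g \<odot> far (\<rho> g) X0 X0 b)"
    unfolding ab(1) using act_add[OF g_in O O aH bH] cmp_add_right[OF R R O act_Hom[OF g_in O O aH] act_Hom[OF g_in O O bH] mH] ar by simp
  moreover have "r = t - m" if "r = s + p" "m = s + q" "q = - p" "s + s = t" for r s t m p q :: 'a
    unfolding that(1,2,3) that(4)[symmetric] by simp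
  ultimately have mr: "\<mu> g \<odot> ?r = scl D (2 * \<alpha>) (\<mu> g) - (e \<odot> \<mu> g)"
    using em bm scl_two[of "scl D \<alpha> (\<mu> g)"] by (metis scale_scale)
  define h where "h = prj j \<odot> \<mu> g \<odot> ?i"
  have pm: "prj j \<odot> \<mu> g \<in> Hom D (fob (\<rho> g) X0) (Y j)" by (rule cmp_in[OF R O YO(2) mH d(5)[OF ij(2)]])
  have hH: "h \<in> Hom D (fob (\<rho> g) (Y i)) (Y j)" unfolding h_def by (rule cmp_in[OF RY(1) R YO(2) iH pm])
  have "h \<noteq> 0"
  proof
    assume "h = 0"
    have emH: "e \<odot> \<mu> g \<in> Hom D (fob (\<rho> g) X0) X0" by (rule cmp_in[OF R O O mH eH])
    have "prj j \<odot> (\<mu> g \<odot> ?r) = prj j \<odot> \<mu> g \<odot> ?r" by (rule cmp_assoc[OF R R O YO(2) rH mH d(5)[OF ij(2)]])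
    also have "\<dots> = h \<odot> ?p" unfolding r h_def by (rule cmp_assoc[OF R RY(1) R YO(2) pH iH pm])
    also have "\<dots> = 0" using \<open>h = 0\<close> cmp_zero_left[OF R RY(1) YO(2) pH] by simp
    finally have 1: "prj j \<odot> (\<mu> g \<odot> ?r) = 0" .
    have "prj j \<odot> (e \<odot> \<mu> g) = 0"
      using cmp_assoc[OF R O O YO(2) mH eH d(5)[OF ij(2)]] pe cmp_zero_left[OF R O YO(2) mH] by simp
    with 1 have 2: "scl D (2 * \<alpha>) (prj j \<odot> \<mu> g) = 0"
      unfolding mr using cmp_diff_right[OF R O YO(2) scl_in[OF R O mH] emH d(5)[OF ij(2)]] cmp_scl_right[OF R O YO(2) mH d(5)[OF ij(2)]] by simp
    have "prj j \<odot> \<mu> g \<noteq> 0"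
    proof
      assume z: "prj j \<odot> \<mu> g = 0"
      note im = inv_arr[OF R O mi]
      have "prj j = prj j \<odot> (\<mu> g \<odot> inv_arr D (fob (\<rho> g) X0) X0 (\<mu> g))" using im(3) idn_right[OF O YO(2) d(5)[OF ij(2)]] by simp
      also have "\<dots> = 0" using cmp_assoc[OF O R O YO(2) im(1) mH d(5)[OF ij(2)]] z cmp_zero_left[OF O R YO(2) im(1)] by simp
      finally have "idn D (Y j) = 0" using d(6)[OF ij(2,2)] cmp_zero_left[OF YO(2) O YO(2) d(4)[OF ij(2)]] by simp
      then show False using br(2) by (simp add: brick_def)
    qed
    with 2 two have "\<alpha> = 0" by simp
    with mr have neg: "\<mu> g \<odot> ?r = - (e \<odot> \<mu> g)" by simp
    have rr: "?r \<odot> ?r = ?r" using act_cmp[OF g_in O O O eH eH] ee by simp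
    have "- (e \<odot> \<mu> g) = \<mu> g \<odot> ?r \<odot> ?r" using cmp_assoc[OF R R R O rH rH mH] rr neg by simp
    also have "\<dots> = - (e \<odot> \<mu> g \<odot> ?r)" 
      unfolding neg using cmp_scl_left[OF R R O rH emH, of "-1"] by simp
    also have "e \<odot> \<mu> g \<odot> ?r = - (e \<odot> (e \<odot> \<mu> g))"
      using cmp_assoc[OF R R O O rH mH eH] neg cmp_scl_right[OF R O O emH eH, of "-1"] by simp
    also have "e \<odot> (e \<odot> \<mu> g) = e \<odot> \<mu> g" using cmp_assoc[OF R O O O mH eH eH] ee by simp
    finally have "scl D 2 (e \<odot> \<mu> g) = 0" using scl_two[of "e \<odot> \<mu> g"] by (simp add: neg_eq_iff_add_eq_0)
    then have "e \<odot> \<mu> g = 0 \<odot> \<mu> g" using two cmp_zero_left[OF R O O mH] by simp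
    then have "e = 0" by (rule iso_cancel_right[OF R O O mi eH zero_in[OF O O]])
    then show False using e0 by simp
  qed
  moreover have "brick D (fob (\<rho> g) (Y i))"
    using equivalence_brick_iff[OF autoequivalence[OF g_in] YO(1)] br(1) by simp
  ultimately show ?thesis by (intro isomorphicI[OF schur[OF _ br(2) hH]])
qed

end

section \<open>Decompositions after forgetting the equivariant structure\<close>

context fusion_equivariantization
begin

text \<open>Well defined because decompositions in D are unique and isomorphic objects stay
  isomorphic in D.\<close>

definition forget_class :: "'p set \<Rightarrow> 'o set multiset" where
  "forget_class x = (THE M. decomp D (forget (rep_ob x)) M)"

lemma forget_class_eq:
  assumes Z: "Z \<in> Ob C" and M: "decomp D (forget Z) M"
  shows "forget_class (iso_class C Z) = M"
proof -
  note r = C.rep_ob_iso_class[OF Z]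
  have "decomp D (forget (rep_ob (iso_class C Z))) M"
    by (rule decomp_iso[OF M forget_Ob[OF r(1)] forget_iso[OF Z r(1,2)]])
  then show ?thesis unfolding forget_class_def using decomp_unique by blast
qed

lemma forget_decomp:
  assumes "decomp C X M"
  shows "decomp D (forget X) (\<Sum>x\<in>#M. forget_class x)"
proof -
  obtain k Y where ds: "direct_sum C {..<k} Y X" and b: "\<And>i. i < k \<Longrightarrow> brick C (Y i)"
    and e: "M = image_mset (\<lambda>i. iso_class C (Y i)) (mset_set {..<k::nat})"
    using assms unfolding decomp_def by blast
  have "decomp D (forget (Y i)) (forget_class (iso_class C (Y i)))" if "i < k" for i
  proof -
    have O: "Y i \<in> Ob C" by (rule C.brick_Ob[OF b[OF that]])
    obtain N where N: "decomp D (forget (Y i)) N" using decomposable[OF forget_Ob[OF O]] by blast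
    then show ?thesis using forget_class_eq[OF O N] by simp
  qed
  then have "decomp D (forget X) (\<Sum>i<k. forget_class (iso_class C (Y i)))"
    by (intro decomp_sum[OF forget_direct_sum[OF ds]]) simp
  then show ?thesis by (simp add: e image_mset.compositionality comp_def sum_unfold_sum_mset)
qed

end

context order_two_equivariantization
begin

text \<open>An arrow in D splits into equivariant arrows to Y and to the twist of Y. As the twist is
  isomorphic to Y, both parts vanish.\<close>

lemma Hom_forget_zero:
  assumes XY: "X \<in> Ob C" "Y \<in> Ob C" "Hom C X Y = {0}" and iso: "isomorphic E (fob F Y) (twist \<zeta> (fob F Y))"
  shows "Hom D (forget X) (forget Y) = {0}"
proof -
  obtain X0 \<mu> where FX: "fob F X = (X0, \<mu>)" by fastforce
  obtain Y0 \<nu> where FY: "fob F Y = (Y0, \<nu>)" by fastforce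
  note O = forget_Ob[OF XY(1), unfolded FX fst_conv] forget_Ob[OF XY(2), unfolded FY fst_conv]
  have s: "structure_map X0 \<mu>" "structure_map Y0 \<nu>" using E_object_F[OF XY(1)] E_object_F[OF XY(2)] by (simp_all add: FX FY)
  let ?\<nu> = "\<lambda>g\<in>carrier G. scl D (\<zeta> g) (\<nu> g)"
  have H0: "a = 0" if "a \<in> Hom E (X0, \<mu>) (Y0, \<nu>)" for a
    using C.equivalence_Hom(1)[OF equivalence XY(1,2)] C.far_zero[OF F_functor XY(1,2)] that XY(3) by (simp add: FX FY)
  obtain \<theta> where \<theta>: "iso_arr E (Y0, ?\<nu>) (Y0, \<nu>) \<theta>"
    using isomorphic_E_sym[OF iso] by (auto simp: isomorphic_def FY twist_def)
  have "f = 0" if f: "f \<in> Hom D X0 Y0" for f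
  proof -
    obtain a b where ab: "a \<in> Hom E (X0, \<mu>) (Y0, \<nu>)" "b \<in> Hom E (X0, \<mu>) (Y0, ?\<nu>)" "f = a + b"
      using Hom_D_split[of X0 \<mu> Y0 \<nu> f g \<zeta>] F_Ob[OF XY(1)] F_Ob[OF XY(2)] f order_two sign two
      by (auto simp: FX FY twist_def)
    have bH: "b \<in> Hom D X0 Y0" using ab(2) by (simp add: Hom_E)
    have \<theta>i: "iso_arr D Y0 Y0 \<theta>" by (rule iso_arr_E_D[OF \<theta>])
    have "\<theta> \<odot> b = 0" by (rule H0[OF cmp_in_E[OF s(1) structure_map_twist[OF s(2)] s(2) ab(2) iso_arr_Hom[OF \<theta>]]])
    then have "\<theta> \<odot> b = \<theta> \<odot> 0" using cmp_zero_right[OF O O(2) iso_arr_Hom[OF \<theta>i]] by simp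
    then have "b = 0" by (rule iso_cancel_left[OF O O(2) \<theta>i bH zero_in[OF O]])
    then show ?thesis using ab(3) H0[OF ab(1)] by simp
  qed
  then show ?thesis using zero_in[OF O] by (auto simp: FX FY)
qed

text \<open>The endomorphisms in D are combinations of the identity and one isomorphism
  \<open>\<psi>\<close> onto the twist, so there is room for at most two orthogonal idempotents. A
  single summand is excluded by \<open>twist_trivial\<close>: a brick of D is not isomorphic to its
  twist by the sign.\<close>

lemma card_summands:
  assumes X: "brick C X" and iso: "isomorphic E (fob F X) (twist \<zeta> (fob F X))"
    and bp: "biproduct D I Y (forget X) inc prj" and br: "\<And>i. i \<in> I \<Longrightarrow> brick D (Y i)"
  shows "card I = 2"
proof -
  note XO = C.brick_Ob[OF X]
  obtain X0 \<mu> where F: "fob F X = (X0, \<mu>)" by fastforce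
  note O = forget_Ob[OF XO, unfolded F fst_conv]
  note d = biproductD[OF bp, unfolded F fst_conv]
  have s: "structure_map X0 \<mu>" using E_object_F[OF XO] by (simp add: F)
  let ?\<mu> = "\<lambda>g\<in>carrier G. scl D (\<zeta> g) (\<mu> g)"
  have nz: "idn D (Y i) \<noteq> 0" if "i \<in> I" for i using br[OF that] by (simp add: brick_def)
  obtain \<psi> where "iso_arr E (X0, \<mu>) (X0, ?\<mu>) \<psi>" using iso by (auto simp: isomorphic_def F twist_def)
  then obtain \<psi>' where \<psi>: "\<psi> \<in> Hom E (X0, \<mu>) (X0, ?\<mu>)" "\<psi>' \<in> Hom E (X0, ?\<mu>) (X0, \<mu>)" "\<psi> \<odot> \<psi>' = idn D X0"
    by (auto simp: iso_arr_def cmp_E idn_E)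
  have \<psi>H: "\<psi> \<in> Hom D X0 X0" "\<psi>' \<in> Hom D X0 X0" using \<psi> by (auto simp: Hom_E)
  define e where "e i = inc i \<odot> prj i" for i
  have eH: "e i \<in> Hom D X0 X0" if "i \<in> I" for i
    unfolding e_def by (rule cmp_in[OF O d(3)[OF that] O d(5)[OF that] d(4)[OF that]])
  have "\<exists>\<alpha> \<beta>. e i = scl D \<alpha> (idn D X0) + scl D \<beta> \<psi>" if i: "i \<in> I" for i
  proof -
    obtain \<alpha> b where b: "e i = scl D \<alpha> (idn D X0) + b" "b \<in> Hom E (X0, \<mu>) (X0, ?\<mu>)"
      using self_split[OF X, unfolded F fst_conv, OF eH[OF i]] by (auto simp: twist_def)
    have bH: "b \<in> Hom D X0 X0" using b(2) by (simp add: Hom_E)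
    have "\<psi>' \<odot> b \<in> Hom E (X0, \<mu>) (X0, \<mu>)" by (rule cmp_in_E[OF s structure_map_twist[OF s] s b(2) \<psi>(2)])
    then obtain \<beta> where \<beta>: "\<psi>' \<odot> b = scl D \<beta> (idn D X0)" using E_brick_Hom[OF X] by (auto simp: F)
    have "b = \<psi> \<odot> (\<psi>' \<odot> b)" using cmp_assoc[OF O O O O bH \<psi>H(2,1)] \<psi>(3) idn_left[OF O O bH] by simp
    also have "\<dots> = scl D \<beta> \<psi>" unfolding \<beta> using cmp_scl_right[OF O O O idn_in[OF O] \<psi>H(1)] idn_right[OF O O \<psi>H(1)] by simp
    finally show ?thesis using b(1) by blast
  qed
  then obtain \<alpha> \<beta> where \<alpha>\<beta>: "\<And>i. i \<in> I \<Longrightarrow> e i = scl D (\<alpha> i) (idn D X0) + scl D (\<beta> i) \<psi>" by metis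
  \<comment> \<open>The diagonal block of f at the summand l; on the idempotents \<open>e i\<close>
    it is the identity or 0.\<close>
  define t where "t l f = prj l \<odot> (f \<odot> inc l)" for l f
  have t_scl: "t l (scl D c f) = scl D c (t l f)" and t_diff: "t l (f - h) = t l f - t l h"
    if l: "l \<in> I" and f: "f \<in> Hom D X0 X0" and h: "h \<in> Hom D X0 X0" for l c f h
  proof -
    note YO = d(3)[OF l] and i = d(4)[OF l] and p = d(5)[OF l]
    note fi = cmp_in[OF YO O O i f] cmp_in[OF YO O O i h]
    show "t l (scl D c f) = scl D c (t l f)"
      unfolding t_def using cmp_scl_left[OF YO O O i f] cmp_scl_right[OF YO O YO fi(1) p] by simp
    show "t l (f - h) = t l f - t l h"
      unfolding t_def using cmp_diff_left[OF YO O O i f h] cmp_diff_right[OF YO O YO fi p] by simp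
  qed
  have t_idn: "t l (idn D X0) = idn D (Y l)" if l: "l \<in> I" for l
    unfolding t_def using idn_left[OF d(3)[OF l] O d(4)[OF l]] d(6)[OF l l] by simp
  have t_e: "t l (e i) = (if i = l then idn D (Y l) else 0)" if l: "l \<in> I" and i: "i \<in> I" for l i
  proof -
    note YO = d(3)[OF l] d(3)[OF i]
    have "e i \<odot> inc l = inc i \<odot> (prj i \<odot> inc l)"
      unfolding e_def by (rule cmp_assoc[OF YO(1) O YO(2) O d(4)[OF l] d(5)[OF i] d(4)[OF i], symmetric])
    also have "\<dots> = (if i = l then inc l else 0)"
      using d(6)[OF l i] idn_right[OF YO(1) O d(4)[OF l]] cmp_zero_right[OF YO O d(4)[OF i]] by auto
    finally show ?thesis
      unfolding t_def using d(6)[OF l l] cmp_zero_right[OF YO(1) O YO(1) d(5)[OF l]] by simp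
  qed
  have idH: "scl D c (idn D X0) \<in> Hom D X0 X0" for c by (rule scl_in[OF O O idn_in[OF O]])
  \<comment> \<open>Eliminating \<open>\<psi>\<close> from two idempotents leaves a scalar. Its
    block at a third summand is 0, so the scalar is 0, and the block at i gives
    \<open>\<beta> j = 0\<close>. Then \<open>e j\<close> is itself a scalar, which cannot be 0 at l
    and the identity at j.\<close>
  have distinct: False if ijl: "i \<in> I" "j \<in> I" "l \<in> I" and ne: "i \<noteq> j" "i \<noteq> l" "j \<noteq> l" for i j l
  proof -
    note sH = scl_in[OF O O eH[OF ijl(1)]] scl_in[OF O O eH[OF ijl(2)]]
    have "scl D (\<beta> j) (e i) - scl D (\<beta> i) (e j) = scl D (\<beta> j * \<alpha> i - \<beta> i * \<alpha> j) (idn D X0)" (is "?L = ?R")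
      unfolding \<alpha>\<beta>[OF ijl(1)] \<alpha>\<beta>[OF ijl(2)]
      by (simp add: scale_right_distrib scale_left_diff_distrib mult.commute)
    then have L: "t m ?L = scl D (\<beta> j * \<alpha> i - \<beta> i * \<alpha> j) (idn D (Y m))" if "m \<in> I" for m
      using t_scl[OF that idn_in[OF O] idn_in[OF O]] t_idn[OF that] by simp
    have L': "t m ?L = scl D (\<beta> j) (t m (e i)) - scl D (\<beta> i) (t m (e j))" if m: "m \<in> I" for m
      unfolding t_diff[OF m sH] using t_scl[OF m eH[OF ijl(1)] eH[OF ijl(1)]] t_scl[OF m eH[OF ijl(2)] eH[OF ijl(2)]] by simp
    have "\<beta> j * \<alpha> i - \<beta> i * \<alpha> j = 0" using L[OF ijl(3)] L'[OF ijl(3)] t_e ijl ne nz[OF ijl(3)] by simp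
    then have "scl D (\<beta> j) (idn D (Y i)) = 0" using L[OF ijl(1)] L'[OF ijl(1)] t_e ijl ne by simp
    then have "\<beta> j = 0" using nz[OF ijl(1)] by simp
    then have ej: "e j = scl D (\<alpha> j) (idn D X0)" using \<alpha>\<beta>[OF ijl(2)] by simp
    then have tj: "t m (e j) = scl D (\<alpha> j) (idn D (Y m))" if "m \<in> I" for m
      using t_scl[OF that idn_in[OF O] idn_in[OF O]] t_idn[OF that] by simp
    have "\<alpha> j = 0" using tj[OF ijl(3)] t_e[OF ijl(3,2)] ne nz[OF ijl(3)] by simp
    then show False using tj[OF ijl(2)] t_e[OF ijl(2,2)] nz[OF ijl(2)] by simp
  qed
  have "card I \<noteq> 0"
  proof
    assume "card I = 0"
    then have "I = {}" using d(1) by simp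
    then show False using d(7) idn_forget_nonzero[OF X] by (simp add: F)
  qed
  moreover have "card I \<noteq> 1"
  proof
    assume "card I = 1"
    then obtain i where i: "I = {i}" by (auto simp: card_1_singleton_iff)
    have "iso_arr D (Y i) X0 (inc i)"
      by (rule iso_arrI[of _ _ _ _ "prj i"]) (use d(4,5,6,7) i in auto)
    then have "brick D X0" by (intro brick_iso[OF br _ isomorphicI]) (use i O in auto)
    then have "\<zeta> g = 1" using twist_trivial[OF XO _ iso g_in] by (simp add: F)
    then have "(1::'k) + 1 = 0" using sign by (metis add.right_inverse add.commute)
    then show False using two by (simp add: one_add_one)
  qed
  moreover have "\<not> card I \<ge> 3"
  proof
    assume "card I \<ge> 3"
    then obtain T where "T \<subseteq> I" "card T = 3" by (rule obtain_subset_with_card_n)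
    then show False using distinct by (auto simp: card_3_iff)
  qed
  ultimately show ?thesis by linarith
qed

text \<open>There are two summands, and \<open>summand_conjugate\<close> applied in both directions
  shows that g exchanges their classes; in particular it acts on them as an involution.\<close>

lemma forget_pair:
  assumes X: "brick C X" and iso: "isomorphic E (fob F X) (twist \<zeta> (fob F X))"
  shows "\<exists>Y\<in>Ob D. isomorphic D (fob (\<rho> g) (fob (\<rho> g) Y)) Y \<and> decomp D (forget X) {#iso_class D Y, iso_class D (fob (\<rho> g) Y)#}"
proof -
  have O: "forget X \<in> Ob D" by (rule forget_Ob[OF C.brick_Ob[OF X]])
  obtain M where M: "decomp D (forget X) M" using decomposable[OF O] by blast
  obtain k Y where ds: "direct_sum D {..<k} Y (forget X)" and b: "\<And>i. i < k \<Longrightarrow> brick D (Y i)"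
    and e: "M = image_mset (\<lambda>i. iso_class D (Y i)) (mset_set {..<k::nat})"
    using M unfolding decomp_def by blast
  obtain inc prj where bp: "biproduct D {..<k} Y (forget X) inc prj" using ds unfolding direct_sum_biproduct by blast
  have k: "k = 2" using card_summands[OF X iso bp] b by simp
  have sw: "isomorphic D (fob (\<rho> g) (Y 0)) (Y 1)" "isomorphic D (fob (\<rho> g) (Y 1)) (Y 0)"
    using summand_conjugate[OF X bp, of 0 1] summand_conjugate[OF X bp, of 1 0] b k by auto
  have YO: "Y 0 \<in> Ob D" "Y 1 \<in> Ob D" using b k brick_Ob by auto
  have RO: "fob (\<rho> g) (Y 0) \<in> Ob D" "fob (\<rho> g) (Y 1) \<in> Ob D" "fob (\<rho> g) (fob (\<rho> g) (Y 0)) \<in> Ob D" using act_Ob[OF g_in] YO by auto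
  have "isomorphic D (fob (\<rho> g) (fob (\<rho> g) (Y 0))) (Y 0)"
    by (rule isomorphic_trans[OF RO(3,2) YO(1) functor_isomorphic[OF action_functor[OF g_in] RO(1) YO(2) sw(1)] sw(2)])
  moreover have "iso_class D (Y 1) = iso_class D (fob (\<rho> g) (Y 0))" using iso_class_eq[OF RO(1) YO(2)] sw(1) by simp
  moreover have "M = {#iso_class D (Y 0), iso_class D (Y 1)#}"
    by (simp add: e k numeral_2_eq_2 lessThan_Suc add_mset_commute)
  ultimately show ?thesis using M YO(1) by auto
qed

end

section \<open>The twisted homomorphism into the invertible objects of D\<close>

context order_two_equivariantization
begin

lemma bismash_unit_group_not_solvable:
  assumes B: "bismash_fusion n C V W" and n5: "n \<ge> 5"
    and \<chi>: "\<chi> \<in> Ob C" "isomorphic E (fob F \<chi>) (twist \<zeta> (fob F (unit_ob C)))" and \<chi>W: "isomorphic C \<chi> (W id)"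
  shows "\<not> solvable (unit_group D)"
proof -
  interpret B: bismash_fusion n C V W by (rule B)
  interpret act: tensor_map D D "Ob D" "fob (\<rho> g)"
    by unfold_locales
      (use tob_in unit_in act_Ob[OF g_in] functor_isomorphic[OF action_functor[OF g_in]] isomorphicI[OF act_ten[OF g_in]]
        isomorphicI[OF is_tensor_functor.funi_iso[OF action_functor[OF g_in]]] in auto)
  let ?A = "carrier (alt_group n)" and ?I = "iso_monoid D"
  \<comment> \<open>The action of g on classes of objects of D, which becomes the involution of the
    twisted homomorphism.\<close>
  define \<sigma> where "\<sigma> = act.class_map"
  have \<sigma>_class: "\<sigma> (iso_class D X) = iso_class D (fob (\<rho> g) X)" if "X \<in> Ob D" for X
    unfolding \<sigma>_def by (rule act.class_map_iso_class[OF that])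
  note tob = twist_object_tob[OF \<chi>]
  note tO = E_object_twist[OF E_object_F]
  have Wid: "W id \<in> Ob C" by (rule B.W_Ob[OF B.A_id flip_id])
  have V\<chi>: "isomorphic C (V s \<boxtimes>\<^bsub>C\<^esub> \<chi>) (V s \<boxtimes>\<^bsub>C\<^esub> W id)" "V s \<boxtimes>\<^bsub>C\<^esub> \<chi> \<in> Ob C" "V s \<boxtimes>\<^bsub>C\<^esub> W id \<in> Ob C" if "s \<in> ?A" for s
    using C.isomorphic_tob[OF B.V_Ob[OF that] B.V_Ob[OF that] \<chi>(1) Wid C.isomorphic_refl[OF B.V_Ob[OF that]] \<chi>W]
      C.tob_in B.V_Ob[OF that] \<chi>(1) Wid by auto
  \<comment> \<open>A moved \<open>V s\<close> absorbs \<open>W id\<close>, and tensoring with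
    \<open>W id\<close> is twisting by the sign; so \<open>V s\<close> is isomorphic to its own
    twist.\<close>
  have moved: "isomorphic E (fob F (V s)) (twist \<zeta> (fob F (V s)))" if s: "s \<in> ?A" "flip s \<noteq> s" for s
  proof -
    note O = B.V_Ob[OF s(1)]
    have "isomorphic C (V s \<boxtimes>\<^bsub>C\<^esub> W id) (V s)" using B.V_moved_tob_W[OF B.A_id flip_id s] by simp
    from C.isomorphic_trans[OF V\<chi>(2,3)[OF s(1)] O V\<chi>(1)[OF s(1)] this]
    have "isomorphic E (fob F (V s)) (fob F (V s \<boxtimes>\<^bsub>C\<^esub> \<chi>))"
      by (rule isomorphic_E_sym[OF C.functor_isomorphic[OF F_functor V\<chi>(2)[OF s(1)] O]])
    then show ?thesis by (intro E_trans[OF E_object_F[OF O] E_object_F[OF V\<chi>(2)[OF s(1)]] tO[OF O] _ tob(1)[OF O]])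
  qed
  \<comment> \<open>\<open>W h\<close> is the twist of \<open>V h\<close>, and a twist leaves the
    underlying object of D unchanged.\<close>
  have VW: "isomorphic D (forget (V h)) (forget (W h))" if h: "h \<in> ?A" "flip h = h" for h
  proof -
    note O = B.V_Ob[OF h(1)] B.W_Ob[OF h]
    have "isomorphic C (V h \<boxtimes>\<^bsub>C\<^esub> W id) (W h)" using B.V_fixed_tob_W[OF B.A_id flip_id h] by simp
    from C.isomorphic_trans[OF V\<chi>(2,3)[OF h(1)] O(2) V\<chi>(1)[OF h(1)] this]
    have "isomorphic E (fob F (W h)) (fob F (V h \<boxtimes>\<^bsub>C\<^esub> \<chi>))"
      by (rule isomorphic_E_sym[OF C.functor_isomorphic[OF F_functor V\<chi>(2)[OF h(1)] O(2)]])
    then have "isomorphic E (fob F (W h)) (twist \<zeta> (fob F (V h)))"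
      by (intro E_trans[OF E_object_F[OF O(2)] E_object_F[OF V\<chi>(2)[OF h(1)]] tO[OF O(1)] _ tob(1)[OF O(1)]])
    from isomorphic_sym[OF isomorphic_E_D[OF this]] show ?thesis by (simp add: twist_def)
  qed
  \<comment> \<open>\<open>V h\<close> is invertible in C, so its image in D is invertible and
    therefore simple.\<close>
  have fixed_brick: "brick D (forget (V h))" if h: "h \<in> ?A" "flip h = h" for h
  proof -
    note hi = B.A_inv[OF h(1)] and O = B.V_Ob[OF h(1)]
    note Oi = B.V_Ob[OF hi(1)] and VO = B.V_Ob[OF B.A_id]
    have T: "V h \<boxtimes>\<^bsub>C\<^esub> V (inv' h) \<in> Ob C" by (rule C.tob_in[OF O Oi])
    have "isomorphic C (V h \<boxtimes>\<^bsub>C\<^esub> V (inv' h)) (V id)" using B.V_fixed_tob_V[OF h hi(1)] hi(3) by simp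
    then have 1: "isomorphic C (V h \<boxtimes>\<^bsub>C\<^esub> V (inv' h)) (unit_ob C)" by (rule C.isomorphic_trans[OF T VO C.unit_in _ B.V_id])
    have "isomorphic D (forget (V h) \<boxtimes> forget (V (inv' h))) (unit_ob D)"
      by (rule isomorphic_trans[OF _ _ _ forget_tob[OF O Oi] isomorphic_trans[OF _ _ _ forget_iso[OF T C.unit_in 1] isomorphic_sym[OF forget_unit]]])
        (use forget_Ob O Oi T C.unit_in tob_in unit_in in auto)
    then show ?thesis by (rule brick_invertible[OF forget_Ob[OF O] forget_Ob[OF Oi]])
  qed
  \<comment> \<open>With y a chosen summand of \<open>V s\<close> in D, this is the full
    decomposition that y determines.\<close>
  define m where "m s y = (if flip s = s then {#y#} else {#y, \<sigma> y#})" for s :: "nat \<Rightarrow> nat" and y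
  define R where "R s y \<longleftrightarrow> decomp D (forget (V s)) (m s y) \<and> \<sigma> (\<sigma> y) = y \<and> (flip s = s \<longrightarrow> \<sigma> y = y) \<and> y \<in> carrier ?I" for s y
  have "\<exists>y. R s y" if s: "s \<in> ?A" for s
  proof (cases "flip s = s")
    case True
    note O = forget_Ob[OF B.V_Ob[OF s]]
    have "iso_class D (fob (\<rho> g) (forget (V s))) = iso_class D (forget (V s))"
      using structure_iso(1,2)[OF B.V_Ob[OF s] g_in] O isomorphicI by (metis iso_class_eq)
    then have "\<sigma> (iso_class D (forget (V s))) = iso_class D (forget (V s))" using \<sigma>_class[OF O] by simp
    then have "R s (iso_class D (forget (V s)))"
      using True decomp_brick[OF fixed_brick[OF s True]] iso_monoid_carrier[OF O] by (simp add: R_def m_def)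
    then show ?thesis by blast
  next
    case False
    obtain Y where Y: "Y \<in> Ob D" "isomorphic D (fob (\<rho> g) (fob (\<rho> g) Y)) Y"
      "decomp D (forget (V s)) {#iso_class D Y, iso_class D (fob (\<rho> g) Y)#}"
      using forget_pair[OF B.V_brick[OF s] moved[OF s False]] by blast
    have RO: "fob (\<rho> g) Y \<in> Ob D" "fob (\<rho> g) (fob (\<rho> g) Y) \<in> Ob D" using act_Ob[OF g_in] Y by auto
    have "R s (iso_class D Y)"
      using Y(3) False \<sigma>_class[OF Y(1)] \<sigma>_class[OF RO(1)] iso_class_eq[OF RO(2) Y(1)] Y(2) iso_monoid_carrier[OF Y(1)]
      by (simp add: R_def m_def)
    then show ?thesis by blast
  qed
  then obtain q where q: "\<And>s. s \<in> ?A \<Longrightarrow> R s (q s)" by metis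
  define M where "M s = m s (q s)" for s
  define N where "N t = {#q t, \<sigma> (q t)#}" for t
  have qM: "decomp D (forget (V s)) (M s)" and \<sigma>\<sigma>: "\<sigma> (\<sigma> (q s)) = q s" and \<sigma>fix: "flip s = s \<Longrightarrow> \<sigma> (q s) = q s"
    and qcar: "q s \<in> carrier ?I" if "s \<in> ?A" for s
    using q[OF that] by (auto simp: R_def M_def)
  have setM: "set_mset (M s) = {q s, \<sigma> (q s)}" if "s \<in> ?A" for s using \<sigma>fix[OF that] by (auto simp: M_def m_def)
  have \<sigma>_hom: "\<sigma> x \<in> carrier ?I" "\<sigma> (x \<otimes>\<^bsub>?I\<^esub> y) = \<sigma> x \<otimes>\<^bsub>?I\<^esub> \<sigma> y" if xy: "x \<in> carrier ?I" "y \<in> carrier ?I" for x y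
  proof -
    obtain X Y where XY: "X \<in> Ob D" "x = iso_class D X" "Y \<in> Ob D" "y = iso_class D Y"
      using xy by (metis iso_monoid_carrierE)
    show "\<sigma> x \<in> carrier ?I" using XY \<sigma>_class act_Ob[OF g_in] iso_monoid_carrier by simp
    show "\<sigma> (x \<otimes>\<^bsub>?I\<^esub> y) = \<sigma> x \<otimes>\<^bsub>?I\<^esub> \<sigma> y"
      unfolding XY(2,4) \<sigma>_def by (rule act.class_map_mult[OF XY(1,3)])
  qed
  have WM: "decomp D (forget (W h)) (M h)" if h: "h \<in> ?A" "flip h = h" for h
    by (rule decomp_iso[OF qM[OF h(1)] forget_Ob[OF B.W_Ob[OF h]] VW[OF h]])
  \<comment> \<open>Provides the length bound for \<open>decomp_tob\<close>. If s or u is fixed, the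
    product is a single \<open>V\<close> whose length is the product of the lengths; otherwise there
    are four simple objects against two times two.\<close>
  have prod: "\<exists>L. decomp D (forget (V s) \<boxtimes> forget (V u)) L \<and> size L \<le> size (M s) * size (M u) \<and>
      {q (s \<circ> u), \<sigma> (q (s \<circ> u))} \<subseteq> set_mset L \<and>
      set_mset L \<subseteq> {q (s \<circ> u), \<sigma> (q (s \<circ> u)), q (s \<circ> flip u), \<sigma> (q (s \<circ> flip u))}"
    if s: "s \<in> ?A" and u: "u \<in> ?A" for s u
  proof -
    note O = B.V_Ob[OF s] B.V_Ob[OF u]
    note su = B.A_comp[OF s u] and sfu = B.A_comp[OF s B.A_flip[OF u]]
    have T: "V s \<boxtimes>\<^bsub>C\<^esub> V u \<in> Ob C" by (rule C.tob_in[OF O])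
    have FT: "forget (V s) \<boxtimes> forget (V u) \<in> Ob D" by (rule tob_in[OF forget_Ob[OF O(1)] forget_Ob[OF O(2)]])
    note tob_decomp = decomp_iso[OF _ FT isomorphic_sym[OF forget_tob[OF O]]]
    show ?thesis
    proof (cases "flip s = s \<or> flip u = u")
      case True
      then have i: "isomorphic C (V (s \<circ> u)) (V s \<boxtimes>\<^bsub>C\<^esub> V u)" and sz: "size (M (s \<circ> u)) = size (M s) * size (M u)"
        using B.V_fixed_tob_V[OF s _ u] B.V_tob_V_fixed[OF u _ s] B.flip_comp_fixed(1)[OF s _ u] B.flip_comp_fixed(2)[OF u _ s]
        by (auto simp: M_def m_def intro: C.isomorphic_sym)
      have "decomp D (forget (V s) \<boxtimes> forget (V u)) (M (s \<circ> u))"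
        by (rule tob_decomp[OF decomp_iso[OF qM[OF su] forget_Ob[OF T] forget_iso[OF B.V_Ob[OF su] T i]]])
      then show ?thesis using sz setM[OF su] by (intro exI[of _ "M (s \<circ> u)"]) auto
    next
      case False
      have K: "forget_class (iso_class C (V t)) = M t" if "t \<in> ?A" for t
        by (rule forget_class_eq[OF B.V_Ob[OF that] qM[OF that]])
      have K': "forget_class (iso_class C (W t)) = M t" if "t \<in> ?A" "flip t = t" for t
        by (rule forget_class_eq[OF B.W_Ob[OF that] WM[OF that]])
      \<comment> \<open>For fixed t both \<open>V t\<close> and \<open>W t\<close> contribute
        \<open>q t\<close>, which \<open>\<sigma>\<close> fixes; so fixed and moved elements lead to
        the same multiset \<open>N t\<close>.\<close>
      have N: "(\<Sum>x\<in>#(if flip t = t then {#iso_class C (V t), iso_class C (W t)#} else {#iso_class C (V t)#}). forget_class x) = N t"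
        if "t \<in> ?A" for t
        using K[OF that] K'[OF that] \<sigma>fix[OF that] by (simp add: M_def m_def N_def)
      have "decomp D (forget (V s) \<boxtimes> forget (V u)) (N (s \<circ> u) + N (s \<circ> flip u))"
        using tob_decomp[OF forget_decomp[OF B.V_moved_tob_V_moved[OF s _ u]]] False
        unfolding image_mset_union sum_mset.union N[OF su] N[OF sfu] by simp
      moreover have "size (N (s \<circ> u) + N (s \<circ> flip u)) \<le> size (M s) * size (M u)" using False by (simp add: N_def M_def m_def)
      ultimately show ?thesis by (intro exI[of _ "N (s \<circ> u) + N (s \<circ> flip u)"]) (auto simp: N_def)
    qed
  qed
  have q_prod: "x \<otimes>\<^bsub>?I\<^esub> y \<in> {q (s \<circ> u), \<sigma> (q (s \<circ> u)), q (s \<circ> flip u), \<sigma> (q (s \<circ> flip u))}"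
    and q_comp: "r \<in> {q (s \<circ> u), \<sigma> (q (s \<circ> u))} \<Longrightarrow> \<exists>x\<in>{q s, \<sigma> (q s)}. \<exists>y\<in>{q u, \<sigma> (q u)}. r = x \<otimes>\<^bsub>?I\<^esub> y"
    if s: "s \<in> ?A" and u: "u \<in> ?A" and x: "x \<in> {q s, \<sigma> (q s)}" and y: "y \<in> {q u, \<sigma> (q u)}" for s u x y r
  proof -
    obtain L where L: "decomp D (forget (V s) \<boxtimes> forget (V u)) L" "size L \<le> size (M s) * size (M u)"
      "{q (s \<circ> u), \<sigma> (q (s \<circ> u))} \<subseteq> set_mset L"
      "set_mset L \<subseteq> {q (s \<circ> u), \<sigma> (q (s \<circ> u)), q (s \<circ> flip u), \<sigma> (q (s \<circ> flip u))}"
      using prod[OF s u] by blast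
    note D = decomp_tob[OF qM[OF s] qM[OF u] L(1,2)]
    show "x \<otimes>\<^bsub>?I\<^esub> y \<in> {q (s \<circ> u), \<sigma> (q (s \<circ> u)), q (s \<circ> flip u), \<sigma> (q (s \<circ> flip u))}"
      by (rule subsetD[OF L(4) D(1)]) (use x y setM[OF s] setM[OF u] in simp_all)
    show "\<exists>x\<in>{q s, \<sigma> (q s)}. \<exists>y\<in>{q u, \<sigma> (q u)}. r = x \<otimes>\<^bsub>?I\<^esub> y" if r: "r \<in> {q (s \<circ> u), \<sigma> (q (s \<circ> u))}"
    proof -
      obtain x y where "x \<in># M s" "y \<in># M u" "r = x \<otimes>\<^bsub>?I\<^esub> y" using D(2)[OF subsetD[OF L(3) r]] by blast
      then show ?thesis unfolding setM[OF s] setM[OF u] by blast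
    qed
  qed
  have q_id: "q id = \<one>\<^bsub>?I\<^esub>"
  proof -
    have "isomorphic D (unit_ob D) (forget (V id))"
      by (rule isomorphic_trans[OF _ _ _ forget_unit forget_iso[OF C.unit_in B.V_Ob[OF B.A_id] C.isomorphic_sym[OF B.V_id]]])
        (use forget_Ob B.V_Ob[OF B.A_id] C.unit_in unit_in in auto)
    from decomp_iso[OF decomp_brick[OF brick_unit] forget_Ob[OF B.V_Ob[OF B.A_id]] this]
    have "{#iso_class D (unit_ob D)#} = M id" by (rule decomp_unique[OF _ qM[OF B.A_id]])
    then show ?thesis by (simp add: M_def m_def iso_monoid_one)
  qed
  have \<sigma>one: "\<sigma> \<one>\<^bsub>?I\<^esub> = \<one>\<^bsub>?I\<^esub>" using \<sigma>fix[OF B.A_id] by (simp add: q_id)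
  have q_flip: "q (flip s) \<in> {q s, \<sigma> (q s)}" if s: "s \<in> ?A" for s
  proof -
    have "isomorphic C (V s) (V (flip s))" using B.V_iso[OF s B.A_flip[OF s]] by simp
    from decomp_iso[OF qM[OF s] _ forget_iso[OF _ _ this]]
    have "decomp D (forget (V (flip s))) (M s)" using forget_Ob B.V_Ob s B.A_flip by blast
    from decomp_unique[OF this qM[OF B.A_flip[OF s]]] show ?thesis using setM[OF s] setM[OF B.A_flip[OF s]] by auto
  qed
  \<comment> \<open>The values at s and at its inverse multiply to the unit after possibly replacing
    some by their images under \<open>\<sigma>\<close>. Where necessary \<open>\<sigma>\<close> is
    applied to the whole equation, which gives \<open>q s\<close> a left and a right
    inverse.\<close>
  have q_unit: "q s \<in> Units ?I" if s: "s \<in> ?A" for s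
  proof -
    interpret I: monoid ?I by (rule monoid_iso_monoid)
    note si = B.A_inv[OF s]
    have car: "z \<in> carrier ?I" if "t \<in> ?A" "z \<in> {q t, \<sigma> (q t)}" for t z
      using that qcar[OF that(1)] \<sigma>_hom(1)[OF qcar[OF that(1)] qcar[OF that(1)]] by auto
    obtain a b where a: "a \<in> {q (inv' s), \<sigma> (q (inv' s))}" "b \<in> {q s, \<sigma> (q s)}" "\<one>\<^bsub>?I\<^esub> = a \<otimes>\<^bsub>?I\<^esub> b"
      using q_comp[OF si(1) s insertI1 insertI1, of "\<one>\<^bsub>?I\<^esub>"] si(2) by (auto simp: q_id)
    obtain c d where c: "c \<in> {q s, \<sigma> (q s)}" "d \<in> {q (inv' s), \<sigma> (q (inv' s))}" "\<one>\<^bsub>?I\<^esub> = c \<otimes>\<^bsub>?I\<^esub> d"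
      using q_comp[OF s si(1) insertI1 insertI1, of "\<one>\<^bsub>?I\<^esub>"] si(3) by (auto simp: q_id)
    have abcd: "a \<in> carrier ?I" "b \<in> carrier ?I" "c \<in> carrier ?I" "d \<in> carrier ?I"
      using car[OF si(1)] car[OF s] a c by auto
    have "\<exists>l\<in>carrier ?I. l \<otimes>\<^bsub>?I\<^esub> q s = \<one>\<^bsub>?I\<^esub>"
      using a(2,3) \<sigma>_hom[OF abcd(1,2)] \<sigma>one \<sigma>\<sigma>[OF s] abcd by (metis insertE singletonD)
    moreover have "\<exists>r\<in>carrier ?I. q s \<otimes>\<^bsub>?I\<^esub> r = \<one>\<^bsub>?I\<^esub>"
      using c(1,3) \<sigma>_hom[OF abcd(3,4)] \<sigma>_hom(1)[OF abcd(4,4)] \<sigma>one \<sigma>\<sigma>[OF s] abcd by (metis insertE singletonD)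
    ultimately show ?thesis using qcar[OF s] I.inv_unique unfolding Units_def by (metis (mono_tags, lifting) mem_Collect_eq)
  qed
  interpret U: group "unit_group D" by (rule unit_group_is_group)
  have "group_hom ((unit_group D)\<lparr>carrier := carrier (unit_group D)\<rparr>) (unit_group D) \<sigma>"
    unfolding \<sigma>_def by (rule act.class_map_hom[OF U.subgroup_self]) (auto elim: unit_group_classE)
  then interpret \<sigma>: group_hom "unit_group D" "unit_group D" \<sigma> by simp
  \<comment> \<open>If \<open>q\<close> were constant, the image of \<open>V id\<close> would be a
    summand of a moved \<open>V s\<close> in D, whereas \<open>Hom_forget_zero\<close> excludes
    arrows between their images.\<close>
  have nontriv: "\<exists>s\<in>?A. q s \<noteq> \<one>\<^bsub>?I\<^esub>"
  proof (rule ccontr)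
    assume n: "\<not> (\<exists>s\<in>?A. q s \<noteq> \<one>\<^bsub>?I\<^esub>)"
    obtain s where s: "s \<in> ?A" "flip s \<noteq> s" using B.moved_exists[OF n5] by blast
    note O = B.V_Ob[OF s(1)] and Oid = B.V_Ob[OF B.A_id]
    have b: "brick D (forget (V id))" by (rule fixed_brick[OF B.A_id flip_id])
    have "decomp D (forget (V id)) {#\<one>\<^bsub>?I\<^esub>#}" using qM[OF B.A_id] q_id by (simp add: M_def m_def)
    then have "iso_class D (forget (V id)) = \<one>\<^bsub>?I\<^esub>" using decomp_unique[OF decomp_brick[OF b]] by fastforce
    moreover have "\<one>\<^bsub>?I\<^esub> \<in># M s" using n s(1) setM[OF s(1)] by auto
    ultimately have "Hom D (forget (V id)) (forget (V s)) \<noteq> {0}" using Hom_nonzero_iff[OF qM[OF s(1)] b] by simp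
    moreover have "Hom C (V id) (V s) = {0}"
      using C.schur_dichotomy[OF B.V_brick[OF B.A_id] B.V_brick[OF s(1)]] B.V_iso[OF B.A_id s(1)] s(2) by auto
    ultimately show False using Hom_forget_zero[OF Oid O _ moved[OF s]] by simp
  qed
  show ?thesis
  proof (rule B.twisted_hom_not_solvable[OF n5 unit_group_is_group \<sigma>.homh, of q])
    show "q s \<in> carrier (unit_group D)" if "s \<in> ?A" for s using q_unit[OF that] by (simp add: units_of_carrier)
    show "\<exists>x\<in>{q s, \<sigma> (q s)}. \<exists>y\<in>{q u, \<sigma> (q u)}. q (s \<circ> u) = x \<otimes>\<^bsub>unit_group D\<^esub> y" if "s \<in> ?A" "u \<in> ?A" for s u
      using q_comp[OF that insertI1 insertI1, of "q (s \<circ> u)"] unfolding units_of_mult by blast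
    show "x \<otimes>\<^bsub>unit_group D\<^esub> y \<in> {q (s \<circ> u), \<sigma> (q (s \<circ> u)), q (s \<circ> flip u), \<sigma> (q (s \<circ> flip u))}"
      if "s \<in> ?A" "u \<in> ?A" "x \<in> {q s, \<sigma> (q s)}" "y \<in> {q u, \<sigma> (q u)}" for s u x y
      unfolding units_of_mult by (rule q_prod[OF that])
  qed (use \<sigma>\<sigma> q_flip \<sigma>fix q_id nontriv in \<open>auto simp: units_of_one\<close>)
qed

end

lemma (in fusion_equivariantization) bismash_unit_group_not_solvable:
  assumes B: "bismash_fusion n C V W" and n5: "n \<ge> 5" and p: "prime (order G)" and two: "(2::'k) \<noteq> 0"
    and \<zeta>: "\<And>x y. x \<in> carrier G \<Longrightarrow> y \<in> carrier G \<Longrightarrow> \<zeta> (x \<otimes>\<^bsub>G\<^esub> y) = \<zeta> x * \<zeta> y" "\<zeta> \<one>\<^bsub>G\<^esub> = (1::'k)"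
    and g: "g \<in> carrier G" "\<zeta> g \<noteq> 1"
  shows "\<not> solvable (unit_group D)"
proof -
  interpret B: bismash_fusion n C V W by (rule B)
  obtain \<chi> where \<chi>: "\<chi> \<in> Ob C" "isomorphic E (fob F \<chi>) (twist \<zeta> (fob F (unit_ob C)))"
    using twist_object_exists[of \<zeta>] \<zeta> by blast
  note tob = twist_object_tob[OF \<chi>]
  note UO = C.unit_in
  note tO = E_object_twist[OF E_object_F]
  have bu: "brick D (forget (unit_ob C))" by (rule brick_iso[OF brick_unit forget_Ob[OF UO] forget_unit])
  have br: "brick C X" if X: "X \<in> Ob C" and i: "isomorphic D (forget X) (forget (unit_ob C))" for X
    by (rule brick_of_brick_forget[OF X brick_iso[OF bu forget_Ob[OF X] isomorphic_sym[OF i]]])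
  have f\<chi>: "isomorphic D (forget \<chi>) (forget (unit_ob C))" using isomorphic_E_D[OF \<chi>(2)] by (simp add: twist_def)
  have b\<chi>: "brick C \<chi>" by (rule br[OF \<chi>(1) f\<chi>])
  have \<chi>\<chi>O: "\<chi> \<boxtimes>\<^bsub>C\<^esub> \<chi> \<in> Ob C" by (rule C.tob_in[OF \<chi>(1,1)])
  have \<chi>\<chi>: "isomorphic E (fob F (\<chi> \<boxtimes>\<^bsub>C\<^esub> \<chi>)) (twist \<zeta> (twist \<zeta> (fob F (unit_ob C))))"
    by (rule E_trans[OF E_object_F[OF \<chi>\<chi>O] tO[OF \<chi>(1)] _ tob(1)[OF \<chi>(1)] E_object_twist_iso[OF E_object_F[OF \<chi>(1)] tO[OF UO] \<chi>(2)]])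
      (rule E_object_twist[OF tO[OF UO]])
  have "isomorphic D (forget (\<chi> \<boxtimes>\<^bsub>C\<^esub> \<chi>)) (forget (unit_ob C))" using isomorphic_E_D[OF \<chi>\<chi>] by (simp add: twist_def)
  then have b\<chi>\<chi>: "brick C (\<chi> \<boxtimes>\<^bsub>C\<^esub> \<chi>)" by (rule br[OF \<chi>\<chi>O])
  \<comment> \<open>An object that is isomorphic to the unit and realizes a twist of the unit makes
    this twist trivial; applied to \<open>\<chi>\<close> and to its square.\<close>
  have unit_twist: "isomorphic E (fob F (unit_ob C)) (twist \<xi> (fob F (unit_ob C)))"
    if "X \<in> Ob C" "isomorphic C X (unit_ob C)" "isomorphic E (fob F X) (twist \<xi> (fob F (unit_ob C)))" for X \<xi>
    by (rule E_trans[OF E_object_F[OF UO] E_object_F[OF that(1)] tO[OF UO]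
          C.functor_isomorphic[OF F_functor UO that(1) C.isomorphic_sym[OF that(2)]] that(3)])
  have "\<not> isomorphic C \<chi> (unit_ob C)"
    using twist_trivial[OF UO bu unit_twist[OF \<chi>(1) _ \<chi>(2)] g(1)] g(2) by blast
  moreover have "isomorphic C (\<chi> \<boxtimes>\<^bsub>C\<^esub> Y) (Y \<boxtimes>\<^bsub>C\<^esub> \<chi>)" if Y: "Y \<in> Ob C" for Y
  proof (rule C.equivalence_reflects_iso[OF equivalence C.tob_in[OF \<chi>(1) Y] C.tob_in[OF Y \<chi>(1)]])
    show "isomorphic E (fob F (\<chi> \<boxtimes>\<^bsub>C\<^esub> Y)) (fob F (Y \<boxtimes>\<^bsub>C\<^esub> \<chi>))"
      by (rule E_trans[OF E_object_F[OF C.tob_in[OF \<chi>(1) Y]] tO[OF Y] E_object_F[OF C.tob_in[OF Y \<chi>(1)]]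
            tob(2)[OF Y] isomorphic_E_sym[OF tob(1)[OF Y]]])
  qed
  ultimately have \<chi>W: "isomorphic C \<chi> (W id)" by (rule B.central_object_W_id[OF n5 b\<chi> b\<chi>\<chi>])
  have Wid: "W id \<in> Ob C" by (rule B.W_Ob[OF B.A_id flip_id])
  have "isomorphic C (W id \<boxtimes>\<^bsub>C\<^esub> W id) (V id)" using B.W_tob_W[OF B.A_id flip_id B.A_id flip_id] by simp
  then have "isomorphic C (\<chi> \<boxtimes>\<^bsub>C\<^esub> \<chi>) (unit_ob C)"
    using C.isomorphic_trans[OF \<chi>\<chi>O C.tob_in[OF Wid Wid] UO C.isomorphic_tob[OF \<chi>(1) Wid \<chi>(1) Wid \<chi>W \<chi>W]]
      C.isomorphic_trans[OF C.tob_in[OF Wid Wid] B.V_Ob[OF B.A_id] UO _ B.V_id] by blast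
  \<comment> \<open>The square of \<open>\<chi>\<close> realizes the twist by the square of
    \<open>\<zeta>\<close>, and by the fusion rules it is the unit.\<close>
  from twist_trivial[OF UO bu unit_twist[OF \<chi>\<chi>O this \<chi>\<chi>[unfolded twist_twist]] g(1)]
  have "\<zeta> g * \<zeta> g = 1" .
  then have \<zeta>g: "\<zeta> g = -1" using g(2) by (simp add: square_eq_1_iff)
  have fin: "finite (carrier G)" using p by (metis order_def card.infinite not_prime_0)
  have pow: "\<zeta> (g [^]\<^bsub>G\<^esub> k) = (-1) ^ k" for k :: nat
    by (induction k) (simp_all add: \<zeta> \<zeta>g g(1))
  \<comment> \<open>A group with an element on which a character takes the value -1 has even order,
    so the prime is 2.\<close>
  have "(-1 :: 'k) ^ order G = 1" using pow[of "order G"] G.pow_order_eq_1[OF g(1)] \<zeta>(2) by simp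
  moreover have "(-1 :: 'k) \<noteq> 1" using g(2) \<zeta>g by simp
  ultimately have "even (order G)" by (metis power_minus_odd power_one)
  then have ord: "order G = 2" using primes_dvd_imp_eq[OF two_is_prime_nat p] by simp
  have g1: "g \<noteq> \<one>\<^bsub>G\<^esub>" using g(2) \<zeta>(2) by auto
  have "{\<one>\<^bsub>G\<^esub>, g} = carrier G"
    by (rule card_subset_eq[OF fin]) (use g g1 ord in \<open>auto simp: order_def\<close>)
  moreover have "g \<otimes>\<^bsub>G\<^esub> g = \<one>\<^bsub>G\<^esub>" using G.pow_order_eq_1[OF g(1)] g(1) by (simp add: ord numeral_2_eq_2)
  ultimately interpret order_two_equivariantization G D \<rho> \<gamma> \<upsilon> C F \<zeta> g
    by unfold_locales (use \<zeta> \<zeta>g two in auto)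
  show ?thesis by (rule bismash_unit_group_not_solvable[OF B n5 \<chi> \<chi>W])
qed

theorem theorem4p22:
  fixes n :: nat
    and C :: "('o, 'a::ab_group_add, 'k::{alg_closed_field, field_char_0}) tensor_category"
  assumes "n \<ge> 5"
    and "fusion_category C"
    and "grothendieck_equivalent (Rep (bismash n)) C"
  shows "\<not> solvable_fusion TYPE('p) TYPE('b::ab_group_add) C"
proof
  assume "solvable_fusion TYPE('p) TYPE('b::ab_group_add) C"
  then obtain N and \<C> :: "nat \<Rightarrow> ('p, 'b, 'k) tensor_category" and \<G> :: "nat \<Rightarrow> int monoid"
    where fus: "\<forall>i\<le>N. fusion_category (\<C> i)" and base: "tensor_equivalent (\<C> 0) Vect" and top: "tensor_equivalent (\<C> N) C"
      and step: "\<forall>i\<in>{1..N}. group (\<G> i) \<and> cyclic_group (\<G> i) \<and> prime (order (\<G> i)) \<and>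
           (is_equivariantization (\<G> i) (\<C> i) (\<C> (i - 1)) \<or> is_extension (\<G> i) (\<C> i) (\<C> (i - 1)))"
    unfolding solvable_fusion_def by blast
  have fN: "fusion_category (\<C> N)" using fus by simp
  have deg: "bismash_degree n" by unfold_locales (use assms(1) in simp)
  \<comment> \<open>The fusion rules are moved from C to the end of the chain, the category that the
    last step describes.\<close>
  have "grothendieck_equivalent (\<C> N) C" by (rule tensor_equivalent_imp_grothendieck_equivalent[OF fN assms(2) top])
  then have "grothendieck_equivalent (Rep (bismash n)) (\<C> N)"
    by (rule grothendieck_equivalent_cancel[OF assms(3)]) (use fN in \<open>simp add: fusion_category_def\<close>)
  then obtain V W where B: "bismash_fusion n (\<C> N) V W" using bismash_degree.bismash_fusion_exists[OF deg fN] by blast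
  interpret B: bismash_fusion n "\<C> N" V W by (rule B)
  show False
  proof (cases "N = 0")
    case True
    \<comment> \<open>A chain of length 0 ends in a category equivalent to \<open>Vect\<close>,
      which has a single simple object, while \<open>V id\<close> and \<open>W id\<close> are
      different.\<close>
    have "isomorphic (\<C> N) (V id) (W id)"
      using Vect_equivalent_brick_unit[OF fN _ B.W_brick[OF B.A_id flip_id]] base True
        B.isomorphic_trans[OF B.V_Ob[OF B.A_id] B.unit_in B.W_Ob[OF B.A_id flip_id] B.V_id] by simp
    then show False using B.V_W_iso[OF B.A_id B.A_id flip_id] by simp
  next
    case False
    then have N: "N \<in> {1..N}" "N - 1 \<le> N" by auto
    let ?D = "\<C> (N - 1)"
    have G: "group (\<G> N)" "cyclic_group (\<G> N)" "prime (order (\<G> N))" using step N by auto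
    have fD: "fusion_category ?D" using fus N by simp
    have sol: "solvable (unit_group ?D)" by (rule solvable_chain_unit_group[OF fus base step N(2)])
    obtain \<zeta> :: "int \<Rightarrow> 'k" and g where \<zeta>: "\<And>x y. x \<in> carrier (\<G> N) \<Longrightarrow> y \<in> carrier (\<G> N) \<Longrightarrow> \<zeta> (x \<otimes>\<^bsub>\<G> N\<^esub> y) = \<zeta> x * \<zeta> y"
      "\<zeta> \<one>\<^bsub>\<G> N\<^esub> = 1" and g: "g \<in> carrier (\<G> N)" "\<zeta> g \<noteq> 1"
      using prime_cyclic_character[OF G] by metis
    have "is_equivariantization (\<G> N) (\<C> N) ?D \<or> is_extension (\<G> N) (\<C> N) ?D" using step N by blast
    then show False
    proof
      assume "is_equivariantization (\<G> N) (\<C> N) ?D"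
      then obtain \<rho> \<gamma> \<upsilon> F where fe: "fusion_equivariantization (\<G> N) ?D \<rho> \<gamma> \<upsilon> (\<C> N) F"
        using equivariantization_locale[OF fN fD G(1)] by blast
      have "\<not> solvable (unit_group ?D)"
        by (rule fusion_equivariantization.bismash_unit_group_not_solvable[OF fe B assms(1) G(3) _ \<zeta> g]) simp
      then show False using sol by simp
    next
      assume "is_extension (\<G> N) (\<C> N) ?D"
      then obtain \<A> where gr: "graded_category (\<C> N) (\<G> N) \<A>"
        using extension_graded[OF fN group.cyclic_imp_abelian_group[OF G(1,2)]] by blast
      show False by (rule B.not_graded[OF assms(1) gr g(1)]) (use g \<zeta>(2) in auto)
    qed
  qed
qed

end
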